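(* Let $\Gamma$ be the exchange graph of a mutation-finite real quiver of rank $3$ distinct from the Markov quiver. Then $\Gamma$ has polynomial growth. In the case when the quiver is affine, the polynomial growth rate of $\Gamma$ is equal to the rank $\operatorname{rk}_{\mathbb Z}(L)$ of the lattice $L$ of translation vectors of $\Gamma$.
   Context: **Exchange matrices.** A real quiver of rank $3$ is given by a real skew-symmetric $3\times3$ matrix $B=(b_{ij})$ (arrow $i\to j$ of weight $b_{ij}$ whenever $b_{ij}>0$); it is acyclic if there is no oriented cycle, and cyclic otherwise. The mutation $\mu_k(B)=(b'_{ij})$ is given by $b'_{ij}=-b_{ij}$ if $k\in\{i,j\}$ and $b'_{ij}=b_{ij}+(b_{ik}|b_{kj}|+|b_{ik}|b_{kj})/2$ otherwise. $B$ is mutation-finite if only finitely many matrices are obtained from it by mutations. The Markov quiver is given by $b_{12}=b_{23}=2$, $b_{13}=-2$; "distinct" means up to reordering of indices. Every other mutation-finite $B$ of rank $3$ is mutation-equivalent to an acyclic matrix. **Seeds.** Let $V$ be a $3$-dimensional real vector space with a symmetric bilinear form. A geometric realisation of $B$ is a basis $\mathbf v=(v_1,v_2,v_3)$ of $V$ with $(v_i,v_i)=2$, $|(v_i,v_j)|=|b_{ij}|$ for $i\ne j$, and such that, if all $(v_i,v_j)\ne0$, the number of pairs $i<j$ with $(v_i,v_j)>0$ is even if $B$ is acyclic and odd otherwise. A seed is a pair $(\mathbf v,B)$ up to simultaneous permutation of indices. For a mutation-finite real skew-symmetric $3\times3$ matrix $B$ distinct from the Markov quiver exactly one of two cases occurs.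 *Finite type:* the form is positive definite, $V=\mathbb R^3$ with the standard inner product, and $\Pi_v=\{w\in\mathbb S^2:(v,w)<0\}$. *Affine:* $V$ is the space of affine functions $f(x)=\langle a,x\rangle+c$ on the Euclidean plane $\mathbb E^2$ with $(f,g)=\langle a,a'\rangle$ for $g(x)=\langle a',x\rangle+c'$, and $\Pi_f=\{x\in\mathbb E^2: f(x)<0\}$. The seed is represented by its domain $\Pi_{v_1}\cap\Pi_{v_2}\cap\Pi_{v_3}$ (a spherical triangle, resp. a Euclidean triangle or an infinite region bounded by two parallel half-lines and a segment) together with a quiver whose vertices are its sides. **Positivity and mutation.** A reference point $u$ is a point of $\mathbb S^2$ in the finite type case, and a point of $\mathbb E^2$ or an infinitely far point on a directed line $\ell$ in the affine case. A vector $v$ is positive if $u\in\Pi_v$ (for $u$ infinitely far on $\ell$: all points of $\ell$ sufficiently far in the given direction lie in $\Pi_v$), and negative if $-v$ is positive. The mutation is $\mu_k(\mathbf v,B)=(\mathbf v',\mu_k(B))$ with $v_k'=-v_k$ and, for $i\ne k$: if $v_k$ is positive, $v_i'=v_i$ when $b_{ik}>0$ and $v_i'=v_i-(v_i,v_k)v_k$ when $b_{ik}<0$; if $v_k$ is negative, $v_i'=v_i$ when $b_{ik}<0$ and $v_i'=v_i-(v_i,v_k)v_k$ when $b_{ik}>0$ (if $b_{ik}=0$ then $v_i'=v_i$). The exchange graph $\Gamma$ has as vertices all seeds obtained from an initial seed by mutations; edges join seeds related by one mutation. **Compatibility.** For $i\ne j$ with $|b_{ij}|<2$, regard $(v_i,v_j)$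 with the corresponding $2\times2$ submatrix as a rank $2$ seed, ordered so that $b_{ij}\ge0$, and write $b_{ij}=2\cos(\pi p/q)$ with $p,q\ge1$ coprime, $2p\le q$. Let $\tau$ swap the indices and let $\mu_2$ be mutation at the second vector. $u$ is compatible with this subseed if the period of $(\tau\circ\mu_2)^m$, $m\geq0$, on it equals $q+2p$. The reference point is always assumed compatible with all such rank $2$ subseeds of all seeds in $\Gamma$. **Lattice $L$ (affine case).** For a vector $w$ in the plane, $w+(\mathbf v,B)$ denotes the seed with domain translated by $w$ and the same quiver. $L$ is the group of all vectors $w$ such that $(\mathbf v,B)\mapsto w+(\mathbf v,B)$ is a symmetry of $\Gamma$ (equivalently, the $\mathbb Z$-span of all vectors $w$ such that $\Gamma$ contains two seeds differing by translation by $w$). **Growth.** Let $x_0$ be the initial seed, $d$ the graph distance on vertices and $gr(m)=|\{x: d(x_0,x)\le m\}|$. $\Gamma$ has polynomial growth if $gr(m)=\mathcal O(m^r)$ for some $r\ge0$; the polynomial growth rate is the smallest natural number $r$ with $gr(m)=\mathcal O(m^r)$. *)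

theory Defs
  imports "HOL-Analysis.Analysis" "HOL-Library.Landau_Symbols"
begin

section \<open>Exchange matrices\<close>

definition skew_symmetric :: "real^'n^'n \<Rightarrow> bool" where
  "skew_symmetric B \<longleftrightarrow> transpose B = - B"

definition acyclic_quiver :: "real^'n^'n \<Rightarrow> bool" where
  "acyclic_quiver B \<longleftrightarrow> acyclic {(i, j). B $ i $ j > 0}"

definition matrix_mutation :: "'n \<Rightarrow> real^'n^'n \<Rightarrow> real^'n^'n" where
  "matrix_mutation k B = (\<chi> i j.
     if k \<in> {i, j} then - (B $ i $ j)
     else B $ i $ j + (B $ i $ k * \<bar>B $ k $ j\<bar> + \<bar>B $ i $ k\<bar> * B $ k $ j) / 2)"

definition mutation_finite :: "real^'n^'n \<Rightarrow> bool" where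
  "mutation_finite B \<longleftrightarrow> finite {B'. (\<lambda>X Y. \<exists>k. Y = matrix_mutation k X)\<^sup>*\<^sup>* B B'}"

definition markov_quiver :: "real^3^3" where
  "markov_quiver = vector [vector [0, 2, -2], vector [-2, 0, 2], vector [2, -2, 0]]"

definition reindex_matrix :: "('m \<Rightarrow> 'n) \<Rightarrow> real^'n^'n \<Rightarrow> real^'m^'m" where
  "reindex_matrix \<sigma> B = (\<chi> i j. B $ \<sigma> i $ \<sigma> j)"

definition same_quiver :: "real^'n^'n \<Rightarrow> real^'n^'n \<Rightarrow> bool" where
  "same_quiver B C \<longleftrightarrow> (\<exists>\<sigma>. bij \<sigma> \<and> reindex_matrix \<sigma> B = C)"

section \<open>Seeds and their mutations\<close>

text \<open>
  A space \<open>V\<close> enters through its symmetric bilinear form \<open>form\<close>, and the reference point through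
  the predicate \<open>pos\<close> on \<open>V\<close> of being positive with respect to it.  Both cases (vectors in
  three-space, affine functions on the plane) are instances.  The index type is arbitrary so that
  rank 2 subseeds are seeds over the index type \<open>2\<close>.
\<close>

definition geometric_realisation ::
    "('v::real_vector \<Rightarrow> 'v \<Rightarrow> real) \<Rightarrow> (3 \<Rightarrow> 'v) \<Rightarrow> real^3^3 \<Rightarrow> bool" where
  "geometric_realisation form v B \<longleftrightarrow>
     inj v \<and> independent (range v) \<and> span (range v) = UNIV \<and>
     (\<forall>i. form (v i) (v i) = 2) \<and>
     (\<forall>i j. i \<noteq> j \<longrightarrow> \<bar>form (v i) (v j)\<bar> = \<bar>B $ i $ j\<bar>) \<and>
     ((\<forall>i j. i \<noteq> j \<longrightarrow> form (v i) (v j) \<noteq> 0) \<longrightarrow>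
        (if acyclic_quiver B then even (card {(i, j). i < j \<and> form (v i) (v j) > 0})
         else odd (card {(i, j). i < j \<and> form (v i) (v j) > 0})))"

type_synonym ('n, 'v) labelled_seed = "('n \<Rightarrow> 'v) \<times> (real^'n^'n)"

definition reindex :: "('m::finite \<Rightarrow> 'n::finite) \<Rightarrow> ('n::finite, 'v) labelled_seed \<Rightarrow> ('m::finite, 'v) labelled_seed" where
  "reindex \<sigma> s = (fst s \<circ> \<sigma>, reindex_matrix \<sigma> (snd s))"

text \<open>A seed proper is a labelled seed up to simultaneous permutation of the indices.\<close>

definition seed_class :: "('n::finite, 'v) labelled_seed \<Rightarrow> ('n::finite, 'v) labelled_seed set" where
  "seed_class s = {reindex \<sigma> s | \<sigma>. bij \<sigma>}"

text \<open>
  The mathematical definition only covers the case that \<open>v k\<close> is positive or negative; for vectors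
  that are neither, the value below is meaningless, and \<open>general_position\<close> excludes this.
\<close>

definition seed_mutation ::
    "('v::real_vector \<Rightarrow> 'v \<Rightarrow> real) \<Rightarrow> ('v \<Rightarrow> bool) \<Rightarrow> 'n::finite \<Rightarrow>
     ('n::finite, 'v) labelled_seed \<Rightarrow> ('n::finite, 'v) labelled_seed" where
  "seed_mutation form pos k s = (case s of (v, B) \<Rightarrow>
     ((\<lambda>i. if i = k then - v k
           else if (pos (v k) \<and> B $ i $ k < 0) \<or> (\<not> pos (v k) \<and> B $ i $ k > 0)
             then v i - form (v i) (v k) *\<^sub>R v k
           else v i),
      matrix_mutation k B))"

definition mutation_reachable ::
    "('v::real_vector \<Rightarrow> 'v \<Rightarrow> real) \<Rightarrow> ('v \<Rightarrow> bool) \<Rightarrow>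
     ('n::finite, 'v) labelled_seed \<Rightarrow> ('n::finite, 'v) labelled_seed set" where
  "mutation_reachable form pos s0 =
     {s. (\<lambda>x y. \<exists>k. y = seed_mutation form pos k x)\<^sup>*\<^sup>* s0 s}"

section \<open>The exchange graph and its growth\<close>

definition exchange_vertices ::
    "('v::real_vector \<Rightarrow> 'v \<Rightarrow> real) \<Rightarrow> ('v \<Rightarrow> bool) \<Rightarrow>
     ('n::finite, 'v) labelled_seed \<Rightarrow> ('n::finite, 'v) labelled_seed set set" where
  "exchange_vertices form pos s0 = seed_class ` mutation_reachable form pos s0"

definition exchange_adjacent ::
    "('v::real_vector \<Rightarrow> 'v \<Rightarrow> real) \<Rightarrow> ('v \<Rightarrow> bool) \<Rightarrow> ('n::finite, 'v) labelled_seed \<Rightarrow>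
     ('n::finite, 'v) labelled_seed set \<Rightarrow> ('n::finite, 'v) labelled_seed set \<Rightarrow> bool" where
  "exchange_adjacent form pos s0 X Y \<longleftrightarrow>
     X \<in> exchange_vertices form pos s0 \<and> Y \<in> exchange_vertices form pos s0 \<and>
     ((\<exists>s\<in>X. \<exists>k. seed_mutation form pos k s \<in> Y) \<or>
      (\<exists>s\<in>Y. \<exists>k. seed_mutation form pos k s \<in> X))"

definition exchange_dist ::
    "('v::real_vector \<Rightarrow> 'v \<Rightarrow> real) \<Rightarrow> ('v \<Rightarrow> bool) \<Rightarrow> ('n::finite, 'v) labelled_seed \<Rightarrow>
     ('n::finite, 'v) labelled_seed set \<Rightarrow> ('n::finite, 'v) labelled_seed set \<Rightarrow> nat" where
  "exchange_dist form pos s0 X Y = (LEAST n. (exchange_adjacent form pos s0 ^^ n) X Y)"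

definition exchange_growth ::
    "('v::real_vector \<Rightarrow> 'v \<Rightarrow> real) \<Rightarrow> ('v \<Rightarrow> bool) \<Rightarrow> ('n::finite, 'v) labelled_seed \<Rightarrow> nat \<Rightarrow> nat" where
  "exchange_growth form pos s0 m =
     card {X \<in> exchange_vertices form pos s0. exchange_dist form pos s0 (seed_class s0) X \<le> m}"

definition polynomial_growth :: "(nat \<Rightarrow> nat) \<Rightarrow> bool" where
  "polynomial_growth g \<longleftrightarrow> (\<exists>r::real. r \<ge> 0 \<and> (\<lambda>m. real (g m)) \<in> O(\<lambda>m. real m powr r))"

definition growth_rate :: "(nat \<Rightarrow> nat) \<Rightarrow> nat" where
  "growth_rate g = (LEAST r. (\<lambda>m. real (g m)) \<in> O(\<lambda>m. real m ^ r))"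

section \<open>Conditions on the reference point\<close>

definition general_position ::
    "('v::real_vector \<Rightarrow> 'v \<Rightarrow> real) \<Rightarrow> ('v \<Rightarrow> bool) \<Rightarrow> ('n::finite, 'v) labelled_seed \<Rightarrow> bool" where
  "general_position form pos s0 \<longleftrightarrow>
     (\<forall>s \<in> mutation_reachable form pos s0. \<forall>i. pos (fst s i) \<or> pos (- fst s i))"

definition has_period :: "('a \<Rightarrow> 'a) \<Rightarrow> 'a \<Rightarrow> nat \<Rightarrow> bool" where
  "has_period f x n \<longleftrightarrow> n > 0 \<and> (f ^^ n) x = x \<and> (\<forall>m. 0 < m \<and> m < n \<longrightarrow> (f ^^ m) x \<noteq> x)"

definition swap2 :: "2 \<Rightarrow> 2" where
  "swap2 i = (if i = 1 then 2 else 1)"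

text \<open>
  For a rank 2 seed with \<open>0 \<le> b\<^sub>1\<^sub>2 < 2\<close>, the pair \<open>(p, q)\<close> is unique if it exists; a weight that is
  not of the form \<open>2 cos (\<pi> p / q)\<close> imposes no condition.
\<close>

definition compatible2 ::
    "('v::real_vector \<Rightarrow> 'v \<Rightarrow> real) \<Rightarrow> ('v \<Rightarrow> bool) \<Rightarrow> (2, 'v) labelled_seed \<Rightarrow> bool" where
  "compatible2 form pos s \<longleftrightarrow>
     (\<forall>p q :: nat. p \<ge> 1 \<and> q \<ge> 1 \<and> coprime p q \<and> 2 * p \<le> q \<and>
        snd s $ 1 $ 2 = 2 * cos (pi * real p / real q) \<longrightarrow>
        has_period (reindex swap2 \<circ> seed_mutation form pos 2) s (q + 2 * p))"

definition compatible ::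
    "('v::real_vector \<Rightarrow> 'v \<Rightarrow> real) \<Rightarrow> ('v \<Rightarrow> bool) \<Rightarrow> ('n::finite, 'v) labelled_seed \<Rightarrow> bool" where
  "compatible form pos s0 \<longleftrightarrow>
     (\<forall>s \<in> mutation_reachable form pos s0. \<forall>\<sigma> :: 2 \<Rightarrow> 'n.
        inj \<sigma> \<and> 0 \<le> snd s $ \<sigma> 1 $ \<sigma> 2 \<and> snd s $ \<sigma> 1 $ \<sigma> 2 < 2 \<longrightarrow>
        compatible2 form pos (reindex \<sigma> s))"

section \<open>Finite type: the sphere\<close>

definition half_sphere :: "real^3 \<Rightarrow> (real^3) set" where
  "half_sphere v = {w \<in> sphere 0 1. v \<bullet> w < 0}"

definition sphere_pos :: "real^3 \<Rightarrow> real^3 \<Rightarrow> bool" where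
  "sphere_pos u v \<longleftrightarrow> u \<in> half_sphere v"

section \<open>Affine case: the Euclidean plane\<close>

text \<open>The pair \<open>(a, c)\<close> stands for the affine function \<open>x \<mapsto> a \<bullet> x + c\<close>.\<close>

type_synonym affine_fun = "(real^2) \<times> real"

definition affine_eval :: "affine_fun \<Rightarrow> real^2 \<Rightarrow> real" where
  "affine_eval f x = fst f \<bullet> x + snd f"

definition affine_form :: "affine_fun \<Rightarrow> affine_fun \<Rightarrow> real" where
  "affine_form f g = fst f \<bullet> fst g"

definition half_plane :: "affine_fun \<Rightarrow> (real^2) set" where
  "half_plane f = {x. affine_eval f x < 0}"

text \<open>
  \<open>At_Infinity x d\<close> is the infinitely far point on the line through \<open>x\<close> directed by \<open>d\<close>.
\<close>

datatype plane_ref = Proper "real^2" | At_Infinity "real^2" "real^2"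

fun valid_plane_ref :: "plane_ref \<Rightarrow> bool" where
  "valid_plane_ref (Proper u) \<longleftrightarrow> True"
| "valid_plane_ref (At_Infinity x d) \<longleftrightarrow> d \<noteq> 0"

fun plane_pos :: "plane_ref \<Rightarrow> affine_fun \<Rightarrow> bool" where
  "plane_pos (Proper u) f \<longleftrightarrow> u \<in> half_plane f"
| "plane_pos (At_Infinity x d) f \<longleftrightarrow> (\<forall>\<^sub>F t in at_top. x + t *\<^sub>R d \<in> half_plane f)"

text \<open>
  \<open>translate_seed w\<close> replaces each \<open>f\<close> by \<open>x \<mapsto> f (x - w)\<close>, which translates the domain by \<open>w\<close>.
\<close>

definition translate_seed ::
    "real^2 \<Rightarrow> ('n::finite, affine_fun) labelled_seed \<Rightarrow> ('n::finite, affine_fun) labelled_seed" where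
  "translate_seed w s = (\<lambda>i. (fst (fst s i), snd (fst s i) - fst (fst s i) \<bullet> w), snd s)"

definition translation_vectors ::
    "('n::finite, affine_fun) labelled_seed set set \<Rightarrow> (real^2) set" where
  "translation_vectors \<Gamma> = {w. \<exists>X\<in>\<Gamma>. \<exists>Y\<in>\<Gamma>. Y = translate_seed w ` X}"

definition int_scale :: "int \<Rightarrow> 'v::real_vector \<Rightarrow> 'v" where
  "int_scale k x = real_of_int k *\<^sub>R x"

definition translation_lattice ::
    "('n::finite, affine_fun) labelled_seed set set \<Rightarrow> (real^2) set" where
  "translation_lattice \<Gamma> = module.span int_scale (translation_vectors \<Gamma>)"

text \<open>
  The rank of a subgroup, as a relation so that a group of infinite rank has none.
\<close>

definition has_int_rank :: "'v::real_vector set \<Rightarrow> nat \<Rightarrow> bool" where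
  "has_int_rank L r \<longleftrightarrow>
     (\<exists>S\<subseteq>L. finite S \<and> \<not> module.dependent int_scale S \<and> card S = r) \<and>
     (\<forall>S\<subseteq>L. finite S \<and> \<not> module.dependent int_scale S \<longrightarrow> card S \<le> r)"

end

theory Submission
  imports Defs
begin

text \<open>
  \<^emph>\<open>Why the growth is polynomial.\<close> The compatibility of the reference point amounts to a rule
  (\<open>sign_rule\<close>) that relates, for every arrow, the signs of its two vectors and their inner product.
  Under this rule a mutation changes the vectors and the exchange matrix by the same base change
  (\<open>sign_rule_mutation\<close>), so that all exchange matrices are the Gram matrices of one fixed skew form
  \<open>om\<close> on \<open>V\<close>. The isometries that preserve \<open>om\<close> form a one-parameter group: the rotations about one axis,
  or the translations along one direction \<open>dir\<close>. As there are finitely many exchange matrices, all seeds are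
  images of finitely many ones under this group, and each mutation displaces the position in the
  group by one of finitely many numbers (\<open>ball_positions\<close>). Hence the ball of radius \<open>m\<close> has at most as
  many elements as there are sums of \<open>m\<close> such numbers, which is polynomial in \<open>m\<close>.  In the affine case
  the displacements lie in the lattice \<open>L\<close>, which is finitely generated for the same reason, and the exponent
  is the rank of \<open>L\<close> (\<open>upper_bound\<close>).

  \<^emph>\<open>Why the rank is attained.\<close> Let the quiver be affine and connected.  An acyclic seed can be mutated
  forever at positive sources, and this moves it to infinity along \<open>dir\<close> (\<open>roll_far\<close>). Far away the signs
  of vectors do not change under translation, so that the seeds are those of a translation
  invariant world (\<open>uniform_left\<close>), in which a translation between two seeds can be repeated as often as
  one likes, at a cost that is linear in the number of repetitions. This gives the lower bound
  (\<open>lower_bound\<close>), provided that the translations of this world generate a lattice of the same rank as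
  those between arbitrary seeds.

  This last point is where the geometry enters.  The form \<open>(form + om) / 2\<close> is triangular in a suitable,
  exceptional order of each seed. A mutation changes the triple of reflections in exceptional order by
  a braid move (\<open>braid_mutation\<close>), independently of the reference point.  Hence two seeds that differ by a
  translation yield a translation that preserves a braid orbit of triples, and so do all its multiples. On
  the other hand the triples of the invariant world, together with their rotations, are closed under all braid
  moves (\<open>normal_triples\<close>), and up to translations of that world there are only finitely many of them. By the
  pigeonhole principle every translation between seeds has a multiple in the translation group of
  the invariant world (\<open>translation_multiple\<close>).

  If a vertex is isolated, then the other two vectors are normal to parallel lines, mutation moves
  along a path, and the rank and the growth rate are both 1 (\<open>isolated_growth\<close>).
\<close>

section \<open>Seeds, mutations and the growth of the exchange graph\<close>

lemma three_cases:
  fixes i j k l :: 3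
  assumes "i \<noteq> j" "j \<noteq> k" "i \<noteq> k"
  shows "l = i \<or> l = j \<or> l = k"
  using assms exhaust_3[of i] exhaust_3[of j] exhaust_3[of k] exhaust_3[of l] by metis

lemma UNIV_three:
  fixes i j k :: 3
  assumes "i \<noteq> j" "j \<noteq> k" "i \<noteq> k"
  shows "(UNIV :: 3 set) = {i, j, k}"
  using three_cases[OF assms] by auto

lemma sum_three:
  fixes i j k :: 3 and f :: "3 \<Rightarrow> 'a :: comm_monoid_add"
  assumes "i \<noteq> j" "j \<noteq> k" "i \<noteq> k"
  shows "sum f UNIV = f i + f j + f k"
  unfolding UNIV_three[OF assms] using assms by (simp add: add.assoc)

lemma skewD: "skew_symmetric B \<Longrightarrow> B $ j $ i = - (B $ i $ j)"
proof -
  assume "skew_symmetric B"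
  then have "transpose B $ i $ j = (- B) $ i $ j" by (simp only: skew_symmetric_def)
  then show ?thesis by (simp add: transpose_def)
qed

lemma skewI: "(\<And>i j. B $ j $ i = - (B $ i $ j)) \<Longrightarrow> skew_symmetric (B :: real^'n^'n)"
proof -
  assume *: "\<And>i j. B $ j $ i = - (B $ i $ j)"
  have "transpose B $ i $ j = (- B) $ i $ j" for i j
    by (simp only: transpose_def vec_lambda_beta uminus_vec_def *[of i j])
  then show ?thesis by (simp only: skew_symmetric_def vec_eq_iff) blast
qed

lemma skew0: "skew_symmetric (B :: real^'n^'n) \<Longrightarrow> B $ i $ i = 0"
  using skewD[of B i i] by simp

lemma matrix_mutation_nth:
  "matrix_mutation k B $ i $ j = (if k = i \<or> k = j then - (B $ i $ j)
     else B $ i $ j + (B $ i $ k * \<bar>B $ k $ j\<bar> + \<bar>B $ i $ k\<bar> * B $ k $ j) / 2)"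
  by (simp add: matrix_mutation_def)

lemma skew_mutation: "skew_symmetric B \<Longrightarrow> skew_symmetric (matrix_mutation k B)"
proof (rule skewI)
  fix i j assume s: "skew_symmetric B"
  show "matrix_mutation k B $ j $ i = - (matrix_mutation k B $ i $ j)"
    using skewD[OF s, of i j] skewD[OF s, of i k] skewD[OF s, of k j]
    by (auto simp: matrix_mutation_nth field_simps)
qed

lemma matrix_mutation_invol:
  assumes "skew_symmetric B" shows "matrix_mutation k (matrix_mutation k B) = B"
  by (auto simp: vec_eq_iff matrix_mutation_nth field_simps)

lemma fst_mutation:
  "fst (seed_mutation form pos k s) i = (if i = k then - fst s k
     else if (pos (fst s k) \<and> snd s $ i $ k < 0) \<or> (\<not> pos (fst s k) \<and> snd s $ i $ k > 0)
     then fst s i - form (fst s i) (fst s k) *\<^sub>R fst s k else fst s i)"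
  by (cases s) (simp add: seed_mutation_def)

lemma snd_mutation: "snd (seed_mutation form pos k s) = matrix_mutation k (snd s)"
  by (cases s) (simp add: seed_mutation_def)

definition mutation_step :: "('v::real_vector \<Rightarrow> 'v \<Rightarrow> real) \<Rightarrow> ('v \<Rightarrow> bool) \<Rightarrow>
     ('n::finite, 'v) labelled_seed \<Rightarrow> ('n, 'v) labelled_seed \<Rightarrow> bool" where
  "mutation_step form pos s s' \<longleftrightarrow> (\<exists>k. s' = seed_mutation form pos k s)"

definition labelled_ball :: "('v::real_vector \<Rightarrow> 'v \<Rightarrow> real) \<Rightarrow> ('v \<Rightarrow> bool) \<Rightarrow>
     ('n::finite, 'v) labelled_seed \<Rightarrow> nat \<Rightarrow> ('n, 'v) labelled_seed set" where
  "labelled_ball form pos s0 m = {s. \<exists>n\<le>m. (mutation_step form pos ^^ n) s0 s}"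

lemma reachable_step: "mutation_reachable form pos s0 = {s. (mutation_step form pos)\<^sup>*\<^sup>* s0 s}"
  unfolding mutation_reachable_def mutation_step_def by simp

lemma reachable_ball: "mutation_reachable form pos s0 = (\<Union>m. labelled_ball form pos s0 m)"
  unfolding reachable_step labelled_ball_def rtranclp_power by auto

lemma reachable_refl: "s0 \<in> mutation_reachable form pos s0"
  unfolding reachable_step by simp

lemma reachable_mutation:
  "s \<in> mutation_reachable form pos s0 \<Longrightarrow> seed_mutation form pos k s \<in> mutation_reachable form pos s0"
  unfolding reachable_step mem_Collect_eq
  by (rule rtranclp.rtrancl_into_rtrancl) (auto simp: mutation_step_def)

lemma reachable_induct [consumes 1, case_names base step]:
  assumes "s \<in> mutation_reachable form pos s0" "P s0"
    and "\<And>s k. s \<in> mutation_reachable form pos s0 \<Longrightarrow> P s \<Longrightarrow> P (seed_mutation form pos k s)"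
  shows "P s"
proof -
  have "(mutation_step form pos)\<^sup>*\<^sup>* s0 s" using assms(1) by (simp add: reachable_step)
  then have "P s \<and> s \<in> mutation_reachable form pos s0"
    by induction (use assms in \<open>auto simp: mutation_step_def intro: reachable_mutation reachable_refl\<close>)
  then show ?thesis ..
qed

lemma reachable_trans:
  "s \<in> mutation_reachable form pos s0 \<Longrightarrow> t \<in> mutation_reachable form pos s \<Longrightarrow>
   t \<in> mutation_reachable form pos s0"
  unfolding reachable_step by auto

lemma labelled_ball_Suc:
  "labelled_ball form pos s0 (Suc m) = labelled_ball form pos s0 m \<union>
     {seed_mutation form pos k s | k s. s \<in> labelled_ball form pos s0 m}"
proof -
  have "(\<exists>n\<le>Suc m. (mutation_step form pos ^^ n) s0 s) \<longleftrightarrow>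
      s = s0 \<or> (\<exists>n\<le>m. (mutation_step form pos ^^ Suc n) s0 s)" for s
  proof
    assume "\<exists>n\<le>Suc m. (mutation_step form pos ^^ n) s0 s"
    then obtain n where n: "n \<le> Suc m" "(mutation_step form pos ^^ n) s0 s" by blast
    show "s = s0 \<or> (\<exists>n\<le>m. (mutation_step form pos ^^ Suc n) s0 s)"
    proof (cases n)
      case 0 then show ?thesis using n by simp
    next
      case (Suc l) then show ?thesis using n by blast
    qed
  next
    assume "s = s0 \<or> (\<exists>n\<le>m. (mutation_step form pos ^^ Suc n) s0 s)"
    then show "\<exists>n\<le>Suc m. (mutation_step form pos ^^ n) s0 s"
    proof
      assume "s = s0" then show ?thesis by (intro exI[of _ 0]) simp
    qed blast
  qed
  then have "labelled_ball form pos s0 (Suc m) = insert s0 {s'. \<exists>n\<le>m. (mutation_step form pos ^^ Suc n) s0 s'}"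
    unfolding labelled_ball_def by blast
  also have "\<dots> = labelled_ball form pos s0 m \<union>
     {seed_mutation form pos k s | k s. s \<in> labelled_ball form pos s0 m}" (is "?A = ?B")
  proof (intro equalityI subsetI)
    fix s assume "s \<in> ?A"
    then consider "s = s0" | n where "n \<le> m" "(mutation_step form pos ^^ Suc n) s0 s" by auto
    then show "s \<in> ?B"
    proof cases
      case 1 then show ?thesis by (auto simp: labelled_ball_def intro: exI[of _ 0])
    next
      case 2
      then obtain t where "(mutation_step form pos ^^ n) s0 t" "mutation_step form pos t s" by auto
      then show ?thesis using 2 by (auto simp: labelled_ball_def mutation_step_def)
    qed
  next
    fix s assume "s \<in> ?B"
    then consider "s \<in> labelled_ball form pos s0 m" | k t where "s = seed_mutation form pos k t" "t \<in> labelled_ball form pos s0 m"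
      by auto
    then show "s \<in> ?A"
    proof cases
      case 1
      then obtain n where n: "n \<le> m" "(mutation_step form pos ^^ n) s0 s" by (auto simp: labelled_ball_def)
      show ?thesis
      proof (cases n)
        case 0 then show ?thesis using n by simp
      next
        case (Suc l)
        then have "l \<le> m" "(mutation_step form pos ^^ Suc l) s0 s" using n by simp_all
        then show ?thesis by blast
      qed
    next
      case 2
      then obtain n where n: "n \<le> m" "(mutation_step form pos ^^ n) s0 t" by (auto simp: labelled_ball_def)
      then have "(mutation_step form pos ^^ Suc n) s0 s" using 2
        by (intro relpowp_Suc_I) (auto simp: mutation_step_def)
      then show ?thesis using n by blast
    qed
  qed
  finally show ?thesis .
qed

lemma labelled_ball_0: "labelled_ball form pos s0 0 = {s0}"
  by (auto simp: labelled_ball_def)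

lemma finite_labelled_ball: "finite (labelled_ball form pos (s0 :: ('n::finite, 'v::real_vector) labelled_seed) m)"
proof (induction m)
  case 0 then show ?case by (simp add: labelled_ball_0)
next
  case (Suc m)
  have "{seed_mutation form pos k s | k s. s \<in> labelled_ball form pos s0 m}
      = (\<lambda>p. seed_mutation form pos (fst p) (snd p)) ` (UNIV \<times> labelled_ball form pos s0 m)" by force
  then show ?case using Suc by (simp add: labelled_ball_Suc)
qed

lemma labelled_ball_add:
  assumes "s \<in> labelled_ball form pos s0 m" "t \<in> labelled_ball form pos s n"
  shows "t \<in> labelled_ball form pos s0 (m + n)"
proof -
  obtain i j where "i \<le> m" "j \<le> n" "(mutation_step form pos ^^ i) s0 s" "(mutation_step form pos ^^ j) s t"
    using assms by (auto simp: labelled_ball_def)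
  then have "i + j \<le> m + n" "(mutation_step form pos ^^ (i + j)) s0 t"
    by (auto simp: relpowp_add)
  then show ?thesis unfolding labelled_ball_def by blast
qed

lemma reindex_id: "reindex id s = s"
  by (simp add: reindex_def reindex_matrix_def)

lemma reindex_reindex: "reindex \<rho> (reindex \<sigma> s) = reindex (\<sigma> \<circ> \<rho>) s"
  by (simp add: reindex_def reindex_matrix_def comp_assoc)

lemma seed_class_self: "s \<in> seed_class s"
  unfolding seed_class_def using reindex_id[of s] by force

lemma seed_class_reindex:
  assumes s: "bij \<sigma>" shows "seed_class (reindex \<sigma> s) = seed_class s"
proof (intro equalityI subsetI)
  fix t assume "t \<in> seed_class (reindex \<sigma> s)"
  then obtain \<rho> where "bij \<rho>" "t = reindex \<rho> (reindex \<sigma> s)" by (auto simp: seed_class_def)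
  then have "t = reindex (\<sigma> \<circ> \<rho>) s" "bij (\<sigma> \<circ> \<rho>)" using s by (simp_all add: reindex_reindex bij_comp)
  then show "t \<in> seed_class s" unfolding seed_class_def by blast
next
  fix t assume "t \<in> seed_class s"
  then obtain \<rho> where r: "bij \<rho>" "t = reindex \<rho> s" by (auto simp: seed_class_def)
  have "\<sigma> \<circ> (inv \<sigma> \<circ> \<rho>) = \<rho>" using s by (simp add: fun_eq_iff bij_is_surj surj_f_inv_f)
  then have "t = reindex (inv \<sigma> \<circ> \<rho>) (reindex \<sigma> s)" using r by (simp add: reindex_reindex)
  moreover have "bij (inv \<sigma> \<circ> \<rho>)" using s r by (simp add: bij_comp bij_imp_bij_inv)
  ultimately show "t \<in> seed_class (reindex \<sigma> s)" unfolding seed_class_def by blast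
qed

lemma seed_class_eq_iff: "seed_class s = seed_class t \<longleftrightarrow> (\<exists>\<sigma>. bij \<sigma> \<and> t = reindex \<sigma> s)"
proof
  assume "seed_class s = seed_class t"
  then have "t \<in> seed_class s" using seed_class_self[of t] by metis
  then show "\<exists>\<sigma>. bij \<sigma> \<and> t = reindex \<sigma> s" by (auto simp: seed_class_def)
qed (auto simp: seed_class_reindex)

lemma in_seed_class: "t \<in> seed_class s \<longleftrightarrow> seed_class t = seed_class s"
proof
  assume "t \<in> seed_class s"
  then obtain \<sigma> where "bij \<sigma>" "t = reindex \<sigma> s" by (auto simp: seed_class_def)
  then show "seed_class t = seed_class s" by (simp add: seed_class_reindex)
next
  assume "seed_class t = seed_class s"
  then show "t \<in> seed_class s" using seed_class_self[of t] by metis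
qed

lemma mutation_reindex:
  assumes "bij \<sigma>"
  shows "seed_mutation form pos k (reindex \<sigma> s) = reindex \<sigma> (seed_mutation form pos (\<sigma> k) s)"
proof -
  have inj: "\<sigma> i = \<sigma> j \<longleftrightarrow> i = j" for i j using assms by (auto dest: bij_is_inj injD)
  have "matrix_mutation k (reindex_matrix \<sigma> (snd s)) = reindex_matrix \<sigma> (matrix_mutation (\<sigma> k) (snd s))"
    by (auto simp: vec_eq_iff reindex_matrix_def matrix_mutation_nth inj)
  moreover have "fst (seed_mutation form pos k (reindex \<sigma> s)) i = fst (reindex \<sigma> (seed_mutation form pos (\<sigma> k) s)) i" for i
    by (simp add: fst_mutation reindex_def reindex_matrix_def inj)
  ultimately show ?thesis
    by (intro prod_eqI ext) (simp_all add: snd_mutation, simp_all add: reindex_def snd_mutation)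
qed

text \<open>Since relabelling commutes with mutation, a path in the exchange graph lifts to a path of labelled
  seeds, so that distances may be computed with labels.\<close>

lemma exchange_growth_eq:
  assumes inv: "\<And>s k. s \<in> mutation_reachable form pos s0 \<Longrightarrow>
      seed_mutation form pos k (seed_mutation form pos k s) = s"
  shows "exchange_growth form pos s0 m = card (seed_class ` labelled_ball form pos s0 m)"
proof -
  let ?adj = "exchange_adjacent form pos s0" and ?R = "mutation_reachable form pos s0"
  have invc: "seed_mutation form pos k (seed_mutation form pos k s) = s"
    if s: "seed_class s \<in> exchange_vertices form pos s0" for s k
  proof -
    obtain t where t: "t \<in> ?R" "seed_class s = seed_class t"
      using s by (auto simp: exchange_vertices_def)
    then obtain \<sigma> where "bij \<sigma>" "s = reindex \<sigma> t" using seed_class_eq_iff by metis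
    then show ?thesis using inv[OF t(1)] by (simp add: mutation_reindex)
  qed
  have up: "(?adj ^^ n) (seed_class s0) (seed_class s)" if "(mutation_step form pos ^^ n) s0 s" for n s
    using that
  proof (induction n arbitrary: s)
    case (Suc n)
    then obtain t where t: "(mutation_step form pos ^^ n) s0 t" and st: "mutation_step form pos t s"
      by auto
    then obtain k where s: "s = seed_mutation form pos k t" unfolding mutation_step_def by blast
    have tR: "t \<in> ?R" using t by (auto simp: reachable_step rtranclp_power)
    have "?adj (seed_class t) (seed_class s)"
      unfolding exchange_adjacent_def exchange_vertices_def s
      using tR reachable_mutation[OF tR] seed_class_self by (meson imageI)
    then show ?case using Suc.IH[OF t] by auto
  qed auto
  have down: "\<exists>s. (mutation_step form pos ^^ n) s0 s \<and> X = seed_class s" if "(?adj ^^ n) (seed_class s0) X" for n X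
    using that
  proof (induction n arbitrary: X)
    case 0 then show ?case by auto
  next
    case (Suc n)
    then obtain Y where Y: "(?adj ^^ n) (seed_class s0) Y" "?adj Y X" by auto
    then obtain t where t: "(mutation_step form pos ^^ n) s0 t" "Y = seed_class t" using Suc.IH by blast
    obtain x where x: "X = seed_class x" using Y(2) by (auto simp: exchange_adjacent_def exchange_vertices_def)
    have "\<exists>s\<in>Y. \<exists>k. seed_mutation form pos k s \<in> X"
      using Y(2) unfolding exchange_adjacent_def
    proof (elim conjE disjE bexE exE)
      fix s k assume s: "s \<in> X" "seed_mutation form pos k s \<in> Y" and X: "X \<in> exchange_vertices form pos s0"
      have "seed_class s = X" using s(1) by (simp add: x in_seed_class)
      then have "seed_mutation form pos k (seed_mutation form pos k s) = s" using invc X by simp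
      then show ?thesis using s by metis
    qed auto
    then obtain s k where s: "s \<in> Y" "seed_mutation form pos k s \<in> X" by blast
    obtain \<sigma> where sg: "bij \<sigma>" "s = reindex \<sigma> t" using s(1) t(2) by (auto simp: seed_class_def)
    have "X = seed_class (seed_mutation form pos (\<sigma> k) t)"
      using s(2) sg by (simp add: x in_seed_class mutation_reindex seed_class_reindex)
    moreover have "(mutation_step form pos ^^ Suc n) s0 (seed_mutation form pos (\<sigma> k) t)"
      using t(1) by (intro relpowp_Suc_I) (auto simp: mutation_step_def)
    ultimately show ?case by blast
  qed
  have "{X \<in> exchange_vertices form pos s0. exchange_dist form pos s0 (seed_class s0) X \<le> m}
      = seed_class ` labelled_ball form pos s0 m" (is "?A = ?B")
  proof (intro equalityI subsetI)
    fix X assume X: "X \<in> ?A"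
    then obtain s where s: "s \<in> ?R" "X = seed_class s" by (auto simp: exchange_vertices_def)
    then obtain n where "(mutation_step form pos ^^ n) s0 s" by (auto simp: reachable_step rtranclp_power)
    then have ex: "\<exists>n. (?adj ^^ n) (seed_class s0) X" using up s(2) by blast
    have "(?adj ^^ exchange_dist form pos s0 (seed_class s0) X) (seed_class s0) X"
      unfolding exchange_dist_def using LeastI_ex[OF ex] .
    from down[OF this] X show "X \<in> ?B" unfolding labelled_ball_def by auto
  next
    fix X assume "X \<in> ?B"
    then obtain n s where s: "n \<le> m" "(mutation_step form pos ^^ n) s0 s" "X = seed_class s"
      by (auto simp: labelled_ball_def)
    have "exchange_dist form pos s0 (seed_class s0) X \<le> n"
      unfolding exchange_dist_def using up[OF s(2)] s(3) by (simp add: Least_le)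
    moreover have "s \<in> ?R" using s(2) by (auto simp: reachable_step rtranclp_power)
    ultimately show "X \<in> ?A" using s by (auto simp: exchange_vertices_def)
  qed
  then show ?thesis unfolding exchange_growth_def by simp
qed

lemma card_class_le: "card (seed_class (s :: ('n::finite,'v) labelled_seed)) \<le> card {\<sigma> :: 'n \<Rightarrow> 'n. bij \<sigma>}"
proof -
  have "seed_class s = (\<lambda>\<sigma>. reindex \<sigma> s) ` {\<sigma>. bij \<sigma>}" by (auto simp: seed_class_def)
  then show ?thesis by (simp add: card_image_le)
qed

lemma card_ball_le:
  fixes A :: "('n::finite,'v) labelled_seed set"
  assumes "finite A"
  shows "card A \<le> card {\<sigma> :: 'n \<Rightarrow> 'n. bij \<sigma>} * card (seed_class ` A)"
proof -
  have fin: "finite (seed_class s)" for s :: "('n,'v) labelled_seed"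
  proof -
    have "seed_class s = (\<lambda>\<sigma>. reindex \<sigma> s) ` {\<sigma>. bij \<sigma>}" by (auto simp: seed_class_def)
    then show ?thesis by simp
  qed
  have "A \<subseteq> \<Union> (seed_class ` A)" using seed_class_self by blast
  then have "card A \<le> card (\<Union> (seed_class ` A))" using assms fin by (intro card_mono) auto
  also have "\<dots> \<le> sum card (seed_class ` A)" by (rule card_Union_le_sum_card)
  also have "\<dots> \<le> (\<Sum>X\<in>seed_class ` A. card {\<sigma> :: 'n \<Rightarrow> 'n. bij \<sigma>})"
    by (intro sum_mono) (auto simp: card_class_le)
  finally show ?thesis by (simp add: mult.commute)
qed

section \<open>Mutation at two vertices\<close>

text \<open>For vectors of norm 2 and inner product \<open>c\<close>: up to a sign the first vector is reflected in the second one
  and both are exchanged, so that the pair is turned within its span.\<close>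

definition rot2 :: "real \<Rightarrow> 'v::real_vector \<times> 'v \<Rightarrow> 'v \<times> 'v" where
  "rot2 c x = (snd x, c *\<^sub>R snd x - fst x)"

definition rot_coord :: "real \<Rightarrow> real \<Rightarrow> real \<Rightarrow> complex" where
  "rot_coord \<phi> x y = of_real y - cis (- \<phi>) * of_real x"

lemma rot_coord_Re_Im:
  "Re (rot_coord \<phi> x y) = y - cos \<phi> * x" "Im (rot_coord \<phi> x y) = sin \<phi> * x"
  by (simp_all add: rot_coord_def)

lemma rot_coord_rot: "rot_coord \<phi> y (2 * cos \<phi> * y - x) = cis \<phi> * rot_coord \<phi> x y"
proof -
  have sc: "cos \<phi> * cos \<phi> + sin \<phi> * sin \<phi> = 1" using sin_cos_squared_add[of \<phi>] by (simp add: power2_eq_square)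
  have "2 * cos \<phi> * y - x - cos \<phi> * y = cos \<phi> * (y - cos \<phi> * x) - sin \<phi> * (sin \<phi> * x)"
    using sc by algebra
  moreover have "sin \<phi> * y = cos \<phi> * (sin \<phi> * x) + sin \<phi> * (y - cos \<phi> * x)" by algebra
  ultimately show ?thesis unfolding complex_eq_iff by (simp only: rot_coord_Re_Im times_complex.sel cis.sel)
qed

lemma rot_coord_minus: "rot_coord \<phi> (- x) (- y) = - rot_coord \<phi> x y"
  by (simp add: rot_coord_def)

lemma rot_coord_0:
  assumes "rot_coord \<phi> x y = 0" "sin \<phi> \<noteq> 0" shows "x = 0" "y = 0"
proof -
  show x: "x = 0" using assms rot_coord_Re_Im(2)[of \<phi> x y] by simp
  show "y = 0" using assms x rot_coord_Re_Im(1)[of \<phi> x y] by simp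
qed

lemma cis_sign_angle:
  assumes "(-1)^m * cis (real a * \<phi>) = 1" shows "\<exists>n::int. real a * \<phi> = of_int n * pi"
proof -
  have "Im ((-1)^m * cis (real a * \<phi>)) = 0" using assms by simp
  then have "sin (real a * \<phi>) = 0" by (cases "even m") auto
  then show ?thesis by (auto simp: sin_zero_iff_int2)
qed

text \<open>The tropical rotation below is what mutation at two vertices, done alternately, does to the
  weights towards a third vertex.  Negative second coordinates cost two steps that together change
  all signs.\<close>

definition trop_step :: "real \<Rightarrow> real \<times> real \<Rightarrow> real \<times> real" where
  "trop_step b x = (snd x, b * max (snd x) 0 - fst x)"

definition trop_macro :: "real \<Rightarrow> real \<times> real \<Rightarrow> real \<times> real" where
  "trop_macro b x = (if snd x \<ge> 0 then (snd x, b * snd x - fst x) else (- fst x, - snd x))"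

definition trop_good :: "real \<times> real \<Rightarrow> bool" where
  "trop_good x \<longleftrightarrow> fst x \<ge> 0 \<or> snd x \<ge> 0"

lemma trop_good_step: "\<not> trop_good x \<Longrightarrow> trop_good (trop_step b x)"
  by (auto simp: trop_good_def trop_step_def)

lemma trop_macro_good:
  assumes "trop_good x"
  shows "trop_good (trop_macro b x)" "\<exists>n. trop_macro b x = (trop_step b ^^ n) x"
proof -
  show "trop_good (trop_macro b x)" using assms by (auto simp: trop_good_def trop_macro_def)
  show "\<exists>n. trop_macro b x = (trop_step b ^^ n) x"
  proof (cases "snd x \<ge> 0")
    case True
    then have "trop_macro b x = (trop_step b ^^ 1) x" by (simp add: trop_macro_def trop_step_def)
    then show ?thesis by blast
  next
    case False
    then have "trop_macro b x = (trop_step b ^^ 2) x" using assms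
      by (simp add: trop_macro_def trop_step_def trop_good_def numeral_2_eq_2)
    then show ?thesis by blast
  qed
qed

lemma trop_macro_period:
  assumes n: "n \<ge> 1" and per: "(trop_macro (2 * cos \<phi>) ^^ n) x = x" and x: "x \<noteq> (0, 0)"
    and \<phi>: "sin \<phi> \<noteq> 0"
  shows "\<exists>a k. a \<ge> (1::nat) \<and> real a * \<phi> = of_int k * pi"
proof -
  let ?M = "trop_macro (2 * cos \<phi>)"
  let ?Z = "\<lambda>y. rot_coord \<phi> (fst y) (snd y)"
  have step: "?Z (?M y) = (if snd y \<ge> 0 then cis \<phi> else -1) * ?Z y" for y
    by (simp add: trop_macro_def rot_coord_rot rot_coord_minus)
  have "\<exists>a m. n = a + m \<and> ?Z ((?M ^^ n) x) = (-1)^m * cis (real a * \<phi>) * ?Z x \<and>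
      m \<le> a + (if snd ((?M ^^ n) x) \<ge> 0 then 1 else 0)" for n
  proof (induction n)
    case 0 show ?case by (auto intro!: exI[of _ "0::nat"])
  next
    case (Suc n)
    then obtain a m where IH: "n = a + m" "?Z ((?M ^^ n) x) = (-1)^m * cis (real a * \<phi>) * ?Z x"
      "m \<le> a + (if snd ((?M ^^ n) x) \<ge> 0 then 1 else 0)" by blast
    show ?case
    proof (cases "snd ((?M ^^ n) x) \<ge> 0")
      case True
      have "?Z ((?M ^^ Suc n) x) = cis \<phi> * ?Z ((?M ^^ n) x)" using True by (simp add: step)
      also have "\<dots> = (-1)^m * cis (real (Suc a) * \<phi>) * ?Z x"
        unfolding IH(2) by (simp add: algebra_simps flip: cis_mult)
      finally show ?thesis using IH True by (intro exI[of _ "Suc a"] exI[of _ m]) auto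
    next
      case False
      have "?Z ((?M ^^ Suc n) x) = - ?Z ((?M ^^ n) x)" using False by (simp add: step)
      also have "\<dots> = (-1)^(Suc m) * cis (real a * \<phi>) * ?Z x" unfolding IH(2) by simp
      finally have "?Z ((?M ^^ Suc n) x) = (-1)^(Suc m) * cis (real a * \<phi>) * ?Z x" .
      moreover have "snd ((?M ^^ Suc n) x) \<ge> 0" using False by (simp add: trop_macro_def)
      ultimately show ?thesis using IH False by (intro exI[of _ a] exI[of _ "Suc m"]) auto
    qed
  qed
  then obtain a m where am: "n = a + m" "?Z ((?M ^^ n) x) = (-1)^m * cis (real a * \<phi>) * ?Z x"
    "m \<le> a + (if snd ((?M ^^ n) x) \<ge> 0 then 1 else 0)" by blast
  have Z: "?Z x \<noteq> 0" using rot_coord_0[of \<phi> "fst x" "snd x"] x \<phi> by (metis prod.collapse)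
  have one: "(-1)^m * cis (real a * \<phi>) = 1" using am(2) Z unfolding per by simp
  have "a \<noteq> 0"
  proof
    assume "a = 0"
    then have "m = 1" using am n by (auto split: if_splits)
    then show False using one \<open>a = 0\<close> by simp
  qed
  then show ?thesis using cis_sign_angle[OF one] by (intro exI[of _ a]) auto
qed

lemma angle_as_fraction:
  assumes "0 < \<phi>" "\<phi> < pi / 2" "real a * \<phi> = of_int k * pi" "a \<ge> (1::nat)"
  shows "\<exists>p q :: nat. p \<ge> 1 \<and> q \<ge> 1 \<and> coprime p q \<and> 2 * p < q \<and> \<phi> = pi * real p / real q"
proof -
  have "real a * \<phi> > 0" using assms(1,4) by (intro mult_pos_pos) simp_all
  then have "of_int k * pi > 0" unfolding assms(3) .
  then have k: "k > 0" by (simp add: zero_less_mult_iff)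
  define d where "d = gcd (nat k) a"
  have d: "d > 0" using assms(4) by (simp add: d_def)
  obtain p q where pq: "nat k = p * d" "a = q * d" "coprime p q"
    using gcd_coprime_exists[of "nat k" a] d unfolding d_def by blast
  have "nat k \<noteq> 0" "a \<noteq> 0" using assms(4) k by simp_all
  then have "q \<noteq> 0" "p \<noteq> 0" unfolding pq(1,2) by (metis mult_0)+
  then have q: "q \<ge> 1" "p \<ge> 1" by simp_all
  have "real a * \<phi> = real (nat k) * pi" using assms(3) k by simp
  then have "real q * \<phi> = real p * pi" using d unfolding pq(1,2) by (simp add: mult_ac)
  then have phi: "\<phi> = pi * real p / real q" using q by (simp add: field_simps)
  have "2 * p < q"
  proof (rule ccontr)
    assume "\<not> 2 * p < q"
    then have "2 * real p \<ge> real q" by linarith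
    then have "pi * real p / real q \<ge> pi / 2" using q by (simp add: field_simps)
    then show False using assms phi by simp
  qed
  then show ?thesis using pq q phi by blast
qed

definition matrix_reach :: "real^'n^'n \<Rightarrow> (real^'n^'n) set" where
  "matrix_reach B = {B'. (\<lambda>X Y. \<exists>k. Y = matrix_mutation k X)\<^sup>*\<^sup>* B B'}"

lemma matrix_reach_refl: "B \<in> matrix_reach B"
  by (simp add: matrix_reach_def)

lemma matrix_reach_step: "B' \<in> matrix_reach B \<Longrightarrow> matrix_mutation k B' \<in> matrix_reach B"
  unfolding matrix_reach_def mem_Collect_eq by (rule rtranclp.rtrancl_into_rtrancl) auto

lemma matrix_reach_trans: "B' \<in> matrix_reach B \<Longrightarrow> matrix_reach B' \<subseteq> matrix_reach B"
  unfolding matrix_reach_def by auto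

lemma mutation_finite_reach: "mutation_finite B \<Longrightarrow> B' \<in> matrix_reach B \<Longrightarrow> mutation_finite B'"
  using matrix_reach_trans[of B' B] finite_subset
  unfolding mutation_finite_def matrix_reach_def[symmetric] by blast

lemma skew_reach: "skew_symmetric B \<Longrightarrow> B' \<in> matrix_reach B \<Longrightarrow> skew_symmetric B'"
proof -
  assume *: "skew_symmetric B" "B' \<in> matrix_reach B"
  from *(2) have "(\<lambda>X Y. \<exists>k. Y = matrix_mutation k X)\<^sup>*\<^sup>* B B'" by (simp add: matrix_reach_def)
  then show ?thesis using *(1) by induction (auto intro: skew_mutation)
qed

text \<open>Alternate mutation at the two ends of an arrow of weight \<open>2 cos \<phi>\<close> turns the pair of
  weights to a third vertex by the angle \<open>\<phi>\<close>, apart from sign changes; with finitely many matrices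
  the angle is therefore a rational multiple of \<open>\<pi>\<close>.\<close>

lemma weight_rational:
  fixes B :: "real^'n^'n"
  assumes sk: "skew_symmetric B" and fin: "mutation_finite B"
    and ne: "i \<noteq> j" "j \<noteq> k" "i \<noteq> k" and b: "0 < B $ i $ j" "B $ i $ j < 2"
    and nz: "B $ i $ k \<noteq> 0 \<or> B $ j $ k \<noteq> 0"
  shows "\<exists>p q :: nat. p \<ge> 1 \<and> q \<ge> 1 \<and> coprime p q \<and> 2 * p < q \<and> B $ i $ j = 2 * cos (pi * real p / real q)"
proof -
  define b where "b = B $ i $ j"
  define \<phi> where "\<phi> = arccos (b / 2)"
  have bphi: "b = 2 * cos \<phi>" using assms by (simp add: \<phi>_def b_def)
  have phi: "0 < \<phi>" "\<phi> < pi / 2"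
    using arccos_lt_bounded[of "b/2"] b arccos_less_arccos[of 0 "b/2"] by (auto simp: \<phi>_def b_def)
  define st where "st = (\<lambda>(X :: real^'n^'n, i, j). (- (X $ i $ k), X $ j $ k))"
  define T where "T = {(X, i', j') | X i' j'. X \<in> matrix_reach B \<and> i' \<noteq> j' \<and> {i', j'} = {i, j} \<and> X $ i' $ j' = b}"
  have "finite (matrix_reach B)" using fin by (simp add: mutation_finite_def matrix_reach_def)
  then have "finite (matrix_reach B \<times> {i,j} \<times> {i,j})" by blast
  then have finT: "finite T" by (rule finite_subset[rotated]) (auto simp: T_def)
  have stepT: "trop_step b x \<in> st ` T" if xT: "x \<in> st ` T" for x
  proof -
    obtain X i' j' where X: "X \<in> matrix_reach B" "i' \<noteq> j'" "{i', j'} = {i, j}" "X $ i' $ j' = b" "x = st (X, i', j')"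
      using xT unfolding T_def by blast
    have sX: "skew_symmetric X" using skew_reach[OF sk X(1)] .
    have "k \<notin> {i', j'}" unfolding X(3) using ne by simp
    then have "trop_step b x = st (matrix_mutation j' X, j', i')"
      using X(2,4,5) b(1) by (auto simp: st_def trop_step_def matrix_mutation_nth max_def field_simps b_def)
    moreover have "(matrix_mutation j' X, j', i') \<in> T"
      using X matrix_reach_step[OF X(1)] skewD[OF sX, of i' j'] by (auto simp: T_def matrix_mutation_nth)
    ultimately show ?thesis by blast
  qed
  have iterT: "(trop_step b ^^ n) x \<in> st ` T" if "x \<in> st ` T" for x n
    using that by (induction n) (auto simp: stepT)
  have nz': "\<not> (fst (trop_step b x) = 0 \<and> snd (trop_step b x) = 0)" if "x \<noteq> (0,0)" for x
    using that by (cases x) (auto simp: trop_step_def)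
  define x0 where "x0 = st (B, i, j)"
  have "(B, i, j) \<in> T" using matrix_reach_refl ne by (auto simp: T_def b_def)
  then have x0: "x0 \<in> st ` T" unfolding x0_def by (rule imageI)
  have x0n: "x0 \<noteq> (0,0)" using nz by (auto simp: x0_def st_def)
  obtain x1 where x1: "x1 \<in> st ` T" "x1 \<noteq> (0,0)" "trop_good x1"
  proof (cases "trop_good x0")
    case True then show ?thesis using x0 x0n that by blast
  next
    case False
    have "trop_step b x0 \<noteq> (0,0)" using nz'[OF x0n] by auto
    then show ?thesis using that[OF stepT[OF x0]] trop_good_step[OF False] by blast
  qed
  have orb: "(trop_macro b ^^ n) x1 \<in> st ` T \<and> trop_good ((trop_macro b ^^ n) x1) \<and> (trop_macro b ^^ n) x1 \<noteq> (0,0)" for n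
  proof (induction n)
    case (Suc n)
    obtain l where l: "trop_macro b ((trop_macro b ^^ n) x1) = (trop_step b ^^ l) ((trop_macro b ^^ n) x1)"
      using trop_macro_good(2) Suc by blast
    have "trop_macro b y \<noteq> (0,0)" if "y \<noteq> (0,0)" for y using that by (cases y) (auto simp: trop_macro_def)
    then have "trop_macro b ((trop_macro b ^^ n) x1) \<noteq> (0,0)" using Suc by blast
    moreover have "trop_good (trop_macro b ((trop_macro b ^^ n) x1))" using Suc trop_macro_good(1) by blast
    moreover have "trop_macro b ((trop_macro b ^^ n) x1) \<in> st ` T" unfolding l using Suc iterT by blast
    ultimately show ?case by simp
  qed (use x1 in auto)
  have "\<not> inj_on (\<lambda>n. (trop_macro b ^^ n) x1) UNIV"
  proof
    assume "inj (\<lambda>n. (trop_macro b ^^ n) x1)"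
    moreover have "finite (range (\<lambda>n. (trop_macro b ^^ n) x1))"
      by (rule finite_subset[of _ "st ` T"]) (use orb finT in auto)
    ultimately show False using finite_imageD infinite_UNIV_nat by blast
  qed
  then obtain m n where mn: "m < n" "(trop_macro b ^^ m) x1 = (trop_macro b ^^ n) x1"
    unfolding inj_on_def by (metis linorder_neqE_nat)
  have "(trop_macro b ^^ (n - m)) ((trop_macro b ^^ m) x1) = (trop_macro b ^^ m) x1"
    using mn by (metis funpow_add comp_apply le_add_diff_inverse2 less_imp_le)
  moreover have "sin \<phi> \<noteq> 0" using phi sin_gt_zero[of \<phi>] by simp
  moreover have "n - m \<ge> 1" using mn by simp
  ultimately obtain a k where "a \<ge> 1" "real a * \<phi> = of_int k * pi"
    using trop_macro_period[of "n - m" \<phi> "(trop_macro b ^^ m) x1"] orb[of m] unfolding bphi by blast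
  then show ?thesis using angle_as_fraction[OF phi] bphi unfolding b_def by metis
qed

section \<open>Positivity and the sign rule\<close>

text \<open>All that matters about a reference point is that the positive vectors are closed under addition
  and positive scaling and do not contain zero.\<close>

locale seed_space =
  fixes form :: "'v::real_vector \<Rightarrow> 'v \<Rightarrow> real" and pos :: "'v \<Rightarrow> bool"
  assumes form_add: "form (x + y) z = form x z + form y z"
    and form_scale: "form (c *\<^sub>R x) z = c * form x z"
    and form_sym: "form x y = form y x"
    and pos_add: "pos x \<Longrightarrow> pos y \<Longrightarrow> pos (x + y)"
    and pos_scale: "c > 0 \<Longrightarrow> pos x \<Longrightarrow> pos (c *\<^sub>R x)"
    and pos_zero: "\<not> pos 0"
begin

lemma form_add2: "form z (x + y) = form z x + form z y"
  using form_add[of x y z] by (simp add: form_sym)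

lemma form_scale2: "form z (c *\<^sub>R x) = c * form z x"
  using form_scale[of c x z] by (simp add: form_sym)

lemma form_minus: "form (- x) z = - form x z" using form_scale[of "-1" x z] by simp

lemma form_minus2: "form z (- x) = - form z x" using form_scale2[of z "-1" x] by simp

lemma form_diff: "form (x - y) z = form x z - form y z"
  using form_add[of x "- y" z] by (simp add: form_minus)

lemma form_diff2: "form z (x - y) = form z x - form z y"
  using form_diff[of x y z] by (simp add: form_sym)

lemma form_zero: "form 0 z = 0" using form_scale[of 0 0 z] by simp

lemma form_zero2: "form z 0 = 0" using form_zero[of z] by (simp add: form_sym)

lemmas form_simps = form_add form_scale form_add2 form_scale2 form_minus form_minus2 form_diff
  form_diff2 form_zero form_zero2

lemma pos_minus: "pos x \<Longrightarrow> \<not> pos (- x)"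
  using pos_add[of x "- x"] pos_zero by auto

lemma mutation_invol:
  assumes "skew_symmetric (snd s)" "form (fst s k) (fst s k) = 2" "pos (fst s k) \<or> pos (- fst s k)"
  shows "seed_mutation form pos k (seed_mutation form pos k s) = s"
proof -
  have sg: "pos (- fst s k) \<longleftrightarrow> \<not> pos (fst s k)" using assms(3) pos_minus[of "fst s k"] by auto
  have "fst (seed_mutation form pos k (seed_mutation form pos k s)) i = fst s i" for i
    by (auto simp: fst_mutation[of form pos k "seed_mutation form pos k s"] fst_mutation[of form pos k s]
        snd_mutation matrix_mutation_nth form_simps assms(2) sg)
  then show ?thesis using matrix_mutation_invol[OF assms(1)]
    by (intro prod_eqI ext) (simp_all add: snd_mutation)
qed

definition pair_step :: "'v \<times> 'v \<Rightarrow> 'v \<times> 'v" where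
  "pair_step w = (- snd w, if pos (snd w) then fst w else fst w - form (fst w) (snd w) *\<^sub>R snd w)"

definition decided :: "'v \<Rightarrow> bool" where "decided x \<longleftrightarrow> pos x \<or> pos (- x)"

lemma decidedD: "decided x \<Longrightarrow> pos (- x) \<longleftrightarrow> \<not> pos x"
  unfolding decided_def using pos_minus[of x] by auto

lemma rot2_scale1: "rot2 c (t *\<^sub>R x) = t *\<^sub>R rot2 c x"
  by (simp add: rot2_def algebra_simps)

text \<open>Rank 2 dynamics.  As long as the second vector is negative the pair is rotated; once it is
  positive, two steps in a row change the signs of both vectors.  Counting both kinds of moves over a
  period, at most two rotations separate sign changes if the two vectors make an acute angle,
  and at least one does in any case.\<close>

lemma pair_step_period:
  assumes norm: "form (fst w) (fst w) = 2" "form (snd w) (snd w) = 2"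
    and c: "form (fst w) (snd w) = c" "c \<noteq> 0"
    and dec: "\<And>n. decided (fst ((pair_step ^^ n) w)) \<and> decided (snd ((pair_step ^^ n) w))"
    and allowed: "pos (fst w) \<or> \<not> pos (snd w)"
    and per: "(pair_step ^^ N) w = w"
  shows "\<exists>a m. N = a + 2 * m \<and> m \<le> a \<and> (c > 0 \<longrightarrow> a \<le> 2 * m) \<and>
     (- fst w, snd w) = (-1)^m *\<^sub>R (rot2 (- c) ^^ a) (- fst w, snd w)"
proof -
  define e :: "'v \<times> 'v \<Rightarrow> nat" where "e = (\<lambda>x. if pos (snd x) then 0 else 1)"
  define d :: "'v \<times> 'v \<Rightarrow> nat" where "d = (\<lambda>x. if pos (snd x) then 0 else if pos (fst x) then 1 else 2)"
  define M where "M = (\<lambda>n a m x. n = a + 2 * m \<and> form (fst x) (fst x) = 2 \<and> form (snd x) (snd x) = 2 \<and>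
     form (fst x) (snd x) = c \<and> (pos (fst x) \<or> \<not> pos (snd x)) \<and>
     (- fst x, snd x) = (-1)^m *\<^sub>R (rot2 (- c) ^^ a) (- fst w, snd w) \<and>
     m + e w \<le> a + e x \<and> (c > 0 \<longrightarrow> a + d x \<le> 2 * m + d w))"
  have inv: "(\<exists>a m. M n a m ((pair_step ^^ n) w)) \<or>
     (\<exists>a m. pos (snd ((pair_step ^^ n) w)) \<and> form (fst ((pair_step ^^ n) w)) (snd ((pair_step ^^ n) w)) = - c \<and>
        M (Suc n) a m (- snd ((pair_step ^^ n) w), fst ((pair_step ^^ n) w)))" for n
  proof (induction n)
    case 0
    have "M 0 0 0 w" using norm c allowed by (simp add: M_def)
    then show ?case by auto
  next
    case (Suc n)
    define x where "x = (pair_step ^^ n) w"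
    have nx: "(pair_step ^^ Suc n) w = pair_step x" by (simp add: x_def)
    have dx: "decided (fst x)" "decided (snd x)" using dec[of n] by (auto simp: x_def)
    from Suc consider (mac) a m where "M n a m x"
      | (mid) a m where "pos (snd x)" "form (fst x) (snd x) = - c" "M (Suc n) a m (- snd x, fst x)"
      unfolding x_def by blast
    then show ?case
    proof cases
      case mac
      show ?thesis
      proof (cases "pos (snd x)")
        case True
        then have p: "pos (fst x)" "\<not> pos (- snd x)" using mac pos_minus by (auto simp: M_def)
        have ps: "pair_step x = (- snd x, fst x)" using True by (simp add: pair_step_def)
        have "(- fst (- fst x, - snd x), snd (- fst x, - snd x)) = (-1) *\<^sub>R (- fst x, snd x)" by simp
        also have "\<dots> = (-1)^(Suc m) *\<^sub>R (rot2 (- c) ^^ a) (- fst w, snd w)"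
          using mac by (simp add: M_def)
        finally have "M (Suc (Suc n)) a (Suc m) (- fst x, - snd x)"
          using mac True p unfolding M_def by (auto simp: form_simps e_def d_def)
        then have "M (Suc (Suc n)) a (Suc m) (- snd (- snd x, fst x), fst (- snd x, fst x))"
          by simp
        moreover have "pos (snd (- snd x, fst x))" "form (fst (- snd x, fst x)) (snd (- snd x, fst x)) = - c"
          using p mac form_sym[of "snd x" "fst x"] by (auto simp: M_def form_simps)
        ultimately show ?thesis unfolding nx ps by blast
      next
        case False
        then have p: "pos (- snd x)" using decidedD[OF dx(2)] by simp
        have ps: "pair_step x = (- snd x, fst x - c *\<^sub>R snd x)" using False mac by (simp add: pair_step_def M_def)
        have "(- fst (pair_step x), snd (pair_step x)) = rot2 (- c) (- fst x, snd x)"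
          by (simp add: ps rot2_def)
        also have "\<dots> = (-1)^m *\<^sub>R rot2 (- c) ((rot2 (- c) ^^ a) (- fst w, snd w))"
          using mac by (simp add: M_def rot2_scale1)
        finally have lin: "(- fst (pair_step x), snd (pair_step x)) = (-1)^m *\<^sub>R (rot2 (- c) ^^ Suc a) (- fst w, snd w)"
          by simp
        have dd: "d (pair_step x) + 1 \<le> d x" if "c > 0"
        proof (cases "pos (fst x)")
          case True
          then have "pos (fst x + c *\<^sub>R (- snd x))" using that p by (intro pos_add pos_scale)
          then show ?thesis using True False by (simp add: d_def ps)
        next
          case F: False
          then show ?thesis using False p by (simp add: d_def ps)
        qed
        have "M (Suc n) (Suc a) m (pair_step x)"
          using mac False p lin dd unfolding M_def
          by (auto simp: ps form_simps form_sym[of "snd x" "fst x"] e_def)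
        then show ?thesis unfolding nx by blast
      qed
    next
      case mid
      have ps: "pair_step x = (- snd x, fst x)" using mid by (simp add: pair_step_def)
      show ?thesis unfolding nx ps using mid by auto
    qed
  qed
  from inv[of N] c(2) have "\<exists>a m. M N a m w" unfolding per by (auto simp: c(1))
  then show ?thesis by (auto simp: M_def)
qed

lemma rot2_coord:
  assumes lin: "\<And>x y. l (x - y) = l x - l y" "\<And>t x. l (t *\<^sub>R x) = t * l x"
  shows "rot_coord \<phi> (l (fst ((rot2 (2 * cos \<phi>) ^^ a) x))) (l (snd ((rot2 (2 * cos \<phi>) ^^ a) x)))
    = cis (real a * \<phi>) * rot_coord \<phi> (l (fst x)) (l (snd x))"
proof (induction a)
  case (Suc a)
  define y where "y = (rot2 (2 * cos \<phi>) ^^ a) x"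
  have "rot_coord \<phi> (l (fst (rot2 (2 * cos \<phi>) y))) (l (snd (rot2 (2 * cos \<phi>) y)))
      = cis \<phi> * rot_coord \<phi> (l (fst y)) (l (snd y))"
    using rot_coord_rot[of \<phi> "l (snd y)" "l (fst y)"] by (simp add: rot2_def lin)
  also have "\<dots> = cis \<phi> * (cis (real a * \<phi>) * rot_coord \<phi> (l (fst x)) (l (snd x)))"
    using Suc by (simp add: y_def)
  also have "\<dots> = cis (real (Suc a) * \<phi>) * rot_coord \<phi> (l (fst x)) (l (snd x))"
    by (simp add: algebra_simps flip: cis_mult)
  finally show ?case by (simp add: y_def)
qed simp

text \<open>A pair with the wrong relation between signs and inner product turns by the angle
  \<open>\<pi> - \<pi> p / q\<close> instead of \<open>\<pi> p / q\<close>, and then the count of rotations and sign changes excludes the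
  period \<open>q + 2 p\<close>.\<close>

lemma pair_period_wrong:
  assumes norm: "form (fst w) (fst w) = 2" "form (snd w) (snd w) = 2"
    and pq: "p \<ge> 1" "q \<ge> 1" "coprime p q" "2 * p < q"
    and c: "form (fst w) (snd w) = 2 * cos (pi * real p / real q)"
    and dec: "\<And>n. decided (fst ((pair_step ^^ n) w)) \<and> decided (snd ((pair_step ^^ n) w))"
    and allowed: "pos (fst w) \<or> \<not> pos (snd w)"
    and per: "(pair_step ^^ (q + 2 * p)) w = w"
  shows False
proof -
  define \<phi> where "\<phi> = pi - pi * real p / real q"
  have th: "0 < pi * real p / real q" "pi * real p / real q < pi / 2"
  proof -
    have "2 * real p < real q" using pq(4) by linarith
    then show "pi * real p / real q < pi / 2" using pq by (simp add: field_simps)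
    show "0 < pi * real p / real q" using pq by simp
  qed
  have cpos: "2 * cos (pi * real p / real q) > 0" using cos_gt_zero[OF th] by simp
  have mc: "- (2 * cos (pi * real p / real q)) = 2 * cos \<phi>" by (simp add: \<phi>_def cos_diff)
  have sphi: "sin \<phi> \<noteq> 0" using sin_gt_zero[OF th(1)] th pi_gt_zero by (simp add: \<phi>_def sin_diff)
  obtain a m where am: "q + 2 * p = a + 2 * m" "m \<le> a" "a \<le> 2 * m"
    "(- fst w, snd w) = (-1)^m *\<^sub>R (rot2 (2 * cos \<phi>) ^^ a) (- fst w, snd w)"
    using pair_step_period[OF norm c _ dec allowed per] cpos unfolding mc by auto
  define l where "l = (\<lambda>x. form x (snd w))"
  have l: "l (x - y) = l x - l y" "l (t *\<^sub>R x) = t * l x" for x y t by (simp_all add: l_def form_simps)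
  define Z where "Z = (\<lambda>x. rot_coord \<phi> (l (fst x)) (l (snd x)))"
  have Zs: "Z (t *\<^sub>R x) = of_real t * Z x" for t x by (simp add: Z_def l rot_coord_def algebra_simps)
  have "Z (- fst w, snd w) = (-1)^m * (cis (real a * \<phi>) * Z (- fst w, snd w))"
    by (subst am(4)) (simp add: Zs, simp add: Z_def rot2_coord[of l, OF l])
  moreover have "Z (- fst w, snd w) \<noteq> 0"
    using rot_coord_0(2)[OF _ sphi, of "l (- fst w)" "l (snd w)"] norm(2) by (auto simp: Z_def l_def)
  ultimately have "(-1)^m * cis (real a * \<phi>) = 1" by (metis mult.assoc mult_cancel_right1)
  then obtain k :: int where "real a * \<phi> = of_int k * pi" using cis_sign_angle by blast
  then have "pi * (real a * (real q - real p)) = pi * (of_int k * real q)"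
    using pq by (simp add: \<phi>_def field_simps)
  then have "real a * (real q - real p) = of_int k * real q" using pi_neq_zero mult_left_cancel by blast
  then have "of_int (int a * (int q - int p)) = (of_int (k * int q) :: real)" by simp
  then have "int a * (int q - int p) = k * int q" by (simp only: of_int_eq_iff)
  then have "int q dvd int a * (int q - int p)" by simp
  moreover have "coprime (int q) (int q - int p)"
  proof -
    have "coprime (int q) (int p)" using pq(3) by (simp add: coprime_commute)
    then show ?thesis using gcd_diff2[of "int q" "int p"] by (simp add: coprime_iff_gcd_eq_1 gcd.commute)
  qed
  ultimately have "int q dvd int a" by (simp add: coprime_dvd_mult_left_iff)
  then have "q dvd a" by simp
  moreover have "a < q" using am pq by linarith
  ultimately have "a = 0" using dvd_imp_le[of q a] by (cases "a = 0") auto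
  then show False using am pq by simp
qed

text \<open>Only one of the two possible relations between signs and inner product survives the period condition;
  a pair of the exceptional sign pattern is moved to the other patterns by one step.\<close>

lemma pair_sign_rule:
  assumes norm: "form (fst w) (fst w) = 2" "form (snd w) (snd w) = 2"
    and pq: "p \<ge> 1" "q \<ge> 1" "coprime p q" "2 * p < q"
    and b: "b = 2 * cos (pi * real p / real q)" and c: "\<bar>form (fst w) (snd w)\<bar> = b"
    and dec: "\<And>n. decided (fst ((pair_step ^^ n) w)) \<and> decided (snd ((pair_step ^^ n) w))"
    and per: "(pair_step ^^ (q + 2 * p)) w = w"
  shows "form (fst w) (snd w) = (if \<not> pos (fst w) \<and> pos (snd w) then b else - b)"
proof (rule ccontr)
  assume neg: "\<not> ?thesis"
  have cc: "form (fst w) (snd w) = b \<or> form (fst w) (snd w) = - b" using c by (simp add: abs_if split: if_splits)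
  show False
  proof (cases "\<not> pos (fst w) \<and> pos (snd w)")
    case False
    then have "form (fst w) (snd w) = b" using neg cc by auto
    then show False using pair_period_wrong[OF norm pq _ dec _ per] False b by auto
  next
    case True
    then have f: "form (fst w) (snd w) = - b" using neg cc by auto
    let ?w = "pair_step w"
    have w: "?w = (- snd w, fst w)" using True by (simp add: pair_step_def)
    have shift: "(pair_step ^^ n) ?w = (pair_step ^^ Suc n) w" for n by (simp add: funpow_swap1)
    show False
    proof (rule pair_period_wrong[of ?w p q, OF _ _ pq])
      show "form (fst ?w) (snd ?w) = 2 * cos (pi * real p / real q)"
        using f by (simp add: w form_simps form_sym b)
      show "decided (fst ((pair_step ^^ n) ?w)) \<and> decided (snd ((pair_step ^^ n) ?w))" for n
        using dec[of "Suc n"] shift[of n] by simp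
      show "(pair_step ^^ (q + 2 * p)) ?w = ?w" using per shift[of "q + 2 * p"] by simp
      show "pos (fst ?w) \<or> \<not> pos (snd ?w)" using True by (simp add: w)
    qed (simp_all add: w form_simps norm)
  qed
qed

end

section \<open>Geometric realisations under mutation\<close>

text \<open>For a triangle of weights \<open>a, b, c\<close> along \<open>i \<rightarrow> j \<rightarrow> k \<rightarrow> i\<close> and inner products \<open>x, y, z\<close>: the
  parity condition says that \<open>x y z\<close> has the majority sign of \<open>a, b, c\<close>.\<close>

definition sign_compat :: "real \<Rightarrow> real \<Rightarrow> real \<Rightarrow> real \<Rightarrow> real \<Rightarrow> real \<Rightarrow> bool" where
  "sign_compat a b c x y z \<longleftrightarrow> \<bar>x\<bar> = \<bar>a\<bar> \<and> \<bar>y\<bar> = \<bar>b\<bar> \<and> \<bar>z\<bar> = \<bar>c\<bar> \<and>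
     ((a > 0 \<and> b > 0) \<or> (b > 0 \<and> c > 0) \<or> (a > 0 \<and> c > 0) \<longrightarrow> x * y * z = a * b * c) \<and>
     ((a < 0 \<and> b < 0) \<or> (b < 0 \<and> c < 0) \<or> (a < 0 \<and> c < 0) \<longrightarrow> x * y * z = - (a * b * c))"

lemma sign_compat_rotate: "sign_compat a b c x y z \<Longrightarrow> sign_compat b c a y z x"
  unfolding sign_compat_def by (simp add: mult_ac disj_ac)

lemma sign_compat_path:
  assumes "sign_compat a b c x y z" "a > 0" "b > 0" and s: "(x' = x \<and> y' = - y) \<or> (x' = - x \<and> y' = y)"
  shows "sign_compat (- a) (- b) (c - a * b) x' y' (z - x * y)"
proof -
  have xa: "x = a \<or> x = - a" "y = b \<or> y = - b" and P: "x * y * z = a * b * c"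
    using assms by (auto simp: sign_compat_def)
  then have "\<exists>e. (e = 1 \<or> e = -1) \<and> x * y = e * (a * b)" by (elim disjE) (auto intro: exI[of _ 1] exI[of _ "-1"])
  then obtain e where e: "e = 1 \<or> e = -1" "x * y = e * (a * b)" by blast
  then have ee: "e * e = 1" by auto
  have ab: "a * b > 0" using assms by simp
  have "(a * b) * (e * z) = (a * b) * c" using P unfolding e(2) by (simp add: mult_ac)
  then have "e * z = c" using ab by (metis mult_left_cancel less_irrefl)
  then have z: "z = e * c" using ee by (metis mult.assoc mult_1)
  have zz: "z - x * y = e * (c - a * b)" unfolding z e(2) by (simp add: algebra_simps)
  have "x' * y' = - (e * (a * b))" using s unfolding e(2)[symmetric] by auto
  then have "x' * y' * (z - x * y) = - (e * e) * (a * b * (c - a * b))" unfolding zz by (simp add: mult_ac)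
  then have prod: "x' * y' * (z - x * y) = - (- a * - b * (c - a * b))" using ee by simp
  have "\<bar>z - x * y\<bar> = \<bar>c - a * b\<bar>" unfolding zz using e(1) by auto
  moreover have "\<bar>x'\<bar> = \<bar>- a\<bar>" "\<bar>y'\<bar> = \<bar>- b\<bar>" using s xa by auto
  ultimately show ?thesis using prod assms(2,3) unfolding sign_compat_def by auto
qed

lemma sign_compat_reverse: "sign_compat a b c x y z \<Longrightarrow> sign_compat (- b) (- a) (- c) y x z"
  unfolding sign_compat_def by (simp add: mult_ac disj_ac)

lemma sign_compat_path2:
  assumes "sign_compat a b c x y z" "a < 0" "b < 0" and s: "(x' = x \<and> y' = - y) \<or> (x' = - x \<and> y' = y)"
  shows "sign_compat (- a) (- b) (c + a * b) x' y' (z - x * y)"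
proof -
  have "sign_compat (- (- b)) (- (- a)) (- c - (- b) * (- a)) y' x' (z - y * x)"
    using sign_compat_path[OF sign_compat_reverse[OF assms(1)], of y' x'] assms(2-) by auto
  from sign_compat_reverse[OF this] show ?thesis by (simp add: mult.commute add.commute)
qed

lemma sign_compat_nopath:
  assumes "sign_compat a b c x y z" "a * b \<le> 0" "\<bar>x'\<bar> = \<bar>x\<bar>" "\<bar>y'\<bar> = \<bar>y\<bar>" "x' * y' = x * y"
  shows "sign_compat (- a) (- b) c x' y' z"
proof -
  have P: "c > 0 \<Longrightarrow> x * y * z = a * b * c" "c < 0 \<Longrightarrow> x * y * z = - (a * b * c)" if "a \<noteq> 0" "b \<noteq> 0"
  proof -
    have "(a > 0 \<and> b < 0) \<or> (a < 0 \<and> b > 0)" using assms(2) that by (auto simp: mult_le_0_iff)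
    moreover have "(b > 0 \<and> c > 0) \<or> (a > 0 \<and> c > 0) \<Longrightarrow> x * y * z = a * b * c"
      "(b < 0 \<and> c < 0) \<or> (a < 0 \<and> c < 0) \<Longrightarrow> x * y * z = - (a * b * c)"
      using assms(1) unfolding sign_compat_def by argo+
    ultimately show "c > 0 \<Longrightarrow> x * y * z = a * b * c" "c < 0 \<Longrightarrow> x * y * z = - (a * b * c)"
      by blast+
  qed
  have Z: "x * y * z = 0" "a * b * c = 0" if "a = 0 \<or> b = 0"
  proof -
    have "\<bar>x\<bar> = \<bar>a\<bar>" "\<bar>y\<bar> = \<bar>b\<bar>" using assms(1) unfolding sign_compat_def by blast+
    then have "x = 0 \<or> y = 0" using that by (metis abs_eq_0_iff)
    then show "x * y * z = 0" "a * b * c = 0" using that by auto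
  qed
  have "\<bar>x'\<bar> = \<bar>- a\<bar>" "\<bar>y'\<bar> = \<bar>- b\<bar>" "\<bar>z\<bar> = \<bar>c\<bar>"
    using assms(1,3,4) by (simp_all add: sign_compat_def)
  moreover have E: "x' * y' * z = x * y * z" "- a * - b * c = a * b * c" using assms(5) by simp_all
  moreover have "\<not> (- a > 0 \<and> - b > 0)" "\<not> (- a < 0 \<and> - b < 0)"
    using assms(2) by (auto simp: mult_le_0_iff)
  moreover have "c > 0 \<Longrightarrow> x' * y' * z = - a * - b * c"
    unfolding E by (cases "a = 0 \<or> b = 0") (simp_all add: P Z)
  moreover have "c < 0 \<Longrightarrow> x' * y' * z = - (- a * - b * c)"
    unfolding E by (cases "a = 0 \<or> b = 0") (simp_all add: P Z)
  ultimately show ?thesis unfolding sign_compat_def by blast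
qed

definition realises :: "('v \<Rightarrow> 'v \<Rightarrow> real) \<Rightarrow> (3, 'v) labelled_seed \<Rightarrow> bool" where
  "realises form s \<longleftrightarrow> skew_symmetric (snd s) \<and> (\<forall>i. form (fst s i) (fst s i) = 2) \<and>
     (\<forall>i j k. i \<noteq> j \<and> j \<noteq> k \<and> i \<noteq> k \<longrightarrow>
        sign_compat (snd s $ i $ j) (snd s $ j $ k) (snd s $ k $ i)
          (form (fst s i) (fst s j)) (form (fst s j) (fst s k)) (form (fst s k) (fst s i)))"

context seed_space begin

lemma realises_mutation:
  assumes s: "realises form s" shows "realises form (seed_mutation form pos l s)"
proof -
  define v where "v = fst s"
  define B where "B = snd s"
  define v' where "v' = fst (seed_mutation form pos l s)"
  define B' where "B' = matrix_mutation l B"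
  have sk: "skew_symmetric B" and nv: "\<And>i. form (v i) (v i) = 2"
    and sc: "\<And>i j k. i \<noteq> j \<Longrightarrow> j \<noteq> k \<Longrightarrow> i \<noteq> k \<Longrightarrow>
      sign_compat (B $ i $ j) (B $ j $ k) (B $ k $ i) (form (v i) (v j)) (form (v j) (v k)) (form (v k) (v i))"
    using s by (auto simp: realises_def v_def B_def)
  have v': "v' i = (if i = l then - v l else if (pos (v l) \<and> B $ i $ l < 0) \<or> (\<not> pos (v l) \<and> B $ i $ l > 0)
     then v i - form (v i) (v l) *\<^sub>R v l else v i)" for i
    by (simp add: v'_def v_def B_def fst_mutation)
  have core: "sign_compat (B' $ i $ l) (B' $ l $ k) (B' $ k $ i) (form (v' i) (v' l)) (form (v' l) (v' k)) (form (v' k) (v' i))"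
    if ne: "i \<noteq> l" "l \<noteq> k" "i \<noteq> k" for i k
  proof -
    define a where "a = B $ i $ l"
    define b where "b = B $ l $ k"
    define c where "c = B $ k $ i"
    define x where "x = form (v i) (v l)"
    define y where "y = form (v l) (v k)"
    define z where "z = form (v k) (v i)"
    note sy = form_sym[of "v l" "v i"] form_sym[of "v k" "v l"] form_sym[of "v i" "v k"]
    have sc0: "sign_compat a b c x y z" using sc[OF ne] by (simp add: a_def b_def c_def x_def y_def z_def)
    have kl: "B $ k $ l = - b" "B $ l $ i = - a" using skewD[OF sk, of l k] skewD[OF sk, of i l] by (simp_all add: a_def b_def)
    have B1: "B' $ i $ l = - a" "B' $ l $ k = - b" using ne by (simp_all add: B'_def matrix_mutation_nth a_def b_def)
    have B2: "B' $ k $ i = c + (- b * \<bar>a\<bar> - \<bar>b\<bar> * a) / 2"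
      using ne by (simp add: B'_def matrix_mutation_nth kl c_def)
    define ri where "ri \<longleftrightarrow> (pos (v l) \<and> a < 0) \<or> (\<not> pos (v l) \<and> a > 0)"
    define rk where "rk \<longleftrightarrow> (pos (v l) \<and> b > 0) \<or> (\<not> pos (v l) \<and> b < 0)"
    have vi: "v' i = (if ri then v i - x *\<^sub>R v l else v i)" "v' k = (if rk then v k - y *\<^sub>R v l else v k)" "v' l = - v l"
      using ne by (auto simp: v' kl a_def[symmetric] ri_def rk_def x_def y_def sy)
    have f1: "form (v' i) (v' l) = (if ri then x else - x)"
      by (simp add: vi form_simps nv sy x_def[symmetric])
    have f2: "form (v' l) (v' k) = (if rk then y else - y)"
      by (simp add: vi form_simps nv sy y_def[symmetric])
    have f3: "form (v' k) (v' i) = (if ri = rk then z else z - x * y)"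
      unfolding vi by (simp add: form_simps nv sy x_def[symmetric] y_def[symmetric] z_def[symmetric] algebra_simps)
    consider "a > 0" "b > 0" | "a < 0" "b < 0" | "a * b \<le> 0" by (metis linorder_not_less mult_le_0_iff order.strict_iff_order)
    then show ?thesis
    proof cases
      case 1
      then have "B' $ k $ i = c - a * b" "ri \<noteq> rk" by (auto simp: B2 ri_def rk_def)
      then show ?thesis unfolding B1 f1 f2 f3 using sign_compat_path[OF sc0 1] by auto
    next
      case 2
      then have "B' $ k $ i = c + a * b" "ri \<noteq> rk" by (auto simp: B2 ri_def rk_def)
      then show ?thesis unfolding B1 f1 f2 f3 using sign_compat_path2[OF sc0 2] by auto
    next
      case 3
      then have c': "B' $ k $ i = c" by (auto simp: B2 abs_if mult_le_0_iff)
      have alt: "a = 0 \<or> b = 0 \<or> (a > 0 \<and> b < 0) \<or> (a < 0 \<and> b > 0)"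
        using 3 by (auto simp: mult_le_0_iff less_le)
      have x0: "a = 0 \<Longrightarrow> x = 0" "b = 0 \<Longrightarrow> y = 0" using sc0 by (auto simp: sign_compat_def)
      have "form (v' k) (v' i) = z" using alt x0 unfolding f3 by (elim disjE) (auto simp: ri_def rk_def)
      moreover have "(if ri then x else - x) * (if rk then y else - y) = x * y"
        using alt x0 by (elim disjE) (auto simp: ri_def rk_def)
      ultimately show ?thesis unfolding B1 c' f1 f2 using sign_compat_nopath[OF sc0 3] by auto
    qed
  qed
  have nv': "form (v' i) (v' i) = 2" for i
    unfolding v' using nv[of i] nv[of l] by (auto simp: form_simps form_sym[of "v l" "v i"])
  have "sign_compat (B' $ i $ j) (B' $ j $ k) (B' $ k $ i) (form (v' i) (v' j)) (form (v' j) (v' k)) (form (v' k) (v' i))"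
    if ne: "i \<noteq> j" "j \<noteq> k" "i \<noteq> k" for i j k
    using three_cases[OF ne, of l]
  proof (elim disjE)
    assume "l = j" then show ?thesis using core[of i k] ne by auto
  next
    assume "l = i"
    then show ?thesis using core[of k j] ne sign_compat_rotate by blast
  next
    assume "l = k"
    then show ?thesis using core[of j i] ne sign_compat_rotate by blast
  qed
  moreover have "skew_symmetric B'" unfolding B'_def by (rule skew_mutation[OF sk])
  ultimately show ?thesis using nv'
    unfolding realises_def snd_mutation B_def[symmetric] v'_def[symmetric] B'_def[symmetric] by blast
qed

end

definition basis3 :: "(3 \<Rightarrow> 'v::real_vector) \<Rightarrow> bool" where
  "basis3 v \<longleftrightarrow> (\<forall>c. (\<Sum>i\<in>UNIV. c i *\<^sub>R v i) = 0 \<longrightarrow> (\<forall>i. c i = 0)) \<and> (\<forall>x. \<exists>c. x = (\<Sum>i\<in>UNIV. c i *\<^sub>R v i))"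

lemma basis3_three:
  assumes "i \<noteq> j" "j \<noteq> k" "i \<noteq> k"
  shows "basis3 v \<longleftrightarrow> (\<forall>a b c. a *\<^sub>R v i + b *\<^sub>R v j + c *\<^sub>R v k = 0 \<longrightarrow> a = 0 \<and> b = 0 \<and> c = 0) \<and>
     (\<forall>x. \<exists>a b c. x = a *\<^sub>R v i + b *\<^sub>R v j + c *\<^sub>R v k)" (is "_ \<longleftrightarrow> ?A \<and> ?B")
proof -
  let ?f = "\<lambda>a b c l. if l = i then a else if l = j then b else (c::real)"
  have f: "(\<Sum>l\<in>UNIV. ?f a b c l *\<^sub>R v l) = a *\<^sub>R v i + b *\<^sub>R v j + c *\<^sub>R v k" for a b c
    using assms by (simp add: sum_three[OF assms])
  show ?thesis
  proof
    assume b: "basis3 v"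
    have ?A
    proof (intro allI impI)
      fix a b' c assume "a *\<^sub>R v i + b' *\<^sub>R v j + c *\<^sub>R v k = 0"
      then have "(\<Sum>l\<in>UNIV. ?f a b' c l *\<^sub>R v l) = 0" unfolding f .
      moreover have "\<forall>c. (\<Sum>i\<in>UNIV. c i *\<^sub>R v i) = 0 \<longrightarrow> (\<forall>i. c i = 0)"
        using b unfolding basis3_def by blast
      ultimately have "\<forall>l. ?f a b' c l = 0" using spec[of _ "?f a b' c"] by blast
      from spec[OF this, of i] spec[OF this, of j] spec[OF this, of k] show "a = 0 \<and> b' = 0 \<and> c = 0"
        using assms by simp
    qed
    moreover have ?B using b unfolding basis3_def sum_three[OF assms] by blast
    ultimately show "?A \<and> ?B" by blast
  next
    assume AB: "?A \<and> ?B"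
    have "\<exists>c. x = (\<Sum>l\<in>UNIV. c l *\<^sub>R v l)" for x
    proof -
      obtain a b c where "x = a *\<^sub>R v i + b *\<^sub>R v j + c *\<^sub>R v k" using AB by blast
      then show ?thesis by (intro exI[of _ "?f a b c"]) (simp only: f)
    qed
    moreover have "\<forall>l. c l = 0" if "(\<Sum>l\<in>UNIV. c l *\<^sub>R v l) = 0" for c
    proof -
      have "c i = 0 \<and> c j = 0 \<and> c k = 0" using AB that unfolding sum_three[OF assms] by blast
      then show ?thesis using three_cases[OF assms] by metis
    qed
    ultimately show "basis3 v" unfolding basis3_def by blast
  qed
qed

lemma distinct3_ex: "\<exists>j k::3. i \<noteq> j \<and> j \<noteq> k \<and> i \<noteq> k"
proof -
  have "(1::3) \<noteq> 2" "(2::3) \<noteq> 3" "(1::3) \<noteq> 3" by simp_all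
  then show ?thesis using exhaust_3[of i] by metis
qed

lemma basis3_mutation:
  assumes "basis3 (fst s)" shows "basis3 (fst (seed_mutation form pos l s))"
proof -
  obtain j k :: 3 where ne: "l \<noteq> j" "j \<noteq> k" "l \<noteq> k" using distinct3_ex by blast
  define v where "v = fst s"
  define v' where "v' = fst (seed_mutation form pos l s)"
  obtain p q where v': "v' l = - v l" "v' j = v j + p *\<^sub>R v l" "v' k = v k + q *\<^sub>R v l"
  proof -
    have "\<exists>p. v' i = v i + p *\<^sub>R v l" if "i \<noteq> l" for i
    proof (cases "v' i = v i")
      case True then show ?thesis by (intro exI[of _ 0]) simp
    next
      case False
      then have "v' i = v i - form (v i) (v l) *\<^sub>R v l"
        using that unfolding v'_def v_def fst_mutation by (auto split: if_splits)
      then show ?thesis by (intro exI[of _ "- form (v i) (v l)"]) simp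
    qed
    moreover have "v' l = - v l" by (simp add: v'_def v_def fst_mutation)
    ultimately show ?thesis using that ne by metis
  qed
  have b: "\<And>a b c. a *\<^sub>R v l + b *\<^sub>R v j + c *\<^sub>R v k = 0 \<Longrightarrow> a = 0 \<and> b = 0 \<and> c = 0"
     "\<And>x. \<exists>a b c. x = a *\<^sub>R v l + b *\<^sub>R v j + c *\<^sub>R v k"
    using assms unfolding basis3_three[OF ne] v_def by blast+
  have eq: "a *\<^sub>R v' l + b *\<^sub>R v' j + c *\<^sub>R v' k = (b * p + c * q - a) *\<^sub>R v l + b *\<^sub>R v j + c *\<^sub>R v k" for a b c
    by (simp add: v' algebra_simps)
  have "\<exists>a b c. x = a *\<^sub>R v' l + b *\<^sub>R v' j + c *\<^sub>R v' k" for x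
  proof -
    obtain a b' c where "x = a *\<^sub>R v l + b' *\<^sub>R v j + c *\<^sub>R v k" using b(2) by blast
    then have "x = (b' * p + c * q - a) *\<^sub>R v' l + b' *\<^sub>R v' j + c *\<^sub>R v' k" unfolding eq by simp
    then show ?thesis by blast
  qed
  moreover have "a = 0 \<and> b' = 0 \<and> c = 0" if "a *\<^sub>R v' l + b' *\<^sub>R v' j + c *\<^sub>R v' k = 0" for a b' c
    using b(1)[of "b' * p + c * q - a" b' c] that unfolding eq by auto
  ultimately show ?thesis unfolding v'_def[symmetric] basis3_three[OF ne] by blast
qed

section \<open>From the definition to the invariants\<close>

lemma geometric_realisation_basis:
  assumes "geometric_realisation form v B" shows "basis3 v"
proof -
  have inj: "inj v" and ind: "independent (range v)" and sp: "span (range v) = UNIV"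
    using assms by (auto simp: geometric_realisation_def)
  have "\<exists>c. x = (\<Sum>i\<in>UNIV. c i *\<^sub>R v i)" for x
  proof -
    have "x \<in> span (range v)" using sp by simp
    then obtain u where "x = (\<Sum>w\<in>range v. u w *\<^sub>R w)" using span_finite[of "range v"] by auto
    also have "\<dots> = (\<Sum>i\<in>UNIV. u (v i) *\<^sub>R v i)" using inj by (simp add: sum.reindex)
    finally show ?thesis by (intro exI[of _ "u \<circ> v"]) simp
  qed
  moreover have "c i = 0" if "(\<Sum>i\<in>UNIV. c i *\<^sub>R v i) = 0" for c i
  proof -
    define u where "u = c \<circ> inv v"
    have "(\<Sum>w\<in>range v. u w *\<^sub>R w) = (\<Sum>i\<in>UNIV. u (v i) *\<^sub>R v i)" using inj by (simp add: sum.reindex)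
    also have "\<dots> = 0" using that inj by (simp add: u_def)
    finally have "u (v i) = 0" using ind independentD[of "range v" "range v" u "v i"] by auto
    then show ?thesis using inj by (simp add: u_def)
  qed
  ultimately show ?thesis unfolding basis3_def by blast
qed

lemma acyclic_path:
  fixes B :: "real^3^3"
  assumes sk: "skew_symmetric B" and ne: "i \<noteq> j" "j \<noteq> k" "i \<noteq> k"
    and b: "B $ i $ j > 0" "B $ j $ k > 0"
  shows "acyclic_quiver B \<longleftrightarrow> B $ k $ i \<le> 0"
proof
  assume ac: "acyclic_quiver B"
  show "B $ k $ i \<le> 0"
  proof (rule ccontr)
    assume "\<not> B $ k $ i \<le> 0"
    then have "(i, j) \<in> {(i, j). B $ i $ j > 0}" "(j, k) \<in> {(i, j). B $ i $ j > 0}" "(k, i) \<in> {(i, j). B $ i $ j > 0}"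
      using b by auto
    then have "(i, i) \<in> {(i, j). B $ i $ j > 0}\<^sup>+" by (meson trancl.simps)
    then show False using ac by (auto simp: acyclic_quiver_def acyclic_def)
  qed
next
  assume c: "B $ k $ i \<le> 0"
  define f :: "3 \<Rightarrow> nat" where "f l = (if l = i then 0 else if l = j then 1 else 2)" for l
  have neg: "\<not> B $ j $ i > 0" "\<not> B $ k $ j > 0" "\<not> B $ k $ i > 0" "\<And>l. \<not> B $ l $ l > 0"
    using b c skewD[OF sk, of i j] skewD[OF sk, of j k] skew0[OF sk] by auto
  have "{(i, j). B $ i $ j > 0} \<subseteq> Wellfounded.measure f"
  proof clarify
    fix a b assume ab: "B $ a $ b > 0"
    show "(a, b) \<in> Wellfounded.measure f"
      using three_cases[OF ne, of a] three_cases[OF ne, of b] ab neg ne by (auto simp: f_def)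
  qed
  then have "acyclic {(i, j). B $ i $ j > 0}" by (meson wf_acyclic wf_measure wf_subset)
  then show "acyclic_quiver B" by (simp add: acyclic_quiver_def)
qed

lemma card_pairs_parity:
  fixes f :: "3 \<Rightarrow> 3 \<Rightarrow> real"
  assumes sym: "\<And>i j. f i j = f j i" and ne: "i \<noteq> j" "j \<noteq> k" "i \<noteq> k"
    and nz: "f i j \<noteq> 0" "f j k \<noteq> 0" "f k i \<noteq> 0"
  shows "even (card {(i, j). i < j \<and> f i j > 0}) \<longleftrightarrow> f i j * f j k * f k i < 0"
proof -
  define e :: "3 \<Rightarrow> 3 \<Rightarrow> 3 \<times> 3" where "e a b = (if a < b then (a, b) else (b, a))" for a b
  define S where "S a b = (if f a b > 0 then {e a b} else {})" for a b
  have "{(i, j). i < j \<and> f i j > 0} = S i j \<union> S j k \<union> S k i"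
  proof (intro equalityI subsetI)
    fix x assume x: "x \<in> {(i, j). i < j \<and> f i j > 0}"
    obtain a b where ab: "x = (a, b)" "a < b" "f a b > 0" using x by auto
    then have "x \<in> S a b" "x \<in> S b a" using sym[of a b] by (auto simp: S_def e_def)
    then show "x \<in> S i j \<union> S j k \<union> S k i"
      using three_cases[OF ne, of a] three_cases[OF ne, of b] ab(2) by auto
  next
    fix x assume "x \<in> S i j \<union> S j k \<union> S k i"
    then show "x \<in> {(i, j). i < j \<and> f i j > 0}"
      using ne sym[of i j] sym[of j k] sym[of k i] by (auto simp: S_def e_def split: if_splits)
  qed
  moreover have "e i j \<noteq> e j k" "e j k \<noteq> e k i" "e i j \<noteq> e k i" using ne by (auto simp: e_def)
  ultimately have "card {(i, j). i < j \<and> f i j > 0} =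
      (if f i j > 0 then 1 else 0) + (if f j k > 0 then 1 else 0) + (if f k i > 0 then 1 else 0)"
    by (simp add: S_def)
  moreover have "even ((if f i j > 0 then 1 else 0) + (if f j k > 0 then 1 else 0) + (if f k i > 0 then 1 else (0::nat)))
     \<longleftrightarrow> f i j * f j k * f k i < 0"
    using nz by (auto simp: mult_less_0_iff zero_less_mult_iff)
  ultimately show ?thesis by simp
qed

lemma (in seed_space) geometric_realisation_realises:
  assumes g: "geometric_realisation form v B" and sk: "skew_symmetric B"
  shows "realises form (v, B)"
proof -
  have path: "form (v i) (v j) * form (v j) (v k) * form (v k) (v i) = B $ i $ j * B $ j $ k * B $ k $ i"
    if ne: "i \<noteq> j" "j \<noteq> k" "i \<noteq> k" and b: "B $ i $ j > 0" "B $ j $ k > 0" for i j k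
  proof -
    have ab: "\<And>i j. i \<noteq> j \<Longrightarrow> \<bar>form (v i) (v j)\<bar> = \<bar>B $ i $ j\<bar>" using g by (auto simp: geometric_realisation_def)
    let ?P = "form (v i) (v j) * form (v j) (v k) * form (v k) (v i)"
    have absP: "\<bar>?P\<bar> = B $ i $ j * B $ j $ k * \<bar>B $ k $ i\<bar>" using ne b ab by (simp add: abs_mult)
    show ?thesis
    proof (cases "B $ k $ i = 0")
      case True then show ?thesis using absP by simp
    next
      case False
      have nz: "form (v i) (v j) \<noteq> 0" "form (v j) (v k) \<noteq> 0" "form (v k) (v i) \<noteq> 0"
        using ab[of i j] ab[of j k] ab[of k i] ne b False by auto
      have "form (v a) (v c) \<noteq> 0" if "a \<noteq> c" for a c
        using three_cases[OF ne, of a] three_cases[OF ne, of c] that nz form_sym[of "v a" "v c"] by auto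
      then have "acyclic_quiver B \<longleftrightarrow> even (card {(i, j). i < j \<and> form (v i) (v j) > 0})"
        using g unfolding geometric_realisation_def by (auto split: if_splits)
      then have "B $ k $ i \<le> 0 \<longleftrightarrow> ?P < 0"
        using card_pairs_parity[of "\<lambda>i j. form (v i) (v j)", OF form_sym ne nz] acyclic_path[OF sk ne b] by simp
      moreover have "B $ i $ j * B $ j $ k > 0" using b by simp
      ultimately show ?thesis using absP False by (auto simp: abs_if zero_less_mult_iff split: if_splits)
    qed
  qed
  have "sign_compat (B $ i $ j) (B $ j $ k) (B $ k $ i) (form (v i) (v j)) (form (v j) (v k)) (form (v k) (v i))"
    if ne: "i \<noteq> j" "j \<noteq> k" "i \<noteq> k" for i j k
  proof -
    note sw = skewD[OF sk, of i j] skewD[OF sk, of j k] skewD[OF sk, of k i]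
    note fs = form_sym[of "v j" "v i"] form_sym[of "v k" "v j"] form_sym[of "v i" "v k"]
    let ?P = "form (v i) (v j) * form (v j) (v k) * form (v k) (v i)"
    let ?Q = "B $ i $ j * B $ j $ k * B $ k $ i"
    have "B $ i $ j > 0 \<Longrightarrow> B $ j $ k > 0 \<Longrightarrow> ?P = ?Q" "B $ j $ k > 0 \<Longrightarrow> B $ k $ i > 0 \<Longrightarrow> ?P = ?Q"
      "B $ i $ j > 0 \<Longrightarrow> B $ k $ i > 0 \<Longrightarrow> ?P = ?Q"
      using path[of i j k] path[of j k i] path[of k i j] ne by (simp_all add: mult_ac)
    moreover have "B $ i $ j < 0 \<Longrightarrow> B $ j $ k < 0 \<Longrightarrow> ?P = - ?Q" "B $ j $ k < 0 \<Longrightarrow> B $ k $ i < 0 \<Longrightarrow> ?P = - ?Q"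
      "B $ i $ j < 0 \<Longrightarrow> B $ k $ i < 0 \<Longrightarrow> ?P = - ?Q"
      using path[of k j i] path[of i k j] path[of j i k] ne by (simp_all add: sw fs mult_ac)
    moreover have "\<bar>form (v i) (v j)\<bar> = \<bar>B $ i $ j\<bar>" "\<bar>form (v j) (v k)\<bar> = \<bar>B $ j $ k\<bar>" "\<bar>form (v k) (v i)\<bar> = \<bar>B $ k $ i\<bar>"
      using g ne by (simp_all add: geometric_realisation_def)
    ultimately show ?thesis unfolding sign_compat_def by blast
  qed
  then show ?thesis using sk g unfolding realises_def geometric_realisation_def by auto
qed

section \<open>The skew form behind the exchange matrices\<close>

definition sign_rule :: "('v::real_vector \<Rightarrow> 'v \<Rightarrow> real) \<Rightarrow> ('v \<Rightarrow> bool) \<Rightarrow> (3, 'v) labelled_seed \<Rightarrow> bool" where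
  "sign_rule form pos s \<longleftrightarrow> (\<forall>i j. i \<noteq> j \<and> snd s $ i $ j \<ge> 0 \<longrightarrow> form (fst s i) (fst s j) =
     (if \<not> pos (fst s i) \<and> pos (fst s j) then snd s $ i $ j else - (snd s $ i $ j)))"

definition skew_bilinear :: "('v::real_vector \<Rightarrow> 'v \<Rightarrow> real) \<Rightarrow> bool" where
  "skew_bilinear om \<longleftrightarrow> (\<forall>x y z. om (x + y) z = om x z + om y z) \<and> (\<forall>c x z. om (c *\<^sub>R x) z = c * om x z) \<and>
     (\<forall>x y. om x y = - om y x)"

lemma skew_bilinear_simps:
  assumes "skew_bilinear om"
  shows "om (x + y) z = om x z + om y z" "om (c *\<^sub>R x) z = c * om x z"
    "om z (x + y) = om z x + om z y" "om z (c *\<^sub>R x) = c * om z x"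
    "om (- x) z = - om x z" "om z (- x) = - om z x" "om (x - y) z = om x z - om y z"
    "om z (x - y) = om z x - om z y" "om x x = 0" "om 0 z = 0" "om z 0 = 0"
proof -
  show a: "om (x + y) z = om x z + om y z" for x y z using assms unfolding skew_bilinear_def by blast
  show s: "om (c *\<^sub>R x) z = c * om x z" for c x z using assms unfolding skew_bilinear_def by blast
  have k: "om x y = - om y x" for x y using assms unfolding skew_bilinear_def by blast
  show a2: "om z (x + y) = om z x + om z y" for x y z using a[of x y z] k[of z "x+y"] k[of z x] k[of z y] by simp
  show s2: "om z (c *\<^sub>R x) = c * om z x" for c x z using s[of c x z] k[of z "c *\<^sub>R x"] k[of z x] by simp
  show m: "om (- x) z = - om x z" for x z using s[of "-1" x z] by simp
  show m2: "om z (- x) = - om z x" for x z using s2[of z "-1" x] by simp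
  show "om (x - y) z = om x z - om y z" using a[of x "- y" z] m by simp
  show "om z (x - y) = om z x - om z y" using a2[of z x "- y"] m2 by simp
  show "om x x = 0" using k[of x x] by simp
  show "om 0 z = 0" using s[of 0 0 z] by simp
  show "om z 0 = 0" using s2[of z 0 0] by simp
qed

lemma skew_form_exists:
  fixes v :: "3 \<Rightarrow> 'v::real_vector"
  assumes b: "basis3 v" and sk: "skew_symmetric B"
  shows "\<exists>om. skew_bilinear om \<and> (\<forall>i j. om (v i) (v j) = B $ i $ j)"
proof -
  have ind: "\<And>c. (\<Sum>i\<in>UNIV. c i *\<^sub>R v i) = 0 \<Longrightarrow> (\<forall>i. c i = 0)" and ex: "\<forall>x. \<exists>c. x = (\<Sum>i\<in>UNIV. c i *\<^sub>R v i)"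
    using b unfolding basis3_def by blast+
  obtain co where co: "\<And>x. x = (\<Sum>i\<in>UNIV. co x i *\<^sub>R v i)" using choice[OF ex] by blast
  have uniq: "co x = c" if "x = (\<Sum>i\<in>UNIV. c i *\<^sub>R v i)" for x c
  proof -
    have "(\<Sum>i\<in>UNIV. (co x i - c i) *\<^sub>R v i) = (\<Sum>i\<in>UNIV. co x i *\<^sub>R v i) - (\<Sum>i\<in>UNIV. c i *\<^sub>R v i)"
      by (simp add: algebra_simps sum_subtractf)
    also have "\<dots> = 0" using co[of x] that by simp
    finally show ?thesis using ind by fastforce
  qed
  have add: "co (x + y) = (\<lambda>i. co x i + co y i)" for x y
  proof (rule uniq)
    show "x + y = (\<Sum>i\<in>UNIV. (co x i + co y i) *\<^sub>R v i)"
      using co[of x] co[of y] by (simp add: algebra_simps sum.distrib)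
  qed
  have scale: "co (c *\<^sub>R x) = (\<lambda>i. c * co x i)" for x c
  proof (rule uniq)
    show "c *\<^sub>R x = (\<Sum>i\<in>UNIV. (c * co x i) *\<^sub>R v i)"
      by (subst co[of x]) (simp add: scaleR_sum_right)
  qed
  have bas: "co (v i) = (\<lambda>j. if j = i then 1 else 0)" for i
  proof (rule uniq)
    have "(\<Sum>j\<in>UNIV. (if j = i then 1 else 0) *\<^sub>R v j) = (\<Sum>j\<in>UNIV. if j = i then v j else 0)"
      by (intro sum.cong) auto
    then show "v i = (\<Sum>j\<in>UNIV. (if j = i then 1 else 0) *\<^sub>R v j)" by simp
  qed
  define om where "om = (\<lambda>x y. \<Sum>i\<in>UNIV. \<Sum>j\<in>UNIV. co x i * co y j * B $ i $ j)"
  have "om (x + y) z = om x z + om y z" for x y z by (simp add: om_def add algebra_simps sum.distrib)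
  moreover have "om (c *\<^sub>R x) z = c * om x z" for c x z
    by (simp add: om_def scale algebra_simps sum_distrib_left)
  moreover have "om x y = - om y x" for x y
  proof -
    have "om x y = (\<Sum>j\<in>UNIV. \<Sum>i\<in>UNIV. co x i * co y j * B $ i $ j)"
      unfolding om_def by (rule sum.swap)
    also have "\<dots> = (\<Sum>j\<in>UNIV. \<Sum>i\<in>UNIV. - (co y j * co x i * B $ j $ i))"
    proof (intro sum.cong refl)
      fix i j show "co x i * co y j * B $ i $ j = - (co y j * co x i * B $ j $ i)"
        using skewD[OF sk, of j i] by simp
    qed
    finally show ?thesis by (simp add: om_def sum_negf)
  qed
  moreover have "om (v i) (v j) = B $ i $ j" for i j
  proof -
    have delta: "(\<Sum>l\<in>UNIV. (if l = j then 1 else 0) * f l) = f j" for f :: "3 \<Rightarrow> real" and j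
    proof -
      have "(\<Sum>l\<in>UNIV. (if l = j then 1 else 0) * f l) = (\<Sum>l\<in>UNIV. if l = j then f l else 0)"
        by (rule sum.cong) auto
      then show ?thesis by simp
    qed
    have "om (v i) (v j) = (\<Sum>k\<in>UNIV. (if k = i then 1 else 0) * (\<Sum>l\<in>UNIV. (if l = j then 1 else 0) * B $ k $ l))"
      unfolding om_def bas by (simp only: sum_distrib_left mult.assoc)
    then show ?thesis by (simp only: delta)
  qed
  ultimately show ?thesis unfolding skew_bilinear_def by blast
qed

context seed_space begin

text \<open>Under the sign rule a reflection adds a nonnegative multiple of the mutated vector, so that
  mutation changes the vectors and the exchange matrix by the same base change.\<close>

lemma sign_rule_mutation:
  assumes r: "sign_rule form pos s" and sk: "skew_symmetric (snd s)" and ne: "i \<noteq> k"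
  shows "fst (seed_mutation form pos k s) i =
    fst s i + (if pos (fst s k) then max (- (snd s $ i $ k)) 0 else max (snd s $ i $ k) 0) *\<^sub>R fst s k"
proof -
  let ?b = "snd s $ i $ k"
  have kb: "snd s $ k $ i = - ?b" using skewD[OF sk] .
  have "form (fst s i) (fst s k) = - ?b" if "\<not> pos (fst s k)" "?b > 0"
    using r that ne unfolding sign_rule_def by auto
  moreover have "form (fst s i) (fst s k) = ?b" if "pos (fst s k)" "?b < 0"
  proof -
    have "form (fst s k) (fst s i) = - (snd s $ k $ i)" using r that ne kb unfolding sign_rule_def by auto
    then show ?thesis using kb by (simp add: form_sym)
  qed
  ultimately show ?thesis using ne by (auto simp: fst_mutation max_def)
qed

lemma skew_form_mutation:
  assumes om: "skew_bilinear om" and r: "sign_rule form pos s" and sk: "skew_symmetric (snd s)"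
    and b: "\<And>i j. om (fst s i) (fst s j) = snd s $ i $ j"
  shows "om (fst (seed_mutation form pos k s) i) (fst (seed_mutation form pos k s) j)
    = snd (seed_mutation form pos k s) $ i $ j"
proof -
  note sb = skew_bilinear_simps[OF om]
  have kk: "fst (seed_mutation form pos k s) k = - fst s k" by (simp add: fst_mutation)
  consider "i = k" "j = k" | "i = k" "j \<noteq> k" | "i \<noteq> k" "j = k" | "i \<noteq> k" "j \<noteq> k" by blast
  then show ?thesis
  proof cases
    case 1
    then show ?thesis using skew0[OF sk, of k] by (simp add: kk sb snd_mutation matrix_mutation_nth)
  next
    case 2
    then show ?thesis
      unfolding 2(1) kk sign_rule_mutation[OF r sk 2(2)] by (simp add: sb b snd_mutation matrix_mutation_nth)
  next
    case 3
    then show ?thesis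
      unfolding 3(2) kk sign_rule_mutation[OF r sk 3(1)] by (simp add: sb b snd_mutation matrix_mutation_nth)
  next
    case 4
    have kj: "snd s $ k $ j = - (snd s $ j $ k)" using skewD[OF sk] .
    show ?thesis
      unfolding sign_rule_mutation[OF r sk 4(1)] sign_rule_mutation[OF r sk 4(2)]
      using 4 by (auto simp: sb b snd_mutation matrix_mutation_nth kj max_def abs_if algebra_simps)
  qed
qed

end

definition isolated :: "'n \<Rightarrow> real^'n^'n \<Rightarrow> bool" where
  "isolated i B \<longleftrightarrow> (\<forall>j. B $ i $ j = 0)"

lemma isolated_mutation:
  assumes sk: "skew_symmetric B" and i: "isolated i B" shows "isolated i (matrix_mutation k B)"
  using i by (auto simp: isolated_def matrix_mutation_nth)

lemma isolated_mutation_iff: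
  assumes sk: "skew_symmetric B" shows "isolated i (matrix_mutation k B) \<longleftrightarrow> isolated i B"
  using isolated_mutation[OF sk] isolated_mutation[OF skew_mutation[OF sk], of i k k]
  by (auto simp: matrix_mutation_invol[OF sk])

text \<open>What both geometries have in common. The compatibility of the reference point enters only through
  the sign rule. Isolated vertices are excluded because the skew form does not see them.\<close>

locale coherent = seed_space form pos
  for form :: "'v::real_vector \<Rightarrow> 'v \<Rightarrow> real" and pos :: "'v \<Rightarrow> bool" +
  fixes R :: "(3, 'v) labelled_seed set" and om :: "'v \<Rightarrow> 'v \<Rightarrow> real"
  assumes om: "skew_bilinear om"
    and closed: "s \<in> R \<Longrightarrow> seed_mutation form pos k s \<in> R"
    and dec: "s \<in> R \<Longrightarrow> decided (fst s i)"
    and realis: "s \<in> R \<Longrightarrow> realises form s"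
    and rule: "s \<in> R \<Longrightarrow> sign_rule form pos s"
    and om_B: "s \<in> R \<Longrightarrow> om (fst s i) (fst s j) = snd s $ i $ j"
    and basis: "s \<in> R \<Longrightarrow> basis3 (fst s)"
    and conn: "s \<in> R \<Longrightarrow> \<not> isolated i (snd s)"
begin

lemmas om_simps = skew_bilinear_simps[OF om]

lemma om_sym: "om x y = - om y x" using om unfolding skew_bilinear_def by blast

lemma skew: "s \<in> R \<Longrightarrow> skew_symmetric (snd s)" using realis by (auto simp: realises_def)

lemma norm: "s \<in> R \<Longrightarrow> form (fst s i) (fst s i) = 2" using realis by (auto simp: realises_def)

lemma involutive: "s \<in> R \<Longrightarrow> seed_mutation form pos k (seed_mutation form pos k s) = s"
  using mutation_invol skew norm dec unfolding decided_def by blast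

lemma neg_iff: "s \<in> R \<Longrightarrow> pos (- fst s i) \<longleftrightarrow> \<not> pos (fst s i)" using decidedD dec by blast

text \<open>The Euler form; its Gram matrix is triangular in a suitable order of each seed.\<close>

definition eul :: "'v \<Rightarrow> 'v \<Rightarrow> real" where "eul x y = (form x y + om x y) / 2"

lemmas eul_simps = eul_def form_simps om_simps

lemma eul_add: "eul (x + y) z = eul x z + eul y z" "eul z (x + y) = eul z x + eul z y"
  and eul_scale: "eul (c *\<^sub>R x) z = c * eul x z" "eul z (c *\<^sub>R x) = c * eul z x"
  and eul_minus: "eul (- x) z = - eul x z" "eul z (- x) = - eul z x"
  by (simp_all add: eul_simps add_divide_distrib distrib_left)

lemma eul_self: "s \<in> R \<Longrightarrow> eul (fst s i) (fst s i) = 1" by (simp add: eul_simps norm)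

lemma eul_form: "eul x y + eul y x = form x y"
  using om_sym[of x y] by (simp add: eul_def form_sym[of y x] field_simps)

lemma rule_form: "s \<in> R \<Longrightarrow> i \<noteq> j \<Longrightarrow> snd s $ i $ j \<ge> 0 \<Longrightarrow> form (fst s i) (fst s j) =
     (if \<not> pos (fst s i) \<and> pos (fst s j) then snd s $ i $ j else - (snd s $ i $ j))"
  using rule unfolding sign_rule_def by blast

lemma eul_zero:
  assumes "s \<in> R" "i \<noteq> j" "snd s $ i $ j \<ge> 0" "\<not> (\<not> pos (fst s i) \<and> pos (fst s j))"
  shows "eul (fst s i) (fst s j) = 0"
  using rule_form[OF assms(1-3)] assms(4) om_B[OF assms(1), of i j] by (simp add: eul_def)

lemma eul_zero_pm:
  assumes "s \<in> R" "pos (fst s i)" "\<not> pos (fst s j)"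
  shows "eul (fst s i) (fst s j) = 0"
proof (cases "snd s $ i $ j \<ge> 0")
  case True
  then show ?thesis using eul_zero[of s i j] assms by auto
next
  case False
  have "i \<noteq> j" using assms by auto
  moreover have "snd s $ j $ i = - (snd s $ i $ j)" using skewD[OF skew[OF assms(1)]] .
  ultimately have "form (fst s j) (fst s i) = snd s $ j $ i" "om (fst s i) (fst s j) = - (snd s $ j $ i)"
    using rule_form[OF assms(1), of j i] assms False om_B[OF assms(1), of i j] by auto
  then show ?thesis using form_sym[of "fst s i" "fst s j"] by (simp add: eul_def)
qed

lemma eul_zero_B:
  assumes "s \<in> R" "eul (fst s i) (fst s j) = 0"
  shows "form (fst s i) (fst s j) = - (snd s $ i $ j)" "eul (fst s j) (fst s i) = - (snd s $ i $ j)"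
proof -
  show f: "form (fst s i) (fst s j) = - (snd s $ i $ j)"
    using assms om_B[OF assms(1), of i j] by (simp add: eul_def)
  show "eul (fst s j) (fst s i) = - (snd s $ i $ j)" using f eul_form[of "fst s i" "fst s j"] assms(2) by simp
qed

lemma mutation_vec:
  assumes "s \<in> R" "i \<noteq> k" shows "fst (seed_mutation form pos k s) i =
    fst s i + (if pos (fst s k) then max (- (snd s $ i $ k)) 0 else max (snd s $ i $ k) 0) *\<^sub>R fst s k"
  using sign_rule_mutation[OF rule skew] assms by blast

lemma mutation_vec_self: "fst (seed_mutation form pos k s) k = - fst s k"
  by (simp add: fst_mutation)

text \<open>By parity the vectors of a cyclic quiver cannot all have the same sign, since then all inner products
  would be negative.\<close>

lemma three_cycle:
  assumes s: "s \<in> R" and ne: "i \<noteq> j" "j \<noteq> k" "i \<noteq> k"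
    and b: "snd s $ i $ j > 0" "snd s $ j $ k > 0"
  shows "form (fst s i) (fst s j) * form (fst s j) (fst s k) * form (fst s k) (fst s i)
     = snd s $ i $ j * snd s $ j $ k * snd s $ k $ i"
proof -
  have "sign_compat (snd s $ i $ j) (snd s $ j $ k) (snd s $ k $ i)
          (form (fst s i) (fst s j)) (form (fst s j) (fst s k)) (form (fst s k) (fst s i))"
    using realis[OF s] ne unfolding realises_def by blast
  then show ?thesis using b unfolding sign_compat_def by blast
qed

end

section \<open>Counting sums of displacements\<close>

definition rat_scale :: "rat \<Rightarrow> 'v::real_vector \<Rightarrow> 'v" where
  "rat_scale q x = of_rat q *\<^sub>R x"

global_interpretation int_mod: module "int_scale :: int \<Rightarrow> 'v::real_vector \<Rightarrow> 'v"
  by standard (simp_all add: int_scale_def algebra_simps)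

global_interpretation rat_vs: vector_space "rat_scale :: rat \<Rightarrow> 'v::real_vector \<Rightarrow> 'v"
  by standard (simp_all add: rat_scale_def algebra_simps of_rat_add of_rat_mult)

lemma rat_scale_of_int: "rat_scale (of_int k) x = int_scale k x"
  by (simp add: rat_scale_def int_scale_def)

lemma common_denominator:
  assumes "finite A" shows "\<exists>Q>0. \<forall>a\<in>A. \<exists>z::int. of_int Q * (f a :: rat) = of_int z"
  using assms
proof (induction A rule: finite_induct)
  case empty then show ?case by (intro exI[of _ 1]) auto
next
  case (insert a A)
  then obtain Q where Q: "Q > 0" "\<forall>a\<in>A. \<exists>z::int. of_int Q * f a = of_int z" by blast
  obtain p q where pq: "quotient_of (f a) = (p, q)" by (metis surj_pair)
  have q: "q > 0" "f a = of_int p / of_int q" using quotient_of_denom_pos[OF pq] quotient_of_div[OF pq] by simp_all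
  have fa: "of_int (Q * q) * f a = of_int (Q * p)" 
  proof -
    have "of_int q * (of_int p / of_int q) = (of_int p :: rat)" using q(1) by simp
    then show ?thesis unfolding q(2) by (simp only: of_int_mult mult.assoc)
  qed
  have "\<exists>z::int. of_int (Q * q) * f b = of_int z" if bA: "b \<in> A" for b
  proof -
    obtain z :: int where z: "of_int Q * f b = of_int z" using Q(2) bA by blast
    have "of_int (Q * q) * f b = of_int q * (of_int Q * f b)" by (simp only: of_int_mult mult_ac)
    also have "\<dots> = of_int (q * z)" unfolding z by simp
    finally have "of_int (Q * q) * f b = of_int (q * z)" .
    then show ?thesis by blast
  qed
  then have "\<forall>b\<in>insert a A. \<exists>z::int. of_int (Q * q) * f b = of_int z" using fa by blast
  moreover have "Q * q > 0" using Q(1) q(1) by simp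
  ultimately show ?case by blast
qed

lemma int_independent_iff:
  fixes S :: "'v::real_vector set"
  assumes fin: "finite S"
  shows "module.dependent int_scale S \<longleftrightarrow> module.dependent rat_scale S"
proof
  assume "module.dependent int_scale S"
  then obtain u where u: "\<exists>v\<in>S. u v \<noteq> (0::int)" "(\<Sum>v\<in>S. int_scale (u v) v) = 0"
    using int_mod.dependent_finite[OF fin] by auto
  have "(\<Sum>v\<in>S. rat_scale (of_int (u v)) v) = 0" using u(2) by (simp add: rat_scale_of_int)
  moreover have "\<exists>v\<in>S. of_int (u v) \<noteq> (0::rat)" using u(1) by simp
  ultimately show "module.dependent rat_scale S"
    unfolding rat_vs.dependent_finite[OF fin] by (intro exI[of _ "\<lambda>v. of_int (u v)"]) blast
next
  assume "module.dependent rat_scale S"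
  then obtain u where u: "\<exists>v\<in>S. u v \<noteq> (0::rat)" "(\<Sum>v\<in>S. rat_scale (u v) v) = 0"
    using rat_vs.dependent_finite[OF fin] by auto
  obtain Q where Q: "Q > 0" "\<forall>a\<in>S. \<exists>z::int. of_int Q * u a = of_int z"
    using common_denominator[OF fin, of u] by blast
  then obtain z where z: "\<And>a. a \<in> S \<Longrightarrow> of_int Q * u a = of_int (z a)" by metis
  have "(\<Sum>v\<in>S. int_scale (z v) v) = (\<Sum>v\<in>S. rat_scale (of_int Q) (rat_scale (u v) v))"
  proof (rule sum.cong)
    fix v assume "v \<in> S"
    then show "int_scale (z v) v = rat_scale (of_int Q) (rat_scale (u v) v)"
      by (simp add: z flip: rat_scale_of_int)
  qed simp
  also have "\<dots> = rat_scale (of_int Q) (\<Sum>v\<in>S. rat_scale (u v) v)" by (simp only: rat_vs.scale_sum_right)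
  also have "\<dots> = 0" unfolding u(2) by simp
  finally have "(\<Sum>v\<in>S. int_scale (z v) v) = 0" .
  moreover have "\<exists>v\<in>S. z v \<noteq> 0"
  proof -
    obtain v where "v \<in> S" "u v \<noteq> 0" using u(1) by blast
    then have "of_int (z v) \<noteq> (0::rat)" using Q(1) by (simp flip: z)
    then show ?thesis using \<open>v \<in> S\<close> by auto
  qed
  ultimately show "module.dependent int_scale S" unfolding int_mod.dependent_finite[OF fin] by blast
qed

lemma int_span_subset_rat_span: "module.span int_scale S \<subseteq> module.span rat_scale (S :: 'v::real_vector set)"
proof
  fix x assume "x \<in> module.span int_scale S"
  then show "x \<in> module.span rat_scale S"
    by (induction rule: int_mod.span_induct_alt)
      (auto intro: rat_vs.span_zero rat_vs.span_add rat_vs.span_scale rat_vs.span_base simp flip: rat_scale_of_int)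
qed

lemma has_int_rank_basis:
  assumes "finite I" "I \<subseteq> L" "\<not> module.dependent rat_scale I" "L \<subseteq> module.span rat_scale I"
  shows "has_int_rank L (card I)"
  unfolding has_int_rank_def
proof (intro conjI allI impI)
  show "\<exists>S\<subseteq>L. finite S \<and> \<not> module.dependent int_scale S \<and> card S = card I"
    using assms int_independent_iff by blast
  fix S assume "S \<subseteq> L" and S: "finite S \<and> \<not> module.dependent int_scale S"
  then have "\<not> module.dependent rat_scale S" "S \<subseteq> module.span rat_scale I" using int_independent_iff assms by blast+
  then show "card S \<le> card I" using rat_vs.independent_span_bound[OF assms(1)] by blast
qed

definition list_sums :: "'a::comm_monoid_add set \<Rightarrow> nat \<Rightarrow> 'a set" where
  "list_sums D m = {sum_list xs | xs. set xs \<subseteq> D \<and> length xs \<le> m}"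

lemma list_sums_0: "0 \<in> list_sums D m"
  unfolding list_sums_def by (intro CollectI exI[of _ "[]"]) simp

lemma list_sums_Suc: "x \<in> list_sums D m \<Longrightarrow> d \<in> D \<Longrightarrow> x + d \<in> list_sums D (Suc m)"
proof -
  assume "x \<in> list_sums D m" "d \<in> D"
  then obtain xs where "x = sum_list xs" "set xs \<subseteq> D" "length xs \<le> m" by (auto simp: list_sums_def)
  then have "x + d = sum_list (xs @ [d])" "set (xs @ [d]) \<subseteq> D" "length (xs @ [d]) \<le> Suc m"
    using \<open>d \<in> D\<close> by auto
  then show ?thesis unfolding list_sums_def by blast
qed

lemma list_sums_mono: "m \<le> n \<Longrightarrow> list_sums D m \<subseteq> list_sums D n"
  unfolding list_sums_def by force

text \<open>After multiplication with a common denominator, a sum of \<open>m\<close> displacements is an integral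
  combination of \<open>card I\<close> many vectors with coefficients that are at most proportional to \<open>m\<close>.\<close>

lemma card_list_sums:
  fixes D :: "'v::real_vector set"
  assumes fin: "finite D" "finite I" and D: "D \<subseteq> module.span rat_scale I"
  shows "\<exists>P::nat. \<forall>m. finite (list_sums D m) \<and> card (list_sums D m) \<le> (2 * P * m + 1) ^ card I"
proof -
  have "\<forall>d\<in>D. \<exists>r. d = (\<Sum>a\<in>I. rat_scale (r a) a)"
    using D rat_vs.span_finite[OF fin(2)] by auto
  then obtain r where r: "\<And>d. d \<in> D \<Longrightarrow> d = (\<Sum>a\<in>I. rat_scale (r d a) a)" by metis
  obtain Q where Q: "Q > 0" "\<forall>x\<in>D \<times> I. \<exists>z::int. of_int Q * r (fst x) (snd x) = of_int z"
    using common_denominator[of "D \<times> I" "\<lambda>x. r (fst x) (snd x)"] fin by auto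
  then have "\<forall>x\<in>D \<times> I. \<exists>z::int. of_int Q * r (fst x) (snd x) = of_int z" by blast
  then obtain z' where z': "\<And>x. x \<in> D \<times> I \<Longrightarrow> of_int Q * r (fst x) (snd x) = of_int (z' x)" by metis
  define z where "z d a = z' (d, a)" for d a
  have z: "int_scale Q d = (\<Sum>a\<in>I. int_scale (z d a) a)" if "d \<in> D" for d
  proof -
    have "int_scale Q d = (\<Sum>a\<in>I. rat_scale (of_int Q) (rat_scale (r d a) a))"
      by (subst r[OF that]) (simp only: rat_vs.scale_sum_right flip: rat_scale_of_int)
    also have "\<dots> = (\<Sum>a\<in>I. int_scale (z d a) a)"
      using z'[of "(d, _)"] that by (intro sum.cong) (auto simp: z_def simp flip: rat_scale_of_int)
    finally show ?thesis .
  qed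
  define P where "P = (\<Sum>x\<in>D \<times> I. nat \<bar>z' x\<bar>)"
  have P: "\<bar>z d a\<bar> \<le> int P" if "d \<in> D" "a \<in> I" for d a
  proof -
    have "nat \<bar>z' (d, a)\<bar> \<le> P" unfolding P_def using that fin by (intro member_le_sum) auto
    then show ?thesis by (simp add: z_def)
  qed
  define g where "g f = (1 / of_int Q) *\<^sub>R (\<Sum>a\<in>I. int_scale (f a) a)" for f :: "'v \<Rightarrow> int"
  define F where "F m = PiE I (\<lambda>_. {- int (P * m)..int (P * m)})" for m
  have sub: "list_sums D m \<subseteq> g ` F m" for m
  proof
    fix x assume "x \<in> list_sums D m"
    then obtain xs where xs: "x = sum_list xs" "set xs \<subseteq> D" "length xs \<le> m" by (auto simp: list_sums_def)
    define c where "c a = (\<Sum>d\<leftarrow>xs. z d a)" for a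
    have "int_scale Q (sum_list xs) = (\<Sum>a\<in>I. int_scale (\<Sum>d\<leftarrow>xs. z d a) a) \<and>
       (\<forall>a\<in>I. \<bar>\<Sum>d\<leftarrow>xs. z d a\<bar> \<le> int (P * length xs))" if "set xs \<subseteq> D" for xs
      using that
    proof (induction xs)
      case Nil then show ?case by (simp add: int_scale_def)
    next
      case (Cons d xs)
      then have IH: "int_scale Q (sum_list xs) = (\<Sum>a\<in>I. int_scale (\<Sum>d\<leftarrow>xs. z d a) a)"
        "\<And>a. a \<in> I \<Longrightarrow> \<bar>\<Sum>d\<leftarrow>xs. z d a\<bar> \<le> int (P * length xs)" by auto
      have "int_scale Q (sum_list (d # xs)) = (\<Sum>a\<in>I. int_scale (\<Sum>d\<leftarrow>d # xs. z d a) a)"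
        using IH(1) z[of d] Cons.prems
        by (simp add: int_mod.scale_right_distrib int_mod.scale_left_distrib sum.distrib)
      moreover have "\<bar>\<Sum>d\<leftarrow>d # xs. z d a\<bar> \<le> int (P * length (d # xs))" if "a \<in> I" for a
        using IH(2)[OF that] P[of d a] that Cons.prems by (simp add: algebra_simps)
      ultimately show ?case by blast
    qed
    from this[OF xs(2)] have c: "int_scale Q x = (\<Sum>a\<in>I. int_scale (c a) a)" "\<And>a. a \<in> I \<Longrightarrow> \<bar>c a\<bar> \<le> int (P * length xs)"
      by (auto simp: c_def xs(1))
    have cm: "\<bar>c a\<bar> \<le> int (P * m)" if "a \<in> I" for a
    proof -
      have "int (P * length xs) \<le> int (P * m)" using xs(3) by (simp add: mult_left_mono)
      then show ?thesis using c(2)[OF that] by linarith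
    qed
    have "x = (1 / of_int Q) *\<^sub>R int_scale Q x" using Q(1) by (simp add: int_scale_def)
    also have "\<dots> = g (restrict c I)" by (simp add: g_def c(1))
    finally have "x = g (restrict c I)" .
    moreover have "c a \<in> {- int (P * m)..int (P * m)}" if "a \<in> I" for a
      using cm[OF that] unfolding atLeastAtMost_iff by linarith
    then have "restrict c I \<in> F m" unfolding F_def by auto
    ultimately show "x \<in> g ` F m" by blast
  qed
  have "finite (F m)" for m unfolding F_def using fin by (intro finite_PiE) auto
  moreover have "card (F m) = (2 * P * m + 1) ^ card I" for m
    unfolding F_def using fin by (simp add: card_PiE nat_add_distrib nat_mult_distrib mult.assoc)
  ultimately have "finite (list_sums D m) \<and> card (list_sums D m) \<le> (2 * P * m + 1) ^ card I" for m
    using finite_subset[OF sub] card_mono[OF _ sub] card_image_le[of "F m" g]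
    by (metis finite_imageI le_trans)
  then show ?thesis by blast
qed

lemma rat_basis_of_finite:
  fixes D :: "'v::real_vector set"
  assumes "finite D"
  obtains I where "finite I" "I \<subseteq> D" "\<not> module.dependent rat_scale I" "D \<subseteq> module.span rat_scale I"
proof -
  obtain I where "I \<subseteq> D" "\<not> module.dependent rat_scale I" "D \<subseteq> module.span rat_scale I"
    by (rule rat_vs.maximal_independent_subset)
  then show ?thesis using that[of I] finite_subset[OF _ assms] by blast
qed

section \<open>Orders of growth\<close>

lemma bigo_power:
  assumes "\<And>m. real (g m) \<le> C * (real m + 1) ^ r"
  shows "(\<lambda>m. real (g m)) \<in> O(\<lambda>m. real m ^ r)"
proof (rule landau_o.bigI[where c = "\<bar>C\<bar> * 2 ^ r + 1"])
  show "\<forall>\<^sub>F m in at_top. norm (real (g m)) \<le> (\<bar>C\<bar> * 2 ^ r + 1) * norm (real m ^ r)"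
    using eventually_ge_at_top[of 1]
  proof eventually_elim
    case (elim m)
    have "(real m + 1) ^ r \<le> (2 * real m) ^ r" using elim by (intro power_mono) auto
    then have "\<bar>C\<bar> * (real m + 1) ^ r \<le> \<bar>C\<bar> * (2 * real m) ^ r" by (intro mult_left_mono) auto
    moreover have "real (g m) \<le> \<bar>C\<bar> * (real m + 1) ^ r"
      using assms[of m] by (smt (verit) mult_right_mono zero_le_power of_nat_0_le_iff)
    moreover have "\<bar>C\<bar> * (2 * real m) ^ r = \<bar>C\<bar> * 2 ^ r * real m ^ r" by (simp add: power_mult_distrib)
    moreover have "(\<bar>C\<bar> * 2 ^ r + 1) * real m ^ r = \<bar>C\<bar> * 2 ^ r * real m ^ r + real m ^ r" by (simp add: algebra_simps)
    moreover have "real m ^ r \<ge> 0" by simp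
    ultimately have "real (g m) \<le> (\<bar>C\<bar> * 2 ^ r + 1) * real m ^ r" by linarith
    then show ?case by simp
  qed
qed (simp add: add_nonneg_pos)

lemma bigo_power_lower:
  assumes up: "(\<lambda>m. real (g m)) \<in> O(\<lambda>m. real m ^ r')" and c: "c > 0"
    and low: "\<And>n. real (g (A + B * n)) \<ge> c * (real n + 1) ^ r"
  shows "r \<le> r'"
proof (rule ccontr)
  assume "\<not> r \<le> r'"
  then obtain e where e: "r = r' + Suc e" using less_imp_Suc_add[of r' r] by auto
  obtain C where C: "C > 0" "\<forall>\<^sub>F m in at_top. norm (real (g m)) \<le> C * norm (real m ^ r')"
    using landau_o.bigE[OF up] by blast
  then obtain M where M: "\<And>m. m \<ge> M \<Longrightarrow> real (g m) \<le> C * real m ^ r'"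
    by (auto simp: eventually_at_top_linorder)
  define K where "K = real (A + B + 1)"
  define n where "n = M + nat \<lceil>C * K ^ r' / c\<rceil>"
  have "real (A + (B + 1) * n) \<le> K * (real n + 1)" by (simp add: K_def algebra_simps)
  moreover have "real (A + B * n) \<le> real (A + (B + 1) * n)" by simp
  ultimately have "real (A + B * n) \<le> K * (real n + 1)" by linarith
  show False
  proof (cases "B = 0")
    case True
    define G where "G = real (g A)"
    have "c * (real k + 1) \<le> G" for k
    proof -
      have "real k + 1 \<le> (real k + 1) ^ r" unfolding e by (simp add: self_le_power)
      then have "c * (real k + 1) \<le> c * (real k + 1) ^ r" using c by simp
      also have "\<dots> \<le> G" using low[of k] by (simp add: True G_def)
      finally show ?thesis .
    qed
    moreover obtain k where "real k > G / c" using reals_Archimedean2 by blast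
    then have "c * (real k + 1) > G" using c by (simp add: field_simps)
    ultimately show False using not_less by blast
  next
    case False
    then have "B * n \<ge> n" by (cases B) auto
    moreover have "n \<ge> M" by (simp add: n_def)
    ultimately have "A + B * n \<ge> M" by linarith
    then have "c * (real n + 1) ^ r \<le> C * real (A + B * n) ^ r'" using low[of n] M by fastforce
    also have "\<dots> \<le> C * (K * (real n + 1)) ^ r'"
      using C(1) \<open>real (A + B * n) \<le> K * (real n + 1)\<close> by (intro mult_left_mono power_mono) auto
    finally have "c * (real n + 1) ^ Suc e * (real n + 1) ^ r' \<le> C * K ^ r' * (real n + 1) ^ r'"
      by (simp add: e power_add power_mult_distrib mult_ac)
    then have "c * (real n + 1) ^ Suc e \<le> C * K ^ r'" by simp
    moreover have "real n + 1 \<le> (real n + 1) ^ Suc e" by (rule self_le_power) auto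
    then have "c * (real n + 1) \<le> c * (real n + 1) ^ Suc e" using c by simp
    ultimately have "c * (real n + 1) \<le> C * K ^ r'" by linarith
    then have "real n + 1 \<le> C * K ^ r' / c" using c by (simp add: field_simps)
    moreover have "real n \<ge> C * K ^ r' / c" unfolding n_def by linarith
    ultimately show False by linarith
  qed
qed

lemma growth_rate_eqI:
  assumes "\<And>m. real (g m) \<le> C * (real m + 1) ^ r"
    and "c > 0" "\<And>n. real (g (A + B * n)) \<ge> c * (real n + 1) ^ r"
  shows "growth_rate g = r"
  unfolding growth_rate_def
  by (intro Least_equality bigo_power[OF assms(1)] bigo_power_lower[OF _ assms(2,3)])

lemma polynomial_growthI:
  assumes "\<And>m. real (g m) \<le> C * (real m + 1) ^ r"
  shows "polynomial_growth g"
proof -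
  have "(\<lambda>m. real (g m)) \<in> O(\<lambda>m. real m ^ r)" by (rule bigo_power[OF assms])
  also have "(\<lambda>m. real m ^ r) \<in> O(\<lambda>m. real m powr real r)"
  proof (rule landau_o.bigI[where c = 1])
    show "\<forall>\<^sub>F m in at_top. norm (real m ^ r) \<le> 1 * norm (real m powr real r)"
      using eventually_gt_at_top[of 0] by eventually_elim (simp add: powr_realpow)
  qed simp
  finally show ?thesis unfolding polynomial_growth_def by (intro exI[of _ "real r"]) simp
qed

section \<open>Seeds modulo a one-parameter group of isometries\<close>

lemma mutation_sign: "seed_mutation form pos k s = seed_mutation form (\<lambda>_. pos (fst s k)) k s"
  by (cases s) (simp add: seed_mutation_def fun_eq_iff)

locale one_param = seed_space form pos for form :: "'v::real_vector \<Rightarrow> 'v \<Rightarrow> real" and pos +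
  fixes Phi :: "real \<Rightarrow> 'v \<Rightarrow> 'v"
  assumes Phi_add: "Phi t (x + y) = Phi t x + Phi t y"
    and Phi_scale: "Phi t (c *\<^sub>R x) = c *\<^sub>R Phi t x"
    and Phi_form: "form (Phi t x) (Phi t y) = form x y"
    and Phi_Phi: "Phi t (Phi t' x) = Phi (t + t') x"
    and Phi_0: "Phi 0 x = x"
begin

definition act :: "real \<Rightarrow> ('n::finite, 'v) labelled_seed \<Rightarrow> ('n, 'v) labelled_seed" where
  "act t s = (\<lambda>i. Phi t (fst s i), snd s)"

lemma Phi_minus: "Phi t (- x) = - Phi t x" using Phi_scale[of t "-1" x] by simp

lemma Phi_diff: "Phi t (x - y) = Phi t x - Phi t y"
  using Phi_add[of t x "- y"] by (simp add: Phi_minus)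

lemma act_act: "act t (act t' s) = act (t + t') s" by (simp add: act_def Phi_Phi)

lemma act_0: "act 0 s = s" by (simp add: act_def Phi_0)

lemma act_signed: "seed_mutation form (\<lambda>_. e) k (act t s) = act t (seed_mutation form (\<lambda>_. e) k s)"
  by (auto simp: seed_mutation_def act_def Phi_minus Phi_diff Phi_scale Phi_form split: prod.splits)

lemma act_mutation:
  assumes "pos (Phi t (fst s k)) = pos' (fst s k)"
  shows "seed_mutation form pos k (act t s) = act t (seed_mutation form pos' k s)"
  using assms unfolding mutation_sign[of form pos k "act t s"] mutation_sign[of form pos' k s] act_signed
  by (simp add: act_def)

text \<open>The displacement caused by a mutation depends only on the representative, the vertex and the sign.
  Displacements are differences of positions that occur, so that they lie in every group that
  contains all positions.\<close>

lemma ball_positions: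
  fixes s0 :: "('n::finite, 'v) labelled_seed"
  assumes fin: "finite Rep" and cl: "\<And>s k. s \<in> R \<Longrightarrow> seed_mutation form pos k s \<in> R" and s0: "s0 \<in> R"
    and rep: "\<And>s. s \<in> R \<Longrightarrow> \<exists>r\<in>Rep. \<exists>t. s = act t r"
  obtains D t0 where "finite D" "\<And>d. d \<in> D \<Longrightarrow> \<exists>t t' r r'. r \<in> Rep \<and> r' \<in> Rep \<and> act t r \<in> R \<and> act t' r' \<in> R \<and> d = t' - t"
    "\<exists>r\<in>Rep. s0 = act t0 r"
    "\<And>m. labelled_ball form pos s0 m \<subseteq> (\<lambda>(r, x). act (t0 + x) r) ` (Rep \<times> list_sums D m)"
proof -
  obtain r0 t0 where r0: "r0 \<in> Rep" "s0 = act t0 r0" using rep[OF s0] by blast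
  define occ where "occ = (\<lambda>(r, k, e) d. \<exists>t t' r'. r' \<in> Rep \<and> act t r \<in> R \<and> act t' r' \<in> R \<and> d = t' - t \<and>
      seed_mutation form (\<lambda>_. e) k r = act d r')"
  define X where "X = {x \<in> Rep \<times> (UNIV :: 'n set) \<times> (UNIV :: bool set). \<exists>d. occ x d}"
  define dd where "dd x = (SOME d. occ x d)" for x
  have dd: "occ x (dd x)" if "x \<in> X" for x
    using that unfolding X_def dd_def by (auto intro: someI_ex)
  have finX: "finite X" unfolding X_def using fin by auto
  have step: "\<exists>r'\<in>Rep. \<exists>d\<in>dd ` X. seed_mutation form pos k (act t r) = act (t + d) r'"
    if r: "r \<in> Rep" "act t r \<in> R" for r t k
  proof -
    define e where "e = pos (fst (act t r) k)"
    have mut: "seed_mutation form pos k (act t r) = act t (seed_mutation form (\<lambda>_. e) k r)"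
      unfolding mutation_sign[of form pos] act_signed e_def ..
    obtain r' t' where r': "r' \<in> Rep" "seed_mutation form pos k (act t r) = act t' r'" using rep[OF cl[OF r(2)]] by blast
    have "seed_mutation form (\<lambda>_. e) k r = act (- t) (act t (seed_mutation form (\<lambda>_. e) k r))"
      by (simp add: act_act act_0)
    also have "\<dots> = act (t' - t) r'" unfolding mut[symmetric] r'(2) act_act by simp
    finally have "occ (r, k, e) (t' - t)"
      unfolding occ_def prod.case using r r'(1) cl[OF r(2), of k] r'(2)
      by (intro exI[of _ t] exI[of _ t'] exI[of _ r']) simp
    then have x: "(r, k, e) \<in> X" using r by (auto simp: X_def)
    then obtain r'' where "r'' \<in> Rep" "seed_mutation form (\<lambda>_. e) k r = act (dd (r, k, e)) r''"
      using dd[OF x] by (auto simp: occ_def)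
    then have "seed_mutation form pos k (act t r) = act (t + dd (r, k, e)) r''" by (simp add: mut act_act)
    then show ?thesis using x \<open>r'' \<in> Rep\<close> by blast
  qed
  have "labelled_ball form pos s0 m \<subseteq> R \<inter> (\<lambda>(r, x). act (t0 + x) r) ` (Rep \<times> list_sums (dd ` X) m)" for m
  proof (induction m)
    case 0
    show ?case using r0 s0 list_sums_0[of "dd ` X" 0]
      by (auto simp: labelled_ball_0 intro!: image_eqI[of _ _ "(r0, 0)"])
  next
    case (Suc m)
    show ?case
    proof
      fix s assume "s \<in> labelled_ball form pos s0 (Suc m)"
      then consider "s \<in> labelled_ball form pos s0 m" | k s' where "s' \<in> labelled_ball form pos s0 m" "s = seed_mutation form pos k s'"
        by (auto simp: labelled_ball_Suc)
      then show "s \<in> R \<inter> (\<lambda>(r, x). act (t0 + x) r) ` (Rep \<times> list_sums (dd ` X) (Suc m))"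
      proof cases
        case 1 then show ?thesis using Suc list_sums_mono[of m "Suc m" "dd ` X"] by fastforce
      next
        case 2
        have sR: "s' \<in> R" and "s' \<in> (\<lambda>(r, x). act (t0 + x) r) ` (Rep \<times> list_sums (dd ` X) m)"
          using Suc 2(1) by blast+
        then obtain y where y: "y \<in> Rep \<times> list_sums (dd ` X) m" "s' = (case y of (r, x) \<Rightarrow> act (t0 + x) r)" by blast
        obtain r x where "y = (r, x)" by (cases y)
        then have r: "r \<in> Rep" "x \<in> list_sums (dd ` X) m" "s' = act (t0 + x) r" "s' \<in> R" using y sR by simp_all
        obtain r' d where r': "r' \<in> Rep" "d \<in> dd ` X" "s = act (t0 + x + d) r'"
        proof -
          have "act (t0 + x) r \<in> R" using r(3,4) by simp
          from step[OF r(1) this, of k] show ?thesis using that unfolding 2(2) r(3) by blast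
        qed
        have "x + d \<in> list_sums (dd ` X) (Suc m)" using r(2) r'(2) by (rule list_sums_Suc)
        then have "s \<in> (\<lambda>(r, x). act (t0 + x) r) ` (Rep \<times> list_sums (dd ` X) (Suc m))"
          using r'(1) by (intro image_eqI[of _ _ "(r', x + d)"]) (simp_all add: r'(3) add.assoc)
        moreover have "s \<in> R" unfolding 2(2) by (rule cl[OF r(4)])
        ultimately show ?thesis by (rule IntI[rotated])
      qed
    qed
  qed
  then have balls: "labelled_ball form pos s0 m \<subseteq> (\<lambda>(r, x). act (t0 + x) r) ` (Rep \<times> list_sums (dd ` X) m)" for m
    by blast
  show ?thesis
  proof (rule that[of "dd ` X" t0])
    fix d assume "d \<in> dd ` X"
    then obtain x where x: "x \<in> X" "d = dd x" by blast
    obtain r k e where rke: "x = (r, k, e)" by (cases x)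
    have "r \<in> Rep" using x(1) by (simp add: X_def rke)
    moreover have "occ (r, k, e) d" using dd[OF x(1)] x(2) by (simp add: rke)
    ultimately show "\<exists>t t' r r'. r \<in> Rep \<and> r' \<in> Rep \<and> act t r \<in> R \<and> act t' r' \<in> R \<and> d = t' - t"
      unfolding occ_def prod.case by blast
  qed (use finX r0 balls in auto)
qed

end

lemma finite_vectors: "finite S \<Longrightarrow> finite {x :: 'a^'n. \<forall>i. x $ i \<in> S}"
proof -
  assume "finite S"
  then have "finite (vec_lambda ` (PiE (UNIV :: 'n set) (\<lambda>_. S)))" by (intro finite_imageI finite_PiE) auto
  moreover have "{x :: 'a^'n. \<forall>i. x $ i \<in> S} \<subseteq> vec_lambda ` (PiE UNIV (\<lambda>_. S))"
  proof
    fix x :: "'a^'n" assume "x \<in> {x. \<forall>i. x $ i \<in> S}"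
    then show "x \<in> vec_lambda ` (PiE UNIV (\<lambda>_. S))"
      by (intro image_eqI[of _ _ "\<lambda>i. x $ i"]) auto
  qed
  ultimately show ?thesis by (rule finite_subset[rotated])
qed

definition gram :: "('v \<Rightarrow> 'v \<Rightarrow> real) \<Rightarrow> (3, 'v) labelled_seed \<Rightarrow> real^3^3" where
  "gram form s = (\<chi> i j. form (fst s i) (fst s j))"

lemma reach_matrix: "s \<in> mutation_reachable form pos s0 \<Longrightarrow> snd s \<in> matrix_reach (snd s0)"
  by (induction rule: reachable_induct) (auto simp: snd_mutation intro: matrix_reach_refl matrix_reach_step)

lemma (in coherent) finite_gram:
  assumes "finite (snd ` R)" shows "finite ((\<lambda>s. (snd s, gram form s)) ` R)"
proof -
  define S where "S = insert 2 (\<Union>B\<in>snd ` R. \<Union>i. \<Union>j. {B $ i $ j, - (B $ i $ j)})"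
  have "finite S" unfolding S_def by (intro finite.insertI finite_UN_I assms) auto
  then have "finite {x :: real^3^3. \<forall>i. x $ i \<in> {y. \<forall>j. y $ j \<in> S}}" by (intro finite_vectors)
  moreover have "gram form s $ i $ j \<in> S" if s: "s \<in> R" for s i j
  proof (cases "i = j")
    case True then show ?thesis using norm[OF s] by (simp add: gram_def S_def)
  next
    case False
    then obtain k where "j \<noteq> k" "i \<noteq> k" using distinct3_ex three_cases by metis
    then have "\<bar>form (fst s i) (fst s j)\<bar> = \<bar>snd s $ i $ j\<bar>"
      using realis[OF s] False unfolding realises_def sign_compat_def by blast
    then have "form (fst s i) (fst s j) \<in> {snd s $ i $ j, - (snd s $ i $ j)}" by (auto simp: abs_if split: if_splits)
    then show ?thesis unfolding gram_def S_def using s by auto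
  qed
  then have "gram form ` R \<subseteq> {x. \<forall>i. x $ i \<in> {y. \<forall>j. y $ j \<in> S}}" by auto
  ultimately have "finite (gram form ` R)" using finite_subset by blast
  then have "finite (snd ` R \<times> gram form ` R)" using assms by blast
  then show ?thesis by (rule finite_subset[rotated]) auto
qed

text \<open>Up to the group there are finitely many seeds, since Gram matrices are determined up to signs by the
  finitely many exchange matrices; this chooses one seed for each type.\<close>

lemma finite_representatives:
  assumes "finite (f ` R)"
  obtains Rep where "finite Rep" "Rep \<subseteq> R" "\<And>s. s \<in> R \<Longrightarrow> \<exists>r\<in>Rep. f s = f r"
proof -
  obtain Rep where "Rep \<subseteq> R" "finite Rep" "f ` R = f ` Rep"
    using finite_subset_image[OF assms subset_refl] by metis
  then show ?thesis using that[of Rep] by (metis imageE imageI)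
qed

section \<open>Isolated vertices\<close>

primrec alternating :: "('v::real_vector \<Rightarrow> 'v \<Rightarrow> real) \<Rightarrow> ('v \<Rightarrow> bool) \<Rightarrow> (3, 'v) labelled_seed \<Rightarrow> 3 \<Rightarrow> 3 \<Rightarrow> nat
    \<Rightarrow> (3, 'v) labelled_seed" where
  "alternating form pos s a b 0 = s"
| "alternating form pos s a b (Suc n) = seed_mutation form pos (if even n then a else b) (alternating form pos s a b n)"

lemma isolated_commute:
  assumes "skew_symmetric (snd s)" "isolated i (snd s)" "i \<noteq> j"
  shows "seed_mutation form pos j (seed_mutation form pos i s) = seed_mutation form pos i (seed_mutation form pos j s)"
proof -
  have z: "snd s $ i $ l = 0" "snd s $ l $ i = 0" for l
    using assms(2) skewD[OF assms(1), of i l] by (simp_all add: isolated_def)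
  have "matrix_mutation j (matrix_mutation i (snd s)) = matrix_mutation i (matrix_mutation j (snd s))"
    using assms(3) by (auto simp: vec_eq_iff matrix_mutation_nth z)
  moreover have "fst (seed_mutation form pos j (seed_mutation form pos i s)) l =
      fst (seed_mutation form pos i (seed_mutation form pos j s)) l" for l
    using assms(3) by (auto simp: fst_mutation[of form pos j "seed_mutation form pos i s"] fst_mutation[of form pos i s]
       fst_mutation[of form pos i "seed_mutation form pos j s"] fst_mutation[of form pos j s] snd_mutation matrix_mutation_nth z)
  ultimately show ?thesis by (intro prod_eqI ext) (simp_all add: snd_mutation)
qed

text \<open>Mutation at an isolated vertex only changes a sign, and the mutations at the two other vertices
  form a single path.\<close>

lemma isolated_ball:
  fixes s0 :: "(3, 'v::real_vector) labelled_seed"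
  assumes inv: "\<And>s k. s \<in> mutation_reachable form pos s0 \<Longrightarrow> seed_mutation form pos k (seed_mutation form pos k s) = s"
    and sk: "skew_symmetric (snd s0)" and iso: "isolated i (snd s0)"
  shows "card (labelled_ball form pos s0 m) \<le> 4 * (m + 1)"
proof -
  obtain j k where ne: "i \<noteq> j" "j \<noteq> k" "i \<noteq> k" using distinct3_ex by blast
  let ?R = "mutation_reachable form pos s0" and ?mu = "seed_mutation form pos"
  define W where "W n = alternating form pos s0 j k ` {..n} \<union> alternating form pos s0 k j ` {..n}" for n
  have skR: "skew_symmetric (snd s) \<and> isolated i (snd s)" if "s \<in> ?R" for s
    using that by (induction rule: reachable_induct) (auto simp: sk iso snd_mutation skew_mutation isolated_mutation)
  have altR: "alternating form pos s0 a b n \<in> ?R" for a b n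
    by (induction n) (auto intro: reachable_refl reachable_mutation)
  have WR: "s \<in> ?R" if "s \<in> W n" for s n using that altR by (auto simp: W_def)
  have Wmono: "s \<in> W (Suc n)" if "s \<in> W n" for s n using that by (force simp: W_def)
  have stepab: "?mu l (alternating form pos s0 a b n) \<in> W (Suc n)"
    if lab: "(a = j \<and> b = k) \<or> (a = k \<and> b = j)" and l: "l = a \<or> l = b" and n: "n \<le> N" "N = n" for a b l n N
  proof (cases n)
    case 0
    have "?mu l (alternating form pos s0 a b n) = alternating form pos s0 l (if l = a then b else a) 1"
      by (simp add: 0)
    moreover have "alternating form pos s0 l (if l = a then b else a) 1 \<in> W (Suc n)"
      using lab l ne unfolding W_def by (auto simp del: alternating.simps)
    ultimately show ?thesis by simp
  next
    case (Suc n')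
    define c where "c = (if even n' then a else b)"
    show ?thesis
    proof (cases "l = c")
      case True
      have "?mu l (alternating form pos s0 a b n) = alternating form pos s0 a b n'"
        using inv[OF altR] by (simp add: Suc True c_def)
      moreover have "alternating form pos s0 a b n' \<in> W (Suc n)"
        using lab Suc unfolding W_def by auto
      ultimately show ?thesis by simp
    next
      case False
      then have "?mu l (alternating form pos s0 a b n) = alternating form pos s0 a b (Suc n)"
        using l by (auto simp: Suc c_def)
      moreover have "alternating form pos s0 a b (Suc n) \<in> W (Suc n)"
        using lab unfolding W_def by (auto simp del: alternating.simps)
      ultimately show ?thesis by simp
    qed
  qed
  have Wsub: "W n \<subseteq> W n'" if "n \<le> n'" for n n' using that unfolding W_def by (intro Un_mono image_mono) auto
  have stepW: "?mu l s \<in> W (Suc n)" if l: "l = j \<or> l = k" and s: "s \<in> W n" for l s n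
  proof -
    obtain a b n' where ab: "(a = j \<and> b = k) \<or> (a = k \<and> b = j)" "n' \<le> n" "s = alternating form pos s0 a b n'"
      using s unfolding W_def by auto
    then have "?mu l s \<in> W (Suc n')" using stepab[of a b l n' n'] l by blast
    then show ?thesis using Wsub[of "Suc n'" "Suc n"] ab by auto
  qed
  have "labelled_ball form pos s0 m \<subseteq> W m \<union> ?mu i ` W m" for m
  proof (induction m)
    case 0 show ?case by (simp add: labelled_ball_0 W_def)
  next
    case (Suc m)
    have "?mu l s \<in> W (Suc m) \<union> ?mu i ` W (Suc m)" if s: "s \<in> W m \<union> ?mu i ` W m" for l s
    proof (cases "l = i")
      case True
      from s show ?thesis
      proof
        assume "s \<in> W m"
        then have "s \<in> W (Suc m)" by (rule Wmono)
        then show ?thesis using True by blast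
      next
        assume "s \<in> ?mu i ` W m"
        then obtain w where w: "w \<in> W m" "s = ?mu i w" by blast
        then have "?mu l s = w" using inv[OF WR] True by blast
        then show ?thesis using Wmono[OF w(1)] by simp
      qed
    next
      case False
      then have l: "l = j \<or> l = k" using three_cases[OF ne] by metis
      from s show ?thesis
      proof
        assume "s \<in> W m" then show ?thesis using stepW[OF l] by blast
      next
        assume "s \<in> ?mu i ` W m"
        then obtain w where w: "w \<in> W m" "s = ?mu i w" by blast
        then have "?mu l s = ?mu i (?mu l w)" using isolated_commute[of w i l] skR[OF WR] False by auto
        then show ?thesis using stepW[OF l w(1)] by blast
      qed
    qed
    then show ?case using Suc Wmono unfolding labelled_ball_Suc by blast
  qed
  moreover have "finite (W m)" "card (W m) \<le> 2 * (m + 1)"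
  proof -
    show "finite (W m)" by (simp add: W_def)
    have "card (W m) \<le> card (alternating form pos s0 j k ` {..m}) + card (alternating form pos s0 k j ` {..m})"
      unfolding W_def by (rule card_Un_le)
    also have "\<dots> \<le> card {..m} + card {..m}" by (intro add_mono card_image_le) auto
    finally show "card (W m) \<le> 2 * (m + 1)" by simp
  qed
  ultimately have "card (labelled_ball form pos s0 m) \<le> card (W m \<union> ?mu i ` W m)"
    by (intro card_mono) auto
  also have "\<dots> \<le> card (W m) + card (?mu i ` W m)" by (rule card_Un_le)
  also have "\<dots> \<le> 2 * (m + 1) + 2 * (m + 1)"
    using \<open>card (W m) \<le> 2 * (m + 1)\<close> card_image_le[OF \<open>finite (W m)\<close>, of "?mu i"] by linarith
  finally show ?thesis by simp
qed

section \<open>The sign rule from compatibility\<close>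

definition pair_seed :: "'v \<times> 'v \<Rightarrow> real \<Rightarrow> (2, 'v) labelled_seed" where
  "pair_seed w b = (\<lambda>x. if x = 1 then fst w else snd w,
     \<chi> x y. if x = 1 \<and> y = 2 then b else if x = 2 \<and> y = 1 then - b else 0)"

context seed_space begin

lemma pair_seed_step:
  assumes "b > 0"
  shows "(reindex swap2 \<circ> seed_mutation form pos 2) (pair_seed w b) = pair_seed (pair_step w) b"
proof -
  have t: "(2::2) \<noteq> 1" by simp
  have "fst ((reindex swap2 \<circ> seed_mutation form pos 2) (pair_seed w b)) x = fst (pair_seed (pair_step w) b) x" for x
    using exhaust_2[of x] assms t
    by (auto simp: reindex_def fst_mutation pair_seed_def swap2_def pair_step_def)
  moreover have "snd ((reindex swap2 \<circ> seed_mutation form pos 2) (pair_seed w b)) $ x $ y = snd (pair_seed (pair_step w) b) $ x $ y" for x y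
    using exhaust_2[of x] exhaust_2[of y] t
    by (auto simp: reindex_def snd_mutation reindex_matrix_def matrix_mutation_nth pair_seed_def swap2_def)
  ultimately show ?thesis by (intro prod_eqI ext) (simp_all add: vec_eq_iff)
qed

lemma pair_seed_inj: "pair_seed w b = pair_seed w' b \<Longrightarrow> w = w'"
proof -
  assume "pair_seed w b = pair_seed w' b"
  then have "fst (pair_seed w b) 1 = fst (pair_seed w' b) 1" "fst (pair_seed w b) 2 = fst (pair_seed w' b) 2" by simp_all
  then show ?thesis by (simp add: pair_seed_def prod_eq_iff)
qed

lemma pair_seed_iter:
  "b > 0 \<Longrightarrow> ((reindex swap2 \<circ> seed_mutation form pos 2) ^^ n) (pair_seed w b) = pair_seed ((pair_step ^^ n) w) b"
proof -
  assume b: "b > 0"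
  define F where "F = reindex swap2 \<circ> seed_mutation form pos (2 :: 2)"
  have "F (pair_seed w b) = pair_seed (pair_step w) b" for w
    using pair_seed_step[OF b] by (simp only: F_def)
  then have "(F ^^ n) (pair_seed w b) = pair_seed ((pair_step ^^ n) w) b" by (induction n) simp_all
  then show ?thesis by (simp only: F_def)
qed

text \<open>Alternate mutation at the ends of an arrow performs the rank 2 dynamics on the pair.\<close>

lemma pair_orbit:
  assumes sk: "\<And>s. s \<in> R \<Longrightarrow> skew_symmetric (snd s)"
    and cl: "\<And>s k. s \<in> R \<Longrightarrow> seed_mutation form pos k s \<in> R"
    and s: "(s :: (3, 'v) labelled_seed) \<in> R" "i \<noteq> j" "snd s $ i $ j = b" "b > 0"
  shows "\<exists>s'\<in>R. \<exists>i' j'. i' \<noteq> j' \<and> {i', j'} = {i, j} \<and> snd s' $ i' $ j' = b \<and>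
     (pair_step ^^ n) (fst s i, fst s j) = (fst s' i', fst s' j')"
proof (induction n)
  case 0 then show ?case using s by auto
next
  case (Suc n)
  then obtain s' i' j' where IH: "s' \<in> R" "i' \<noteq> j'" "{i', j'} = {i, j}" "snd s' $ i' $ j' = b"
    "(pair_step ^^ n) (fst s i, fst s j) = (fst s' i', fst s' j')" by blast
  let ?t = "seed_mutation form pos j' s'"
  have "(pair_step ^^ Suc n) (fst s i, fst s j) = (fst ?t j', fst ?t i')"
    using IH s(4) by (simp add: pair_step_def fst_mutation)
  moreover have "snd ?t $ j' $ i' = b" using IH skewD[OF sk[OF IH(1)], of i' j'] by (simp add: snd_mutation matrix_mutation_nth)
  moreover have "{j', i'} = {i, j}" using IH(3) by (simp add: insert_commute)
  moreover have "j' \<noteq> i'" "?t \<in> R" using IH(2) cl[OF IH(1)] by auto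
  ultimately show ?case by (intro bexI[of _ ?t] exI[of _ j'] exI[of _ i'] conjI)
qed

text \<open>A third vertex joined to the pair is needed to see that the weight comes from a rational angle: without
  it the matrix does not change along the alternate mutations, and the condition on the period is empty
  for irrational angles.\<close>

lemma compatible_sign_rule:
  fixes s0 :: "(3, 'v) labelled_seed"
  defines "R \<equiv> mutation_reachable form pos s0"
  assumes gp: "general_position form pos s0" and co: "compatible form pos s0"
    and re: "\<And>s. s \<in> R \<Longrightarrow> realises form s" and mf: "mutation_finite (snd s0)"
    and s: "s \<in> R" and ne: "i \<noteq> j" "j \<noteq> k" "i \<noteq> k"
    and b: "0 < snd s $ i $ j" "snd s $ i $ j < 2" and nz: "snd s $ i $ k \<noteq> 0 \<or> snd s $ j $ k \<noteq> 0"
  shows "form (fst s i) (fst s j) =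
     (if \<not> pos (fst s i) \<and> pos (fst s j) then snd s $ i $ j else - (snd s $ i $ j))"
proof -
  let ?b = "snd s $ i $ j" and ?w = "(fst s i, fst s j)"
  have sk: "skew_symmetric (snd s)" if "s \<in> R" for s using re[OF that] by (simp add: realises_def)
  have mfs: "mutation_finite (snd s)" using mutation_finite_reach[OF mf reach_matrix[OF s[unfolded R_def]]] .
  obtain p q :: nat where pq: "p \<ge> 1" "q \<ge> 1" "coprime p q" "2 * p < q" "?b = 2 * cos (pi * real p / real q)"
    using weight_rational[OF sk[OF s] mfs ne b nz] by blast
  define \<sigma> :: "2 \<Rightarrow> 3" where "\<sigma> x = (if x = 1 then i else j)" for x
  have t: "(2::2) \<noteq> 1" by simp
  have sig: "inj \<sigma>" "\<sigma> 1 = i" "\<sigma> 2 = j"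
    using ne t exhaust_2 by (auto simp: \<sigma>_def inj_def split: if_splits)
  have seed: "reindex \<sigma> s = pair_seed ?w ?b"
  proof -
    have "fst (reindex \<sigma> s) x = fst (pair_seed ?w ?b) x" for x by (simp add: reindex_def pair_seed_def \<sigma>_def)
    moreover have "snd (reindex \<sigma> s) $ x $ y = snd (pair_seed ?w ?b) $ x $ y" for x y
      using exhaust_2[of x] exhaust_2[of y] t skew0[OF sk[OF s]] skewD[OF sk[OF s], of i j]
      by (auto simp: reindex_def reindex_matrix_def pair_seed_def \<sigma>_def)
    ultimately show ?thesis by (intro prod_eqI ext) (simp_all add: vec_eq_iff)
  qed
  have c2: "compatible2 form pos (reindex \<sigma> s)"
    using co s sig b unfolding compatible_def R_def by force
  have "has_period (reindex swap2 \<circ> seed_mutation form pos 2) (pair_seed ?w ?b) (q + 2 * p)"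
    using c2 pq t unfolding compatible2_def seed by (auto simp: pair_seed_def)
  then have "pair_seed ((pair_step ^^ (q + 2 * p)) ?w) ?b = pair_seed ?w ?b"
    using pair_seed_iter[OF b(1)] unfolding has_period_def by metis
  then have per: "(pair_step ^^ (q + 2 * p)) ?w = ?w" by (rule pair_seed_inj)
  have dec: "decided (fst s i)" if "s \<in> R" for s i
    using gp that unfolding general_position_def R_def decided_def by blast
  have cl: "seed_mutation form pos k s \<in> R" if "s \<in> R" for s k
    using that unfolding R_def by (rule reachable_mutation)
  have orb: "decided (fst ((pair_step ^^ n) ?w)) \<and> decided (snd ((pair_step ^^ n) ?w))" for n
    using pair_orbit[OF sk cl s ne(1) refl b(1), of n] dec by force
  have "\<bar>form (fst s i) (fst s j)\<bar> = ?b"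
    using re[OF s] ne b unfolding realises_def sign_compat_def by (metis abs_of_pos)
  then show ?thesis
    using pair_sign_rule[OF _ _ pq(1-5) _ orb per] re[OF s] by (auto simp: realises_def)
qed

end

section \<open>The spherical case\<close>

lemma sphere_seed_space: "seed_space (\<bullet>) (sphere_pos u)"
  by standard (auto simp: inner_left_distrib inner_right_distrib inner_commute sphere_pos_def half_sphere_def mult_pos_neg)

lemma skew_form_cross:
  fixes om :: "real^3 \<Rightarrow> real^3 \<Rightarrow> real"
  assumes "skew_bilinear om"
  shows "\<exists>\<kappa>. \<forall>x y. om x y = \<kappa> \<bullet> cross3 x y"
proof -
  note sb = skew_bilinear_simps[OF assms]
  define e :: "3 \<Rightarrow> real^3" where "e i = axis i 1" for i
  have x: "x = x$1 *\<^sub>R e 1 + x$2 *\<^sub>R e 2 + x$3 *\<^sub>R e 3" for x :: "real^3"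
    by (simp add: vec_eq_iff forall_3 e_def axis_def)
  have k: "om (e 2) (e 1) = - om (e 1) (e 2)" "om (e 3) (e 2) = - om (e 2) (e 3)" "om (e 1) (e 3) = - om (e 3) (e 1)"
    using assms unfolding skew_bilinear_def by blast+
  define \<kappa> :: "real^3" where "\<kappa> = vector [om (e 2) (e 3), om (e 3) (e 1), om (e 1) (e 2)]"
  have "om x y = \<kappa> \<bullet> cross3 x y" for x y
  proof -
    have "om x y = om (x$1 *\<^sub>R e 1 + x$2 *\<^sub>R e 2 + x$3 *\<^sub>R e 3) (y$1 *\<^sub>R e 1 + y$2 *\<^sub>R e 2 + y$3 *\<^sub>R e 3)"
      using x by metis
    also have "\<dots> = \<kappa> \<bullet> cross3 x y"
      by (simp add: sb k \<kappa>_def cross3_def inner_vec_def sum_3 vector_3 algebra_simps)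
    finally show ?thesis .
  qed
  then show ?thesis by blast
qed

lemma orthonormal_frame:
  fixes k :: "real^3"
  assumes k: "k \<bullet> k = 1"
  obtains f g where "\<And>x y :: real^3. x \<bullet> y = (x \<bullet> k) * (y \<bullet> k) + (x \<bullet> f) * (y \<bullet> f) + (x \<bullet> g) * (y \<bullet> g)"
    "\<And>x y. k \<bullet> cross3 x y = (x \<bullet> f) * (y \<bullet> g) - (x \<bullet> g) * (y \<bullet> f)"
    "f \<bullet> f = 1" "g \<bullet> g = 1" "f \<bullet> g = 0" "f \<bullet> k = 0" "g \<bullet> k = 0"
proof -
  obtain f0 :: "real^3" where f0: "f0 \<noteq> 0" "orthogonal k f0" using orthogonal_to_vector_exists[of k] by auto
  define f where "f = f0 /\<^sub>R norm f0"
  have ff: "f \<bullet> f = 1" "f \<bullet> k = 0" "k \<bullet> f = 0"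
    using f0 by (auto simp: f_def orthogonal_def inner_commute power2_norm_eq_inner[symmetric] power2_eq_square)
  define g where "g = cross3 k f"
  have gk: "g \<bullet> k = 0" "g \<bullet> f = 0" unfolding g_def by (simp_all add: dot_cross_self)
  have kg: "k \<bullet> g = 0" "f \<bullet> g = 0" using gk by (simp_all add: inner_commute)
  have gg: "g \<bullet> g = 1" unfolding g_def by (simp add: dot_cross ff k)
  have fg: "cross3 f g = k" unfolding g_def by (simp add: Lagrange ff)
  have exp: "x = (x \<bullet> k) *\<^sub>R k + (x \<bullet> f) *\<^sub>R f + (x \<bullet> g) *\<^sub>R g" for x
  proof -
    define r where "r = x - ((x \<bullet> k) *\<^sub>R k + (x \<bullet> f) *\<^sub>R f + (x \<bullet> g) *\<^sub>R g)"
    have r0: "r \<bullet> k = 0" "r \<bullet> f = 0" "r \<bullet> g = 0"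
      using ff gk kg gg k by (simp_all add: r_def inner_diff_left inner_add_left)
    have "cross3 r g = 0" unfolding g_def by (simp add: Lagrange r0)
    then have "cross3 r g \<bullet> cross3 r g = 0" by simp
    then have "r \<bullet> r = 0" using gg r0 by (simp add: dot_cross inner_commute)
    then show ?thesis by (simp add: r_def)
  qed
  have P: "x \<bullet> y = (x \<bullet> k) * (y \<bullet> k) + (x \<bullet> f) * (y \<bullet> f) + (x \<bullet> g) * (y \<bullet> g)" for x y
  proof -
    have "x \<bullet> y = ((x \<bullet> k) *\<^sub>R k + (x \<bullet> f) *\<^sub>R f + (x \<bullet> g) *\<^sub>R g) \<bullet> y" using exp[of x] by simp
    then show ?thesis by (simp only: inner_add_left inner_scaleR_left inner_commute[of k y] inner_commute[of f y] inner_commute[of g y])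
  qed
  have Q: "k \<bullet> cross3 x y = (x \<bullet> f) * (y \<bullet> g) - (x \<bullet> g) * (y \<bullet> f)" for x y
    using dot_cross[of f g x y] fg by (simp add: inner_commute mult.commute)
  show ?thesis by (rule that[OF P Q]) (use ff gk gg in \<open>auto simp: inner_commute\<close>)
qed

lemma (in seed_space) coherent_reachable:
  fixes s0 :: "(3, 'v) labelled_seed"
  defines "R \<equiv> mutation_reachable form pos s0"
  assumes re: "\<And>s. s \<in> R \<Longrightarrow> realises form s" and b: "basis3 (fst s0)" and c: "\<And>i. \<not> isolated i (snd s0)"
    and dec: "\<And>s i. s \<in> R \<Longrightarrow> decided (fst s i)" and rule: "\<And>s. s \<in> R \<Longrightarrow> sign_rule form pos s"
  shows "\<exists>om. coherent form pos R om"
proof -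
  have s0: "s0 \<in> R" unfolding R_def by (rule reachable_refl)
  have sk: "skew_symmetric (snd s)" if "s \<in> R" for s using re[OF that] by (simp add: realises_def)
  obtain om where om: "skew_bilinear om" "\<And>i j. om (fst s0 i) (fst s0 j) = snd s0 $ i $ j"
    using skew_form_exists[OF b sk[OF s0]] by blast
  have omR: "\<forall>i j. om (fst s i) (fst s j) = snd s $ i $ j" if "s \<in> R" for s
    using that unfolding R_def
  proof (induction rule: reachable_induct)
    case base then show ?case using om(2) by blast
  next
    case (step s k)
    then have "s \<in> R" by (simp add: R_def)
    then show ?case using skew_form_mutation[OF om(1) rule sk] step.IH by blast
  qed
  have bR: "basis3 (fst s)" if "s \<in> R" for s
    using that unfolding R_def by (induction rule: reachable_induct) (auto intro: b basis3_mutation)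
  have cR: "\<forall>i. \<not> isolated i (snd s)" if "s \<in> R" for s
    using that unfolding R_def
  proof (induction rule: reachable_induct)
    case base then show ?case using c by blast
  next
    case (step s k)
    then have "s \<in> R" by (simp add: R_def)
    then show ?case using step.IH isolated_mutation_iff[OF sk] unfolding snd_mutation by blast
  qed
  have "coherent form pos R om"
  proof
    show "seed_mutation form pos k s \<in> R" if "s \<in> R" for s k
      using that unfolding R_def by (rule reachable_mutation)
  qed (use om re dec rule omR bR cR in blast)+
  then show ?thesis by blast
qed

lemma (in one_param) ball_card_bound:
  fixes s0 :: "('n::finite, 'v) labelled_seed"
  assumes D: "finite Rep"
    and P: "\<And>m. finite (list_sums D m) \<and> card (list_sums D m) \<le> (2 * P * m + 1) ^ r"
    and sub: "\<And>m. labelled_ball form pos s0 m \<subseteq> (\<lambda>(r, x). act (t0 + x) r) ` (Rep \<times> list_sums D m)"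
  shows "\<exists>C. \<forall>m. real (card (labelled_ball form pos s0 m)) \<le> C * (real m + 1) ^ r"
proof -
  have "real (card (labelled_ball form pos s0 m)) \<le> real (card Rep) * real (2 * P + 1) ^ r * (real m + 1) ^ r" for m
  proof -
    have "card (labelled_ball form pos s0 m) \<le> card ((\<lambda>(r, x). act (t0 + x) r) ` (Rep \<times> list_sums D m))"
      using sub D P by (intro card_mono) auto
    also have "\<dots> \<le> card (Rep \<times> list_sums D m)" using D P by (intro card_image_le) auto
    also have "\<dots> \<le> card Rep * (2 * P * m + 1) ^ r" using P by (simp add: card_cartesian_product)
    also have "\<dots> \<le> card Rep * ((2 * P + 1) * (m + 1)) ^ r" by (intro mult_left_mono power_mono) auto
    finally have "real (card (labelled_ball form pos s0 m)) \<le> real (card Rep * ((2 * P + 1) * (m + 1)) ^ r)"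
      by (simp only: of_nat_le_iff)
    also have "\<dots> = real (card Rep) * real (2 * P + 1) ^ r * (real m + 1) ^ r"
      by (simp only: of_nat_mult of_nat_power of_nat_add of_nat_1 power_mult_distrib mult.assoc)
    finally show ?thesis .
  qed
  then show ?thesis by blast
qed

lemma basis3_inner_less:
  fixes v :: "3 \<Rightarrow> 'a::real_inner"
  assumes "basis3 v" "i \<noteq> j" "v i \<bullet> v i = 2" "v j \<bullet> v j = 2"
  shows "\<bar>v i \<bullet> v j\<bar> < 2"
proof -
  obtain k where k: "j \<noteq> k" "i \<noteq> k" using distinct3_ex assms(2) three_cases by metis
  have ind: "\<And>a b c. a *\<^sub>R v i + b *\<^sub>R v j + c *\<^sub>R v k = 0 \<Longrightarrow> a = 0 \<and> b = 0 \<and> c = 0"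
    using assms(1) unfolding basis3_three[OF assms(2) k] by blast
  have "v i + v j \<noteq> 0" using ind[of 1 1 0] by auto
  moreover have "v i - v j \<noteq> 0" using ind[of 1 "-1" 0] by auto
  ultimately have "(v i + v j) \<bullet> (v i + v j) > 0" "(v i - v j) \<bullet> (v i - v j) > 0" by simp_all
  then show ?thesis using assms(3,4)
    by (simp add: inner_add_left inner_add_right inner_diff_left inner_diff_right inner_commute abs_less_iff)
qed

lemma not_isolated_third:
  assumes sk: "skew_symmetric B" and c: "\<And>i. \<not> isolated i B" and ne: "i \<noteq> j"
  obtains k :: 3 where "j \<noteq> k" "i \<noteq> k" "B $ i $ k \<noteq> 0 \<or> B $ j $ k \<noteq> 0"
proof -
  obtain k where k: "j \<noteq> k" "i \<noteq> k" using distinct3_ex ne three_cases by metis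
  obtain l where "B $ k $ l \<noteq> 0" using c[of k] by (auto simp: isolated_def)
  moreover from this have "l \<noteq> k" using skew0[OF sk, of k] by auto
  ultimately have "B $ k $ i \<noteq> 0 \<or> B $ k $ j \<noteq> 0" using three_cases[OF ne k(1) k(2), of l] by auto
  then have "B $ i $ k \<noteq> 0 \<or> B $ j $ k \<noteq> 0" using skewD[OF sk, of i k] skewD[OF sk, of j k] by auto
  then show ?thesis using that k by blast
qed

text \<open>On three-space every skew form is a multiple of the area form of a plane. The orthonormal frame has the
  normal of this plane as its first vector, and the isometries that preserve the form rotate the plane.\<close>

locale sphere_coherent = coherent "(\<bullet>)" "sphere_pos u" R om for u R and om :: "real^3 \<Rightarrow> real^3 \<Rightarrow> real" +
  fixes c :: real and k f g :: "real^3"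
  assumes frame: "\<And>x y :: real^3. x \<bullet> y = (x \<bullet> k) * (y \<bullet> k) + (x \<bullet> f) * (y \<bullet> f) + (x \<bullet> g) * (y \<bullet> g)"
    and omfg: "\<And>x y. om x y = c * ((x \<bullet> f) * (y \<bullet> g) - (x \<bullet> g) * (y \<bullet> f))"
    and on: "k \<bullet> k = 1" "f \<bullet> f = 1" "g \<bullet> g = 1" "f \<bullet> g = 0" "f \<bullet> k = 0" "g \<bullet> k = 0"
begin

definition plane_coord :: "real^3 \<Rightarrow> complex" where "plane_coord x = Complex (x \<bullet> f) (x \<bullet> g)"

definition turn :: "real \<Rightarrow> real^3 \<Rightarrow> real^3" where
  "turn t x = (x \<bullet> k) *\<^sub>R k + Re (cis t * plane_coord x) *\<^sub>R f + Im (cis t * plane_coord x) *\<^sub>R g"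

lemma on': "g \<bullet> f = 0" "k \<bullet> f = 0" "k \<bullet> g = 0" using on by (simp_all add: inner_commute)

lemma turn_coord: "turn t x \<bullet> k = x \<bullet> k" "plane_coord (turn t x) = cis t * plane_coord x"
  unfolding turn_def by (simp_all add: plane_coord_def complex_eq_iff inner_add_left on on')

lemma coord_eqI:
  assumes "x \<bullet> k = y \<bullet> k" "plane_coord x = plane_coord y" shows "x = y"
proof -
  have "(x - y) \<bullet> (x - y) = 0" using assms by (subst frame) (simp add: plane_coord_def inner_diff_left)
  then show ?thesis by simp
qed

lemma plane_coord_add: "plane_coord (x + y) = plane_coord x + plane_coord y"
  "plane_coord (a *\<^sub>R x) = of_real a * plane_coord x"
  by (simp_all add: plane_coord_def complex_eq_iff inner_add_left)

lemma plane_coord_mult: "cnj (plane_coord x) * plane_coord y = Complex (x \<bullet> y - (x \<bullet> k) * (y \<bullet> k))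
    ((x \<bullet> f) * (y \<bullet> g) - (x \<bullet> g) * (y \<bullet> f))"
  by (simp add: plane_coord_def complex_eq_iff frame[of x y])

sublocale turn: one_param "(\<bullet>)" "sphere_pos u" turn
proof
  fix t t' a :: real and x y :: "real^3"
  show "turn t (x + y) = turn t x + turn t y"
    by (rule coord_eqI) (simp_all add: turn_coord plane_coord_add inner_add_left distrib_left)
  show "turn t (a *\<^sub>R x) = a *\<^sub>R turn t x"
    by (rule coord_eqI) (simp_all add: turn_coord plane_coord_add)
  show "turn t (turn t' x) = turn (t + t') x"
    by (rule coord_eqI) (simp_all add: turn_coord flip: cis_mult)
  show "turn 0 x = x" by (rule coord_eqI) (simp_all add: turn_coord)
  have "Re (cnj (plane_coord (turn t x)) * plane_coord (turn t y)) = Re (cnj (plane_coord x) * plane_coord y)"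
  proof -
    have "cnj (cis t * plane_coord x) * (cis t * plane_coord y) = (cnj (cis t) * cis t) * (cnj (plane_coord x) * plane_coord y)"
      by (simp add: mult_ac)
    also have "cnj (cis t) * cis t = 1" by (simp add: cis_cnj cis_mult)
    finally show ?thesis by (simp only: turn_coord mult_1)
  qed
  then show "turn t x \<bullet> turn t y = x \<bullet> y" unfolding plane_coord_mult by (simp add: turn_coord)
qed

definition seed_type :: "(3, real^3) labelled_seed \<Rightarrow> (real^3^3) \<times> (real^3^3) \<times> (real^3)" where
  "seed_type s = (snd s, gram (\<bullet>) s, \<chi> i. fst s i \<bullet> k)"

lemma c0: "s \<in> R \<Longrightarrow> c \<noteq> 0"
proof
  assume s: "s \<in> R" and c: "c = 0"
  then have "snd s $ i $ j = 0" for i j using om_B[OF s, of i j] by (simp add: omfg)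
  then show False using conn[OF s] by (auto simp: isolated_def)
qed

text \<open>The axis is determined by the seed up to sign, as the kernel vector of the exchange matrix of
  unit length.\<close>

lemma axis_unique:
  assumes r: "r \<in> R" and s: "s \<in> R" and eq: "snd s = snd r" "gram (\<bullet>) s = gram (\<bullet>) r"
  shows "(\<forall>j. fst s j \<bullet> k = fst r j \<bullet> k) \<or> (\<forall>j. fst s j \<bullet> k = - (fst r j \<bullet> k))"
proof -
  obtain ga where ga: "k = (\<Sum>i\<in>UNIV. ga i *\<^sub>R fst r i)" using basis[OF r] unfolding basis3_def by blast
  define x where "x = (\<Sum>i\<in>UNIV. ga i *\<^sub>R fst s i)"
  have G: "fst s i \<bullet> fst s j = fst r i \<bullet> fst r j" for i j
    using eq(2) by (simp add: gram_def vec_eq_iff)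
  have oms: "om (\<Sum>i\<in>UNIV. a i *\<^sub>R w i) y = (\<Sum>i\<in>UNIV. a i * om (w i) y)" for a y and w :: "3 \<Rightarrow> real^3"
    unfolding sum_3 by (simp add: om_simps)
  have ox: "om x (fst s j) = 0" for j
  proof -
    have "om x (fst s j) = om k (fst r j)" unfolding x_def oms om_B[OF s] eq(1) om_B[OF r, symmetric] oms[symmetric] ga[symmetric] ..
    then show ?thesis by (simp add: omfg on')
  qed
  have ox': "om x y = 0" for y
  proof -
    obtain a where a: "y = (\<Sum>i\<in>UNIV. a i *\<^sub>R fst s i)" using basis[OF s] unfolding basis3_def by blast
    have "om y x = 0" unfolding a oms using ox om_sym[of _ x] by simp
    then show ?thesis using om_sym[of x y] by simp
  qed
  have xfg: "x \<bullet> f = 0" "x \<bullet> g = 0" using ox'[of g] ox'[of f] c0[OF r] by (simp_all add: omfg on on')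
  have xj: "x \<bullet> fst s j = k \<bullet> fst r j" for j
    using arg_cong[OF ga, of "\<lambda>y. y \<bullet> fst r j"] by (simp add: x_def inner_sum_left G)
  have "x \<bullet> x = k \<bullet> k"
  proof -
    have "x \<bullet> x = (\<Sum>i\<in>UNIV. ga i * (x \<bullet> fst s i))" using arg_cong[OF x_def, of "\<lambda>y. x \<bullet> y"] by (simp add: inner_sum_right)
    also have "\<dots> = (\<Sum>i\<in>UNIV. ga i * (k \<bullet> fst r i))" by (simp only: xj)
    also have "\<dots> = k \<bullet> k" using arg_cong[OF ga, of "\<lambda>y. k \<bullet> y"] by (simp add: inner_sum_right)
    finally show ?thesis .
  qed
  then have "(x \<bullet> k)\<^sup>2 = 1" using frame[of x x] xfg on(1) by (simp add: power2_eq_square)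
  then have "x \<bullet> k = 1 \<or> x \<bullet> k = -1" by (simp add: power2_eq_1_iff)
  moreover have "(x \<bullet> k) * (fst s j \<bullet> k) = fst r j \<bullet> k" for j
    using xj[of j] frame[of x "fst s j"] xfg by (simp add: inner_commute)
  ultimately show ?thesis by (elim disjE) (simp_all, metis minus_minus)
qed

lemma same_type_turn:
  assumes r: "r \<in> R" and s: "s \<in> R" and eq: "seed_type s = seed_type r"
  shows "\<exists>t. s = turn.act t r"
proof -
  have e: "snd s = snd r" "\<And>i j. fst s i \<bullet> fst s j = fst r i \<bullet> fst r j" "\<And>i. fst s i \<bullet> k = fst r i \<bullet> k"
    using eq by (auto simp: seed_type_def gram_def vec_eq_iff)
  define z where "z i = plane_coord (fst r i)" for i
  define z' where "z' i = plane_coord (fst s i)" for i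
  have om_eq: "om (fst s i) (fst s j) = om (fst r i) (fst r j)" for i j
    using om_B[OF r] om_B[OF s] e(1) by simp
  have m: "cnj (z' i) * z' j = cnj (z i) * z j" for i j
    using om_eq[of i j] c0[OF r] unfolding z_def z'_def plane_coord_mult e by (simp add: omfg)
  obtain i where i: "z i \<noteq> 0"
  proof -
    have "\<exists>i. z i \<noteq> 0"
    proof (rule ccontr)
      assume "\<nexists>i. z i \<noteq> 0"
      then have "om (fst r i) (fst r j) = 0" for i j by (auto simp: omfg z_def plane_coord_def complex_eq_iff)
      then show False using conn[OF r] om_B[OF r] by (auto simp: isolated_def)
    qed
    then show ?thesis using that by blast
  qed
  have nn: "cnj (z' i) * z' i = cnj (z i) * z i" by (rule m)
  then have z'i: "z' i \<noteq> 0" using i by auto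
  define rho where "rho = z' i / z i"
  have "cnj rho * rho = 1" using nn i by (simp add: rho_def field_simps)
  then have "cmod rho = 1" by (metis complex_mod_sqrt_Re_mult_cnj mult.commute one_complex.sel(1) real_sqrt_one)
  then obtain t where t: "rho = cis t" using complex_norm_eq_1_exp by (metis cis_conv_exp)
  have zj: "z' j = rho * z j" for j
  proof -
    have "cnj (z' i) * z' j * z i = cnj (z i) * z i * z j" unfolding m by (simp add: mult_ac)
    also have "\<dots> = cnj (z' i) * (z' i * z j)" unfolding nn[symmetric] by (simp add: mult_ac)
    finally have "cnj (z' i) * (z' j * z i) = cnj (z' i) * (z' i * z j)" by (simp add: mult_ac)
    then have "z' j * z i = z' i * z j" using z'i by simp
    then show ?thesis using i by (simp add: rho_def field_simps)
  qed
  have "fst s j = turn t (fst r j)" for j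
    using zj[of j] e(3) by (intro coord_eqI) (simp_all add: turn_coord z_def z'_def t)
  then have "s = turn.act t r" using e(1) by (simp add: turn.act_def prod_eq_iff fun_eq_iff)
  then show ?thesis ..
qed

lemma finite_types:
  assumes "finite (snd ` R)" shows "finite (seed_type ` R)"
proof -
  obtain Rep where Rep: "finite Rep" "Rep \<subseteq> R"
    "\<And>s. s \<in> R \<Longrightarrow> \<exists>r\<in>Rep. (snd s, gram (\<bullet>) s) = (snd r, gram (\<bullet>) r)"
    using finite_representatives[OF finite_gram[OF assms]] by blast
  have "seed_type ` R \<subseteq> (\<Union>r\<in>Rep. {(snd r, gram (\<bullet>) r, \<chi> i. fst r i \<bullet> k), (snd r, gram (\<bullet>) r, \<chi> i. - (fst r i \<bullet> k))})"
  proof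
    fix x assume "x \<in> seed_type ` R"
    then obtain s where s: "s \<in> R" "x = seed_type s" by blast
    then obtain r where r: "r \<in> Rep" "snd s = snd r" "gram (\<bullet>) s = gram (\<bullet>) r" using Rep(3) by blast
    then have "(\<forall>j. fst s j \<bullet> k = fst r j \<bullet> k) \<or> (\<forall>j. fst s j \<bullet> k = - (fst r j \<bullet> k))"
      using axis_unique[of r s] Rep(2) s by blast
    then have "x \<in> {(snd r, gram (\<bullet>) r, \<chi> i. fst r i \<bullet> k), (snd r, gram (\<bullet>) r, \<chi> i. - (fst r i \<bullet> k))}"
      unfolding s(2) seed_type_def r(2,3) by (elim disjE) simp_all
    then show "x \<in> (\<Union>r\<in>Rep. {(snd r, gram (\<bullet>) r, \<chi> i. fst r i \<bullet> k), (snd r, gram (\<bullet>) r, \<chi> i. - (fst r i \<bullet> k))})"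
      using r(1) by blast
  qed
  then show ?thesis using Rep(1) finite_subset by blast
qed

lemma ball_bound:
  assumes "finite (snd ` R)" "s0 \<in> R"
  shows "\<exists>C n. \<forall>m. real (card (labelled_ball (\<bullet>) (sphere_pos u) s0 m)) \<le> C * (real m + 1) ^ n"
proof -
  obtain Rep where Rep: "finite Rep" "Rep \<subseteq> R" "\<And>s. s \<in> R \<Longrightarrow> \<exists>r\<in>Rep. seed_type s = seed_type r"
    using finite_representatives[OF finite_types[OF assms(1)]] by blast
  have rep: "\<exists>r\<in>Rep. \<exists>t. s = turn.act t r" if "s \<in> R" for s
    using Rep(3)[OF that] same_type_turn that Rep(2) by blast
  show ?thesis
  proof (rule turn.ball_positions[OF Rep(1) closed assms(2) rep])
    fix D t0 assume D: "finite D"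
      and sub: "\<And>m. labelled_ball (\<bullet>) (sphere_pos u) s0 m \<subseteq> (\<lambda>(r, x). turn.act (t0 + x) r) ` (Rep \<times> list_sums D m)"
    obtain I where I: "finite I" "I \<subseteq> D" "\<not> module.dependent rat_scale I" "D \<subseteq> module.span rat_scale I"
      by (rule rat_basis_of_finite[OF D])
    obtain P where "\<And>m. finite (list_sums D m) \<and> card (list_sums D m) \<le> (2 * P * m + 1) ^ card I"
      using card_list_sums[OF D I(1,4)] by blast
    from turn.ball_card_bound[OF Rep(1) this sub] show ?thesis by blast
  qed
qed

end

theorem sphere_growth:
  fixes v :: "3 \<Rightarrow> real^3"
  assumes sk: "skew_symmetric B" and mf: "mutation_finite B" and gr: "geometric_realisation (\<bullet>) v B"
    and gp: "general_position (\<bullet>) (sphere_pos u) (v, B)" and co: "compatible (\<bullet>) (sphere_pos u) (v, B)"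
  shows "polynomial_growth (exchange_growth (\<bullet>) (sphere_pos u) (v, B))"
proof -
  interpret seed_space "(\<bullet>)" "sphere_pos u" by (rule sphere_seed_space)
  define R where "R = mutation_reachable (\<bullet>) (sphere_pos u) (v, B)"
  have re: "realises (\<bullet>) s" if "s \<in> R" for s
    using that unfolding R_def
    by (induction rule: reachable_induct) (auto intro: geometric_realisation_realises[OF gr sk] realises_mutation)
  have dec: "decided (fst s i)" if "s \<in> R" for s i
    using gp that unfolding general_position_def R_def decided_def by blast
  have inv: "seed_mutation (\<bullet>) (sphere_pos u) k (seed_mutation (\<bullet>) (sphere_pos u) k s) = s" if "s \<in> R" for s k
    using mutation_invol[of s k] re[OF that] dec[OF that, of k] unfolding realises_def decided_def by blast
  have bas: "basis3 v" by (rule geometric_realisation_basis[OF gr])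
  have growth: "exchange_growth (\<bullet>) (sphere_pos u) (v, B) m \<le> card (labelled_ball (\<bullet>) (sphere_pos u) (v, B) m)" for m
    using exchange_growth_eq[of "(\<bullet>)" "sphere_pos u" "(v, B)" m] inv unfolding R_def
    by (simp add: card_image_le finite_labelled_ball)
  show ?thesis
  proof (cases "\<exists>i. isolated i B")
    case True
    then obtain i where i: "isolated i B" by blast
    have "card (labelled_ball (\<bullet>) (sphere_pos u) (v, B) m) \<le> 4 * (m + 1)" for m
      by (rule isolated_ball[of "(\<bullet>)" "sphere_pos u" "(v, B)" i]) (use inv sk i in \<open>auto simp: R_def\<close>)
    then have "exchange_growth (\<bullet>) (sphere_pos u) (v, B) m \<le> 4 * (m + 1)" for m using growth le_trans by blast
    then have "real (exchange_growth (\<bullet>) (sphere_pos u) (v, B) m) \<le> real (4 * (m + 1))" for m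
      by (simp only: of_nat_le_iff)
    then have "real (exchange_growth (\<bullet>) (sphere_pos u) (v, B) m) \<le> 4 * (real m + 1) ^ 1" for m
      by (simp add: algebra_simps)
    then show ?thesis by (rule polynomial_growthI)
  next
    case False
    have rule: "sign_rule (\<bullet>) (sphere_pos u) s" if s: "s \<in> R" for s
      unfolding sign_rule_def
    proof (intro allI impI)
      fix i j assume ij: "i \<noteq> j \<and> snd s $ i $ j \<ge> 0"
      have sks: "skew_symmetric (snd s)" using re[OF s] by (simp add: realises_def)
      have bs: "basis3 (fst s)"
        using s unfolding R_def by (induction rule: reachable_induct) (auto intro: bas basis3_mutation)
      obtain k where k: "j \<noteq> k" "i \<noteq> k" using distinct3_ex ij three_cases by metis
      have ab: "\<bar>fst s i \<bullet> fst s j\<bar> = \<bar>snd s $ i $ j\<bar>"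
        using re[OF s] ij k unfolding realises_def sign_compat_def by blast
      have lt: "\<bar>snd s $ i $ j\<bar> < 2"
        using basis3_inner_less[OF bs] re[OF s] ij unfolding ab[symmetric] realises_def by blast
      show "fst s i \<bullet> fst s j = (if \<not> sphere_pos u (fst s i) \<and> sphere_pos u (fst s j) then snd s $ i $ j else - (snd s $ i $ j))"
      proof (cases "snd s $ i $ j = 0")
        case True then show ?thesis using ab by simp
      next
        case F: False
        have "\<not> isolated l (snd s)" for l
          using s unfolding R_def
        proof (induction rule: reachable_induct)
          case base then show ?case using False by simp
        next
          case (step s k)
          then have "skew_symmetric (snd s)" using re by (simp add: R_def realises_def)
          then show ?case using step.IH isolated_mutation_iff unfolding snd_mutation by blast
        qed
        then obtain k where "j \<noteq> k" "i \<noteq> k" "snd s $ i $ k \<noteq> 0 \<or> snd s $ j $ k \<noteq> 0"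
          using not_isolated_third[OF sks, of i j] ij by blast
        then show ?thesis
          using compatible_sign_rule[OF gp co re _ s[unfolded R_def], of i j k] ij lt F mf by (auto simp: R_def)
      qed
    qed
    obtain om where coh: "coherent (\<bullet>) (sphere_pos u) R om"
      using coherent_reachable[of "(v, B)"] re bas False dec rule unfolding R_def by auto
    interpret coherent "(\<bullet>)" "sphere_pos u" R om by (rule coh)
    have s0: "(v, B) \<in> R" unfolding R_def by (rule reachable_refl)
    obtain ka where ka: "\<And>x y. om x y = ka \<bullet> cross3 x y" using skew_form_cross[OF om] by blast
    have "ka \<noteq> 0"
    proof
      assume "ka = 0"
      then have "isolated 1 B" using om_B[OF s0] ka by (simp add: isolated_def)
      then show False using False by blast
    qed
    define k where "k = ka /\<^sub>R norm ka"
    have kk: "k \<bullet> k = 1" using \<open>ka \<noteq> 0\<close> by (simp add: k_def power2_norm_eq_inner[symmetric] power2_eq_square)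
    have kak: "ka = norm ka *\<^sub>R k" using \<open>ka \<noteq> 0\<close> by (simp add: k_def)
    obtain f g where fg: "\<And>x y :: real^3. x \<bullet> y = (x \<bullet> k) * (y \<bullet> k) + (x \<bullet> f) * (y \<bullet> f) + (x \<bullet> g) * (y \<bullet> g)"
      "\<And>x y. k \<bullet> cross3 x y = (x \<bullet> f) * (y \<bullet> g) - (x \<bullet> g) * (y \<bullet> f)"
      "f \<bullet> f = 1" "g \<bullet> g = 1" "f \<bullet> g = 0" "f \<bullet> k = 0" "g \<bullet> k = 0"
      using orthonormal_frame[OF kk] by metis
    have om': "om x y = norm ka * ((x \<bullet> f) * (y \<bullet> g) - (x \<bullet> g) * (y \<bullet> f))" for x y
      unfolding ka by (subst kak) (simp only: inner_scaleR_left fg(2))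
    interpret sphere_coherent u R om "norm ka" k f g
      by unfold_locales (rule fg om' kk)+
    have fin: "finite (snd ` R)"
    proof (rule finite_subset)
      show "snd ` R \<subseteq> matrix_reach B" using reach_matrix by (auto simp: R_def)
      show "finite (matrix_reach B)" using mf by (simp add: mutation_finite_def matrix_reach_def)
    qed
    obtain C n where C: "\<forall>m. real (card (labelled_ball (\<bullet>) (sphere_pos u) (v, B) m)) \<le> C * (real m + 1) ^ n"
      using ball_bound[OF fin s0] by (elim exE)
    have "real (exchange_growth (\<bullet>) (sphere_pos u) (v, B) m) \<le> C * (real m + 1) ^ n" for m
    proof -
      have "real (exchange_growth (\<bullet>) (sphere_pos u) (v, B) m) \<le> real (card (labelled_ball (\<bullet>) (sphere_pos u) (v, B) m))"
        using growth by (simp only: of_nat_le_iff)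
      then show ?thesis using spec[OF C, of m] by linarith
    qed
    then show ?thesis by (rule polynomial_growthI)
  qed
qed

section \<open>The affine case: the sign rule\<close>

lemma affine_form_simps:
  "affine_form (x + y) z = affine_form x z + affine_form y z"
  "affine_form (c *\<^sub>R x) z = c * affine_form x z"
  by (simp_all add: affine_form_def inner_add_left)

lemma affine_form_sym: "affine_form x y = affine_form y x"
  by (simp add: affine_form_def inner_commute)

lemma affine_eval_simps:
  "affine_eval (f + g) x = affine_eval f x + affine_eval g x"
  "affine_eval (c *\<^sub>R f) x = c * affine_eval f x" "affine_eval 0 x = 0"
  by (simp_all add: affine_eval_def inner_add_left algebra_simps)

lemma affine_seed_space: "seed_space affine_form (plane_pos u)"
proof
  fix x y z :: affine_fun and c :: real
  show "affine_form (x + y) z = affine_form x z + affine_form y z" "affine_form (c *\<^sub>R x) z = c * affine_form x z"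
    by (simp_all add: affine_form_simps)
  show "affine_form x y = affine_form y x" by (rule affine_form_sym)
  show "plane_pos u x \<Longrightarrow> plane_pos u y \<Longrightarrow> plane_pos u (x + y)"
  proof (cases u)
    case (At_Infinity a d)
    assume "plane_pos u x" "plane_pos u y"
    then have "\<forall>\<^sub>F t in at_top. affine_eval x (a + t *\<^sub>R d) < 0" "\<forall>\<^sub>F t in at_top. affine_eval y (a + t *\<^sub>R d) < 0"
      by (simp_all add: At_Infinity half_plane_def)
    then have "\<forall>\<^sub>F t in at_top. affine_eval (x + y) (a + t *\<^sub>R d) < 0"
      by eventually_elim (simp add: affine_eval_simps)
    then show ?thesis by (simp add: At_Infinity half_plane_def)
  qed (simp add: half_plane_def affine_eval_simps)
  show "c > 0 \<Longrightarrow> plane_pos u x \<Longrightarrow> plane_pos u (c *\<^sub>R x)"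
    by (cases u) (simp_all add: half_plane_def affine_eval_simps mult_pos_neg mult_less_0_iff)
  show "\<not> plane_pos u 0" by (cases u) (simp_all add: half_plane_def affine_eval_simps)
qed

definition const_one :: affine_fun where "const_one = (0, 1)"

lemma plane_pos_const: "plane_pos u (- const_one)"
  by (cases u) (simp_all add: half_plane_def affine_eval_def const_one_def)

lemma norm2_parallel:
  fixes a b :: "'a::real_inner"
  assumes "a \<bullet> a = 2" "b \<bullet> b = 2"
  shows "\<bar>a \<bullet> b\<bar> \<le> 2" "a \<bullet> b = 2 \<Longrightarrow> b = a" "a \<bullet> b = -2 \<Longrightarrow> b = - a"
proof -
  have p: "(a + b) \<bullet> (a + b) = 4 + 2 * (a \<bullet> b)" and m: "(b - a) \<bullet> (b - a) = 4 - 2 * (a \<bullet> b)"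
    using assms by (simp_all add: inner_add_left inner_add_right inner_diff_left inner_diff_right inner_commute)
  have "(a + b) \<bullet> (a + b) \<ge> 0" "(b - a) \<bullet> (b - a) \<ge> 0" by simp_all
  then show "\<bar>a \<bullet> b\<bar> \<le> 2" unfolding p m by (simp add: abs_le_iff)
  show "b = a" if "a \<bullet> b = 2" using m that by simp
  show "b = - a" if "a \<bullet> b = -2" using p that by (simp add: eq_neg_iff_add_eq_0 add.commute)
qed

lemma basis3_not_parallel:
  fixes v :: "3 \<Rightarrow> affine_fun"
  assumes "basis3 v" "\<And>i. fst (v i) = c i *\<^sub>R a" shows False
proof -
  obtain y :: "real^2" where y: "y \<noteq> 0" "orthogonal a y" using orthogonal_to_vector_exists[of a] by auto
  obtain k where "(y, 0) = (\<Sum>i\<in>UNIV. k i *\<^sub>R v i)" using assms(1) unfolding basis3_def by blast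
  then have "fst (y, 0 :: real) = fst (\<Sum>i\<in>UNIV. k i *\<^sub>R v i)" by (rule arg_cong)
  then have "y = (\<Sum>i\<in>UNIV. k i * c i) *\<^sub>R a" by (simp add: sum_3 assms(2) algebra_simps)
  then have "y \<bullet> y = 0" using y(2) by (metis inner_commute inner_scaleR_left mult_zero_right orthogonal_def)
  then show False using y(1) by simp
qed

text \<open>An arrow of weight 2 joins two parallel lines.  Then the quiver is cyclic, and if the sign rule
  failed for this arrow, all three vectors would have the same sign and one mutation would lead to a
  violation at an arrow of smaller weight.\<close>

lemma parallel_sign_rule:
  fixes pos :: "affine_fun \<Rightarrow> bool"
  assumes sp: "seed_space affine_form pos"
    and cl: "\<And>s k. s \<in> R \<Longrightarrow> seed_mutation affine_form pos k s \<in> R"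
    and re: "\<And>s. s \<in> R \<Longrightarrow> realises affine_form s" and bas: "\<And>s. s \<in> R \<Longrightarrow> basis3 (fst s)"
    and conn: "\<And>s i. s \<in> R \<Longrightarrow> \<not> isolated i (snd s)"
    and rule: "\<And>s i j. s \<in> R \<Longrightarrow> i \<noteq> j \<Longrightarrow> 0 < snd s $ i $ j \<Longrightarrow> snd s $ i $ j < 2 \<Longrightarrow>
       affine_form (fst s i) (fst s j) = (if \<not> pos (fst s i) \<and> pos (fst s j) then snd s $ i $ j else - (snd s $ i $ j))"
    and s: "s \<in> R" and ij: "i \<noteq> j" and b2: "snd s $ i $ j = 2"
  shows "affine_form (fst s i) (fst s j) = (if \<not> pos (fst s i) \<and> pos (fst s j) then 2 else - 2)"
proof -
  interpret seed_space affine_form pos by (rule sp)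
  obtain k where k: "j \<noteq> k" "i \<noteq> k" using distinct3_ex ij three_cases by metis
  define v where "v = fst s"
  define y where "y = snd s $ j $ k"
  define z where "z = snd s $ k $ i"
  define Y where "Y = affine_form (v j) (v k)"
  define Z where "Z = affine_form (v k) (v i)"
  have sk: "skew_symmetric (snd s)" and nv: "\<And>i. affine_form (v i) (v i) = 2" using re[OF s] by (auto simp: realises_def v_def)
  have sc: "sign_compat 2 y z (affine_form (v i) (v j)) Y Z"
    using re[OF s] ij k b2 unfolding realises_def v_def y_def z_def Y_def Z_def by metis
  then have ab: "\<bar>affine_form (v i) (v j)\<bar> = 2" "\<bar>Y\<bar> = \<bar>y\<bar>" "\<bar>Z\<bar> = \<bar>z\<bar>" by (simp_all add: sign_compat_def)
  have nf: "fst (v l) \<bullet> fst (v l) = 2" for l using nv[of l] by (simp add: affine_form_def)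
  obtain \<sigma> where sg: "\<sigma> = 1 \<or> \<sigma> = -1" "fst (v j) = \<sigma> *\<^sub>R fst (v i)" "affine_form (v i) (v j) = 2 * \<sigma>"
  proof -
    have "affine_form (v i) (v j) = 2 \<or> affine_form (v i) (v j) = -2" using ab(1) by linarith
    then show ?thesis
    proof
      assume "affine_form (v i) (v j) = 2"
      then show ?thesis using that[of 1] norm2_parallel(2)[OF nf nf, of i j] by (simp add: affine_form_def)
    next
      assume "affine_form (v i) (v j) = -2"
      then show ?thesis using that[of "-1"] norm2_parallel(3)[OF nf nf, of i j] by (simp add: affine_form_def)
    qed
  qed
  have YZ: "Y = \<sigma> * Z" by (simp add: Y_def Z_def affine_form_def sg(2) inner_commute)
  have z0: "Z \<noteq> 0"
  proof
    assume "Z = 0"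
    then have "y = 0" "z = 0" using ab YZ by auto
    then have "snd s $ k $ l = 0" for l
      using three_cases[OF ij k(1) k(2), of l] skewD[OF sk, of j k] skew0[OF sk, of k] by (auto simp: y_def z_def)
    then show False using conn[OF s, of k] by (simp add: isolated_def)
  qed
  define x where "x = \<bar>Z\<bar>"
  have x0: "x > 0" using z0 by (simp add: x_def)
  have "y = x \<and> z = x"
  proof -
    have prod: "affine_form (v i) (v j) * Y * Z > 0"
      using z0 sg(1) unfolding YZ sg(3) by (auto simp: zero_less_mult_iff)
    have yz: "\<bar>y\<bar> = x" "\<bar>z\<bar> = x" using ab YZ sg(1) by (auto simp: x_def)
    have "y > 0 \<Longrightarrow> z > 0"
      using sc prod by (auto simp: sign_compat_def zero_less_mult_iff)
    moreover have "\<not> y < 0"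
    proof
      assume yn: "y < 0"
      then consider "z > 0" | "z < 0" using yz by linarith
      then show False
      proof cases
        case 1
        then have "affine_form (v i) (v j) * Y * Z = 2 * y * z" using sc unfolding sign_compat_def by simp
        then show False using prod yn 1 by (simp add: mult_neg_pos not_less_iff_gr_or_eq zero_less_mult_iff)
      next
        case 2
        then have "affine_form (v i) (v j) * Y * Z = - (2 * y * z)" using sc yn unfolding sign_compat_def by simp
        then show False using prod yn 2 by (simp add: zero_less_mult_iff mult_less_0_iff)
      qed
    qed
    ultimately show ?thesis using yz x0 by linarith
  qed
  then have yx: "y = x" and zx: "z = x" by simp_all
  have x2: "x < 2"
  proof (rule ccontr)
    assume "\<not> x < 2"
    then have "\<bar>affine_form (v i) (v k)\<bar> = 2"
      using norm2_parallel(1)[OF nf nf, of i k] by (simp add: x_def Z_def affine_form_def inner_commute)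
    then have "affine_form (v i) (v k) = 2 \<or> affine_form (v i) (v k) = -2" by linarith
    then obtain \<tau> where "fst (v k) = \<tau> *\<^sub>R fst (v i)"
      using norm2_parallel(2,3)[OF nf nf, of i k] by (metis affine_form_def scaleR_minus1_left scaleR_one)
    then have "fst (fst s l) = (if l = i then 1 else if l = j then \<sigma> else \<tau>) *\<^sub>R fst (v i)" for l
      using three_cases[OF ij k, of l] sg(2) k by (auto simp: v_def)
    then show False
      using basis3_not_parallel[OF bas[OF s], of "\<lambda>l. if l = i then 1 else if l = j then \<sigma> else \<tau>" "fst (v i)"] by blast
  qed
  have rY: "Y = (if \<not> pos (v j) \<and> pos (v k) then x else - x)"
    using rule[OF s k(1)] x0 x2 yx unfolding y_def Y_def v_def by simp
  have rZ: "Z = (if \<not> pos (v k) \<and> pos (v i) then x else - x)"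
    using rule[OF s k(2)[symmetric]] x0 x2 zx unfolding z_def Z_def v_def by simp
  have Bs: "snd s $ j $ i = -2" "snd s $ k $ j = - x" "snd s $ i $ k = - x"
    using skewD[OF sk, of i j] skewD[OF sk, of j k] skewD[OF sk, of k i] b2 yx zx by (simp_all add: y_def z_def)
  have fs: "affine_form (v k) (v j) = Y" "affine_form (v i) (v k) = Z"
    using form_sym by (simp_all add: Y_def Z_def)
  show ?thesis
  proof (cases "\<sigma> = -1")
    case True
    then have "\<not> (\<not> pos (v i) \<and> pos (v j))" using YZ rY rZ x0 by (auto split: if_splits)
    then show ?thesis using sg(3) True by (simp add: v_def)
  next
    case False
    then have s1: "\<sigma> = 1" using sg(1) by simp
    have m: "Y = - x" "Z = - x" using YZ rY rZ x0 s1 by (auto split: if_splits)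
    have "\<not> pos (v i)"
    proof
      assume pi: "pos (v i)"
      then have pk: "pos (v k)" using rZ m x0 by (auto split: if_splits)
      let ?t = "seed_mutation affine_form pos i s"
      have t: "fst ?t k = v k" "fst ?t j = v j - 2 *\<^sub>R v i"
        using ij k pi x0 zx Bs form_sym[of "v j" "v i"] sg(3) s1 by (auto simp: fst_mutation v_def[symmetric] z_def)
      have B: "snd ?t $ k $ j = x" using ij k b2 zx Bs x0 by (simp add: snd_mutation matrix_mutation_nth z_def)
      have "affine_form (fst ?t k) (fst ?t j) = Y - 2 * Z" unfolding t by (simp add: form_simps fs Z_def)
      moreover have "affine_form (fst ?t k) (fst ?t j) = - x"
        using rule[OF cl[OF s, of i], of k j] k x0 x2 B pk unfolding t by simp
      ultimately show False using m x0 by simp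
    qed
    moreover have "pos (v j)"
    proof (rule ccontr)
      assume pj: "\<not> pos (v j)"
      then have pk: "\<not> pos (v k)" using rY m x0 by (auto split: if_splits)
      let ?t = "seed_mutation affine_form pos j s"
      have t: "fst ?t k = v k" "fst ?t i = v i - 2 *\<^sub>R v j"
        using ij k pj x0 Bs b2 sg(3) s1 by (auto simp: fst_mutation v_def[symmetric])
      have B: "snd ?t $ i $ k = x" using ij k b2 yx Bs x0 by (simp add: snd_mutation matrix_mutation_nth y_def)
      have "affine_form (fst ?t i) (fst ?t k) = Z - 2 * Y" unfolding t by (simp add: form_simps fs Y_def)
      moreover have "affine_form (fst ?t i) (fst ?t k) = - x"
        using rule[OF cl[OF s, of j], of i k] k x0 x2 B pk unfolding t by simp
      ultimately show False using m x0 by simp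
    qed
    ultimately show ?thesis using sg(3) s1 by (simp add: v_def)
  qed
qed

lemma affine_coherent_exists:
  fixes v :: "3 \<Rightarrow> affine_fun" and B :: "real^3^3" and u :: plane_ref
  defines "R \<equiv> mutation_reachable affine_form (plane_pos u) (v, B)"
  assumes sk: "skew_symmetric B" and mf: "mutation_finite B" and gr: "geometric_realisation affine_form v B"
    and gp: "general_position affine_form (plane_pos u) (v, B)" and co: "compatible affine_form (plane_pos u) (v, B)"
    and c: "\<And>i. \<not> isolated i B"
  shows "\<exists>om. coherent affine_form (plane_pos u) R om"
proof -
  interpret seed_space affine_form "plane_pos u" by (rule affine_seed_space)
  have cl: "seed_mutation affine_form (plane_pos u) k s \<in> R" if "s \<in> R" for s k
    using that unfolding R_def by (rule reachable_mutation)
  have re: "realises affine_form s" if "s \<in> R" for s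
    using that unfolding R_def
    by (induction rule: reachable_induct) (auto intro: geometric_realisation_realises[OF gr sk] realises_mutation)
  have sks: "skew_symmetric (snd s)" if "s \<in> R" for s using re[OF that] by (simp add: realises_def)
  have bas: "basis3 (fst s)" if "s \<in> R" for s
    using that unfolding R_def
    by (induction rule: reachable_induct) (auto intro: geometric_realisation_basis[OF gr] basis3_mutation)
  have dec: "decided (fst s i)" if "s \<in> R" for s i
    using gp that unfolding general_position_def R_def decided_def by blast
  have conn: "\<forall>i. \<not> isolated i (snd s)" if "s \<in> R" for s
    using that unfolding R_def
  proof (induction rule: reachable_induct)
    case base then show ?case using c by simp
  next
    case (step s k)
    then have "skew_symmetric (snd s)" using sks by (simp add: R_def)
    then show ?case using step.IH isolated_mutation_iff unfolding snd_mutation by blast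
  qed
  have small: "affine_form (fst s i) (fst s j) =
      (if \<not> plane_pos u (fst s i) \<and> plane_pos u (fst s j) then snd s $ i $ j else - (snd s $ i $ j))"
    if s: "s \<in> R" and ij: "i \<noteq> j" and b: "0 < snd s $ i $ j" "snd s $ i $ j < 2" for s i j
  proof -
    have nis: "\<And>i. \<not> isolated i (snd s)" using conn[OF s] by blast
    obtain k where "j \<noteq> k" "i \<noteq> k" "snd s $ i $ k \<noteq> 0 \<or> snd s $ j $ k \<noteq> 0"
      by (rule not_isolated_third[OF sks[OF s] nis ij])
    then show ?thesis
      using compatible_sign_rule[OF gp co re _ s[unfolded R_def], of i j k] ij b mf by (auto simp: R_def)
  qed
  have rule: "sign_rule affine_form (plane_pos u) s" if s: "s \<in> R" for s
    unfolding sign_rule_def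
  proof (intro allI impI)
    fix i j assume ij: "i \<noteq> j \<and> snd s $ i $ j \<ge> 0"
    obtain k where k: "j \<noteq> k" "i \<noteq> k" using distinct3_ex ij three_cases by metis
    have ab: "\<bar>affine_form (fst s i) (fst s j)\<bar> = \<bar>snd s $ i $ j\<bar>"
      using re[OF s] ij k unfolding realises_def sign_compat_def by blast
    have nrm: "fst (fst s l) \<bullet> fst (fst s l) = 2" for l using re[OF s] by (simp add: realises_def affine_form_def)
    have "\<bar>affine_form (fst s i) (fst s j)\<bar> \<le> 2" unfolding affine_form_def by (rule norm2_parallel(1)[OF nrm nrm])
    then consider "snd s $ i $ j = 0" | "0 < snd s $ i $ j" "snd s $ i $ j < 2" | "snd s $ i $ j = 2"
      using ij unfolding ab by linarith
    then show "affine_form (fst s i) (fst s j) =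
      (if \<not> plane_pos u (fst s i) \<and> plane_pos u (fst s j) then snd s $ i $ j else - (snd s $ i $ j))"
    proof cases
      case 1 then show ?thesis using ab by simp
    next
      case 2 then show ?thesis using small[OF s] ij by blast
    next
      case 3
      have ne: "i \<noteq> j" using ij by blast
      show ?thesis
        using parallel_sign_rule[OF seed_space_axioms cl re bas _ small s ne 3] conn 3 by simp
    qed
  qed
  show ?thesis
    using coherent_reachable[of "(v, B)"] re geometric_realisation_basis[OF gr] c dec rule unfolding R_def by auto
qed

section \<open>Exceptional orders\<close>

context coherent begin

text \<open>The Gram matrix of the Euler form in this order is triangular with diagonal 1.\<close>

definition exceptional :: "(3, 'v) labelled_seed \<Rightarrow> 3 \<Rightarrow> 3 \<Rightarrow> 3 \<Rightarrow> bool" where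
  "exceptional s i j k \<longleftrightarrow> i \<noteq> j \<and> j \<noteq> k \<and> i \<noteq> k \<and>
     eul (fst s i) (fst s j) = 0 \<and> eul (fst s i) (fst s k) = 0 \<and> eul (fst s j) (fst s k) = 0"

lemma eul_total:
  assumes "s \<in> R" "i \<noteq> j" shows "eul (fst s i) (fst s j) = 0 \<or> eul (fst s j) (fst s i) = 0"
proof (cases "pos (fst s i) = pos (fst s j)")
  case True
  have "snd s $ j $ i = - (snd s $ i $ j)" by (rule skewD[OF skew[OF assms(1)]])
  then have "snd s $ i $ j \<ge> 0 \<or> snd s $ j $ i \<ge> 0" by linarith
  then show ?thesis using eul_zero[OF assms(1), of i j] eul_zero[OF assms(1), of j i] assms(2) True by metis
next
  case False
  then show ?thesis using eul_zero_pm[OF assms(1)] by blast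
qed

text \<open>The relation \<open>eul = 0\<close> is total on the vectors of a seed; a cycle in it would be a cycle of the quiver on
  vectors of the same sign, with all inner products negative.\<close>

lemma eul_no_cycle:
  assumes s: "s \<in> R" and ne: "i \<noteq> j" "j \<noteq> k" "i \<noteq> k"
    and z: "eul (fst s i) (fst s j) = 0" "eul (fst s j) (fst s k) = 0" "eul (fst s k) (fst s i) = 0"
    and nz: "eul (fst s j) (fst s i) \<noteq> 0" "eul (fst s k) (fst s j) \<noteq> 0" "eul (fst s i) (fst s k) \<noteq> 0"
  shows False
proof -
  have sg: "pos (fst s i) = pos (fst s j)" "pos (fst s j) = pos (fst s k)"
    using nz eul_zero_pm[OF s] by metis+
  have p: "snd s $ a $ b > 0 \<and> form (fst s a) (fst s b) = - (snd s $ a $ b)"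
    if "a \<noteq> b" "eul (fst s a) (fst s b) = 0" "eul (fst s b) (fst s a) \<noteq> 0" "pos (fst s a) = pos (fst s b)" for a b
  proof -
    have f: "form (fst s a) (fst s b) = - (snd s $ a $ b)" "snd s $ a $ b \<noteq> 0"
      using eul_zero_B[OF s that(2)] that(3) by auto
    have "\<not> snd s $ a $ b < 0"
    proof
      assume "snd s $ a $ b < 0"
      then have "snd s $ b $ a \<ge> 0" using skewD[OF skew[OF s], of a b] by simp
      then show False using eul_zero[OF s, of b a] that by auto
    qed
    then show ?thesis using f by auto
  qed
  note q = p[OF ne(1) z(1) nz(1) sg(1)] p[OF ne(2) z(2) nz(2) sg(2)] p[OF ne(3)[symmetric] z(3) nz(3)]
  have q3: "snd s $ k $ i > 0 \<and> form (fst s k) (fst s i) = - (snd s $ k $ i)" using q(3) sg by simp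
  have "snd s $ i $ j * snd s $ j $ k * snd s $ k $ i > 0" using q(1,2) q3 by simp
  moreover have "form (fst s i) (fst s j) * form (fst s j) (fst s k) * form (fst s k) (fst s i) =
      - (snd s $ i $ j * snd s $ j $ k * snd s $ k $ i)" using q(1,2) q3 by simp
  ultimately show False using three_cycle[OF s ne] q(1,2) by simp
qed

lemma exceptional_exists:
  assumes s: "s \<in> R" shows "\<exists>i j k. exceptional s i j k"
proof -
  obtain i j k :: 3 where ne: "i \<noteq> j" "j \<noteq> k" "i \<noteq> k" using distinct3_ex by blast
  let ?T = "\<lambda>a b. eul (fst s a) (fst s b) = 0"
  note ne' = ne ne[symmetric]
  have t: "?T i j \<or> ?T j i" "?T j k \<or> ?T k j" "?T i k \<or> ?T k i" using eul_total[OF s] ne by blast+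
  have c1: "\<not> (?T i j \<and> ?T j k \<and> ?T k i \<and> \<not> ?T j i \<and> \<not> ?T k j \<and> \<not> ?T i k)"
    using eul_no_cycle[OF s ne] by blast
  have c2: "\<not> (?T k j \<and> ?T j i \<and> ?T i k \<and> \<not> ?T j k \<and> \<not> ?T i j \<and> \<not> ?T k i)"
    using eul_no_cycle[OF s, of k j i] ne by blast
  have "exceptional s i j k \<or> exceptional s i k j \<or> exceptional s j i k \<or> exceptional s j k i \<or>
     exceptional s k i j \<or> exceptional s k j i"
    unfolding exceptional_def using t c1 c2 ne' by argo
  then show ?thesis by blast
qed

end

section \<open>Seeds up to translation\<close>

text \<open>A function is positive if it is negative at the reference point; hence the sign of the constant. The
  condition persists when the reference point moves to infinity.\<close>

locale affine_coherent = coherent affine_form pos R om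
  for pos :: "affine_fun \<Rightarrow> bool" and R and om +
  assumes pos_const: "pos (- const_one)"
begin

lemma form_const: "affine_form const_one x = 0" "affine_form x const_one = 0"
  by (simp_all add: affine_form_def const_one_def)

definition slope :: "affine_fun \<Rightarrow> real" where "slope f = om f const_one"

lemma slope_simps: "slope (f + g) = slope f + slope g" "slope (c *\<^sub>R f) = c * slope f" "slope (- f) = - slope f"
  "slope (f - g) = slope f - slope g" "slope const_one = 0" "slope 0 = 0"
  by (simp_all add: slope_def om_simps)

lemma slope_eul: "slope f = 2 * eul f const_one" "slope f = - 2 * eul const_one f"
  using om_sym[of const_one f] by (simp_all add: slope_def eul_def form_const)

definition dir :: "real^2" where "dir = (\<chi> i. om (axis i 1, 0) const_one)"

lemma slope_dir: "slope f = fst f \<bullet> dir"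
proof -
  obtain a c where f: "f = (a, c)" by (cases f)
  have "a = a$1 *\<^sub>R axis 1 1 + a$2 *\<^sub>R axis 2 1" by (simp add: vec_eq_iff forall_2 axis_def)
  then have "f = a$1 *\<^sub>R (axis 1 1, 0) + a$2 *\<^sub>R (axis 2 1, 0) + c *\<^sub>R const_one"
    by (simp add: f const_one_def)
  then have "slope f = a$1 * slope (axis 1 1, 0) + a$2 * slope (axis 2 1, 0)" by (metis add.right_neutral mult_zero_right slope_simps(1,2,5))
  then show ?thesis by (simp add: f dir_def slope_def inner_vec_def sum_2)
qed

text \<open>If constants were in the kernel of the skew form, a triangular Gram matrix would be singular.\<close>

lemma dir_nonzero:
  assumes s: "s \<in> R" shows "dir \<noteq> 0"
proof
  assume "dir = 0"
  then have z: "eul f const_one = 0" for f using slope_dir[of f] slope_eul(1)[of f] by simp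
  obtain i j k where e: "exceptional s i j k" using exceptional_exists[OF s] by blast
  then have ne: "i \<noteq> j" "j \<noteq> k" "i \<noteq> k" by (auto simp: exceptional_def)
  obtain a b c where abc: "const_one = a *\<^sub>R fst s i + b *\<^sub>R fst s j + c *\<^sub>R fst s k"
    using basis[OF s] unfolding basis3_three[OF ne] by blast
  have "eul (fst s l) const_one = a * eul (fst s l) (fst s i) + b * eul (fst s l) (fst s j) + c * eul (fst s l) (fst s k)" for l
    unfolding abc by (simp add: eul_add eul_scale)
  then have *: "0 = a * eul (fst s l) (fst s i) + b * eul (fst s l) (fst s j) + c * eul (fst s l) (fst s k)" for l
    using z by simp
  have "a = 0" using *[of i] e eul_self[OF s] by (simp add: exceptional_def)
  moreover from this have "b = 0" using *[of j] e eul_self[OF s] by (simp add: exceptional_def)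
  moreover from calculation have "c = 0" using *[of k] eul_self[OF s] by simp
  ultimately show False using abc by (simp add: const_one_def zero_prod_def)
qed

lemma slope_nonzero:
  assumes s: "s \<in> R" shows "\<exists>i. slope (fst s i) \<noteq> 0"
proof (rule ccontr)
  assume "\<nexists>i. slope (fst s i) \<noteq> 0"
  then have z: "slope (fst s i) = 0" for i by blast
  obtain c where "(dir, 0) = (\<Sum>i\<in>UNIV. c i *\<^sub>R fst s i)" using basis[OF s] unfolding basis3_def by blast
  then have "slope (dir, 0) = 0" by (simp add: sum_3 slope_simps z)
  then show False using dir_nonzero[OF s] by (simp add: slope_dir)
qed

text \<open>Translation along \<open>dir\<close>, written in terms of the skew form: these are the isometries that act trivially on
  linear parts and preserve \<open>om\<close>.\<close>

definition shift :: "real \<Rightarrow> affine_fun \<Rightarrow> affine_fun" where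
  "shift t f = f - (t * slope f) *\<^sub>R const_one"

lemma slope_shift: "slope (shift t f) = slope f" by (simp add: shift_def slope_simps)

sublocale shift: one_param affine_form pos shift
proof
  show "shift t (x + y) = shift t x + shift t y" for t x y by (simp add: shift_def slope_simps algebra_simps)
  show "shift t (c *\<^sub>R x) = c *\<^sub>R shift t x" for t c x by (simp add: shift_def slope_simps algebra_simps)
  show "affine_form (shift t x) (shift t y) = affine_form x y" for t x y
    by (simp add: shift_def form_simps form_const)
  show "shift t (shift t' x) = shift (t + t') x" for t t' x
    unfolding shift_def[of t "shift t' x"] slope_shift by (simp add: shift_def algebra_simps)
  show "shift 0 x = x" for x by (simp add: shift_def)
qed

abbreviation act where "act \<equiv> shift.act"

lemma om_shift: "om (shift t x) (shift t y) = om x y"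
  using om_sym[of const_one y] by (simp add: shift_def om_simps slope_def algebra_simps)

lemma act_translate: "act t s = translate_seed (t *\<^sub>R dir) s"
  by (simp add: shift.act_def translate_seed_def shift_def slope_dir const_one_def prod_eq_iff fun_eq_iff)

definition linear_type :: "(3, affine_fun) labelled_seed \<Rightarrow> (real^3^3) \<times> (real^2^3)" where
  "linear_type s = (snd s, \<chi> i. fst (fst s i))"

lemma linear_type_eq_iff: "linear_type s = linear_type r \<longleftrightarrow> snd s = snd r \<and> (\<forall>i. fst (fst s i) = fst (fst r i))"
  by (auto simp: linear_type_def vec_eq_iff)

text \<open>The skew form leaves only the translations along one line.\<close>

lemma same_linear_type:
  assumes r: "r \<in> R" and s: "s \<in> R" and eq: "linear_type s = linear_type r"
  shows "\<exists>t. s = act t r"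
proof -
  define d where "d i = snd (fst s i) - snd (fst r i)" for i
  have sd: "fst s i = fst r i + d i *\<^sub>R const_one" for i
    using eq[unfolded linear_type_eq_iff] by (simp add: d_def const_one_def prod_eq_iff)
  have B: "om (fst s i) (fst s j) = om (fst r i) (fst r j)" for i j
    using eq om_B[OF r] om_B[OF s] by (simp add: linear_type_eq_iff)
  have dd: "d j * slope (fst r i) = d i * slope (fst r j)" for i j
    using B[of i j] om_sym[of const_one "fst r j"] unfolding sd by (simp add: om_simps slope_def)
  obtain i where i: "slope (fst r i) \<noteq> 0" using slope_nonzero[OF r] by blast
  define t where "t = - d i / slope (fst r i)"
  have "fst s j = shift t (fst r j)" for j
  proof -
    have "d j = - (t * slope (fst r j))" using dd[of j i] i by (simp add: t_def field_simps)
    then show ?thesis unfolding sd[of j] shift_def by simp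
  qed
  then have "s = act t r" using eq[unfolded linear_type_eq_iff] by (simp add: shift.act_def prod_eq_iff fun_eq_iff)
  then show ?thesis ..
qed

text \<open>Two bases with the same Gram matrix are related by an isometry of linear parts, which maps the
  constant function to a multiple of itself; since it preserves \<open>om\<close> as well, the multiple is 1 or -1.\<close>

lemma slope_unique:
  assumes r: "r \<in> R" and s: "s \<in> R" and eq: "snd s = snd r" "gram affine_form s = gram affine_form r"
  shows "slope (fst s j) = slope (fst r j) \<or> slope (fst s j) = - slope (fst r j)"
proof -
  have G: "affine_form (fst s i) (fst s j) = affine_form (fst r i) (fst r j)" for i j
    using eq(2) by (simp add: gram_def vec_eq_iff)
  have fs: "affine_form (\<Sum>i\<in>UNIV. a i *\<^sub>R w i) y = (\<Sum>i\<in>UNIV. a i * affine_form (w i) y)" for a y and w :: "3 \<Rightarrow> affine_fun"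
    unfolding sum_3 by (simp add: form_simps)
  have oms: "om y (\<Sum>i\<in>UNIV. a i *\<^sub>R w i) = (\<Sum>i\<in>UNIV. a i * om y (w i))" for a y and w :: "3 \<Rightarrow> affine_fun"
    unfolding sum_3 by (simp add: om_simps)
  have radical: "fst x = 0" if "\<And>j. affine_form x (fst s j) = 0" for x
  proof -
    obtain a where a: "(fst x, 0) = (\<Sum>i\<in>UNIV. a i *\<^sub>R fst s i)" using basis[OF s] unfolding basis3_def by blast
    have "affine_form (fst x, 0) x = 0" unfolding a fs using that form_sym[of _ x] by simp
    then show ?thesis by (simp add: affine_form_def)
  qed
  obtain mu where mu: "const_one = (\<Sum>i\<in>UNIV. mu i *\<^sub>R fst r i)" using basis[OF r] unfolding basis3_def by blast
  define x where "x = (\<Sum>i\<in>UNIV. mu i *\<^sub>R fst s i)"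
  have "affine_form x (fst s j) = affine_form const_one (fst r j)" for j unfolding x_def mu fs by (simp add: G)
  then have "fst x = 0" using radical form_const by simp
  then have x: "x = snd x *\<^sub>R const_one" by (simp add: const_one_def prod_eq_iff)
  have sl: "snd x * slope (fst s j) = slope (fst r j)" for j
  proof -
    have "om (fst s j) x = om (fst r j) const_one" unfolding x_def mu oms using om_B[OF r] om_B[OF s] eq(1) by simp
    then show ?thesis by (subst (asm) x) (simp add: slope_def om_simps)
  qed
  obtain xi where xi: "(dir, 0) = (\<Sum>i\<in>UNIV. xi i *\<^sub>R fst r i)" using basis[OF r] unfolding basis3_def by blast
  define y where "y = (\<Sum>i\<in>UNIV. xi i *\<^sub>R fst s i)"
  have fd: "affine_form (dir, 0) f = slope f" for f by (simp add: affine_form_def slope_dir inner_commute)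
  have yj: "affine_form y (fst s j) = slope (fst r j)" for j
  proof -
    have "affine_form y (fst s j) = affine_form (dir, 0) (fst r j)" unfolding y_def xi fs by (simp add: G)
    then show ?thesis by (simp add: fd)
  qed
  have "affine_form (y - snd x *\<^sub>R (dir, 0)) (fst s j) = 0" for j
    by (simp only: form_simps fd yj sl)
  then have "fst (y - snd x *\<^sub>R (dir, 0)) = 0" by (rule radical)
  then have fy: "fst y = snd x *\<^sub>R dir" by simp
  have "affine_form y y = affine_form (dir, 0) (dir, 0)"
  proof -
    have "affine_form y y = (\<Sum>i\<in>UNIV. xi i * affine_form (fst s i) y)"
      using fs[of xi "fst s" y] by (simp add: y_def)
    also have "\<dots> = (\<Sum>i\<in>UNIV. xi i * affine_form (fst r i) (dir, 0))"
      using yj form_sym fd by metis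
    also have "\<dots> = affine_form (dir, 0) (dir, 0)"
      using fs[of xi "fst r" "(dir, 0)"] by (simp add: xi)
    finally show ?thesis .
  qed
  then have "(snd x)\<^sup>2 * (dir \<bullet> dir) = dir \<bullet> dir" by (simp add: affine_form_def fy power2_eq_square)
  then have "(snd x)\<^sup>2 = 1" using dir_nonzero[OF r] by simp
  then have "snd x = 1 \<or> snd x = -1" by (simp add: power2_eq_1_iff)
  then show ?thesis using sl[of j] by auto
qed

lemma finite_circle_line:
  assumes "m \<noteq> 0" "finite P" shows "finite {a :: real^2. a \<bullet> a = 2 \<and> a \<bullet> m \<in> P}"
proof -
  define n :: "real^2" where "n = vector [- (m$2), m$1]"
  define Q where "Q = (\<lambda>p. sqrt (2 * (m \<bullet> m) - p\<^sup>2)) ` P \<union> (\<lambda>p. - sqrt (2 * (m \<bullet> m) - p\<^sup>2)) ` P"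
  have mm: "m \<bullet> m \<noteq> 0" using assms by simp
  have "{a. a \<bullet> a = 2 \<and> a \<bullet> m \<in> P} \<subseteq> (\<lambda>(p, q). (1 / (m \<bullet> m)) *\<^sub>R (p *\<^sub>R m + q *\<^sub>R n)) ` (P \<times> Q)"
  proof
    fix a assume a: "a \<in> {a. a \<bullet> a = 2 \<and> a \<bullet> m \<in> P}"
    define p where "p = a \<bullet> m"
    define q where "q = a \<bullet> n"
    have "p\<^sup>2 + q\<^sup>2 = (a \<bullet> a) * (m \<bullet> m)"
      by (simp add: p_def q_def n_def inner_vec_def sum_2 power2_eq_square algebra_simps)
    then have q2: "q\<^sup>2 = 2 * (m \<bullet> m) - p\<^sup>2" using a by simp
    have "\<bar>q\<bar> = sqrt (2 * (m \<bullet> m) - p\<^sup>2)" by (simp flip: q2)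
    then have "q = sqrt (2 * (m \<bullet> m) - p\<^sup>2) \<or> q = - sqrt (2 * (m \<bullet> m) - p\<^sup>2)" by linarith
    then have "q \<in> Q" using a by (auto simp: Q_def p_def)
    moreover have "(m \<bullet> m) *\<^sub>R a = p *\<^sub>R m + q *\<^sub>R n"
      by (simp add: vec_eq_iff forall_2 p_def q_def n_def inner_vec_def sum_2 algebra_simps)
    then have "a = (1 / (m \<bullet> m)) *\<^sub>R (p *\<^sub>R m + q *\<^sub>R n)" using mm by (metis divideR_right scaleR_one divide_inverse mult_1 inverse_eq_divide)
    ultimately show "a \<in> (\<lambda>(p, q). (1 / (m \<bullet> m)) *\<^sub>R (p *\<^sub>R m + q *\<^sub>R n)) ` (P \<times> Q)"
      using a by (intro image_eqI[of _ _ "(p, q)"]) (auto simp: p_def)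
  qed
  moreover have "finite (P \<times> Q)" using assms(2) by (simp add: Q_def)
  ultimately show ?thesis using finite_subset by blast
qed

text \<open>The norm of a linear part and its product with \<open>dir\<close> leave two possibilities for it.\<close>

lemma finite_types:
  assumes fin: "finite (snd ` R)" shows "finite (linear_type ` R)"
proof (cases "R = {}")
  case False
  then have dir: "dir \<noteq> 0" using dir_nonzero by blast
  obtain Rep where Rep: "finite Rep" "Rep \<subseteq> R"
    "\<And>s. s \<in> R \<Longrightarrow> \<exists>r\<in>Rep. (snd s, gram affine_form s) = (snd r, gram affine_form r)"
    using finite_representatives[OF finite_gram[OF fin]] by blast
  define P where "P = (\<Union>r\<in>Rep. \<Union>i. {slope (fst r i), - slope (fst r i)})"
  have "finite P" unfolding P_def using Rep(1) by (intro finite_UN_I) auto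
  then have "finite {x :: real^2^3. \<forall>i. x $ i \<in> {a. a \<bullet> a = 2 \<and> a \<bullet> dir \<in> P}}"
    by (intro finite_vectors finite_circle_line dir)
  then have "finite (snd ` R \<times> {x :: real^2^3. \<forall>i. x $ i \<in> {a. a \<bullet> a = 2 \<and> a \<bullet> dir \<in> P}})" using fin by blast
  moreover have "linear_type ` R \<subseteq> snd ` R \<times> {x :: real^2^3. \<forall>i. x $ i \<in> {a. a \<bullet> a = 2 \<and> a \<bullet> dir \<in> P}}"
  proof
    fix y assume "y \<in> linear_type ` R"
    then obtain s where s: "s \<in> R" and y: "y = linear_type s" by blast
    obtain r where r: "r \<in> Rep" "snd s = snd r" "gram affine_form s = gram affine_form r" using Rep(3)[OF s] by blast
    have "fst (fst s i) \<bullet> dir \<in> P" for i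
      using slope_unique[of r s i] r Rep(2) s unfolding slope_dir[symmetric] P_def by blast
    moreover have "fst (fst s i) \<bullet> fst (fst s i) = 2" for i using norm[OF s] by (simp add: affine_form_def)
    ultimately show "y \<in> snd ` R \<times> {x :: real^2^3. \<forall>i. x $ i \<in> {a. a \<bullet> a = 2 \<and> a \<bullet> dir \<in> P}}"
      using s by (simp add: y linear_type_def)
  qed
  ultimately show ?thesis using finite_subset by blast
qed simp

end

section \<open>The translation lattice and the upper bound\<close>

lemma translate_translate: "translate_seed w (translate_seed w' s) = translate_seed (w + w') s"
  by (simp add: translate_seed_def inner_add_right algebra_simps)

lemma translate_0: "translate_seed 0 s = s"
  by (simp add: translate_seed_def)

lemma translate_reindex: "translate_seed w (reindex \<sigma> s) = reindex \<sigma> (translate_seed w s)"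
  by (simp add: translate_seed_def reindex_def fun_eq_iff)

lemma translate_seed_class: "translate_seed w ` seed_class (s :: ('n::finite, affine_fun) labelled_seed) = seed_class (translate_seed w s)"
proof -
  have c: "seed_class s = (\<lambda>\<sigma>. reindex \<sigma> s) ` {\<sigma>. bij \<sigma>}" for s :: "('n::finite, affine_fun) labelled_seed"
    by (auto simp: seed_class_def)
  show ?thesis unfolding c image_image translate_reindex ..
qed

lemma translation_vectors_iff:
  "w \<in> translation_vectors (exchange_vertices form pos s0) \<longleftrightarrow>
    (\<exists>s\<in>mutation_reachable form pos s0. \<exists>s'\<in>mutation_reachable form pos s0. \<exists>\<sigma>. bij \<sigma> \<and> translate_seed w s = reindex \<sigma> s')"
  unfolding translation_vectors_def exchange_vertices_def mem_Collect_eq bex_simps(7) translate_seed_class seed_class_eq_iff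
  by blast

lemma list_sums_image:
  fixes d :: "'v::real_vector"
  assumes "d \<noteq> 0"
  shows "list_sums ((\<lambda>t. t *\<^sub>R d) ` D) m = (\<lambda>t. t *\<^sub>R d) ` list_sums D m"
    and "card (list_sums ((\<lambda>t. t *\<^sub>R d) ` D) m) = card (list_sums D m)"
    and "finite (list_sums ((\<lambda>t. t *\<^sub>R d) ` D) m) \<longleftrightarrow> finite (list_sums D m)"
proof -
  have inj: "inj_on (\<lambda>t. t *\<^sub>R d) A" for A using assms by (auto simp: inj_on_def)
  have sl: "sum_list (map (\<lambda>t. t *\<^sub>R d) xs) = sum_list xs *\<^sub>R d" for xs
    by (induction xs) (simp_all add: algebra_simps)
  show *: "list_sums ((\<lambda>t. t *\<^sub>R d) ` D) m = (\<lambda>t. t *\<^sub>R d) ` list_sums D m"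
  proof (intro equalityI subsetI)
    fix x assume "x \<in> list_sums ((\<lambda>t. t *\<^sub>R d) ` D) m"
    then obtain ys where ys: "x = sum_list ys" "set ys \<subseteq> (\<lambda>t. t *\<^sub>R d) ` D" "length ys \<le> m" by (auto simp: list_sums_def)
    then have "ys \<in> lists ((\<lambda>t. t *\<^sub>R d) ` D)" by auto
    then obtain xs where xs: "ys = map (\<lambda>t. t *\<^sub>R d) xs" "set xs \<subseteq> D" unfolding lists_image by auto
    then have "sum_list xs \<in> list_sums D m" using ys(3) unfolding list_sums_def by auto
    then show "x \<in> (\<lambda>t. t *\<^sub>R d) ` list_sums D m" using ys(1) sl[of xs] xs(1) by auto
  next
    fix x assume "x \<in> (\<lambda>t. t *\<^sub>R d) ` list_sums D m"
    then obtain xs where xs: "x = sum_list xs *\<^sub>R d" "set xs \<subseteq> D" "length xs \<le> m" by (auto simp: list_sums_def)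
    then show "x \<in> list_sums ((\<lambda>t. t *\<^sub>R d) ` D) m"
      unfolding list_sums_def by (intro CollectI exI[of _ "map (\<lambda>t. t *\<^sub>R d) xs"]) (auto simp: sl)
  qed
  show "card (list_sums ((\<lambda>t. t *\<^sub>R d) ` D) m) = card (list_sums D m)"
    unfolding * by (rule card_image[OF inj])
  show "finite (list_sums ((\<lambda>t. t *\<^sub>R d) ` D) m) \<longleftrightarrow> finite (list_sums D m)"
    unfolding * by (rule finite_image_iff[OF inj])
qed

context affine_coherent begin

lemma translate_act: "translate_seed w (act t s) = act t (translate_seed w s)"
  unfolding act_translate translate_translate by (simp add: add.commute)

lemma reindex_act: "reindex \<sigma> (act t s) = act t (reindex \<sigma> s)"
  unfolding act_translate by (simp add: translate_reindex)

lemma translate_unique: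
  assumes r: "r \<in> R" and eq: "translate_seed w r = translate_seed w' r" shows "w = w'"
proof -
  have z: "fst (fst r i) \<bullet> (w - w') = 0" for i
    using eq by (simp add: translate_seed_def fun_eq_iff inner_diff_right)
  obtain c where "(w - w', 0) = (\<Sum>i\<in>UNIV. c i *\<^sub>R fst r i)" using basis[OF r] unfolding basis3_def by blast
  then have "fst (w - w', 0 :: real) = fst (\<Sum>i\<in>UNIV. c i *\<^sub>R fst r i)" by (rule arg_cong)
  then have ww: "w - w' = (\<Sum>i\<in>UNIV. c i *\<^sub>R fst (fst r i))" by (simp add: sum_3)
  have "(\<Sum>i\<in>UNIV. c i *\<^sub>R fst (fst r i)) \<bullet> (w - w') = 0" by (simp add: inner_sum_left z)
  then have "(w - w') \<bullet> (w - w') = 0" by (simp flip: ww)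
  then show ?thesis by simp
qed

text \<open>The lattice is generated by the finitely many displacements together with finitely many vectors
  that come from seeds with permuted labels; hence it has a finite rank, which bounds the number of
  positions.\<close>

lemma upper_bound:
  assumes R: "R = mutation_reachable affine_form pos s0" and fin: "finite (snd ` R)"
  defines "L \<equiv> translation_lattice (exchange_vertices affine_form pos s0)"
  shows "\<exists>r C. has_int_rank L r \<and> (\<forall>m. real (card (labelled_ball affine_form pos s0 m)) \<le> C * (real m + 1) ^ r)"
proof -
  have s0: "s0 \<in> R" unfolding R by (rule reachable_refl)
  have dir: "dir \<noteq> 0" by (rule dir_nonzero[OF s0])
  let ?V = "translation_vectors (exchange_vertices affine_form pos s0)"
  have L: "L = module.span int_scale ?V" by (simp add: L_def translation_lattice_def)
  obtain Rep where Rep: "finite Rep" "Rep \<subseteq> R" "\<And>s. s \<in> R \<Longrightarrow> \<exists>r\<in>Rep. linear_type s = linear_type r"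
    using finite_representatives[OF finite_types[OF fin]] by blast
  have rep: "\<exists>r\<in>Rep. \<exists>t. s = act t r" if "s \<in> R" for s
    using Rep(3)[OF that] same_linear_type that Rep(2) by blast
  show ?thesis
  proof (rule shift.ball_positions[OF Rep(1) closed s0 rep])
    fix D t0
    assume D: "finite D" "\<And>d. d \<in> D \<Longrightarrow> \<exists>t t' r r'. r \<in> Rep \<and> r' \<in> Rep \<and> act t r \<in> R \<and> act t' r' \<in> R \<and> d = t' - t"
      and sub: "\<And>m. labelled_ball affine_form pos s0 m \<subseteq> (\<lambda>(r, x). act (t0 + x) r) ` (Rep \<times> list_sums D m)"
    have tv: "t *\<^sub>R dir \<in> ?V" if "r \<in> Rep" "act t r \<in> R" for r t
    proof -
      have "translate_seed (t *\<^sub>R dir) r = reindex id (act t r)" by (simp add: act_translate reindex_id)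
      then show ?thesis using that Rep(2) unfolding translation_vectors_iff R[symmetric] by blast
    qed
    define DD where "DD = (\<lambda>t. t *\<^sub>R dir) ` D"
    define CC where "CC = {c. \<exists>r\<in>Rep. \<exists>r'\<in>Rep. \<exists>\<sigma>. bij \<sigma> \<and> translate_seed c r = reindex \<sigma> r'}"
    have DDL: "DD \<subseteq> L"
    proof
      fix x assume "x \<in> DD"
      then obtain d where d: "d \<in> D" "x = d *\<^sub>R dir" by (auto simp: DD_def)
      obtain t t' r r' where t: "r \<in> Rep" "r' \<in> Rep" "act t r \<in> R" "act t' r' \<in> R" "d = t' - t"
        using D(2)[OF d(1)] by blast
      have "t' *\<^sub>R dir - t *\<^sub>R dir \<in> L" unfolding L
        using tv[OF t(1,3)] tv[OF t(2,4)] by (intro int_mod.span_diff int_mod.span_base)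
      then show "x \<in> L" by (simp add: d t(5) algebra_simps)
    qed
    have CCV: "CC \<subseteq> ?V"
    proof
      fix c assume "c \<in> CC"
      then obtain r r' \<sigma> where c: "r \<in> Rep" "r' \<in> Rep" "bij \<sigma>" "translate_seed c r = reindex \<sigma> r'"
        unfolding CC_def by blast
      then have "r \<in> R" "r' \<in> R" using Rep(2) by auto
      then show "c \<in> ?V" using c(3,4) unfolding translation_vectors_iff R[symmetric]
        by (intro bexI[of _ r] bexI[of _ r'] exI[of _ \<sigma>] conjI)
    qed
    have finC: "finite CC"
    proof -
      have "CC \<subseteq> (\<Union>r\<in>Rep. \<Union>r'\<in>Rep. \<Union>\<sigma>. {c. translate_seed c r = reindex \<sigma> r'})"
      proof
        fix c assume "c \<in> CC"
        then obtain r r' \<sigma> where "r \<in> Rep" "r' \<in> Rep" "translate_seed c r = reindex \<sigma> r'"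
          unfolding CC_def by blast
        then show "c \<in> (\<Union>r\<in>Rep. \<Union>r'\<in>Rep. \<Union>\<sigma>. {c. translate_seed c r = reindex \<sigma> r'})"
          by (intro UN_I[of r] UN_I[of r'] UN_I[of \<sigma>]) simp_all
      qed
      moreover have "finite {c. translate_seed c r = reindex \<sigma> r'}" if "r \<in> Rep" for r r' and \<sigma> :: "3 \<Rightarrow> 3"
      proof (cases "\<exists>c. translate_seed c r = reindex \<sigma> r'")
        case True
        then obtain c where c: "translate_seed c r = reindex \<sigma> r'" by blast
        have "r \<in> R" using that Rep(2) by blast
        then have "c' = c" if "translate_seed c' r = reindex \<sigma> r'" for c'
          using translate_unique[of r c' c] that c by simp
        then have "{c. translate_seed c r = reindex \<sigma> r'} \<subseteq> {c}" by blast
        then show ?thesis using finite_subset by blast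
      qed simp
      then have "finite (\<Union>r\<in>Rep. \<Union>r'\<in>Rep. \<Union>\<sigma>. {c. translate_seed c r = reindex \<sigma> r'})"
        by (intro finite_UN_I Rep(1)) auto
      ultimately show ?thesis using finite_subset by blast
    qed
    have gen: "?V \<subseteq> module.span int_scale (DD \<union> CC)"
    proof
      fix w assume "w \<in> ?V"
      then obtain s s' \<sigma> where s: "s \<in> R" "s' \<in> R" "bij \<sigma>" "translate_seed w s = reindex \<sigma> s'"
        unfolding translation_vectors_iff R[symmetric] by blast
      have pos: "\<exists>r\<in>Rep. \<exists>x. s = act (t0 + x) r \<and> x *\<^sub>R dir \<in> module.span int_scale DD" if "s \<in> R" for s
      proof -
        obtain m where "s \<in> labelled_ball affine_form pos s0 m" using \<open>s \<in> R\<close> by (auto simp: R reachable_ball)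
        then obtain y where y: "y \<in> Rep \<times> list_sums D m" "s = (case y of (r, x) \<Rightarrow> act (t0 + x) r)" using sub[of m] by blast
        obtain r x where rx: "y = (r, x)" by (cases y)
        have "x *\<^sub>R dir \<in> list_sums DD m" using y(1) rx unfolding DD_def list_sums_image(1)[OF dir] by blast
        then obtain xs where "x *\<^sub>R dir = sum_list xs" "set xs \<subseteq> DD" by (auto simp: list_sums_def)
        moreover have "sum_list xs \<in> module.span int_scale DD" if "set xs \<subseteq> DD" for xs
          using that by (induction xs) (auto intro: int_mod.span_zero int_mod.span_add int_mod.span_base)
        ultimately have "x *\<^sub>R dir \<in> module.span int_scale DD" by simp
        then show ?thesis using y rx by (intro bexI[of _ r] exI[of _ x]) simp_all
      qed
      obtain r x where r: "r \<in> Rep" "s = act (t0 + x) r" "x *\<^sub>R dir \<in> module.span int_scale DD" using pos[OF s(1)] by blast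
      obtain r' x' where r': "r' \<in> Rep" "s' = act (t0 + x') r'" "x' *\<^sub>R dir \<in> module.span int_scale DD" using pos[OF s(2)] by blast
      define c where "c = w + x *\<^sub>R dir - x' *\<^sub>R dir"
      have "act (t0 + x) (translate_seed w r) = act (t0 + x') (reindex \<sigma> r')"
        using s(4) unfolding r(2) r'(2) by (simp only: translate_act reindex_act)
      then have "act (- (t0 + x')) (act (t0 + x) (translate_seed w r)) = act (- (t0 + x')) (act (t0 + x') (reindex \<sigma> r'))"
        by (rule arg_cong)
      then have "translate_seed c r = reindex \<sigma> r'"
        unfolding shift.act_act by (simp add: translate_0 shift.act_0 act_translate translate_translate c_def algebra_simps)
      then have "c \<in> CC" using r(1) r'(1) s(3) unfolding CC_def by blast
      then have "c - x *\<^sub>R dir + x' *\<^sub>R dir \<in> module.span int_scale (DD \<union> CC)"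
        using r(3) r'(3) int_mod.span_mono[of DD "DD \<union> CC"]
        by (intro int_mod.span_add int_mod.span_diff) (auto intro: int_mod.span_base)
      then show "w \<in> module.span int_scale (DD \<union> CC)" by (simp add: c_def)
    qed
    have "finite (DD \<union> CC)" using D(1) finC by (simp add: DD_def)
    then obtain I where I: "finite I" "I \<subseteq> DD \<union> CC" "\<not> module.dependent rat_scale I" "DD \<union> CC \<subseteq> module.span rat_scale I"
      by (rule rat_basis_of_finite)
    have "L \<subseteq> module.span int_scale (DD \<union> CC)" unfolding L by (rule int_mod.span_minimal[OF gen int_mod.subspace_span])
    also have "\<dots> \<subseteq> module.span rat_scale (DD \<union> CC)" by (rule int_span_subset_rat_span)
    also have "\<dots> \<subseteq> module.span rat_scale I" by (rule rat_vs.span_minimal[OF I(4) rat_vs.subspace_span])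
    finally have LI: "L \<subseteq> module.span rat_scale I" .
    have "I \<subseteq> L" using I(2) DDL CCV int_mod.span_superset[of ?V] unfolding L by blast
    then have rank: "has_int_rank L (card I)" using has_int_rank_basis[OF I(1) _ I(3) LI] by blast
    obtain P where "\<And>m. finite (list_sums DD m) \<and> card (list_sums DD m) \<le> (2 * P * m + 1) ^ card I"
      using card_list_sums[of DD I] D(1) I by (auto simp: DD_def)
    then have "\<And>m. finite (list_sums D m) \<and> card (list_sums D m) \<le> (2 * P * m + 1) ^ card I"
      unfolding DD_def list_sums_image(2,3)[OF dir] .
    from shift.ball_card_bound[OF Rep(1) this sub] show ?thesis using rank by blast
  qed
qed

end

section \<open>Acyclic seeds\<close>

lemma skew_order:
  fixes B :: "real^3^3"
  assumes sk: "skew_symmetric B"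
  shows "(\<exists>i j k. i \<noteq> j \<and> j \<noteq> k \<and> i \<noteq> k \<and> B $ i $ j \<ge> 0 \<and> B $ i $ k \<ge> 0 \<and> B $ j $ k \<ge> 0) \<or>
    (\<exists>i j k. i \<noteq> j \<and> j \<noteq> k \<and> i \<noteq> k \<and> B $ i $ j > 0 \<and> B $ j $ k > 0 \<and> B $ k $ i > 0)"
proof -
  obtain i j k :: 3 where ne: "i \<noteq> j" "j \<noteq> k" "i \<noteq> k" using distinct3_ex by blast
  let ?P = "\<lambda>i j k. i \<noteq> j \<and> j \<noteq> k \<and> i \<noteq> k \<and> B $ i $ j \<ge> 0 \<and> B $ i $ k \<ge> 0 \<and> B $ j $ k \<ge> 0"
  let ?C = "\<lambda>i j k. i \<noteq> j \<and> j \<noteq> k \<and> i \<noteq> k \<and> B $ i $ j > 0 \<and> B $ j $ k > 0 \<and> B $ k $ i > 0"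
  have "?P i j k \<or> ?P i k j \<or> ?P j i k \<or> ?P j k i \<or> ?P k i j \<or> ?P k j i \<or> ?C i j k \<or> ?C k j i"
    using ne skewD[OF sk, of i j] skewD[OF sk, of j k] skewD[OF sk, of k i] by argo
  then show ?thesis by blast
qed

context coherent begin

lemma eul_zero':
  assumes "s \<in> R" "i \<noteq> j" "snd s $ i $ j \<ge> 0" "snd s $ i $ j > 0 \<Longrightarrow> \<not> (\<not> pos (fst s i) \<and> pos (fst s j))"
  shows "eul (fst s i) (fst s j) = 0"
proof (cases "snd s $ i $ j = 0")
  case True
  then have "form (fst s i) (fst s j) = 0" using rule_form[OF assms(1-3)] by simp
  then show ?thesis using om_B[OF assms(1), of i j] True by (simp add: eul_def)
next
  case False then show ?thesis using eul_zero[OF assms(1-3)] assms(3,4) by simp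
qed

definition acyc :: "(3, 'v) labelled_seed \<Rightarrow> 3 \<Rightarrow> 3 \<Rightarrow> 3 \<Rightarrow> bool" where
  "acyc s i j k \<longleftrightarrow> exceptional s i j k \<and> snd s $ i $ j \<ge> 0 \<and> snd s $ i $ k \<ge> 0 \<and> snd s $ j $ k \<ge> 0"

text \<open>The neighbours of a negative source or of a positive sink are all exempt from reflection. Such
  mutations repair the sign patterns for which an order of the quiver is not exceptional.\<close>

lemma flip:
  assumes s: "s \<in> R" and k: "pos (fst s k) \<Longrightarrow> (\<forall>i. snd s $ i $ k \<ge> 0)" "\<not> pos (fst s k) \<Longrightarrow> (\<forall>i. snd s $ i $ k \<le> 0)"
  defines "t \<equiv> seed_mutation form pos k s"
  shows "t \<in> R" "fst t i = (if i = k then - fst s k else fst s i)"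
    "pos (fst t i) = (if i = k then \<not> pos (fst s k) else pos (fst s i))"
    "snd t $ i $ j = (if k = i \<or> k = j then - (snd s $ i $ j) else snd s $ i $ j)"
proof -
  show tR: "t \<in> R" unfolding t_def by (rule closed[OF s])
  show f: "fst t i = (if i = k then - fst s k else fst s i)" for i
  proof -
    have "\<not> ((pos (fst s k) \<and> snd s $ i $ k < 0) \<or> (\<not> pos (fst s k) \<and> snd s $ i $ k > 0))"
      using k by (meson not_less)
    then show ?thesis unfolding t_def fst_mutation by (simp only: if_False)
  qed
  show "pos (fst t i) = (if i = k then \<not> pos (fst s k) else pos (fst s i))"
    using neg_iff[OF s, of k] by (simp add: f)
  have kj: "snd s $ k $ j = - (snd s $ j $ k)" by (rule skewD[OF skew[OF s]])
  have "(snd s $ i $ k \<ge> 0 \<and> snd s $ j $ k \<ge> 0) \<or> (snd s $ i $ k \<le> 0 \<and> snd s $ j $ k \<le> 0)" using k by blast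
  then have "snd s $ i $ k * \<bar>snd s $ k $ j\<bar> + \<bar>snd s $ i $ k\<bar> * snd s $ k $ j = 0" unfolding kj by auto
  then show "snd t $ i $ j = (if k = i \<or> k = j then - (snd s $ i $ j) else snd s $ i $ j)"
    by (simp add: t_def snd_mutation matrix_mutation_nth)
qed

text \<open>An acyclic quiver fails to be an exceptional order only through a negative vector before a positive one.
  The signs are then changed by a mutation at a source or a sink; for the two alternating sign patterns
  the parity condition provides a vanishing weight.\<close>

lemma acyc_from_order:
  assumes s: "s \<in> R" and ne: "x \<noteq> y" "y \<noteq> z" "x \<noteq> z"
    and b: "snd s $ x $ y \<ge> 0" "snd s $ x $ z \<ge> 0" "snd s $ y $ z \<ge> 0"
  shows "\<exists>s\<in>R. \<exists>i j k. acyc s i j k"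
proof -
  have good: "acyc s i j k"
    if "s \<in> R" "i \<noteq> j" "j \<noteq> k" "i \<noteq> k" "snd s $ i $ j \<ge> 0" "snd s $ i $ k \<ge> 0" "snd s $ j $ k \<ge> 0"
      "snd s $ i $ j > 0 \<longrightarrow> \<not> (\<not> pos (fst s i) \<and> pos (fst s j))"
      "snd s $ i $ k > 0 \<longrightarrow> \<not> (\<not> pos (fst s i) \<and> pos (fst s k))"
      "snd s $ j $ k > 0 \<longrightarrow> \<not> (\<not> pos (fst s j) \<and> pos (fst s k))" for s i j k
    using that eul_zero'[of s i j] eul_zero'[of s i k] eul_zero'[of s j k] unfolding acyc_def exceptional_def by blast
  have sw: "snd s $ y $ x = - (snd s $ x $ y)" "snd s $ z $ x = - (snd s $ x $ z)" "snd s $ z $ y = - (snd s $ y $ z)"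
    using skewD[OF skew[OF s]] by blast+
  have nn: "snd s $ i $ i = 0" for i by (rule skew0[OF skew[OF s]])
  have all: "(\<forall>i. P i) \<longleftrightarrow> P x \<and> P y \<and> P z" for P using three_cases[OF ne] by metis
  have par: "snd s $ x $ y = 0 \<or> snd s $ y $ z = 0 \<or> snd s $ x $ z = 0"
    if "form (fst s x) (fst s y) * form (fst s y) (fst s z) * form (fst s z) (fst s x) = snd s $ x $ y * snd s $ y $ z * snd s $ x $ z"
  proof (rule ccontr)
    assume "\<not> ?thesis"
    then have nz: "snd s $ x $ y > 0" "snd s $ y $ z > 0" "snd s $ x $ z > 0" using b by linarith+
    have "snd s $ x $ y * snd s $ y $ z * snd s $ x $ z = snd s $ x $ y * snd s $ y $ z * (- (snd s $ x $ z))"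
      using three_cycle[OF s ne nz(1,2)] that by (simp only: sw)
    moreover have "snd s $ x $ y * snd s $ y $ z * snd s $ x $ z > 0" using nz by simp
    ultimately show False unfolding mult_minus_right by linarith
  qed
  note fr = rule_form[OF s ne(1) b(1)] rule_form[OF s ne(2) b(3)] rule_form[OF s ne(3) b(2)]
  note ne' = ne ne[symmetric]
  consider "pos (fst s x)" "pos (fst s y) \<or> \<not> pos (fst s z)" | "\<not> pos (fst s x)" "\<not> pos (fst s y)" "\<not> pos (fst s z)"
    | "\<not> pos (fst s x)" "pos (fst s y)" "pos (fst s z)" | "\<not> pos (fst s x)" "\<not> pos (fst s y)" "pos (fst s z)"
    | "\<not> pos (fst s x)" "pos (fst s y)" "\<not> pos (fst s z)" | "pos (fst s x)" "\<not> pos (fst s y)" "pos (fst s z)" by blast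
  then show ?thesis
  proof cases
    case 1 then show ?thesis using good[OF s ne b] s by blast
  next
    case 2 then show ?thesis using good[OF s ne b] s by blast
  next
    case 3
    have k: "pos (fst s x) \<Longrightarrow> (\<forall>i. snd s $ i $ x \<ge> 0)" "\<not> pos (fst s x) \<Longrightarrow> (\<forall>i. snd s $ i $ x \<le> 0)"
      using 3 b unfolding all by (auto simp: sw nn)
    show ?thesis using good[OF flip(1)[OF s k], of y z x] flip(1,3,4)[OF s k] b ne' 3 by (auto simp: sw)
  next
    case 4
    have k: "pos (fst s z) \<Longrightarrow> (\<forall>i. snd s $ i $ z \<ge> 0)" "\<not> pos (fst s z) \<Longrightarrow> (\<forall>i. snd s $ i $ z \<le> 0)"
      using 4 b unfolding all by (auto simp: sw nn)
    show ?thesis using good[OF flip(1)[OF s k], of z x y] flip(1,3,4)[OF s k] b ne' 4 by (auto simp: sw)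
  next
    case 5
    then have "snd s $ x $ y = 0 \<or> snd s $ y $ z = 0 \<or> snd s $ x $ z = 0"
      using fr form_sym[of "fst s z" "fst s x"] by (intro par) (simp add: mult_ac)
    then consider "snd s $ x $ y = 0" | "snd s $ x $ z = 0" | "snd s $ y $ z = 0" by blast
    then show ?thesis
    proof cases
      case 1 then show ?thesis using good[OF s ne b] s 5 by auto
    next
      case 2
      have k: "pos (fst s x) \<Longrightarrow> (\<forall>i. snd s $ i $ x \<ge> 0)" "\<not> pos (fst s x) \<Longrightarrow> (\<forall>i. snd s $ i $ x \<le> 0)"
        using 5 b unfolding all by (auto simp: sw nn)
      show ?thesis using good[OF flip(1)[OF s k], of y z x] flip(1,3,4)[OF s k] b ne' 5 2 by (auto simp: sw)
    next
      case 3
      have k: "pos (fst s y) \<Longrightarrow> (\<forall>i. snd s $ i $ y \<ge> 0)" "\<not> pos (fst s y) \<Longrightarrow> (\<forall>i. snd s $ i $ y \<le> 0)"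
        using 5 b 3 unfolding all by (auto simp: sw nn)
      show ?thesis using good[OF flip(1)[OF s k], of y x z] flip(1,3,4)[OF s k] b ne' 5 3 by (auto simp: sw)
    qed
  next
    case 6
    then have "snd s $ x $ y = 0 \<or> snd s $ y $ z = 0 \<or> snd s $ x $ z = 0"
      using fr form_sym[of "fst s z" "fst s x"] by (intro par) (simp add: mult_ac)
    then consider "snd s $ y $ z = 0" | "snd s $ x $ z = 0" | "snd s $ x $ y = 0" by blast
    then show ?thesis
    proof cases
      case 1 then show ?thesis using good[OF s ne b] s 6 by auto
    next
      case 2
      have k: "pos (fst s z) \<Longrightarrow> (\<forall>i. snd s $ i $ z \<ge> 0)" "\<not> pos (fst s z) \<Longrightarrow> (\<forall>i. snd s $ i $ z \<le> 0)"
        using 6 b unfolding all by (auto simp: sw nn)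
      show ?thesis using good[OF flip(1)[OF s k], of z x y] flip(1,3,4)[OF s k] b ne' 6 2 by (auto simp: sw)
    next
      case 3
      have k: "pos (fst s y) \<Longrightarrow> (\<forall>i. snd s $ i $ y \<ge> 0)" "\<not> pos (fst s y) \<Longrightarrow> (\<forall>i. snd s $ i $ y \<le> 0)"
        using 6 b 3 unfolding all by (auto simp: sw nn)
      show ?thesis using good[OF flip(1)[OF s k], of x z y] flip(1,3,4)[OF s k] b ne' 6 3 by (auto simp: sw)
    qed
  qed
qed

text \<open>Such a mutation moves the source to the end of the order and keeps the seed acyclic and exceptional, so
  that it can be repeated; repetition is what leads to infinity.\<close>

lemma acyc_roll:
  assumes s: "s \<in> R" and a: "acyc s x y z" and p: "pos (fst s x)"
  defines "t \<equiv> seed_mutation form pos x s"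
  shows "t \<in> R" "fst t x = - fst s x" "fst t y = fst s y + (snd s $ x $ y) *\<^sub>R fst s x"
    "fst t z = fst s z + (snd s $ x $ z) *\<^sub>R fst s x" "acyc t y z x"
    "snd t $ y $ z = snd s $ y $ z" "snd t $ y $ x = snd s $ x $ y" "snd t $ z $ x = snd s $ x $ z"
proof -
  have ne: "x \<noteq> y" "y \<noteq> z" "x \<noteq> z" and z: "eul (fst s x) (fst s y) = 0" "eul (fst s x) (fst s z) = 0" "eul (fst s y) (fst s z) = 0"
    and b: "snd s $ x $ y \<ge> 0" "snd s $ x $ z \<ge> 0" "snd s $ y $ z \<ge> 0" using a by (auto simp: acyc_def exceptional_def)
  have sw: "snd s $ y $ x = - (snd s $ x $ y)" "snd s $ z $ x = - (snd s $ x $ z)" "snd s $ z $ y = - (snd s $ y $ z)"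
    using skewD[OF skew[OF s]] by blast+
  show tR: "t \<in> R" unfolding t_def by (rule closed[OF s])
  show tx: "fst t x = - fst s x" unfolding t_def by (rule mutation_vec_self)
  show ty: "fst t y = fst s y + (snd s $ x $ y) *\<^sub>R fst s x"
    unfolding t_def using mutation_vec[OF s, of y x] ne p b by (simp add: sw max_def)
  show tz: "fst t z = fst s z + (snd s $ x $ z) *\<^sub>R fst s x"
    unfolding t_def using mutation_vec[OF s, of z x] ne p b by (simp add: sw max_def)
  show B: "snd t $ y $ z = snd s $ y $ z" "snd t $ y $ x = snd s $ x $ y" "snd t $ z $ x = snd s $ x $ z"
    using ne b by (simp_all add: t_def snd_mutation matrix_mutation_nth sw)
  have e1: "eul (fst t y) (fst t z) = 0"
    by (simp add: ty tz eul_add eul_scale z eul_self[OF s] eul_zero_B(2)[OF s z(1)])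
  have e2: "eul (fst t y) (fst t x) = 0"
    by (simp add: ty tx eul_add eul_scale eul_minus eul_self[OF s] eul_zero_B(2)[OF s z(1)])
  have e3: "eul (fst t z) (fst t x) = 0"
    by (simp add: tz tx eul_add eul_scale eul_minus eul_self[OF s] eul_zero_B(2)[OF s z(2)])
  show "acyc t y z x" unfolding acyc_def exceptional_def using ne ne[symmetric] e1 e2 e3 b B by auto
qed

end

context affine_coherent begin

lemma weight_le_2: "s \<in> R \<Longrightarrow> i \<noteq> j \<Longrightarrow> \<bar>snd s $ i $ j\<bar> \<le> 2 \<and> \<bar>snd s $ i $ j\<bar> = \<bar>affine_form (fst s i) (fst s j)\<bar>"
proof -
  assume s: "s \<in> R" and ne: "i \<noteq> j"
  obtain k where k: "j \<noteq> k" "i \<noteq> k" using distinct3_ex ne three_cases by metis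
  have ab: "\<bar>affine_form (fst s i) (fst s j)\<bar> = \<bar>snd s $ i $ j\<bar>"
    using realis[OF s] ne k unfolding realises_def sign_compat_def by blast
  have n: "fst (fst s l) \<bullet> fst (fst s l) = 2" for l using norm[OF s, of l] by (simp add: affine_form_def)
  show ?thesis using ab norm2_parallel(1)[OF n n, of i j] by (simp add: affine_form_def)
qed

text \<open>Among the seeds with least total weight there is an acyclic one: all weights are at most 2, so that
  a cyclic quiver whose weights cannot be decreased by mutation has three weights 2, and then the
  three lines would be parallel.\<close>

lemma acyc_exists:
  assumes fin: "finite (snd ` R)" and ne: "R \<noteq> {}"
  shows "\<exists>s\<in>R. \<exists>i j k. acyc s i j k"
proof (rule ccontr)
  assume no: "\<not> ?thesis"
  define wt where "wt B = (\<Sum>i\<in>UNIV. \<Sum>j\<in>UNIV. \<bar>B $ i $ j\<bar>)" for B :: "real^3^3"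
  obtain s where s: "s \<in> R" and min: "\<And>t. t \<in> R \<Longrightarrow> wt (snd s) \<le> wt (snd t)"
  proof -
    have f: "finite (wt ` snd ` R)" "wt ` snd ` R \<noteq> {}" using fin ne by auto
    from Min_in[OF f] obtain s where "s \<in> R" "wt (snd s) = Min (wt ` snd ` R)" by auto
    then show ?thesis using that[of s] Min_le[OF f(1)] by auto
  qed
  have cyc: "\<exists>i j k. i \<noteq> j \<and> j \<noteq> k \<and> i \<noteq> k \<and> snd t $ i $ j > 0 \<and> snd t $ j $ k > 0 \<and> snd t $ k $ i > 0" if "t \<in> R" for t
    using skew_order[OF skew[OF that]] acyc_from_order[OF that] no by blast
  have wt3: "wt B = 2 * (\<bar>B $ i $ j\<bar> + \<bar>B $ j $ k\<bar> + \<bar>B $ k $ i\<bar>)"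
    if "i \<noteq> j" "j \<noteq> k" "i \<noteq> k" "skew_symmetric B" for B i j k
    using skewD[OF that(4), of i j] skewD[OF that(4), of j k] skewD[OF that(4), of k i] skew0[OF that(4)]
    unfolding wt_def sum_three[OF that(1-3)] by simp
  have key: "2 * snd s $ k $ i \<le> snd s $ i $ j * snd s $ j $ k"
    if d: "i \<noteq> j" "j \<noteq> k" "i \<noteq> k" and b: "snd s $ i $ j > 0" "snd s $ j $ k > 0" "snd s $ k $ i > 0" for i j k
  proof (rule ccontr)
    assume neg: "\<not> ?thesis"
    let ?t = "seed_mutation affine_form pos j s"
    have sk: "snd s $ k $ j = - (snd s $ j $ k)" "snd s $ j $ i = - (snd s $ i $ j)" by (rule skewD[OF skew[OF s]])+
    have B: "snd ?t $ j $ i = snd s $ i $ j" "snd ?t $ k $ j = snd s $ j $ k" "snd ?t $ k $ i = snd s $ k $ i - snd s $ i $ j * snd s $ j $ k"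
      using d b by (simp_all add: snd_mutation matrix_mutation_nth sk field_simps)
    have tR: "?t \<in> R" by (rule closed[OF s])
    have "snd ?t $ k $ i < 0"
    proof (rule ccontr)
      assume "\<not> snd ?t $ k $ i < 0"
      then show False using acyc_from_order[OF tR, of k j i] d b B no by auto
    qed
    then have "\<bar>snd ?t $ k $ i\<bar> < \<bar>snd s $ k $ i\<bar>" using neg b unfolding B(3) by simp
    moreover have "\<bar>snd ?t $ i $ j\<bar> = \<bar>snd s $ i $ j\<bar>" "\<bar>snd ?t $ j $ k\<bar> = \<bar>snd s $ j $ k\<bar>"
      using d by (simp_all add: snd_mutation matrix_mutation_nth)
    ultimately have "wt (snd ?t) < wt (snd s)"
      unfolding wt3[OF d skew[OF tR]] wt3[OF d skew[OF s]] by simp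
    then show False using min[OF tR] by simp
  qed
  obtain i j k where d: "i \<noteq> j" "j \<noteq> k" "i \<noteq> k" and b: "snd s $ i $ j > 0" "snd s $ j $ k > 0" "snd s $ k $ i > 0"
    using cyc[OF s] by blast
  define x y z where "x = snd s $ i $ j" and "y = snd s $ j $ k" and "z = snd s $ k $ i"
  have le: "x \<le> 2" "y \<le> 2" "z \<le> 2" using weight_le_2[OF s] d b unfolding x_def y_def z_def by (metis abs_le_D1)+
  have K: "2 * z \<le> x * y" "2 * x \<le> y * z" "2 * y \<le> z * x"
    using key[OF d b] key[of j k i] key[of k i j] d b unfolding x_def y_def z_def by (auto simp: mult_ac)
  have p: "x > 0" "y > 0" "z > 0" using b by (simp_all add: x_def y_def z_def)
  have "x * y \<le> x * 2" "x * y \<le> 2 * y" "y * z \<le> 2 * z" "z * x \<le> z * 2" using p le by (simp_all add: mult_left_mono mult_right_mono)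
  then have eq: "x = y" "y = z" using K p by linarith+
  have "2 * x \<le> x * x" using K(2) eq by simp
  then have x2: "x = 2" using p le by simp
  have par: "\<exists>c. fst (fst s l) = c *\<^sub>R fst (fst s i)" for l
  proof (cases "l = i")
    case True then show ?thesis by (intro exI[of _ 1]) simp
  next
    case False
    then have "\<bar>snd s $ i $ l\<bar> = 2"
      using three_cases[OF d, of l] x2 eq skewD[OF skew[OF s], of k i] by (auto simp: x_def y_def z_def)
    then have "\<bar>fst (fst s i) \<bullet> fst (fst s l)\<bar> = 2" using weight_le_2[OF s, of i l] False by (simp add: affine_form_def)
    then have "fst (fst s i) \<bullet> fst (fst s l) = 2 \<or> fst (fst s i) \<bullet> fst (fst s l) = -2" by linarith
    moreover have n: "fst (fst s l) \<bullet> fst (fst s l) = 2" for l using norm[OF s, of l] by (simp add: affine_form_def)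
    ultimately show ?thesis using norm2_parallel(2,3)[OF n n, of i l] by (metis scaleR_minus1_left scaleR_one)
  qed
  then obtain c where "\<And>l. fst (fst s l) = c l *\<^sub>R fst (fst s i)" by metis
  then show False using basis3_not_parallel[OF basis[OF s], of c] by blast
qed

end

section \<open>The braid group acting on triples of involutions\<close>

type_synonym 'a triple = "('a \<Rightarrow> 'a) \<times> ('a \<Rightarrow> 'a) \<times> ('a \<Rightarrow> 'a)"

fun braid1 braid1' braid2 braid2' rot rot' rev3 :: "'a triple \<Rightarrow> 'a triple" where
  "braid1 (p, q, r) = (p \<circ> q \<circ> p, p, r)"
| "braid1' (p, q, r) = (q, q \<circ> p \<circ> q, r)"
| "braid2 (p, q, r) = (p, q \<circ> r \<circ> q, q)"
| "braid2' (p, q, r) = (p, r, r \<circ> q \<circ> r)"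
| "rot (p, q, r) = (q, r, r \<circ> q \<circ> p \<circ> q \<circ> r)"
| "rot' (p, q, r) = (p \<circ> q \<circ> r \<circ> q \<circ> p, p, q)"
| "rev3 (p, q, r) = (r, q, p)"

fun involutions :: "'a triple \<Rightarrow> bool" where
  "involutions (p, q, r) \<longleftrightarrow> (\<forall>x. p (p x) = x) \<and> (\<forall>x. q (q x) = x) \<and> (\<forall>x. r (r x) = x)"

lemma involutions_braid:
  assumes "involutions F"
  shows "involutions (braid1 F)" "involutions (braid1' F)" "involutions (braid2 F)" "involutions (braid2' F)"
    "involutions (rot F)" "involutions (rot' F)"
  using assms by (cases F; simp)+

lemma braid_inverse:
  assumes "involutions F"
  shows "braid1' (braid1 F) = F" "braid1 (braid1' F) = F" "braid2' (braid2 F) = F" "braid2 (braid2' F) = F"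
    "rot' (rot F) = F" "rot (rot' F) = F"
  using assms by (cases F; simp add: fun_eq_iff)+

text \<open>The three involutions and their conjugates by powers of their product form one bi-infinite sequence, and
  \<open>rot\<close> moves the window of length three by one place. Thus three rotations conjugate by the product,
  which every braid move preserves; this is why they are central.\<close>

lemma rot_braid:
  assumes "involutions F"
  shows "rot' F = braid1 (braid2 F)" "rot F = braid2' (braid1' F)"
    "braid1 (rot F) = rot (braid2 F)" "braid1 (rot' F) = rot' (rot' (braid1' F))"
    "braid1 (braid1 F) = rot (braid2 (braid1 (braid2 (braid1 F))))"
    "braid1 (rot (rot (rot F))) = rot (rot (rot (braid1 F)))"
    "braid1 (rot' (rot' (rot' F))) = rot' (rot' (rot' (braid1 F)))"
  using assms by (cases F; simp add: fun_eq_iff)+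

lemma rot_cube_roll:
  assumes "involutions F"
  shows "rot' (rot' (rot' F)) = braid2 (braid1 (braid2 (braid1 (braid2 (braid1 F)))))"
  using assms by (cases F; simp add: fun_eq_iff)

text \<open>All rotations of the triples in \<open>A\<close> and of the triples \<open>braid1 F\<close> with \<open>F\<close> in \<open>C\<close>; the latter are
  needed because acyclic seeds have no mutation that performs \<open>braid1\<close>.\<close>

inductive_set rot_closure :: "'a triple set \<Rightarrow> 'a triple set \<Rightarrow> 'a triple set" for A C where
  base: "F \<in> A \<Longrightarrow> F \<in> rot_closure A C"
| twist: "F \<in> C \<Longrightarrow> braid1 F \<in> rot_closure A C"
| rot: "F \<in> rot_closure A C \<Longrightarrow> rot F \<in> rot_closure A C"
| rot': "F \<in> rot_closure A C \<Longrightarrow> rot' F \<in> rot_closure A C"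

inductive braid_equiv :: "'a triple \<Rightarrow> 'a triple \<Rightarrow> bool" for F where
  refl: "braid_equiv F F"
| b1: "braid_equiv F G \<Longrightarrow> braid_equiv F (braid1 G)"
| b1': "braid_equiv F G \<Longrightarrow> braid_equiv F (braid1' G)"
| b2: "braid_equiv F G \<Longrightarrow> braid_equiv F (braid2 G)"
| b2': "braid_equiv F G \<Longrightarrow> braid_equiv F (braid2' G)"

lemma braid_equiv_trans: "braid_equiv F G \<Longrightarrow> braid_equiv G H \<Longrightarrow> braid_equiv F H"
  by (rotate_tac, induction rule: braid_equiv.induct) (auto intro: braid_equiv.intros)

lemma braid_equiv_involutions: "braid_equiv F G \<Longrightarrow> involutions F \<Longrightarrow> involutions G"
  by (induction rule: braid_equiv.induct) (auto intro: involutions_braid)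

lemma braid_equiv_sym: "braid_equiv F G \<Longrightarrow> involutions F \<Longrightarrow> braid_equiv G F"
proof (induction rule: braid_equiv.induct)
  case refl show ?case by (rule braid_equiv.refl)
next
  case (b1 G)
  then have "braid_equiv (braid1 G) G"
    using braid_equiv.b1'[OF braid_equiv.refl, of "braid1 G"] braid_inverse braid_equiv_involutions by metis
  then show ?case using b1 braid_equiv_trans by blast
next
  case (b1' G)
  then have "braid_equiv (braid1' G) G"
    using braid_equiv.b1[OF braid_equiv.refl, of "braid1' G"] braid_inverse braid_equiv_involutions by metis
  then show ?case using b1' braid_equiv_trans by blast
next
  case (b2 G)
  then have "braid_equiv (braid2 G) G"
    using braid_equiv.b2'[OF braid_equiv.refl, of "braid2 G"] braid_inverse braid_equiv_involutions by metis
  then show ?case using b2 braid_equiv_trans by blast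
next
  case (b2' G)
  then have "braid_equiv (braid2' G) G"
    using braid_equiv.b2[OF braid_equiv.refl, of "braid2' G"] braid_inverse braid_equiv_involutions by metis
  then show ?case using b2' braid_equiv_trans by blast
qed

lemma rev3_braid:
  "rev3 (braid1 F) = braid2' (rev3 F)" "rev3 (braid1' F) = braid2 (rev3 F)"
  "rev3 (braid2 F) = braid1' (rev3 F)" "rev3 (braid2' F) = braid1 (rev3 F)" "rev3 (rev3 F) = F"
  by (cases F; simp)+

lemma braid_equiv_rev3: "braid_equiv F G \<Longrightarrow> braid_equiv (rev3 F) (rev3 G)"
  by (induction rule: braid_equiv.induct) (auto simp: rev3_braid intro: braid_equiv.intros)

fun conj3 :: "('a \<Rightarrow> 'a) \<Rightarrow> ('a \<Rightarrow> 'a) \<Rightarrow> 'a triple \<Rightarrow> 'a triple" where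
  "conj3 f g (p, q, r) = (f \<circ> p \<circ> g, f \<circ> q \<circ> g, f \<circ> r \<circ> g)"

lemma conj3_braid:
  assumes "\<forall>x. g (f x) = x"
  shows "conj3 f g (braid1 F) = braid1 (conj3 f g F)" "conj3 f g (braid1' F) = braid1' (conj3 f g F)"
    "conj3 f g (braid2 F) = braid2 (conj3 f g F)" "conj3 f g (braid2' F) = braid2' (conj3 f g F)"
    "conj3 f g (rot F) = rot (conj3 f g F)" "conj3 f g (rot' F) = rot' (conj3 f g F)"
  using assms by (cases F; simp add: fun_eq_iff)+

lemma conj3_braid_equiv:
  assumes "\<forall>x. g (f x) = x" "braid_equiv F G" shows "braid_equiv (conj3 f g F) (conj3 f g G)"
  using assms(2) by induction (auto simp: conj3_braid[of g f, OF assms(1)] intro: braid_equiv.intros)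

lemma involutions_conj3:
  assumes "\<forall>x. g (f x) = x" "\<forall>x. f (g x) = x" "involutions F" shows "involutions (conj3 f g F)"
  using assms by (cases F) simp

lemma involutions_rot_power: "involutions F \<Longrightarrow> involutions ((rot ^^ n) F)"
  by (induction n) (simp_all add: involutions_braid)

text \<open>Multiples of three rotations commute with the braid moves, so that they act on a whole orbit in the
  same way as on one of its elements.\<close>

lemma rot_power_braid:
  assumes "involutions F"
  shows "(rot ^^ (3 * q)) (braid1 F) = braid1 ((rot ^^ (3 * q)) F)" "(rot ^^ (3 * q)) (braid2 F) = braid2 ((rot ^^ (3 * q)) F)"
    "(rot ^^ (3 * q)) (braid1' F) = braid1' ((rot ^^ (3 * q)) F)" "(rot ^^ (3 * q)) (braid2' F) = braid2' ((rot ^^ (3 * q)) F)"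
proof -
  have c: "rot (rot (rot (braid1 G))) = braid1 (rot (rot (rot G)))" "rot (rot (rot (braid2 G))) = braid2 (rot (rot (rot G)))"
    "rot (rot (rot (braid1' G))) = braid1' (rot (rot (rot G)))" "rot (rot (rot (braid2' G))) = braid2' (rot (rot (rot G)))"
    if "involutions G" for G :: "'a triple" using that by (cases G; simp add: fun_eq_iff)+
  have s: "(rot ^^ (3 * Suc q)) G = rot (rot (rot ((rot ^^ (3 * q)) G)))" for q and G :: "'a triple"
  proof -
    have "3 * Suc q = Suc (Suc (Suc (3 * q)))" by simp
    then show ?thesis by (simp only: funpow.simps o_apply)
  qed
  have *: "(rot ^^ (3 * q)) (braid1 F) = braid1 ((rot ^^ (3 * q)) F) \<and> (rot ^^ (3 * q)) (braid2 F) = braid2 ((rot ^^ (3 * q)) F) \<and>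
    (rot ^^ (3 * q)) (braid1' F) = braid1' ((rot ^^ (3 * q)) F) \<and> (rot ^^ (3 * q)) (braid2' F) = braid2' ((rot ^^ (3 * q)) F)"
  proof (induction q)
    case (Suc q)
    then show ?case unfolding s by (simp only: c[OF involutions_rot_power[OF assms]])
  qed simp
  show "(rot ^^ (3 * q)) (braid1 F) = braid1 ((rot ^^ (3 * q)) F)" "(rot ^^ (3 * q)) (braid2 F) = braid2 ((rot ^^ (3 * q)) F)"
    "(rot ^^ (3 * q)) (braid1' F) = braid1' ((rot ^^ (3 * q)) F)" "(rot ^^ (3 * q)) (braid2' F) = braid2' ((rot ^^ (3 * q)) F)"
    using * by blast+
qed

lemma rot_power_conj3:
  assumes fg: "\<forall>x. g (f x) = x" and eq: "(rot ^^ (3 * q)) F = conj3 f g F" and F: "involutions F"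
    and br: "braid_equiv F G"
  shows "(rot ^^ (3 * q)) G = conj3 f g G"
  using br
proof induction
  case refl show ?case by (rule eq)
next
  case (b1 G) then show ?case
    by (simp only: rot_power_braid(1)[OF braid_equiv_involutions[OF b1(1) F]] conj3_braid[of g f, OF fg])
next
  case (b1' G) then show ?case
    by (simp only: rot_power_braid(3)[OF braid_equiv_involutions[OF b1'(1) F]] conj3_braid[of g f, OF fg])
next
  case (b2 G) then show ?case
    by (simp only: rot_power_braid(2)[OF braid_equiv_involutions[OF b2(1) F]] conj3_braid[of g f, OF fg])
next
  case (b2' G) then show ?case
    by (simp only: rot_power_braid(4)[OF braid_equiv_involutions[OF b2'(1) F]] conj3_braid[of g f, OF fg])
qed

text \<open>The combinatorics of the seeds of a translation invariant world. \<open>A\<close> stands for the triples of all its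
  normal seeds and \<open>C\<close> for those of the acyclic ones. Depending on the sign of the middle vector, one of
  the two rotations of a normal triple is normal again.\<close>

locale normal_triples =
  fixes A C :: "'a triple set"
  assumes inv: "F \<in> A \<Longrightarrow> involutions F" and CA: "C \<subseteq> A"
    and cyclic: "F \<in> A \<Longrightarrow> F \<in> C \<or> braid1 F \<in> A"
    and roll: "F \<in> C \<Longrightarrow> braid2 (braid1 F) \<in> C"
    and middle: "F \<in> A \<Longrightarrow> (braid2 F \<in> A \<and> rot' F \<in> A) \<or> (braid1' F \<in> A \<and> rot F \<in> A)"
begin

lemma inv_closure: "F \<in> rot_closure A C \<Longrightarrow> involutions F"
proof (induction rule: rot_closure.induct)
  case (twist F) then show ?case using inv CA involutions_braid(1) by blast
qed (blast intro: inv involutions_braid)+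

lemma closure_A: "F \<in> A \<Longrightarrow> braid1 F \<in> rot_closure A C"
  using cyclic by (blast intro: rot_closure.base rot_closure.twist)

text \<open>Three rotations are central, so that \<open>braid1\<close> has to be understood only on a generator, on its
  rotation, and on its inverse rotation. The case distinction \<open>middle\<close> says which of the two rotations
  is a generator itself; the identities in \<open>rot_braid\<close> treat the other one.\<close>

lemma closure_braid1:
  "F \<in> rot_closure A C \<Longrightarrow>
   braid1 F \<in> rot_closure A C \<and> braid1 (rot F) \<in> rot_closure A C \<and> braid1 (rot' F) \<in> rot_closure A C"
proof (induction rule: rot_closure.induct)
  case (base F)
  note i = inv[OF base]
  show ?case using middle[OF base]
  proof
    assume m: "braid2 F \<in> A \<and> rot' F \<in> A"
    then have "rot (braid2 F) \<in> rot_closure A C" by (blast intro: rot_closure.base rot_closure.rot)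
    then show ?thesis using m closure_A base rot_braid(3)[OF i] by metis
  next
    assume m: "braid1' F \<in> A \<and> rot F \<in> A"
    then have "rot' (rot' (braid1' F)) \<in> rot_closure A C" by (blast intro: rot_closure.base rot_closure.rot')
    then show ?thesis using m closure_A base rot_braid(4)[OF i] by metis
  qed
next
  case (twist G)
  then have i: "involutions G" using inv CA by blast
  note j = involutions_braid(1)[OF i]
  let ?S = "\<lambda>G. braid2 (braid1 G)"
  have "?S G \<in> C" "?S (?S G) \<in> C" "G \<in> C" using roll twist by blast+
  then have "?S G \<in> A" "?S (?S G) \<in> A" "G \<in> A" using CA by blast+
  then have "rot (?S (?S G)) \<in> rot_closure A C" "rot (?S G) \<in> rot_closure A C" "rot' (rot' G) \<in> rot_closure A C"
    by (blast intro: rot_closure.base rot_closure.rot rot_closure.rot')+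
  then show ?case using rot_braid(5)[OF i] rot_braid(3)[OF j] rot_braid(4)[OF j] braid_inverse(1)[OF i] by metis
next
  case (rot F)
  note i = inv_closure[OF rot(1)]
  have "braid1 (rot (rot F)) = rot (rot (rot (braid1 (rot' F))))"
    using rot_braid(6)[OF involutions_braid(6)[OF i]] braid_inverse(6)[OF i] by simp
  then have "braid1 (rot (rot F)) \<in> rot_closure A C" using rot(2) by (metis rot_closure.rot)
  then show ?case using rot(2) braid_inverse(5)[OF i] by metis
next
  case (rot' F)
  note i = inv_closure[OF rot'(1)]
  have "braid1 (rot' (rot' F)) = rot' (rot' (rot' (braid1 (rot F))))"
    using rot_braid(7)[OF involutions_braid(5)[OF i]] braid_inverse(5)[OF i] by simp
  then have "braid1 (rot' (rot' F)) \<in> rot_closure A C" using rot'(2) by (metis rot_closure.rot')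
  then show ?case using rot'(2) braid_inverse(6)[OF i] by metis
qed

lemma closure_braid:
  assumes F: "F \<in> rot_closure A C"
  shows "braid1 F \<in> rot_closure A C" "braid2 F \<in> rot_closure A C" "braid1' F \<in> rot_closure A C" "braid2' F \<in> rot_closure A C"
proof -
  note i = inv_closure[OF F]
  show "braid1 F \<in> rot_closure A C" using closure_braid1[OF F] by blast
  have "braid2 F = rot' (braid1 (rot F))"
    using rot_braid(3)[OF i] braid_inverse(5)[OF involutions_braid(3)[OF i]] by simp
  then show "braid2 F \<in> rot_closure A C" using closure_braid1[OF F] by (metis rot_closure.rot')
  have c: "braid1' F \<in> rot_closure A C" if F: "F \<in> rot_closure A C" for F
  proof -
    note i = inv_closure[OF F]
    have "braid1' F = rot (rot (braid1 (rot' F)))"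
      using rot_braid(4)[OF i] braid_inverse(6) involutions_braid(2,6) i by metis
    then show ?thesis using closure_braid1[OF F] by (metis rot_closure.rot)
  qed
  show "braid1' F \<in> rot_closure A C" by (rule c[OF F])
  have "rot (braid1' F) \<in> rot_closure A C" using c[OF F] by (rule rot_closure.rot)
  have "braid2' F = rot' (braid1' (rot F))" using i by (cases F) (simp add: fun_eq_iff)
  then show "braid2' F \<in> rot_closure A C" using c[OF rot_closure.rot[OF F]] by (metis rot_closure.rot')
qed

lemma closure_braid_equiv:
  assumes "F \<in> rot_closure A C" "braid_equiv F G" shows "G \<in> rot_closure A C"
  using assms(2) by induction (use assms(1) closure_braid in auto)

lemma closure_cover:
  assumes N: "N > 0" and pow: "\<And>F. F \<in> A \<union> braid1 ` C \<Longrightarrow> (rot ^^ N) F \<in> A \<union> braid1 ` C"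
    and pow': "\<And>F. F \<in> A \<union> braid1 ` C \<Longrightarrow> \<exists>G\<in>A \<union> braid1 ` C. F = (rot ^^ N) G"
    and F: "F \<in> rot_closure A C"
  shows "\<exists>i<N. \<exists>G\<in>A \<union> braid1 ` C. F = (rot ^^ i) G"
  using F
proof (induction rule: rot_closure.induct)
  case (base F) then show ?case using N by (intro exI[of _ 0]) auto
next
  case (twist F) then show ?case using N by (intro exI[of _ 0]) auto
next
  case (rot F)
  then obtain i G where G: "i < N" "G \<in> A \<union> braid1 ` C" "F = (rot ^^ i) G" by blast
  show ?case
  proof (cases "Suc i = N")
    case True
    then have "rot F = (rot ^^ 0) ((rot ^^ N) G)" using G(3) by (simp flip: True)
    then show ?thesis using pow[OF G(2)] N by blast
  next
    case False
    then have "rot F = (rot ^^ Suc i) G" "Suc i < N" using G by simp_all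
    then show ?thesis using G(2) by blast
  qed
next
  case (rot' F)
  then obtain i G where G: "i < N" "G \<in> A \<union> braid1 ` C" "F = (rot ^^ i) G" by blast
  have inv\<Sigma>: "involutions H" if "H \<in> A \<union> braid1 ` C" for H using that inv CA involutions_braid(1) by blast
  have inve: "involutions ((rot ^^ n) H)" if "H \<in> A \<union> braid1 ` C" for n H
    by (rule involutions_rot_power[OF inv\<Sigma>[OF that]])
  show ?case
  proof (cases i)
    case 0
    obtain H where H: "H \<in> A \<union> braid1 ` C" "G = (rot ^^ N) H" using pow'[OF G(2)] by blast
    obtain n where n: "N = Suc n" using N not0_implies_Suc by blast
    have "rot' F = (rot ^^ n) H" using 0 G(3) H(2) braid_inverse(5)[OF inve[OF H(1), of n]] by (simp add: n)
    moreover have "n < N" by (simp add: n)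
    ultimately show ?thesis using H(1) by blast
  next
    case (Suc j)
    then have "rot' F = (rot ^^ j) G" using G(3) braid_inverse(5)[OF inve[OF G(2), of j]] by simp
    moreover have "j < N" using G(1) Suc by simp
    ultimately show ?thesis using G(2) by blast
  qed
qed

end

section \<open>The opposite world\<close>

text \<open>Negating both the vectors and the exchange matrix commutes with mutation. It reverses exceptional
  orders and exchanges the two signs, which halves all case distinctions.\<close>

definition opposite :: "('n, 'v::real_vector) labelled_seed \<Rightarrow> ('n::finite, 'v) labelled_seed" where
  "opposite s = (\<lambda>i. - fst s i, - snd s)"

lemma opposite_simps: "fst (opposite s) i = - fst s i" "snd (opposite s) = - snd s" "opposite (opposite s) = s"
  by (simp_all add: opposite_def)

lemma matrix_mutation_minus: "matrix_mutation k (- B) = - matrix_mutation k B"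
  by (auto simp: vec_eq_iff matrix_mutation_nth field_simps)

context seed_space begin

lemma opposite_mutation:
  assumes "pos (- fst s k) \<longleftrightarrow> \<not> pos (fst s k)"
  shows "seed_mutation form pos k (opposite s) = opposite (seed_mutation form pos k s)"
proof (rule prod_eqI)
  show "snd (seed_mutation form pos k (opposite s)) = snd (opposite (seed_mutation form pos k s))"
    by (simp add: opposite_simps snd_mutation matrix_mutation_minus)
  have "fst (seed_mutation form pos k (opposite s)) i = fst (opposite (seed_mutation form pos k s)) i" for i
    unfolding fst_mutation opposite_simps assms by (simp add: form_simps)
  then show "fst (seed_mutation form pos k (opposite s)) = fst (opposite (seed_mutation form pos k s))" by blast
qed

definition reflect :: "'v \<Rightarrow> 'v \<Rightarrow> 'v" where "reflect v f = f - form f v *\<^sub>R v"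

lemma reflect_reflect: "form v v = 2 \<Longrightarrow> reflect v (reflect v f) = f"
  by (simp add: reflect_def form_simps algebra_simps)

lemma reflect_minus: "reflect (- v) = reflect v"
  by (simp add: reflect_def fun_eq_iff form_simps)

lemma reflect_conj:
  assumes "form v v = 2" shows "reflect (w - form w v *\<^sub>R v) = reflect v \<circ> reflect w \<circ> reflect v"
proof
  fix f
  show "reflect (w - form w v *\<^sub>R v) f = (reflect v \<circ> reflect w \<circ> reflect v) f"
    using assms form_sym[of v w] by (simp add: reflect_def form_simps algebra_simps)
qed

text \<open>Reflections instead of vectors, because braid moves act on the vectors only up to signs.\<close>

definition triple :: "(3, 'v) labelled_seed \<Rightarrow> 3 \<Rightarrow> 3 \<Rightarrow> 3 \<Rightarrow> 'v triple" where
  "triple s i j k = (reflect (fst s i), reflect (fst s j), reflect (fst s k))"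

end

context coherent begin

lemma coherent_opposite: "coherent form pos (opposite ` R) (\<lambda>x y. - om x y)"
proof
  show "skew_bilinear (\<lambda>x y. - om x y)"
    unfolding skew_bilinear_def
  proof (intro conjI allI)
    show "- om x y = - (- om y x)" for x y using om_sym[of y x] by simp
  qed (simp_all add: om_simps)
next
  fix s k assume "s \<in> opposite ` R"
  then obtain r where r: "r \<in> R" "s = opposite r" by blast
  then show "seed_mutation form pos k s \<in> opposite ` R"
    using opposite_mutation[OF neg_iff[OF r(1)]] closed[OF r(1)] by simp
next
  fix s i assume "s \<in> opposite ` R"
  then obtain r where r: "r \<in> R" "s = opposite r" by blast
  show "decided (fst s i)" using dec[OF r(1), of i] by (auto simp: r(2) opposite_simps decided_def)
next
  fix s assume "s \<in> opposite ` R"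
  then obtain r where r: "r \<in> R" "s = opposite r" by blast
  have sc: "sign_compat a b c x y z \<Longrightarrow> sign_compat (- a) (- b) (- c) x y z" for a b c x y z :: real
    unfolding sign_compat_def by simp
  have sk: "skew_symmetric (- snd r)"
  proof (rule skewI)
    fix i j show "(- snd r) $ j $ i = - ((- snd r) $ i $ j)" using skewD[OF skew[OF r(1)], of i j] by simp
  qed
  have scr: "sign_compat (snd r $ i $ j) (snd r $ j $ k) (snd r $ k $ i)
          (form (fst r i) (fst r j)) (form (fst r j) (fst r k)) (form (fst r k) (fst r i))"
    if "i \<noteq> j \<and> j \<noteq> k \<and> i \<noteq> k" for i j k using realis[OF r(1)] that unfolding realises_def by blast
  show "realises form s" using sk scr[THEN sc] norm[OF r(1)]
    unfolding realises_def r(2) opposite_simps by (simp add: form_simps)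
  show "sign_rule form pos s"
    unfolding sign_rule_def r(2) opposite_simps neg_iff[OF r(1)]
  proof (intro allI impI)
    fix i j assume a: "i \<noteq> j \<and> 0 \<le> (- snd r) $ i $ j"
    have ji: "snd r $ j $ i = - (snd r $ i $ j)" by (rule skewD[OF skew[OF r(1)]])
    show "form (- fst r i) (- fst r j) = (if \<not> \<not> pos (fst r i) \<and> \<not> pos (fst r j) then (- snd r) $ i $ j
        else - ((- snd r) $ i $ j))"
      using rule_form[OF r(1), of j i] a form_sym[of "fst r j" "fst r i"] unfolding ji by (auto simp: form_simps)
  qed
  show "- om (fst s i) (fst s j) = snd s $ i $ j" for i j
    using om_B[OF r(1)] by (simp add: r(2) opposite_simps om_simps)
  show "\<not> isolated i (snd s)" for i using conn[OF r(1), of i] by (simp add: r(2) opposite_simps isolated_def)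
  obtain i j k :: 3 where ne: "i \<noteq> j" "j \<noteq> k" "i \<noteq> k" using distinct3_ex by blast
  have b: "basis3 (fst r)" by (rule basis[OF r(1)])
  show "basis3 (fst s)" unfolding basis3_three[OF ne] r(2) opposite_simps
  proof (intro conjI allI impI)
    fix a b' c assume "a *\<^sub>R - fst r i + b' *\<^sub>R - fst r j + c *\<^sub>R - fst r k = 0"
    then have "(-a) *\<^sub>R fst r i + (-b') *\<^sub>R fst r j + (-c) *\<^sub>R fst r k = 0" by simp
    then have "-a = 0 \<and> -b' = 0 \<and> -c = 0" using b unfolding basis3_three[OF ne] by blast
    then show "a = 0" "b' = 0" "c = 0" by simp_all
  next
    fix x
    obtain a b' c where "x = a *\<^sub>R fst r i + b' *\<^sub>R fst r j + c *\<^sub>R fst r k" using b unfolding basis3_three[OF ne] by blast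
    then have "x = (-a) *\<^sub>R - fst r i + (-b') *\<^sub>R - fst r j + (-c) *\<^sub>R - fst r k" by simp
    then show "\<exists>a b c. x = a *\<^sub>R - fst r i + b *\<^sub>R - fst r j + c *\<^sub>R - fst r k" by blast
  qed
qed

end

section \<open>Mutations act by braid moves\<close>

context coherent begin

lemma involutions_triple: "s \<in> R \<Longrightarrow> involutions (triple s i j k)"
  using norm reflect_reflect by (simp add: triple_def)

lemma eul_symmetric_zero:
  assumes s: "s \<in> R" and z: "eul (fst s i) (fst s j) = 0" "eul (fst s j) (fst s i) = 0" and ij: "i \<noteq> j"
  shows "snd s $ i $ j = 0" "form (fst s i) (fst s j) = 0"
    "reflect (fst s i) (reflect (fst s j) f) = reflect (fst s j) (reflect (fst s i) f)"
proof -
  show "snd s $ i $ j = 0" using eul_zero_B(2)[OF s z(1)] z(2) by simp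
  then show f: "form (fst s i) (fst s j) = 0" using eul_zero_B(1)[OF s z(1)] by simp
  show "reflect (fst s i) (reflect (fst s j) f) = reflect (fst s j) (reflect (fst s i) f)"
    using f form_sym[of "fst s j" "fst s i"] by (simp add: reflect_def form_simps algebra_simps)
qed

lemma exceptional_swap:
  assumes s: "s \<in> R" and e: "exceptional s x y z"
  shows "snd s $ x $ y = 0 \<Longrightarrow> exceptional s y x z \<and> triple s y x z = braid1 (triple s x y z)"
    "snd s $ y $ z = 0 \<Longrightarrow> exceptional s x z y \<and> triple s x z y = braid2 (triple s x y z)"
proof -
  have ne: "x \<noteq> y" "y \<noteq> z" "x \<noteq> z" and z: "eul (fst s x) (fst s y) = 0" "eul (fst s x) (fst s z) = 0" "eul (fst s y) (fst s z) = 0"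
    using e by (auto simp: exceptional_def)
  show "exceptional s y x z \<and> triple s y x z = braid1 (triple s x y z)" if "snd s $ x $ y = 0"
  proof -
    have w: "eul (fst s y) (fst s x) = 0" using eul_zero_B(2)[OF s z(1)] that by simp
    show ?thesis using w z ne eul_symmetric_zero(3)[OF s z(1) w ne(1)] reflect_reflect[OF norm[OF s]]
      by (simp add: exceptional_def triple_def fun_eq_iff)
  qed
  show "exceptional s x z y \<and> triple s x z y = braid2 (triple s x y z)" if "snd s $ y $ z = 0"
  proof -
    have w: "eul (fst s z) (fst s y) = 0" using eul_zero_B(2)[OF s z(3)] that by simp
    show ?thesis using w z ne ne(2)[symmetric] eul_symmetric_zero(3)[OF s z(3) w ne(2)] reflect_reflect[OF norm[OF s]]
      by (simp add: exceptional_def triple_def fun_eq_iff)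
  qed
qed

lemma isolatedI:
  assumes s: "s \<in> R" and ne: "i \<noteq> j" "j \<noteq> k" "i \<noteq> k" and z: "snd s $ i $ j = 0" "snd s $ i $ k = 0" shows False
proof -
  have "snd s $ i $ l = 0" for l using three_cases[OF ne, of l] z skew0[OF skew[OF s], of i] by auto
  then show False using conn[OF s, of i] by (simp add: isolated_def)
qed

text \<open>Two exceptional orders differ by an exchange of orthogonal neighbours, which is a braid move of
  commuting reflections.\<close>

lemma exceptional_unique:
  assumes s: "s \<in> R" and e: "exceptional s x y z" and e': "exceptional s i j k"
  shows "braid_equiv (triple s x y z) (triple s i j k)"
proof -
  have ne: "x \<noteq> y" "y \<noteq> z" "x \<noteq> z" and z: "eul (fst s x) (fst s y) = 0" "eul (fst s x) (fst s z) = 0" "eul (fst s y) (fst s z) = 0"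
    using e by (auto simp: exceptional_def)
  have ne': "i \<noteq> j" "j \<noteq> k" "i \<noteq> k" and z': "eul (fst s i) (fst s j) = 0" "eul (fst s i) (fst s k) = 0" "eul (fst s j) (fst s k) = 0"
    using e' by (auto simp: exceptional_def)
  have sw: "snd s $ y $ x = - (snd s $ x $ y)" "snd s $ z $ x = - (snd s $ x $ z)" "snd s $ z $ y = - (snd s $ y $ z)"
    using skewD[OF skew[OF s]] by blast+
  have B: "snd s $ a $ b = 0" if "eul (fst s a) (fst s b) = 0" "eul (fst s b) (fst s a) = 0" "a \<noteq> b" for a b
    using eul_symmetric_zero(1)[OF s that] .
  note c = three_cases[OF ne]
  consider "i = x" "j = y" "k = z" | "i = y" "j = x" "k = z" | "i = x" "j = z" "k = y"
    | "i = y" "j = z" "k = x" | "i = z" "j = x" "k = y" | "i = z" "j = y" "k = x"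
    using c[of i] c[of j] c[of k] ne' by metis
  then show ?thesis
  proof cases
    case 1 then show ?thesis by (simp add: braid_equiv.refl)
  next
    case 2
    then have "snd s $ x $ y = 0" using B[of x y] z z' ne by simp
    then show ?thesis using 2 exceptional_swap(1)[OF s e] by (metis braid_equiv.refl braid_equiv.b1)
  next
    case 3
    then have "snd s $ y $ z = 0" using B[of y z] z z' ne by simp
    then show ?thesis using 3 exceptional_swap(2)[OF s e] by (metis braid_equiv.refl braid_equiv.b2)
  next
    case 4
    then have "snd s $ x $ y = 0" "snd s $ x $ z = 0" using B[of x y] B[of x z] z z' ne by simp_all
    then show ?thesis using isolatedI[OF s, of x y z] ne by blast
  next
    case 5
    then have "snd s $ y $ z = 0" "snd s $ x $ z = 0" using B[of y z] B[of x z] z z' ne by simp_all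
    then have "snd s $ z $ y = 0" "snd s $ z $ x = 0" using sw by simp_all
    then show ?thesis using isolatedI[OF s, of z y x] ne by metis
  next
    case 6
    then have "snd s $ x $ y = 0" "snd s $ x $ z = 0" using B[of x y] B[of x z] z z' ne by simp_all
    then show ?thesis using isolatedI[OF s, of x y z] ne by blast
  qed
qed

lemma mutation_reflect:
  assumes s: "s \<in> R" and p: "pos (fst s l)" and il: "i \<noteq> l"
  shows "snd s $ l $ i \<le> 0 \<Longrightarrow> fst (seed_mutation form pos l s) i = fst s i"
    "snd s $ l $ i > 0 \<Longrightarrow> fst (seed_mutation form pos l s) i = fst s i + (snd s $ l $ i) *\<^sub>R fst s l"
    "snd s $ l $ i > 0 \<Longrightarrow> reflect (fst (seed_mutation form pos l s) i) = reflect (fst s l) \<circ> reflect (fst s i) \<circ> reflect (fst s l)"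
    "eul (fst s i) (fst s l) = 0 \<Longrightarrow> snd s $ l $ i \<le> 0"
proof -
  have sw: "snd s $ i $ l = - (snd s $ l $ i)" by (rule skewD[OF skew[OF s]])
  show "snd s $ l $ i \<le> 0 \<Longrightarrow> fst (seed_mutation form pos l s) i = fst s i"
    using p il by (simp add: fst_mutation sw)
  show "snd s $ l $ i > 0 \<Longrightarrow> fst (seed_mutation form pos l s) i = fst s i + (snd s $ l $ i) *\<^sub>R fst s l"
    using mutation_vec[OF s il] p by (simp add: sw)
  have "fst (seed_mutation form pos l s) i = fst s i - form (fst s i) (fst s l) *\<^sub>R fst s l" if "snd s $ l $ i > 0"
    using p il that by (simp add: fst_mutation sw)
  then show "snd s $ l $ i > 0 \<Longrightarrow> reflect (fst (seed_mutation form pos l s) i) = reflect (fst s l) \<circ> reflect (fst s i) \<circ> reflect (fst s l)"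
    using reflect_conj[OF norm[OF s]] by metis
  show "snd s $ l $ i \<le> 0" if e: "eul (fst s i) (fst s l) = 0"
  proof (rule ccontr)
    assume c: "\<not> ?thesis"
    then have "form (fst s l) (fst s i) = - (snd s $ l $ i)" using rule_form[OF s il[symmetric]] p by simp
    moreover have "form (fst s i) (fst s l) = snd s $ l $ i" using eul_zero_B(1)[OF s e] sw by simp
    ultimately show False using form_sym[of "fst s i" "fst s l"] c by simp
  qed
qed

text \<open>A vector that precedes the mutated one in an exceptional order is never reflected by a mutation at
  a positive vector; hence the mutated vector moves past those reflected vectors that follow it.\<close>

lemma braid_mutation_pos:
  assumes s: "s \<in> R" and e: "exceptional s x y z" and p: "pos (fst s l)"
  defines "t \<equiv> seed_mutation form pos l s"
  shows "\<exists>i j k. exceptional t i j k \<and> braid_equiv (triple s x y z) (triple t i j k)"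
proof -
  have ne: "x \<noteq> y" "y \<noteq> z" "x \<noteq> z" and z: "eul (fst s x) (fst s y) = 0" "eul (fst s x) (fst s z) = 0" "eul (fst s y) (fst s z) = 0"
    using e by (auto simp: exceptional_def)
  note ne' = ne ne[symmetric]
  note mr = mutation_reflect[OF s p, folded t_def]
  have sw: "snd s $ y $ x = - (snd s $ x $ y)" "snd s $ z $ x = - (snd s $ x $ z)" "snd s $ z $ y = - (snd s $ y $ z)"
    using skewD[OF skew[OF s]] by blast+
  have tl: "fst t l = - fst s l" unfolding t_def by (rule mutation_vec_self)
  note ev = eul_add eul_scale eul_minus eul_self[OF s] z
  have keep: ?thesis if "\<And>i. i \<noteq> l \<Longrightarrow> fst t i = fst s i"
  proof -
    have f: "fst t i = (if i = l then - fst s i else fst s i)" for i using that tl by simp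
    have "exceptional t x y z" using e by (auto simp: exceptional_def f eul_minus)
    moreover have "triple t x y z = triple s x y z" by (auto simp: triple_def f reflect_minus)
    ultimately show ?thesis by (metis braid_equiv.refl)
  qed
  have keep: ?thesis if k: "x \<noteq> l \<Longrightarrow> fst t x = fst s x" "y \<noteq> l \<Longrightarrow> fst t y = fst s y" "z \<noteq> l \<Longrightarrow> fst t z = fst s z"
  proof (rule keep)
    fix i assume "i \<noteq> l"
    then show "fst t i = fst s i" using three_cases[OF ne, of i] k by blast
  qed
  consider "l = z" | "l = y" | "l = x" using three_cases[OF ne] by blast
  then show ?thesis
  proof cases
    case 1
    have "fst t x = fst s x" "fst t y = fst s y" using mr(1,4)[of x] mr(1,4)[of y] 1 ne z by blast+
    then show ?thesis using keep 1 by blast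
  next
    case 2
    have tx: "fst t x = fst s x" using mr(1,4)[of x] 2 ne z by blast
    show ?thesis
    proof (cases "snd s $ y $ z \<le> 0")
      case True
      then have "fst t z = fst s z" using mr(1)[of z] 2 ne' by blast
      then show ?thesis using tx keep 2 by blast
    next
      case False
      then have tz: "fst t z = fst s z + (snd s $ y $ z) *\<^sub>R fst s y"
        "reflect (fst t z) = reflect (fst s y) \<circ> reflect (fst s z) \<circ> reflect (fst s y)"
        using mr(2,3)[of z] 2 ne' by auto
      have "exceptional t x z y" using ne' tl unfolding exceptional_def 2
        by (simp add: tx tz(1) ev eul_zero_B(2)[OF s z(3)])
      moreover have "triple t x z y = braid2 (triple s x y z)"
        using tl unfolding triple_def 2 by (simp add: tx tz(2) reflect_minus)
      ultimately show ?thesis by (metis braid_equiv.refl braid_equiv.b2)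
    qed
  next
    case 3
    have ty: "snd s $ x $ y \<le> 0 \<Longrightarrow> fst t y = fst s y" "snd s $ x $ y > 0 \<Longrightarrow> fst t y = fst s y + (snd s $ x $ y) *\<^sub>R fst s x"
      "snd s $ x $ y > 0 \<Longrightarrow> reflect (fst t y) = reflect (fst s x) \<circ> reflect (fst s y) \<circ> reflect (fst s x)"
      using mr(1,2,3)[of y] 3 ne' by blast+
    have tz: "snd s $ x $ z \<le> 0 \<Longrightarrow> fst t z = fst s z" "snd s $ x $ z > 0 \<Longrightarrow> fst t z = fst s z + (snd s $ x $ z) *\<^sub>R fst s x"
      "snd s $ x $ z > 0 \<Longrightarrow> reflect (fst t z) = reflect (fst s x) \<circ> reflect (fst s z) \<circ> reflect (fst s x)"
      using mr(1,2,3)[of z] 3 ne' by blast+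
    have tx: "fst t x = - fst s x" using tl 3 by simp
    note q = eul_zero_B(2)[OF s z(1)] eul_zero_B(2)[OF s z(2)] eul_zero_B(2)[OF s z(3)]
    consider "snd s $ x $ y \<le> 0" "snd s $ x $ z \<le> 0" | "snd s $ x $ y > 0" "snd s $ x $ z \<le> 0"
      | "snd s $ x $ y > 0" "snd s $ x $ z > 0" | "snd s $ x $ y = 0" "snd s $ x $ z > 0"
      | "snd s $ x $ y < 0" "snd s $ x $ z > 0" by linarith
    then show ?thesis
    proof cases
      case 1
      then show ?thesis using ty(1) tz(1) keep \<open>l = x\<close> by blast
    next
      case 2
      have "exceptional t y x z" using ne' unfolding exceptional_def
        by (simp add: tx ty(2)[OF 2(1)] tz(1)[OF 2(2)] ev q)
      moreover have "triple t y x z = braid1 (triple s x y z)"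
        unfolding triple_def by (simp add: tx ty(3)[OF 2(1)] tz(1)[OF 2(2)] reflect_minus)
      ultimately show ?thesis by (metis braid_equiv.refl braid_equiv.b1)
    next
      case 3
      have "exceptional t y z x" using ne' unfolding exceptional_def
        by (simp add: tx ty(2)[OF 3(1)] tz(2)[OF 3(2)] ev q)
      moreover have "triple t y z x = braid2 (braid1 (triple s x y z))"
        unfolding triple_def by (simp add: tx ty(3)[OF 3(1)] tz(3)[OF 3(2)] reflect_minus)
      ultimately show ?thesis by (metis braid_equiv.refl braid_equiv.b1 braid_equiv.b2)
    next
      case 4
      have tyy: "fst t y = fst s y" using ty(1) 4 by simp
      have yx: "triple s y x z = braid1 (triple s x y z)" using exceptional_swap(1)[OF s e 4(1)] by blast
      have "exceptional t y z x" using ne' unfolding exceptional_def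
        by (simp add: tx tyy tz(2)[OF 4(2)] ev q 4(1))
      moreover have "triple t y z x = braid2 (triple s y x z)"
        unfolding triple_def by (simp add: tx tyy tz(3)[OF 4(2)] reflect_minus)
      ultimately show ?thesis unfolding yx by (metis braid_equiv.refl braid_equiv.b1 braid_equiv.b2)
    next
      case 5
      have fyx: "form (fst s y) (fst s x) = snd s $ y $ x"
        using eul_zero_B(1)[OF s z(1)] form_sym[of "fst s y" "fst s x"] sw by simp
      have py: "\<not> pos (fst s y)"
      proof
        assume "pos (fst s y)"
        then have "form (fst s y) (fst s x) = - (snd s $ y $ x)" using rule_form[OF s, of y x] 5 sw ne by simp
        then show False using fyx 5 sw by simp
      qed
      have yz: "snd s $ y $ z = 0"
      proof (rule ccontr)
        assume nz: "snd s $ y $ z \<noteq> 0"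
        have fyz: "form (fst s y) (fst s z) = - (snd s $ y $ z)" by (rule eul_zero_B(1)[OF s z(3)])
        have gt: "snd s $ y $ z > 0"
        proof (rule ccontr)
          assume "\<not> ?thesis"
          then have "snd s $ z $ y > 0" using nz sw by simp
          then have "form (fst s z) (fst s y) = - (snd s $ z $ y)" using rule_form[OF s, of z y] ne py by simp
          then show False using fyz form_sym[of "fst s y" "fst s z"] sw nz by simp
        qed
        have fzx: "form (fst s z) (fst s x) = - (snd s $ x $ z)"
          using eul_zero_B(1)[OF s z(2)] form_sym[of "fst s z" "fst s x"] by simp
        have yx: "snd s $ y $ x > 0" using 5 sw by simp
        have "form (fst s y) (fst s x) * form (fst s x) (fst s z) * form (fst s z) (fst s y)
          = snd s $ y $ x * snd s $ x $ z * snd s $ z $ y"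
          by (rule three_cycle[OF s _ _ _ yx 5(2)]) (use ne in auto)
        then have "snd s $ y $ x * snd s $ x $ z * snd s $ y $ z = - (snd s $ y $ x * snd s $ x $ z * snd s $ y $ z)"
          unfolding fyx form_sym[of "fst s x" "fst s z"] fzx form_sym[of "fst s z" "fst s y"] fyz sw(3) by simp
        moreover have "snd s $ y $ x * snd s $ x $ z * snd s $ y $ z > 0" using yx 5(2) gt by simp
        ultimately show False by linarith
      qed
      have tyy: "fst t y = fst s y" using ty(1) 5 by simp
      have yx: "triple s x z y = braid2 (triple s x y z)" using exceptional_swap(2)[OF s e yz] by blast
      have "exceptional t z x y" using ne' unfolding exceptional_def
        by (simp add: tx tyy tz(2)[OF 5(2)] ev q yz)
      moreover have "triple t z x y = braid1 (triple s x z y)"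
        unfolding triple_def by (simp add: tx tyy tz(3)[OF 5(2)] reflect_minus)
      ultimately show ?thesis unfolding yx by (metis braid_equiv.refl braid_equiv.b1 braid_equiv.b2)
    qed
  qed
qed

lemma braid_mutation:
  fixes l :: 3
  assumes s: "s \<in> R" and e: "exceptional s x y z"
  defines "t \<equiv> seed_mutation form pos l s"
  shows "\<exists>i j k. exceptional t i j k \<and> braid_equiv (triple s x y z) (triple t i j k)"
proof (cases "pos (fst s l)")
  case True then show ?thesis unfolding t_def by (rule braid_mutation_pos[OF s e])
next
  case False
  interpret op: coherent form pos "opposite ` R" "\<lambda>x y. - om x y" by (rule coherent_opposite)
  have oe: "op.eul x y = eul y x" for x y
    unfolding op.eul_def eul_def using om_sym[of x y] form_sym[of x y] by simp
  have oex: "op.exceptional (opposite r) i j k \<longleftrightarrow> exceptional r k j i" for r i j k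
    unfolding op.exceptional_def exceptional_def oe opposite_simps eul_minus by auto
  have otr: "triple (opposite r) i j k = rev3 (triple r k j i)" for r i j k
    by (simp add: triple_def opposite_simps reflect_minus)
  have m: "seed_mutation form pos l (opposite s) = opposite t"
    unfolding t_def by (rule opposite_mutation[OF neg_iff[OF s]])
  have "opposite s \<in> opposite ` R" "pos (fst (opposite s) l)" "op.exceptional (opposite s) z y x"
    using s False neg_iff[OF s, of l] e by (simp_all add: opposite_simps oex)
  then obtain i j k where i: "op.exceptional (opposite t) i j k"
    "braid_equiv (triple (opposite s) z y x) (triple (opposite t) i j k)"
    using op.braid_mutation_pos[of "opposite s" z y x l] unfolding m by blast
  have "braid_equiv (triple s x y z) (triple t k j i)"
    using braid_equiv_rev3[OF i(2)] unfolding otr rev3_braid(5) .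
  then show ?thesis using i(1) unfolding oex by blast
qed

text \<open>Induction backwards: a given exceptional order of the mutated seed is traced back to one of the
  original seed, since the mutation is an involution.\<close>

lemma braid_reachable:
  assumes s: "s \<in> R" and e: "exceptional s x y z"
  shows "t \<in> mutation_reachable form pos s \<Longrightarrow>
    t \<in> R \<and> (\<forall>i j k. exceptional t i j k \<longrightarrow> braid_equiv (triple s x y z) (triple t i j k))"
proof (induction rule: reachable_induct)
  case base
  then show ?case using exceptional_unique[OF s e] s by blast
next
  case (step u l)
  let ?t = "seed_mutation form pos l u"
  have u: "u \<in> R" and t: "?t \<in> R" using step closed by blast+
  have "braid_equiv (triple s x y z) (triple ?t i j k)" if et: "exceptional ?t i j k" for i j k
  proof -
    obtain a b c where a: "exceptional u a b c" "braid_equiv (triple ?t i j k) (triple u a b c)"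
      using braid_mutation[OF t et, of l] unfolding involutive[OF u] by blast
    have "braid_equiv (triple s x y z) (triple u a b c)" using step a(1) by blast
    then show ?thesis using braid_equiv_sym[OF a(2) involutions_triple[OF t]] braid_equiv_trans by blast
  qed
  then show ?case using t by blast
qed

lemma reachable_sym:
  assumes R: "R = mutation_reachable form pos s0" and s: "s \<in> R" shows "mutation_reachable form pos s = R"
proof -
  have "s \<in> mutation_reachable form pos s0 \<Longrightarrow> s0 \<in> mutation_reachable form pos s"
  proof (induction rule: reachable_induct)
    case base show ?case by (rule reachable_refl)
  next
    case (step u k)
    have "u \<in> mutation_reachable form pos (seed_mutation form pos k u)"
      using reachable_mutation[OF reachable_refl, of form pos k "seed_mutation form pos k u"] involutive step R by simp
    then show ?case using step reachable_trans by blast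
  qed
  then show ?thesis using R s reachable_trans by blast
qed

end

section \<open>Rolling an acyclic seed to the far left\<close>

context coherent begin

lemma acyc_form:
  assumes s: "s \<in> R" and a: "acyc s x y z" and ij: "i \<noteq> j"
  shows "form (fst s i) (fst s j) \<le> 0"
proof -
  have ne: "x \<noteq> y" "y \<noteq> z" "x \<noteq> z" and e: "eul (fst s x) (fst s y) = 0" "eul (fst s x) (fst s z) = 0" "eul (fst s y) (fst s z) = 0"
    and b: "snd s $ x $ y \<ge> 0" "snd s $ x $ z \<ge> 0" "snd s $ y $ z \<ge> 0" using a by (auto simp: acyc_def exceptional_def)
  have f: "form (fst s x) (fst s y) \<le> 0" "form (fst s x) (fst s z) \<le> 0" "form (fst s y) (fst s z) \<le> 0"
    using eul_zero_B(1)[OF s] e b by simp_all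
  moreover have "form (fst s y) (fst s x) \<le> 0" "form (fst s z) (fst s x) \<le> 0" "form (fst s z) (fst s y) \<le> 0"
    using f form_sym by metis+
  ultimately show ?thesis using three_cases[OF ne, of i] three_cases[OF ne, of j] ij by metis
qed

text \<open>Where a negative vector precedes a positive one, the sign rule forces the weight between two
  neighbours to vanish, and these may be exchanged.\<close>

lemma acyc_normal:
  assumes s: "s \<in> R" and a: "acyc s i j k" and p: "pos (fst s l)"
  shows "\<exists>x y z. acyc s x y z \<and> pos (fst s x) \<and> ((\<exists>l. \<not> pos (fst s l)) \<longrightarrow> \<not> pos (fst s z))"
proof -
  have e: "exceptional s i j k" and b: "snd s $ i $ j \<ge> 0" "snd s $ i $ k \<ge> 0" "snd s $ j $ k \<ge> 0"
    using a by (auto simp: acyc_def)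
  have ne: "i \<noteq> j" "j \<noteq> k" "i \<noteq> k" and z: "eul (fst s i) (fst s j) = 0" "eul (fst s i) (fst s k) = 0" "eul (fst s j) (fst s k) = 0"
    using e by (auto simp: exceptional_def)
  have sw: "snd s $ j $ i = - (snd s $ i $ j)" "snd s $ k $ i = - (snd s $ i $ k)" "snd s $ k $ j = - (snd s $ j $ k)"
    using skewD[OF skew[OF s]] by blast+
  have B0: "snd s $ a $ b = 0" if "eul (fst s a) (fst s b) = 0" "snd s $ a $ b \<ge> 0" "a \<noteq> b" "\<not> pos (fst s a)" "pos (fst s b)" for a b
    using rule_form[OF s that(3,2)] eul_zero_B(1)[OF s that(1)] that(4,5) by simp
  note c = three_cases[OF ne]
  consider "pos (fst s i)" "\<not> pos (fst s k)" | "pos (fst s i)" "pos (fst s j)" "pos (fst s k)"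
    | "pos (fst s i)" "\<not> pos (fst s j)" "pos (fst s k)"
    | "\<not> pos (fst s i)" "pos (fst s j)" "\<not> pos (fst s k)" | "\<not> pos (fst s i)" "pos (fst s j)" "pos (fst s k)"
    | "\<not> pos (fst s i)" "\<not> pos (fst s j)" "pos (fst s k)" | "\<not> pos (fst s i)" "\<not> pos (fst s j)" "\<not> pos (fst s k)" by blast
  then show ?thesis
  proof cases
    case 1 then show ?thesis using a by blast
  next
    case 2
    then have "pos (fst s l)" for l using c[of l] by auto
    then show ?thesis using a by blast
  next
    case 3
    then have "snd s $ j $ k = 0" using B0[of j k] z b ne by blast
    then have "acyc s i k j" using exceptional_swap(2)[OF s e] b sw by (simp add: acyc_def)
    then show ?thesis using 3 by blast
  next
    case 4
    then have "snd s $ i $ j = 0" using B0[of i j] z b ne by blast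
    then have "acyc s j i k" using exceptional_swap(1)[OF s e] b sw by (simp add: acyc_def)
    then show ?thesis using 4 by blast
  next
    case 5
    then have "snd s $ i $ j = 0" "snd s $ i $ k = 0" using B0[of i j] B0[of i k] z b ne by blast+
    then show ?thesis using isolatedI[OF s ne] by blast
  next
    case 6
    then have "snd s $ i $ k = 0" "snd s $ j $ k = 0" using B0[of i k] B0[of j k] z b ne by blast+
    then have "snd s $ k $ i = 0" "snd s $ k $ j = 0" using sw by simp_all
    then show ?thesis using isolatedI[OF s, of k i j] ne by metis
  next
    case 7 then show ?thesis using c[of l] p by metis
  qed
qed

end

context affine_coherent begin

lemma affine_opposite: "affine_coherent pos (opposite ` R) (\<lambda>x y. - om x y)"
  unfolding affine_coherent_def affine_coherent_axioms_def using coherent_opposite pos_const by blast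

lemma const_nonzero: "const_one \<noteq> 0" "\<not> pos const_one"
  using pos_minus[of "- const_one"] pos_const by (auto simp: const_one_def zero_prod_def)

lemma sum3_zero:
  assumes "s \<in> R" "(\<Sum>i\<in>UNIV. c i *\<^sub>R fst s i) = 0" shows "c i = 0"
  using basis[OF assms(1)] assms(2) unfolding basis3_def by blast

text \<open>Perron and Frobenius: replacing the coefficients of the isotropic vector by their absolute values
  does not increase the form, so that the new vector is isotropic as well.\<close>

lemma const_coefficients:
  assumes s: "s \<in> R" and np: "\<And>i j. i \<noteq> j \<Longrightarrow> affine_form (fst s i) (fst s j) \<le> 0"
    and mu: "const_one = (\<Sum>i\<in>UNIV. mu i *\<^sub>R fst s i)"
  shows "(\<forall>i. mu i > 0) \<or> (\<forall>i. mu i < 0)"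
proof -
  define u where "u = (\<Sum>i\<in>UNIV. \<bar>mu i\<bar> *\<^sub>R fst s i)"
  have fs: "affine_form (\<Sum>i\<in>UNIV. a i *\<^sub>R w i) y = (\<Sum>i\<in>UNIV. a i * affine_form (w i) y)" for a y and w :: "3 \<Rightarrow> affine_fun"
    unfolding sum_3 by (simp add: form_simps)
  have fs2: "affine_form y (\<Sum>i\<in>UNIV. a i *\<^sub>R w i) = (\<Sum>i\<in>UNIV. a i * affine_form y (w i))" for a y and w :: "3 \<Rightarrow> affine_fun"
    unfolding sum_3 by (simp add: form_simps)
  have "affine_form u u = (\<Sum>i\<in>UNIV. \<Sum>j\<in>UNIV. \<bar>mu i\<bar> * (\<bar>mu j\<bar> * affine_form (fst s j) (fst s i)))"
    unfolding u_def fs fs2 by (simp only: sum_distrib_left)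
  also have "\<dots> \<le> (\<Sum>i\<in>UNIV. \<Sum>j\<in>UNIV. mu i * (mu j * affine_form (fst s j) (fst s i)))"
  proof (intro sum_mono)
    fix i j :: 3
    have *: "\<bar>mu i\<bar> * \<bar>mu j\<bar> * f \<le> mu i * mu j * f" if "f \<le> 0" for f
      using that abs_ge_self[of "mu i * mu j"] unfolding abs_mult[symmetric] by (rule mult_right_mono_neg[rotated])
    show "\<bar>mu i\<bar> * (\<bar>mu j\<bar> * affine_form (fst s j) (fst s i)) \<le> mu i * (mu j * affine_form (fst s j) (fst s i))"
    proof (cases "i = j")
      case True then show ?thesis by (simp flip: mult.assoc)
    next
      case False then show ?thesis using *[OF np[OF False[symmetric]]] by (simp add: mult.assoc)
    qed
  qed
  also have "\<dots> = affine_form const_one const_one" unfolding mu fs fs2 by (simp only: sum_distrib_left)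
  finally have "affine_form u u \<le> 0" by (simp add: form_const)
  then have "fst u = 0" by (metis affine_form_def inner_eq_zero_iff inner_ge_zero order_antisym)
  then have u: "u = snd u *\<^sub>R const_one" by (simp add: const_one_def prod_eq_iff)
  have "(\<Sum>i\<in>UNIV. (\<bar>mu i\<bar> - snd u * mu i) *\<^sub>R fst s i) = u - snd u *\<^sub>R (\<Sum>i\<in>UNIV. mu i *\<^sub>R fst s i)"
    unfolding u_def sum_3 by (simp add: algebra_simps)
  also have "\<dots> = 0" unfolding mu[symmetric] using u by simp
  finally have k: "\<bar>mu i\<bar> = snd u * mu i" for i using sum3_zero[OF s, where c = "\<lambda>i. \<bar>mu i\<bar> - snd u * mu i"] by simp
  have nz: "\<exists>i. mu i \<noteq> 0"
  proof (rule ccontr)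
    assume "\<nexists>i. mu i \<noteq> 0"
    then have "mu i = 0" for i by blast
    then show False using mu const_nonzero(1) by simp
  qed
  then have kn: "snd u \<noteq> 0" using k by (metis abs_eq_0 mult_zero_left)
  have adj: "mu j = 0" if "mu i = 0" "affine_form (fst s i) (fst s j) \<noteq> 0" for i j
  proof -
    have "0 = affine_form (fst s i) u" by (subst u) (simp add: form_simps form_const)
    also have "\<dots> = (\<Sum>l\<in>UNIV. \<bar>mu l\<bar> * affine_form (fst s i) (fst s l))" unfolding u_def fs2 ..
    finally have "(\<Sum>l\<in>UNIV. - (\<bar>mu l\<bar> * affine_form (fst s i) (fst s l))) = 0" by (simp add: sum_negf)
    moreover have "0 \<le> - (\<bar>mu l\<bar> * affine_form (fst s i) (fst s l))" for l
    proof (cases "l = i")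
      case False
      then show ?thesis using np[of i l] by (simp add: mult_le_0_iff)
    qed (use that(1) in simp)
    ultimately have "- (\<bar>mu j\<bar> * affine_form (fst s i) (fst s j)) = 0" by (subst (asm) sum_nonneg_eq_0_iff) auto
    then show ?thesis using that(2) by simp
  qed
  have all: "mu i \<noteq> 0" for i
  proof
    assume i: "mu i = 0"
    have nb: "\<exists>j. i \<noteq> j \<and> affine_form (fst s i) (fst s j) \<noteq> 0" for i
    proof -
      obtain j where j: "snd s $ i $ j \<noteq> 0" using conn[OF s, of i] unfolding isolated_def by blast
      then have "i \<noteq> j" using skew0[OF skew[OF s], of i] by auto
      then show ?thesis using weight_le_2[OF s, of i j] j by auto
    qed
    obtain j where j: "i \<noteq> j" "affine_form (fst s i) (fst s j) \<noteq> 0" using nb by blast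
    have mj: "mu j = 0" using adj[OF i j(2)] .
    obtain k where k: "j \<noteq> k" "i \<noteq> k" using distinct3_ex j(1) three_cases by metis
    obtain l where l: "k \<noteq> l" "affine_form (fst s k) (fst s l) \<noteq> 0" using nb by blast
    have "mu l = 0" using three_cases[OF j(1) k, of l] l(1) i mj by blast
    then have "mu k = 0" using adj[of l k] l(2) form_sym by metis
    then show False using nz three_cases[OF j(1) k] i mj by metis
  qed
  show ?thesis
  proof (cases "snd u > 0")
    case True
    have "mu i > 0" for i using k[of i] all[of i] True by (metis abs_ge_zero linorder_neqE_linordered_idom mult_less_cancel_left_pos mult_zero_right not_less)
    then show ?thesis by blast
  next
    case False
    then have "snd u < 0" using kn by simp
    then have "mu i < 0" for i using k[of i] all[of i] by (metis abs_ge_zero linorder_neqE_linordered_idom mult_neg_pos not_less)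
    then show ?thesis by blast
  qed
qed

text \<open>The coefficients \<open>xi\<close> measure the position of a seed: their sum is an affine function of the
  translation, whereas \<open>mu\<close> is invariant under translation and rolling.\<close>

definition coords :: "(3, affine_fun) labelled_seed \<Rightarrow> (3 \<Rightarrow> real) \<Rightarrow> (3 \<Rightarrow> real) \<Rightarrow> bool" where
  "coords s mu xi \<longleftrightarrow> const_one = (\<Sum>i\<in>UNIV. mu i *\<^sub>R fst s i) \<and> (dir, 0) = (\<Sum>i\<in>UNIV. xi i *\<^sub>R fst s i)"

lemma coords_exist: "s \<in> R \<Longrightarrow> \<exists>mu xi. coords s mu xi"
  using basis unfolding coords_def basis3_def by blast

lemma form_dir: "affine_form f (dir, 0) = slope f"
  by (simp add: affine_form_def slope_dir)

lemma coords_act: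
  assumes r: "r \<in> R" "act t r \<in> R" and c: "coords r mu xi" "coords (act t r) mu xi'"
  shows "sum xi' UNIV = sum xi UNIV + t * (dir \<bullet> dir * sum mu UNIV)"
proof -
  have sd: "slope (dir, 0) = dir \<bullet> dir" by (simp add: slope_dir)
  have "(\<Sum>i\<in>UNIV. (xi' i - xi i - t * (dir \<bullet> dir) * mu i) *\<^sub>R fst (act t r) i)
     = (\<Sum>i\<in>UNIV. xi' i *\<^sub>R fst (act t r) i) - (\<Sum>i\<in>UNIV. xi i *\<^sub>R fst (act t r) i)
       - (t * (dir \<bullet> dir)) *\<^sub>R (\<Sum>i\<in>UNIV. mu i *\<^sub>R fst (act t r) i)"
    unfolding sum_3 by (simp add: algebra_simps)
  also have "(\<Sum>i\<in>UNIV. xi i *\<^sub>R fst (act t r) i) = shift t (\<Sum>i\<in>UNIV. xi i *\<^sub>R fst r i)"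
    unfolding sum_3 by (simp add: shift.act_def shift.Phi_add shift.Phi_scale)
  also have "\<dots> = (dir, 0) - (t * (dir \<bullet> dir)) *\<^sub>R const_one"
    using c(1) sd by (simp add: coords_def shift_def flip: sd)
  finally have "(\<Sum>i\<in>UNIV. (xi' i - xi i - t * (dir \<bullet> dir) * mu i) *\<^sub>R fst (act t r) i) = 0"
    using c(2) by (simp add: coords_def)
  then have "xi' i - xi i - t * (dir \<bullet> dir) * mu i = 0" for i
    using sum3_zero[OF r(2), where c = "\<lambda>i. xi' i - xi i - t * (dir \<bullet> dir) * mu i"] by simp
  then have "xi' i = xi i + t * (dir \<bullet> dir) * mu i" for i by (simp add: algebra_simps)
  then show ?thesis by (simp add: sum.distrib sum_distrib_left mult.assoc)
qed

text \<open>If all vectors were negative, the constant function would be positive; therefore there is a positive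
  source. Rolling it over increases the position by minus twice a coefficient.\<close>

lemma roll_step:
  assumes s: "s \<in> R" and a: "acyc s i j k" and c: "coords s mu xi" and neg: "\<And>l. mu l < 0"
  shows "\<exists>t\<in>R. (\<exists>i j k. acyc t i j k) \<and> (\<exists>xi' x. coords t mu xi' \<and> sum xi' UNIV = sum xi UNIV - 2 * mu x)"
proof -
  have "\<exists>l. pos (fst s l)"
  proof (rule ccontr)
    assume "\<nexists>l. pos (fst s l)"
    then have p: "pos (- fst s l)" for l using neg_iff[OF s] by blast
    have "pos ((- mu 1) *\<^sub>R - fst s 1 + (- mu 2) *\<^sub>R - fst s 2 + (- mu 3) *\<^sub>R - fst s 3)"
      using p neg by (intro pos_add pos_scale) simp_all
    then have "pos const_one" using c by (simp add: coords_def sum_3)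
    then show False using const_nonzero by blast
  qed
  then obtain x y z where a: "acyc s x y z" and px: "pos (fst s x)" using acyc_normal[OF s a] by blast
  let ?t = "seed_mutation affine_form pos x s"
  define A C where "A = snd s $ x $ y" and "C = snd s $ x $ z"
  note r = acyc_roll[OF s a px, folded A_def C_def]
  have ne: "x \<noteq> y" "y \<noteq> z" "x \<noteq> z" and e: "eul (fst s x) (fst s y) = 0" "eul (fst s x) (fst s z) = 0"
    using a by (auto simp: acyc_def exceptional_def)
  note st = sum_three[OF ne]
  have mu: "const_one = mu x *\<^sub>R fst s x + mu y *\<^sub>R fst s y + mu z *\<^sub>R fst s z"
    and xi: "(dir, 0) = xi x *\<^sub>R fst s x + xi y *\<^sub>R fst s y + xi z *\<^sub>R fst s z"
    using c by (simp_all add: coords_def st)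
  have f: "affine_form (fst s x) (fst s y) = - A" "affine_form (fst s x) (fst s z) = - C"
    using eul_zero_B(1)[OF s] e by (simp_all add: A_def C_def)
  have "affine_form (fst s x) const_one = 2 * mu x - A * mu y - C * mu z"
    unfolding mu by (simp add: form_simps norm[OF s] f algebra_simps)
  then have m: "2 * mu x = A * mu y + C * mu z" by (simp add: form_const)
  have "slope (fst s x) = A * mu y + C * mu z"
    unfolding slope_def mu by (simp add: om_simps om_B[OF s] skew0[OF skew[OF s]] A_def C_def)
  moreover have "affine_form (fst s x) (dir, 0) = 2 * xi x - A * xi y - C * xi z"
    unfolding xi by (simp add: form_simps norm[OF s] f algebra_simps)
  ultimately have q: "2 * xi x - A * xi y - C * xi z = 2 * mu x" using m by (simp add: form_dir)
  define xi' where "xi' = xi(x := xi x - 2 * mu x)"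
  have xs: "xi' x = xi x - 2 * mu x" "xi' y = xi y" "xi' z = xi z" using ne by (simp_all add: xi'_def)
  have 1: "mu x *\<^sub>R - fst s x + mu y *\<^sub>R (fst s y + A *\<^sub>R fst s x) + mu z *\<^sub>R (fst s z + C *\<^sub>R fst s x)
    = (A * mu y + C * mu z - mu x) *\<^sub>R fst s x + mu y *\<^sub>R fst s y + mu z *\<^sub>R fst s z" by (simp add: algebra_simps)
  have "A * mu y + C * mu z - mu x = mu x" using m by simp
  note 1 = 1[unfolded this]
  have 2: "xi' x *\<^sub>R - fst s x + xi' y *\<^sub>R (fst s y + A *\<^sub>R fst s x) + xi' z *\<^sub>R (fst s z + C *\<^sub>R fst s x)
    = (A * xi y + C * xi z - xi' x) *\<^sub>R fst s x + xi y *\<^sub>R fst s y + xi z *\<^sub>R fst s z"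
    unfolding xs(2,3) by (simp add: algebra_simps)
  have "A * xi y + C * xi z - xi' x = xi x" using q xs by simp
  note 2 = 2[unfolded this]
  have "coords ?t mu xi'" unfolding coords_def st r(2-4) 1 2 using mu xi by blast
  moreover have "sum xi' UNIV = sum xi UNIV - 2 * mu x" by (simp add: st xs)
  ultimately show ?thesis using r(1,5) by blast
qed

text \<open>The positions of the rolled seeds are unbounded, whereas there are finitely many types.\<close>

lemma roll_far:
  assumes fin: "finite (snd ` R)" and s: "s \<in> R" and a: "acyc s i j k" and c: "coords s mu xi" and neg: "\<And>l. mu l < 0"
  shows "\<exists>r\<in>R. (\<exists>i j k. acyc r i j k) \<and> (\<forall>M. \<exists>t<M. act t r \<in> R)"
proof -
  \<comment> \<open>a lower bound for the change of position in each roll\<close>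
  define d where "d = Min (range (\<lambda>l. - 2 * mu l))"
  have d: "d > 0" "d \<le> - 2 * mu l" for l using neg by (auto simp: d_def)
  have "\<exists>t\<in>R. (\<exists>i j k. acyc t i j k) \<and> (\<exists>xi'. coords t mu xi' \<and> sum xi' UNIV \<ge> sum xi UNIV + real n * d)" for n
  proof (induction n)
    case 0 show ?case using s a c by auto
  next
    case (Suc n)
    then obtain t i j k xi1 where t: "t \<in> R" "acyc t i j k" "coords t mu xi1" "sum xi1 UNIV \<ge> sum xi UNIV + real n * d" by blast
    obtain t' xi' x where t': "t' \<in> R" "\<exists>i j k. acyc t' i j k" "coords t' mu xi'" "sum xi' UNIV = sum xi1 UNIV - 2 * mu x"
      using roll_step[OF t(1,2,3) neg] by blast
    have "sum xi' UNIV \<ge> sum xi UNIV + real (Suc n) * d" using t(4) t'(4) d(2)[of x] by (simp add: algebra_simps)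
    then show ?case using t'(1,2,3) by blast
  qed
  then obtain f xis where f: "\<And>n. f n \<in> R" "\<And>n. \<exists>i j k. acyc (f n) i j k" "\<And>n. coords (f n) mu (xis n)"
    "\<And>n. sum (xis n) UNIV \<ge> sum xi UNIV + real n * d" by metis
  have "finite ((\<lambda>n. linear_type (f n)) ` UNIV)" by (rule finite_subset[OF _ finite_types[OF fin]]) (use f(1) in auto)
  from pigeonhole_infinite[OF infinite_UNIV_nat this]
  obtain n0 where n0: "infinite {n. linear_type (f n) = linear_type (f n0)}" by auto
  have "\<exists>t<M. act t (f n0) \<in> R" for M
  proof -
    define K where "K = dir \<bullet> dir * sum mu UNIV"
    have "dir \<bullet> dir > 0" using dir_nonzero[OF s] by simp
    moreover have "sum mu UNIV < 0" using neg by (simp add: sum_3 add_neg_neg)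
    ultimately have K: "K < 0" unfolding K_def by (simp add: mult_pos_neg)
    obtain N where N: "(sum (xis n0) UNIV + M * K - sum xi UNIV) / d < real N" using reals_Archimedean2 by blast
    obtain n where n: "n > N" "linear_type (f n) = linear_type (f n0)"
      using n0 unfolding infinite_nat_iff_unbounded by blast
    obtain t where t: "f n = act t (f n0)" using same_linear_type[OF f(1) f(1) n(2)] by blast
    have "act t (f n0) \<in> R" using f(1)[of n] t by simp
    moreover have "sum (xis n) UNIV = sum (xis n0) UNIV + t * K"
      unfolding K_def by (rule coords_act[OF f(1) _ f(3)]) (use f(1,3)[of n] t in auto)
    moreover have "sum (xis n0) UNIV + M * K - sum xi UNIV < real n * d"
    proof -
      have "sum (xis n0) UNIV + M * K - sum xi UNIV < real N * d" using N d(1) by (simp add: field_simps)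
      also have "\<dots> \<le> real n * d" using n(1) d(1) by simp
      finally show ?thesis .
    qed
    ultimately have "M * K < t * K" using f(4)[of n] by linarith
    then have "t < M" using K by (simp add: mult_less_cancel_right)
    then show ?thesis using \<open>act t (f n0) \<in> R\<close> by blast
  qed
  then show ?thesis using f(1,2) by blast
qed

end

section \<open>Normal seeds of a translation invariant world\<close>

context coherent begin

lemma reflect_after:
  assumes s: "s \<in> R" and il: "i \<noteq> l" and z: "eul (fst s l) (fst s i) = 0 \<or> eul (fst s i) (fst s l) = 0"
  shows "pos (fst s l) \<Longrightarrow> snd s $ l $ i \<ge> 0 \<Longrightarrow> eul (fst s l) (fst s i) = 0 \<Longrightarrow>
      fst (seed_mutation form pos l s) i = fst s i + (snd s $ l $ i) *\<^sub>R fst s l \<and>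
      reflect (fst (seed_mutation form pos l s) i) = reflect (fst s l) \<circ> reflect (fst s i) \<circ> reflect (fst s l)"
    "\<not> pos (fst s l) \<Longrightarrow> snd s $ i $ l \<ge> 0 \<Longrightarrow> eul (fst s i) (fst s l) = 0 \<Longrightarrow>
      fst (seed_mutation form pos l s) i = fst s i + (snd s $ i $ l) *\<^sub>R fst s l \<and>
      reflect (fst (seed_mutation form pos l s) i) = reflect (fst s l) \<circ> reflect (fst s i) \<circ> reflect (fst s l)"
    "pos (fst s l) \<Longrightarrow> snd s $ l $ i \<le> 0 \<Longrightarrow> fst (seed_mutation form pos l s) i = fst s i"
    "\<not> pos (fst s l) \<Longrightarrow> snd s $ i $ l \<le> 0 \<Longrightarrow> fst (seed_mutation form pos l s) i = fst s i"
proof -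
  have sw: "snd s $ i $ l = - (snd s $ l $ i)" by (rule skewD[OF skew[OF s]])
  note m = mutation_vec[OF s il]
  note rc = reflect_conj[OF norm[OF s, of l], of "fst s i"]
  { assume a: "pos (fst s l)" "snd s $ l $ i \<ge> 0" "eul (fst s l) (fst s i) = 0"
    have f: "form (fst s i) (fst s l) = - (snd s $ l $ i)"
      using eul_zero_B(1)[OF s a(3)] form_sym[of "fst s i" "fst s l"] by simp
    have e: "fst (seed_mutation form pos l s) i = fst s i + (snd s $ l $ i) *\<^sub>R fst s l"
      using m a by (simp add: sw)
    show "fst (seed_mutation form pos l s) i = fst s i + (snd s $ l $ i) *\<^sub>R fst s l \<and>
      reflect (fst (seed_mutation form pos l s) i) = reflect (fst s l) \<circ> reflect (fst s i) \<circ> reflect (fst s l)"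
      using rc unfolding e f by simp }
  { assume a: "\<not> pos (fst s l)" "snd s $ i $ l \<ge> 0" "eul (fst s i) (fst s l) = 0"
    have f: "form (fst s i) (fst s l) = - (snd s $ i $ l)" by (rule eul_zero_B(1)[OF s a(3)])
    have e: "fst (seed_mutation form pos l s) i = fst s i + (snd s $ i $ l) *\<^sub>R fst s l"
      using m a by simp
    show "fst (seed_mutation form pos l s) i = fst s i + (snd s $ i $ l) *\<^sub>R fst s l \<and>
      reflect (fst (seed_mutation form pos l s) i) = reflect (fst s l) \<circ> reflect (fst s i) \<circ> reflect (fst s l)"
      using rc unfolding e f by simp }
  show "pos (fst s l) \<Longrightarrow> snd s $ l $ i \<le> 0 \<Longrightarrow> fst (seed_mutation form pos l s) i = fst s i"
    using il by (simp add: fst_mutation sw)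
  show "\<not> pos (fst s l) \<Longrightarrow> snd s $ i $ l \<le> 0 \<Longrightarrow> fst (seed_mutation form pos l s) i = fst s i"
    using il by (simp add: fst_mutation)
qed

end

text \<open>The world as seen from a reference point at infinity in the direction of the translations.\<close>

locale uniform_coherent = affine_coherent pos R om for pos R om +
  assumes pos_shift: "pos (shift t f) = pos f"
begin

text \<open>A seed with three positive vectors would make a multiple of the constant function a positive
  combination of its vectors; shifting one of them gives that multiple the wrong sign.\<close>

lemma not_all_same:
  assumes s: "s \<in> R" shows "\<exists>i. pos (fst s i)" "\<exists>i. \<not> pos (fst s i)"
proof -
  have False if e: "e = 1 \<or> e = -1" and p: "\<And>i. pos (e *\<^sub>R fst s i)" for e :: real
  proof -
    have same: "pos (fst s i) = (e = 1)" for i using e p[of i] neg_iff[OF s, of i] by auto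
    have np: "affine_form (fst s i) (fst s j) \<le> 0" if ij: "i \<noteq> j" for i j
    proof (cases "snd s $ i $ j \<ge> 0")
      case True then show ?thesis using rule_form[OF s ij True] same by simp
    next
      case False
      then have "snd s $ j $ i \<ge> 0" using skewD[OF skew[OF s], of i j] by simp
      then show ?thesis using rule_form[OF s ij[symmetric]] same form_sym[of "fst s i" "fst s j"] by simp
    qed
    obtain mu xi where mu: "const_one = (\<Sum>i\<in>UNIV. mu i *\<^sub>R fst s i)"
      using coords_exist[OF s] unfolding coords_def by blast
    obtain f :: real where f: "f = 1 \<or> f = -1" "\<And>i. f * mu i > 0"
    proof -
      consider "\<forall>i. mu i > 0" | "\<forall>i. mu i < 0" using const_coefficients[OF s np mu] by blast
      then show ?thesis
      proof cases
        case 1 then show ?thesis by (intro that[of 1]) auto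
      next
        case 2 then show ?thesis by (intro that[of "-1"]) auto
      qed
    qed
    obtain l where l: "slope (fst s l) \<noteq> 0" using slope_nonzero[OF s] by blast
    obtain j k where jk: "l \<noteq> j" "j \<noteq> k" "l \<noteq> k" using distinct3_ex by blast
    \<comment> \<open>shifting the vector number \<open>l\<close> by \<open>t\<close> adds twice the constant function to the combination\<close>
    define t where "t = - 2 / (f * mu l * (e * slope (fst s l)))"
    have nz: "f * mu l * (e * slope (fst s l)) \<noteq> 0" using f(2)[of l] l e by auto
    have "(f * mu l) *\<^sub>R shift t (e *\<^sub>R fst s l) = (f * mu l) *\<^sub>R (e *\<^sub>R fst s l) + 2 *\<^sub>R const_one"
    proof -
      have "(f * mu l) * - (t * (e * slope (fst s l))) = - t * (f * mu l * (e * slope (fst s l)))" by simp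
      also have "\<dots> = 2" using nz unfolding t_def by simp
      finally have 2: "(f * mu l) * (t * (e * slope (fst s l))) = - 2" by simp
      show ?thesis unfolding shift_def slope_simps scaleR_diff_right scaleR_scaleR[of "f * mu l" "t * (e * slope (fst s l))"] 2 by simp
    qed
    then have "(f * mu l) *\<^sub>R shift t (e *\<^sub>R fst s l) + (f * mu j) *\<^sub>R (e *\<^sub>R fst s j) + (f * mu k) *\<^sub>R (e *\<^sub>R fst s k)
      = (f * e) *\<^sub>R (mu l *\<^sub>R fst s l + mu j *\<^sub>R fst s j + mu k *\<^sub>R fst s k) + 2 *\<^sub>R const_one"
      by (simp add: algebra_simps)
    also have "\<dots> = (f * e) *\<^sub>R const_one + 2 *\<^sub>R const_one" using mu unfolding sum_three[OF jk] by simp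
    also have "\<dots> = (f * e + 2) *\<^sub>R const_one" by (simp add: scaleR_add_left)
    finally have q: "pos ((f * e + 2) *\<^sub>R const_one)"
      using p f(2) pos_shift by (metis (no_types, lifting) pos_add pos_scale)
    have k: "f * e + 2 > 0" using e f(1) by auto
    have "pos (inverse (f * e + 2) *\<^sub>R ((f * e + 2) *\<^sub>R const_one))" by (rule pos_scale[OF _ q]) (use k in simp)
    moreover have "inverse (f * e + 2) *\<^sub>R ((f * e + 2) *\<^sub>R const_one) = const_one" using k by simp
    ultimately show False using const_nonzero(2) by metis
  qed
  note F = this
  show "\<exists>i. pos (fst s i)" using F[of "-1"] neg_iff[OF s] by auto
  show "\<exists>i. \<not> pos (fst s i)" using F[of 1] by auto
qed

lemma mixed:
  assumes s: "s \<in> R" and ne: "i \<noteq> j" "j \<noteq> k" "i \<noteq> k"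
  shows "\<not> pos (fst s j) \<Longrightarrow> \<not> pos (fst s k) \<Longrightarrow> pos (fst s i)"
    "pos (fst s j) \<Longrightarrow> pos (fst s k) \<Longrightarrow> \<not> pos (fst s i)"
  using not_all_same[OF s] three_cases[OF ne] by metis+

text \<open>In an order of this form mutations are braid moves: at the first vector of a cyclic seed they
  perform \<open>braid1\<close>, at the last one the inverse of \<open>braid2\<close>, and at the middle one \<open>braid2\<close> or the inverse
  of \<open>braid1\<close>, according to its sign. The mutated order is again of this form.\<close>

definition normal :: "(3, affine_fun) labelled_seed \<Rightarrow> 3 \<Rightarrow> 3 \<Rightarrow> 3 \<Rightarrow> bool" where
  "normal s x y z \<longleftrightarrow> s \<in> R \<and> exceptional s x y z \<and> pos (fst s x) \<and> \<not> pos (fst s z) \<and>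
     snd s $ x $ y \<ge> 0 \<and> snd s $ y $ z \<ge> 0"

context
  fixes s x y z
  assumes n: "normal s x y z"
begin

lemma normalD: "s \<in> R" "exceptional s x y z" "pos (fst s x)" "\<not> pos (fst s z)"
    "snd s $ x $ y \<ge> 0" "snd s $ y $ z \<ge> 0" "x \<noteq> y" "y \<noteq> z" "x \<noteq> z"
    "eul (fst s x) (fst s y) = 0" "eul (fst s x) (fst s z) = 0" "eul (fst s y) (fst s z) = 0"
    "eul (fst s y) (fst s x) = - (snd s $ x $ y)" "eul (fst s z) (fst s x) = - (snd s $ x $ z)"
    "eul (fst s z) (fst s y) = - (snd s $ y $ z)"
    "snd s $ y $ x = - (snd s $ x $ y)" "snd s $ z $ x = - (snd s $ x $ z)" "snd s $ z $ y = - (snd s $ y $ z)"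
proof -
  show s: "s \<in> R" and "exceptional s x y z" "pos (fst s x)" "\<not> pos (fst s z)"
    "snd s $ x $ y \<ge> 0" "snd s $ y $ z \<ge> 0" using n by (auto simp: normal_def)
  then show "x \<noteq> y" "y \<noteq> z" "x \<noteq> z" and z: "eul (fst s x) (fst s y) = 0" "eul (fst s x) (fst s z) = 0" "eul (fst s y) (fst s z) = 0"
    by (auto simp: exceptional_def)
  show "eul (fst s y) (fst s x) = - (snd s $ x $ y)" "eul (fst s z) (fst s x) = - (snd s $ x $ z)"
    "eul (fst s z) (fst s y) = - (snd s $ y $ z)" using eul_zero_B(2)[OF s] z by blast+
  show "snd s $ y $ x = - (snd s $ x $ y)" "snd s $ z $ x = - (snd s $ x $ z)" "snd s $ z $ y = - (snd s $ y $ z)"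
    using skewD[OF skew[OF s]] by blast+
qed

lemmas eul_normal = eul_add eul_scale eul_minus eul_self[OF normalD(1)] normalD(10-15)

lemma ne_sym: "y \<noteq> x" "z \<noteq> y" "z \<noteq> x" using normalD by auto

lemma mu_R: "seed_mutation affine_form pos l s \<in> R" by (rule closed[OF normalD(1)])

lemma mu_pos: "pos (fst (seed_mutation affine_form pos l s) l) = (\<not> pos (fst s l))"
  unfolding mutation_vec_self by (rule neg_iff[OF normalD(1)])

lemma mu_x_cyclic:
  assumes c: "snd s $ x $ z \<le> 0"
  defines "t \<equiv> seed_mutation affine_form pos x s"
  shows "normal t y x z \<and> triple t y x z = braid1 (triple s x y z)"
proof -
  have tx: "fst t x = - fst s x" unfolding t_def by (rule mutation_vec_self)
  have ty: "fst t y = fst s y + (snd s $ x $ y) *\<^sub>R fst s x"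
    "reflect (fst t y) = reflect (fst s x) \<circ> reflect (fst s y) \<circ> reflect (fst s x)"
    unfolding t_def using reflect_after(1)[OF normalD(1) ne_sym(1)] normalD by blast+
  have tz: "fst t z = fst s z" unfolding t_def using reflect_after(3)[OF normalD(1) ne_sym(3)] normalD c by blast
  have px: "\<not> pos (fst t x)" "\<not> pos (fst t z)" using mu_pos[of x] normalD(3,4) tz by (simp_all add: t_def)
  have py: "pos (fst t y)"
    by (rule mixed(1)[OF mu_R[of x, folded t_def] _ _ _ px]) (use normalD ne_sym in auto)
  have "exceptional t y x z" using ne_sym normalD(7-9) by (simp add: exceptional_def tx ty tz eul_normal)
  moreover have "snd t $ y $ x \<ge> 0" "snd t $ x $ z \<ge> 0"
    using normalD(5,7-9,16) c by (simp_all add: t_def snd_mutation matrix_mutation_nth)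
  ultimately have "normal t y x z" using px py mu_R[of x] by (simp add: normal_def t_def)
  then show ?thesis by (simp add: triple_def tx ty(2) tz reflect_minus)
qed

lemma mu_z_cyclic:
  assumes c: "snd s $ x $ z \<le> 0"
  defines "t \<equiv> seed_mutation affine_form pos z s"
  shows "normal t x z y \<and> triple t x z y = braid2' (triple s x y z)"
proof -
  have tz: "fst t z = - fst s z" unfolding t_def by (rule mutation_vec_self)
  have ty: "fst t y = fst s y + (snd s $ y $ z) *\<^sub>R fst s z"
    "reflect (fst t y) = reflect (fst s z) \<circ> reflect (fst s y) \<circ> reflect (fst s z)"
    unfolding t_def using reflect_after(2)[OF normalD(1,8)] normalD by blast+
  have tx: "fst t x = fst s x" unfolding t_def using reflect_after(4)[OF normalD(1,9)] normalD c by blast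
  have px: "pos (fst t x)" "pos (fst t z)" using mu_pos[of z] normalD(3,4) tx by (simp_all add: t_def)
  have py: "\<not> pos (fst t y)"
    by (rule mixed(2)[OF mu_R[of z, folded t_def] _ _ _ px]) (use normalD ne_sym in auto)
  have "exceptional t x z y" using ne_sym normalD(7-9) by (simp add: exceptional_def tx ty tz eul_normal)
  moreover have "snd t $ z $ y \<ge> 0" "snd t $ x $ z \<ge> 0"
    using normalD(6,7-9,18) c by (simp_all add: t_def snd_mutation matrix_mutation_nth)
  ultimately have "normal t x z y" using px py mu_R[of z] by (simp add: normal_def t_def)
  then show ?thesis by (simp add: triple_def tx ty(2) tz reflect_minus)
qed

text \<open>The new first vector must be positive. Otherwise the second one is positive and orthogonal to it, and
  a mutation there either makes all vectors negative or violates the sign rule.\<close>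

lemma mu_x_acyclic:
  assumes c: "snd s $ x $ z \<ge> 0"
  defines "t \<equiv> seed_mutation affine_form pos x s"
  shows "normal t y z x \<and> snd t $ y $ x \<ge> 0 \<and> triple t y z x = braid2 (braid1 (triple s x y z))"
proof -
  have tx: "fst t x = - fst s x" unfolding t_def by (rule mutation_vec_self)
  have ty: "fst t y = fst s y + (snd s $ x $ y) *\<^sub>R fst s x"
    "reflect (fst t y) = reflect (fst s x) \<circ> reflect (fst s y) \<circ> reflect (fst s x)"
    unfolding t_def using reflect_after(1)[OF normalD(1) ne_sym(1)] normalD by blast+
  have tz: "fst t z = fst s z + (snd s $ x $ z) *\<^sub>R fst s x"
    "reflect (fst t z) = reflect (fst s x) \<circ> reflect (fst s z) \<circ> reflect (fst s x)"
    unfolding t_def using reflect_after(1)[OF normalD(1) ne_sym(3)] normalD c by blast+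
  have px: "\<not> pos (fst t x)" using mu_pos[of x] normalD(3) by (simp add: t_def)
  have tR: "t \<in> R" using mu_R by (simp add: t_def)
  have e: "exceptional t y z x" using ne_sym normalD(7-9) by (simp add: exceptional_def tx ty tz eul_normal)
  then have ez: "eul (fst t y) (fst t z) = 0" "eul (fst t y) (fst t x) = 0" "eul (fst t z) (fst t x) = 0" by (auto simp: exceptional_def)
  have B: "snd t $ y $ z = snd s $ y $ z" "snd t $ y $ x = snd s $ x $ y" "snd t $ z $ x = snd s $ x $ z"
    using normalD(5-9,16,17,18) c by (simp_all add: t_def snd_mutation matrix_mutation_nth)
  have py: "pos (fst t y)"
  proof (rule ccontr)
    assume y: "\<not> pos (fst t y)"
    then have z: "pos (fst t z)"
      by (intro mixed(1)[OF tR _ _ _ y px]) (use normalD ne_sym in auto)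
    have f: "affine_form (fst t y) (fst t z) = - (snd t $ y $ z)" by (rule eul_zero_B(1)[OF tR ez(1)])
    have 0: "snd t $ y $ z = 0"
      using rule_form[OF tR normalD(8)] f y z B normalD(6) by simp
    have a: "snd t $ y $ x > 0"
      using isolatedI[OF tR normalD(8) ne_sym(3,1)] 0 B normalD(5) by force
    \<comment> \<open>this mutation reflects the first vector but not the second one\<close>
    let ?u = "seed_mutation affine_form pos z t"
    have uR: "?u \<in> R" by (rule closed[OF tR])
    have uz: "\<not> pos (fst ?u z)" unfolding mutation_vec_self using neg_iff[OF tR] z by blast
    have zy0: "snd t $ z $ y = 0" using skewD[OF skew[OF tR], of y z] 0 by simp
    have uy: "fst ?u y = fst t y" using reflect_after(3)[OF tR normalD(8) _ z] ez zy0 by simp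
    have ux: "fst ?u x = fst t x + (snd t $ z $ x) *\<^sub>R fst t z"
      using reflect_after(1)[OF tR normalD(9) _ z] ez B c by simp
    have upx: "pos (fst ?u x)" by (rule mixed(1)[OF uR _ _ _ _ uz, of x y]) (use normalD ne_sym y uy in auto)
    have ub: "snd ?u $ y $ x = snd t $ y $ x"
      using normalD(7-9) zy0 0 by (simp add: snd_mutation matrix_mutation_nth)
    have "affine_form (fst ?u y) (fst ?u x) = snd t $ y $ x"
      using rule_form[OF uR ne_sym(1)] ub a y uy upx by simp
    moreover have "affine_form (fst ?u y) (fst ?u x) = - (snd t $ y $ x)"
      unfolding uy ux using f 0 eul_zero_B(1)[OF tR ez(2)] by (simp add: form_simps)
    ultimately show False using a by simp
  qed
  have "normal t y z x" using px py tR e B normalD(6) c by (simp add: normal_def)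
  moreover have "snd t $ y $ x \<ge> 0" using B normalD(5) by simp
  ultimately show ?thesis by (simp add: triple_def tx ty(2) tz(2) reflect_minus)
qed

text \<open>In the remaining two lemmas the weight between the outer vectors cannot have the wrong sign, because
  a further mutation would only change a sign and lead to three vectors of the same sign.\<close>

lemma mu_y_pos:
  assumes p: "pos (fst s y)"
  defines "t \<equiv> seed_mutation affine_form pos y s"
  shows "normal t x z y \<and> snd t $ x $ y \<le> 0 \<and> triple t x z y = braid2 (triple s x y z)"
proof -
  have ty: "fst t y = - fst s y" unfolding t_def by (rule mutation_vec_self)
  have tz: "fst t z = fst s z + (snd s $ y $ z) *\<^sub>R fst s y"
    "reflect (fst t z) = reflect (fst s y) \<circ> reflect (fst s z) \<circ> reflect (fst s y)"
    unfolding t_def using reflect_after(1)[OF normalD(1) ne_sym(2)] normalD p by blast+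
  have tx: "fst t x = fst s x" unfolding t_def using reflect_after(3)[OF normalD(1,7)] normalD(5,10,16) p by simp
  have tR: "t \<in> R" using mu_R by (simp add: t_def)
  have px: "pos (fst t x)" "\<not> pos (fst t y)" using mu_pos[of y] normalD(3) p tx by (simp_all add: t_def)
  have e: "exceptional t x z y" using ne_sym normalD(7-9) by (simp add: exceptional_def tx ty tz eul_normal)
  then have ez: "eul (fst t x) (fst t z) = 0" by (auto simp: exceptional_def)
  have B: "snd t $ x $ y = - (snd s $ x $ y)" "snd t $ z $ y = snd s $ y $ z"
    using normalD(7-9,18) by (simp_all add: t_def snd_mutation matrix_mutation_nth)
  have xz: "snd t $ x $ z \<ge> 0"
  proof (rule ccontr)
    assume "\<not> ?thesis"
    then have zx: "snd t $ z $ x > 0" using skewD[OF skew[OF tR], of x z] by simp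
    have "affine_form (fst t z) (fst t x) = snd t $ z $ x"
      using eul_zero_B(1)[OF tR ez] skewD[OF skew[OF tR], of x z] form_sym[of "fst t z" "fst t x"] by simp
    then have pz: "\<not> pos (fst t z)" using rule_form[OF tR ne_sym(3)] zx px by (auto split: if_splits)
    let ?u = "seed_mutation affine_form pos x t"
    have "fst ?u y = fst t y" using reflect_after(3)[OF tR ne_sym(1) _ px(1)] e B normalD(5) by (simp add: exceptional_def)
    moreover have "fst ?u z = fst t z"
      using reflect_after(3)[OF tR ne_sym(3) _ px(1)] e \<open>\<not> snd t $ x $ z \<ge> 0\<close> by (simp add: exceptional_def)
    ultimately have "pos (fst ?u x)"
      using mixed(1)[OF closed[OF tR] normalD(7,8,9)] px pz by metis
    then show False unfolding mutation_vec_self using neg_iff[OF tR] px(1) by blast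
  qed
  have "normal t x z y" using px tR e B normalD(6) xz by (simp add: normal_def)
  moreover have "snd t $ x $ y \<le> 0" using B normalD(5) by simp
  ultimately show ?thesis by (simp add: triple_def tx ty tz(2) reflect_minus)
qed

lemma mu_y_neg:
  assumes p: "\<not> pos (fst s y)"
  defines "t \<equiv> seed_mutation affine_form pos y s"
  shows "normal t y x z \<and> snd t $ y $ z \<le> 0 \<and> triple t y x z = braid1' (triple s x y z)"
proof -
  have ty: "fst t y = - fst s y" unfolding t_def by (rule mutation_vec_self)
  have tx: "fst t x = fst s x + (snd s $ x $ y) *\<^sub>R fst s y"
    "reflect (fst t x) = reflect (fst s y) \<circ> reflect (fst s x) \<circ> reflect (fst s y)"
    unfolding t_def using reflect_after(2)[OF normalD(1,7)] normalD p by blast+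
  have tz: "fst t z = fst s z" unfolding t_def using reflect_after(4)[OF normalD(1) ne_sym(2)] normalD(6,12,18) p by simp
  have tR: "t \<in> R" using mu_R by (simp add: t_def)
  have px: "pos (fst t y)" "\<not> pos (fst t z)" using mu_pos[of y] normalD(4) p tz by (simp_all add: t_def)
  have e: "exceptional t y x z" using ne_sym normalD(7-9) by (simp add: exceptional_def tx ty tz eul_normal)
  then have ez: "eul (fst t x) (fst t z) = 0" by (auto simp: exceptional_def)
  have B: "snd t $ y $ z = - (snd s $ y $ z)" "snd t $ y $ x = snd s $ x $ y"
    using normalD(7-9,16) by (simp_all add: t_def snd_mutation matrix_mutation_nth)
  have xz: "snd t $ x $ z \<ge> 0"
  proof (rule ccontr)
    assume "\<not> ?thesis"
    then have zx: "snd t $ z $ x > 0" using skewD[OF skew[OF tR], of x z] by simp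
    have "affine_form (fst t z) (fst t x) = snd t $ z $ x"
      using eul_zero_B(1)[OF tR ez] skewD[OF skew[OF tR], of x z] form_sym[of "fst t z" "fst t x"] by simp
    then have pz: "pos (fst t x)" using rule_form[OF tR ne_sym(3)] zx px by (auto split: if_splits)
    let ?u = "seed_mutation affine_form pos z t"
    have "fst ?u y = fst t y" using reflect_after(4)[OF tR normalD(8) _ px(2)] e B normalD(6) by (simp add: exceptional_def)
    moreover have "fst ?u x = fst t x"
      using reflect_after(4)[OF tR normalD(9) _ px(2)] e \<open>\<not> snd t $ x $ z \<ge> 0\<close> by (simp add: exceptional_def)
    ultimately have "\<not> pos (fst ?u z)"
      using mixed(2)[OF closed[OF tR] ne_sym(2,1,3)] px pz by metis
    then show False unfolding mutation_vec_self using neg_iff[OF tR] px(2) by blast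
  qed
  have "normal t y x z" using px tR e B normalD(5) xz by (simp add: normal_def)
  moreover have "snd t $ y $ z \<le> 0" using B normalD(6) by simp
  ultimately show ?thesis by (simp add: triple_def tx(2) ty tz reflect_minus)
qed

end

definition normal_set :: "affine_fun triple set" where
  "normal_set = {F. \<exists>s x y z. normal s x y z \<and> F = triple s x y z}"

definition acyclic_set :: "affine_fun triple set" where
  "acyclic_set = {F. \<exists>s x y z. normal s x y z \<and> snd s $ x $ z \<ge> 0 \<and> F = triple s x y z}"

lemma normal_setI: "normal s x y z \<Longrightarrow> triple s x y z \<in> normal_set"
  unfolding normal_set_def by blast

lemma acyclic_setI: "normal s x y z \<Longrightarrow> snd s $ x $ z \<ge> 0 \<Longrightarrow> triple s x y z \<in> acyclic_set"
  unfolding acyclic_set_def by blast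

sublocale normal: normal_triples normal_set acyclic_set
proof
  fix F assume "F \<in> normal_set"
  then obtain s x y z where n: "normal s x y z" and F: "F = triple s x y z" unfolding normal_set_def by blast
  show i: "involutions F" unfolding F by (rule involutions_triple[OF normalD(1)[OF n]])
  show "F \<in> acyclic_set \<or> braid1 F \<in> normal_set"
  proof (cases "snd s $ x $ z \<ge> 0")
    case True then show ?thesis using acyclic_setI[OF n] F by blast
  next
    case False
    then have "snd s $ x $ z \<le> 0" by simp
    from mu_x_cyclic[OF n this] show ?thesis unfolding F by (metis normal_setI)
  qed
  show "(braid2 F \<in> normal_set \<and> rot' F \<in> normal_set) \<or> (braid1' F \<in> normal_set \<and> rot F \<in> normal_set)"
  proof (cases "pos (fst s y)")
    case True
    let ?t = "seed_mutation affine_form pos y s"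
    from mu_y_pos[OF n True] have t: "normal ?t x z y" "snd ?t $ x $ y \<le> 0" "triple ?t x z y = braid2 F" by (auto simp: F)
    have "braid1 (braid2 F) \<in> normal_set" using mu_x_cyclic[OF t(1,2)] unfolding t(3) by (metis normal_setI)
    moreover have "braid2 F \<in> normal_set" using normal_setI[OF t(1)] t(3) by simp
    ultimately show ?thesis using rot_braid(1)[OF i] by simp
  next
    case False
    let ?t = "seed_mutation affine_form pos y s"
    from mu_y_neg[OF n False] have t: "normal ?t y x z" "snd ?t $ y $ z \<le> 0" "triple ?t y x z = braid1' F" by (auto simp: F)
    have "braid2' (braid1' F) \<in> normal_set" using mu_z_cyclic[OF t(1,2)] unfolding t(3) by (metis normal_setI)
    moreover have "braid1' F \<in> normal_set" using normal_setI[OF t(1)] t(3) by simp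
    ultimately show ?thesis using rot_braid(2)[OF i] by simp
  qed
next
  show "acyclic_set \<subseteq> normal_set" unfolding acyclic_set_def normal_set_def by blast
next
  fix F assume "F \<in> acyclic_set"
  then obtain s x y z where n: "normal s x y z" and c: "snd s $ x $ z \<ge> 0" and F: "F = triple s x y z"
    unfolding acyclic_set_def by blast
  show "braid2 (braid1 F) \<in> acyclic_set" using mu_x_acyclic[OF n c] unfolding F by (metis acyclic_setI)
qed

end

context affine_coherent begin

section \<open>The group of translations of a translation invariant world\<close>

definition conj_shift :: "real \<Rightarrow> affine_fun triple \<Rightarrow> affine_fun triple" where
  "conj_shift t = conj3 (shift t) (shift (- t))"

lemma shift_inverse: "\<forall>x. shift (- t) (shift t x) = x" "\<forall>x. shift t (shift (- t) x) = x"
  by (simp_all add: shift.Phi_Phi shift.Phi_0)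

lemma conj_shift_add: "conj_shift t (conj_shift u F) = conj_shift (t + u) F"
  by (cases F) (simp add: conj_shift_def fun_eq_iff shift.Phi_Phi add.commute)

lemma conj_shift_0: "conj_shift 0 F = F"
  by (cases F) (simp add: conj_shift_def fun_eq_iff shift.Phi_0)

lemmas conj_shift_braid = conj3_braid[of "shift (- t)" "shift t" for t, OF shift_inverse(1), folded conj_shift_def]

lemma conj_shift_rot: "conj_shift t ((rot ^^ n) F) = (rot ^^ n) (conj_shift t F)"
  by (induction n) (simp_all add: conj_shift_braid)

lemma conj_shift_braid_equiv: "braid_equiv F G \<Longrightarrow> braid_equiv (conj_shift t F) (conj_shift t G)"
  unfolding conj_shift_def by (rule conj3_braid_equiv[of "shift (- t)" "shift t", OF shift_inverse(1)])

lemma reflect_shift: "reflect (shift t v) = shift t \<circ> reflect v \<circ> shift (- t)"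
proof
  fix f
  have "affine_form (shift (- t) f) v = affine_form f (shift t v)"
    using shift.Phi_form[of t "shift (- t) f" v] shift_inverse(2) by simp
  then show "reflect (shift t v) f = (shift t \<circ> reflect v \<circ> shift (- t)) f"
    by (simp add: reflect_def shift.Phi_diff shift.Phi_scale shift.Phi_Phi shift.Phi_0)
qed

lemma triple_act: "triple (act t s) i j k = conj_shift t (triple s i j k)"
  by (simp add: triple_def shift.act_def reflect_shift conj_shift_def)

text \<open>A reflection in a line that is not parallel to the direction of translation determines its position.\<close>

lemma conj_shift_faithful:
  assumes s: "s \<in> R" and ne: "i \<noteq> j" "j \<noteq> k" "i \<noteq> k" and eq: "conj_shift t (triple s i j k) = triple s i j k"
  shows "t = 0"
proof -
  obtain l where l: "slope (fst s l) \<noteq> 0" using slope_nonzero[OF s] by blast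
  have "reflect (shift t (fst s l)) = reflect (fst s l)"
    using eq three_cases[OF ne, of l] unfolding triple_act[symmetric] by (auto simp: triple_def shift.act_def)
  then have "reflect (shift t (fst s l)) (fst s l) = reflect (fst s l) (fst s l)" by simp
  moreover have "affine_form (fst s l) (shift t (fst s l)) = 2"
    by (simp add: shift_def form_simps form_const norm[OF s])
  ultimately have "2 *\<^sub>R shift t (fst s l) = 2 *\<^sub>R fst s l" using norm[OF s] by (simp add: reflect_def)
  then have "(t * slope (fst s l)) *\<^sub>R const_one = 0" by (simp add: shift_def)
  then show ?thesis using l const_nonzero(1) by simp
qed

lemma exceptional_act: "exceptional (act t s) i j k = exceptional s i j k"
proof -
  have "eul (shift t x) (shift t y) = eul x y" for x y by (simp add: eul_def shift.Phi_form om_shift)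
  then show ?thesis by (simp add: exceptional_def shift.act_def)
qed

end

context uniform_coherent begin

lemma mutation_act: "seed_mutation affine_form pos k (act t s) = act t (seed_mutation affine_form pos k s)"
  by (rule shift.act_mutation) (rule pos_shift)

lemma reachable_act: "u \<in> mutation_reachable affine_form pos s \<Longrightarrow> act t u \<in> mutation_reachable affine_form pos (act t s)"
proof (induction rule: reachable_induct)
  case base show ?case by (rule reachable_refl)
next
  case (step u k) then show ?case unfolding mutation_act[symmetric] by (blast intro: reachable_mutation)
qed

context
  fixes s
  assumes R: "R = mutation_reachable affine_form pos s"
begin

definition stab :: "real set" where "stab = {t. act t s \<in> R}"

lemma s_R: "s \<in> R" unfolding R by (rule reachable_refl)

lemma stab_act: assumes "t \<in> stab" "u \<in> R" shows "act t u \<in> R"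
proof -
  have "act t u \<in> mutation_reachable affine_form pos (act t s)" using assms(2) reachable_act R by blast
  moreover have "act t s \<in> R" using assms(1) by (simp add: stab_def)
  ultimately show ?thesis using reachable_sym[OF R] by blast
qed

lemma stabI: assumes "u \<in> R" "act t u \<in> R" shows "t \<in> stab"
proof -
  have "s \<in> mutation_reachable affine_form pos u" using reachable_sym[OF R assms(1)] s_R by blast
  then have "act t s \<in> mutation_reachable affine_form pos (act t u)" by (rule reachable_act)
  then show ?thesis using reachable_sym[OF R assms(2)] by (simp add: stab_def)
qed

lemma stab_diff: assumes "t \<in> stab" "u \<in> stab" shows "t - u \<in> stab"
proof (rule stabI)
  show "act u s \<in> R" "act (t - u) (act u s) \<in> R" using assms by (simp_all add: stab_def shift.act_act)
qed

lemma stab_0: "0 \<in> stab" using s_R by (simp add: stab_def shift.act_0)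

lemma stab_minus: "t \<in> stab \<Longrightarrow> - t \<in> stab" using stab_diff[OF stab_0] by simp

lemma normal_act: "t \<in> stab \<Longrightarrow> normal u x y z \<Longrightarrow> normal (act t u) x y z"
  using stab_act[of t u] pos_shift exceptional_act by (simp add: normal_def shift.act_def)

text \<open>Three rolls rotate back three times. As there are finitely many types up to translation, some power
  of the central element acts on an acyclic triple as a translation of the world.\<close>

lemma rot_period:
  assumes n: "normal s x y z" and c: "snd s $ x $ z \<ge> 0" and fin: "finite (snd ` R)"
  shows "\<exists>q>0. \<exists>t\<in>stab. (rot ^^ (3 * q)) (triple s x y z) = conj_shift t (triple s x y z)"
proof -
  let ?S = "\<lambda>F. braid2 (braid1 F)"
  let ?F = "triple s x y z"
  have roll: "\<exists>t. normal t y z x \<and> snd t $ y $ x \<ge> 0 \<and> triple t y z x = ?S (triple u x y z)"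
    if "normal u x y z" "snd u $ x $ z \<ge> 0" for u x y z using mu_x_acyclic[OF that] by blast
  have cube: "(rot' ^^ Suc (Suc (Suc 0))) G = ?S (?S (?S G))" if "involutions G" for G :: "affine_fun triple"
    using rot_cube_roll[OF that] by simp
  have "\<exists>u. normal u x y z \<and> snd u $ x $ z \<ge> 0 \<and> triple u x y z = (rot' ^^ (3 * m)) ?F" for m
  proof (induction m)
    case 0 show ?case using n c by (intro exI[of _ s]) simp
  next
    case (Suc m)
    then obtain u where u: "normal u x y z" "snd u $ x $ z \<ge> 0" "triple u x y z = (rot' ^^ (3 * m)) ?F" by blast
    obtain u1 where u1: "normal u1 y z x" "snd u1 $ y $ x \<ge> 0" "triple u1 y z x = ?S (triple u x y z)"
      using roll[OF u(1,2)] by blast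
    obtain u2 where u2: "normal u2 z x y" "snd u2 $ z $ y \<ge> 0" "triple u2 z x y = ?S (triple u1 y z x)"
      using roll[OF u1(1,2)] by blast
    obtain u3 where u3: "normal u3 x y z" "snd u3 $ x $ z \<ge> 0" "triple u3 x y z = ?S (triple u2 z x y)"
      using roll[OF u2(1,2)] by blast
    have "triple u3 x y z = (rot' ^^ Suc (Suc (Suc 0))) ((rot' ^^ (3 * m)) ?F)"
      unfolding u3(3) u2(3) u1(3) u(3)[symmetric] cube[OF involutions_triple[OF normalD(1)[OF u(1)]]] ..
    also have "\<dots> = (rot' ^^ (Suc (Suc (Suc 0)) + 3 * m)) ?F" by (simp only: funpow_add o_apply)
    also have "Suc (Suc (Suc 0)) + 3 * m = 3 * Suc m" by simp
    finally show ?case using u3(1,2) by blast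
  qed
  then obtain f where f: "\<And>m. normal (f m) x y z" "\<And>m. triple (f m) x y z = (rot' ^^ (3 * m)) ?F" by metis
  have fR: "f m \<in> R" for m using normalD(1)[OF f(1)] .
  have "finite (range (\<lambda>m. linear_type (f m)))"
    by (rule finite_subset[OF _ finite_types[OF fin]]) (use fR in auto)
  then have "\<not> inj (\<lambda>m. linear_type (f m))" using finite_imageD infinite_UNIV_nat by blast
  then obtain a b where ab: "a < b" "linear_type (f a) = linear_type (f b)"
    unfolding inj_def by (metis linorder_neqE_nat)
  obtain t where t: "f a = act t (f b)" using same_linear_type[OF fR fR ab(2)] by blast
  have ts: "t \<in> stab" using stabI[OF fR[of b]] fR[of a] t by simp
  have inv: "involutions ?F" by (rule involutions_triple[OF s_R])
  have rr: "(rot ^^ m) ((rot' ^^ m) G) = G" if "involutions G" for m and G :: "affine_fun triple"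
    using that
  proof (induction m arbitrary: G)
    case (Suc m)
    have ik: "involutions ((rot' ^^ k) G)" for k by (induction k) (use Suc.prems in \<open>simp_all add: involutions_braid\<close>)
    have r: "rot ((rot' ^^ Suc m) G) = (rot' ^^ m) G" unfolding funpow.simps o_apply by (rule braid_inverse(6)[OF ik])
    have "(rot ^^ Suc m) ((rot' ^^ Suc m) G) = (rot ^^ m) (rot ((rot' ^^ Suc m) G))" by (simp only: funpow_Suc_right o_apply)
    then show ?case unfolding r using Suc by simp
  qed simp
  have "(rot ^^ (3 * b)) (triple (f a) x y z) = conj_shift t ?F"
    unfolding t triple_act f(2) conj_shift_rot[symmetric] by (simp only: rr[OF inv])
  moreover have "(rot ^^ (3 * b)) (triple (f a) x y z) = (rot ^^ (3 * (b - a))) ?F"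
  proof -
    have "(rot ^^ (3 * b)) G = (rot ^^ (3 * (b - a))) ((rot ^^ (3 * a)) G)" for G :: "affine_fun triple"
    proof -
      have "3 * b = 3 * (b - a) + 3 * a" using ab(1) by simp
      then show ?thesis by (metis funpow_add o_apply)
    qed
    then show ?thesis unfolding f(2) by (simp only: rr[OF inv])
  qed
  ultimately show ?thesis using ab(1) ts by (metis zero_less_diff)
qed

text \<open>Modulo the group of translations there are only finitely many triples in the orbit, by
  \<open>closure_cover\<close>. The pigeonhole principle applies to the multiples of the translation.\<close>

lemma translation_multiple:
  assumes n: "normal s x y z" and c: "snd s $ x $ z \<ge> 0" and fin: "finite (snd ` R)"
    and br: "\<And>k::nat. braid_equiv (triple s x y z) (conj_shift (real k * t) (triple s x y z))"
  shows "\<exists>k::nat>0. real k * t \<in> stab"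
proof -
  let ?F = "triple s x y z" and ?A = "normal_set \<union> braid1 ` acyclic_set"
  have inv: "involutions ?F" by (rule involutions_triple[OF s_R])
  obtain q tau where q: "q > 0" "tau \<in> stab" "(rot ^^ (3 * q)) ?F = conj_shift tau ?F"
    using rot_period[OF n c fin] by blast
  have orbit: "braid_equiv ?F G" if "G \<in> ?A" for G
  proof -
    have N: "braid_equiv ?F (triple u i j k)" if "normal u i j k" for u i j k
      using braid_reachable[OF s_R normalD(2)[OF n], of u] normalD(1,2)[OF that] R by blast
    from \<open>G \<in> ?A\<close> show ?thesis
    proof
      assume "G \<in> normal_set" then show ?thesis using N by (auto simp: normal_set_def)
    next
      assume "G \<in> braid1 ` acyclic_set" then show ?thesis
        using N by (auto simp: acyclic_set_def intro: braid_equiv.b1)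
    qed
  qed
  have per: "(rot ^^ (3 * q)) G = conj_shift tau G" if "G \<in> ?A" for G
    using rot_power_conj3[OF shift_inverse(1) q(3)[unfolded conj_shift_def] inv orbit[OF that]]
    unfolding conj_shift_def .
  have sh: "conj_shift u G \<in> ?A" if u: "u \<in> stab" and G: "G \<in> ?A" for u G
    using G
  proof
    assume "G \<in> normal_set"
    then obtain r i j k where r: "normal r i j k" "G = triple r i j k" by (auto simp: normal_set_def)
    then show ?thesis using normal_setI[OF normal_act[OF u r(1)]] by (simp add: triple_act)
  next
    assume "G \<in> braid1 ` acyclic_set"
    then obtain r i j k where r: "normal r i j k" "snd r $ i $ k \<ge> 0" "G = braid1 (triple r i j k)" by (auto simp: acyclic_set_def)
    have "triple (act u r) i j k \<in> acyclic_set"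
      by (rule acyclic_setI[OF normal_act[OF u r(1)]]) (use r(2) in \<open>simp add: shift.act_def\<close>)
    then show ?thesis unfolding r(3) by (simp add: triple_act conj_shift_braid)
  qed
  have pw: "(rot ^^ (3 * q)) G \<in> ?A" if "G \<in> ?A" for G using per[OF that] sh[OF q(2) that] by simp
  have pw': "\<exists>H\<in>?A. G = (rot ^^ (3 * q)) H" if G: "G \<in> ?A" for G
  proof
    show H: "conj_shift (- tau) G \<in> ?A" by (rule sh[OF stab_minus[OF q(2)] G])
    show "G = (rot ^^ (3 * q)) (conj_shift (- tau) G)" unfolding per[OF H] by (simp add: conj_shift_add conj_shift_0)
  qed
  define rep where "rep = inv_into R linear_type"
  \<comment> \<open>triples of one seed of each type, up to translations of the world\<close>
  define K0 where "K0 = (\<lambda>(l, i, j, k). triple (rep l) i j k) ` (linear_type ` R \<times> UNIV \<times> UNIV \<times> UNIV)"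
  define K1 where "K1 = K0 \<union> braid1 ` K0"
  define K where "K = (\<Union>i<3 * q. (rot ^^ i) ` K1)"
  have "finite K0" unfolding K0_def by (intro finite_imageI finite_cartesian_product finite_types[OF fin] finite)
  then have finK: "finite K" by (simp add: K_def K1_def)
  have K0: "\<exists>v\<in>stab. \<exists>H\<in>K0. triple u i j k = conj_shift v H" if u: "u \<in> R" for u i j k
  proof -
    let ?r = "rep (linear_type u)"
    have r: "?r \<in> R" "linear_type u = linear_type ?r"
      using u inv_into_into[of "linear_type u" linear_type R] f_inv_into_f[of "linear_type u" linear_type R] unfolding rep_def by auto
    obtain v where v: "u = act v ?r" using same_linear_type[OF r(1) u r(2)] by blast
    have "v \<in> stab" using stabI[OF r(1)] u v by simp
    moreover have "triple ?r i j k \<in> K0" unfolding K0_def using u by (intro image_eqI[of _ _ "(linear_type u, i, j, k)"]) auto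
    moreover have "triple u i j k = conj_shift v (triple ?r i j k)" using triple_act[of v ?r i j k] unfolding v[symmetric] .
    ultimately show ?thesis by blast
  qed
  have K1: "\<exists>v\<in>stab. \<exists>H\<in>K1. G = conj_shift v H" if "G \<in> ?A" for G
    using that
  proof
    assume "G \<in> normal_set"
    then obtain r i j k where r: "normal r i j k" "G = triple r i j k" unfolding normal_set_def by blast
    then show ?thesis using K0[OF normalD(1)[OF r(1)], of i j k] unfolding K1_def by blast
  next
    assume "G \<in> braid1 ` acyclic_set"
    then obtain r i j k where r: "normal r i j k" "G = braid1 (triple r i j k)" unfolding acyclic_set_def by blast
    then obtain v H where "v \<in> stab" "H \<in> K0" "G = conj_shift v (braid1 H)"
      using K0[OF normalD(1)[OF r(1)], of i j k] by (metis conj_shift_braid(1))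
    then show ?thesis unfolding K1_def by blast
  qed
  have K: "\<exists>v\<in>stab. \<exists>H\<in>K. G = conj_shift v H" if G: "G \<in> rot_closure normal_set acyclic_set" for G
  proof -
    have "3 * q > 0" using q(1) by simp
    from normal.closure_cover[OF this pw pw' G]
    obtain i H where i: "i < 3 * q" "H \<in> ?A" "G = (rot ^^ i) H" by blast
    obtain v H' where v: "v \<in> stab" "H' \<in> K1" "H = conj_shift v H'" using K1[OF i(2)] by blast
    have "G = conj_shift v ((rot ^^ i) H')" unfolding i(3) v(3) conj_shift_rot ..
    then show ?thesis using v(1,2) i(1) unfolding K_def by blast
  qed
  have "?F \<in> rot_closure normal_set acyclic_set" using normal_setI[OF n] by (rule rot_closure.base)
  then have "conj_shift (real k * t) ?F \<in> rot_closure normal_set acyclic_set" for k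
    using normal.closure_braid_equiv br by blast
  then have "\<exists>v\<in>stab. \<exists>H\<in>K. conj_shift (real k * t) ?F = conj_shift v H" for k using K by blast
  then obtain v H where v: "\<And>k. v k \<in> stab" "\<And>k. H k \<in> K" "\<And>k. conj_shift (real k * t) ?F = conj_shift (v k) (H k)" by metis
  have "finite (range H)" by (rule finite_subset[OF _ finK]) (use v(2) in auto)
  then have "\<not> inj H" using finite_imageD infinite_UNIV_nat by blast
  then obtain a b :: nat where ab: "a < b" "H a = H b" unfolding inj_def by (metis linorder_neqE_nat)
  have sol: "conj_shift (real k * t - v k) ?F = H k" for k
  proof -
    have "conj_shift (- v k) (conj_shift (real k * t) ?F) = H k" unfolding v(3) by (simp add: conj_shift_add conj_shift_0)
    then show ?thesis by (simp add: conj_shift_add)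
  qed
  have "conj_shift (- (real a * t - v a)) (conj_shift (real b * t - v b) ?F)
      = conj_shift (- (real a * t - v a)) (conj_shift (real a * t - v a) ?F)" using sol[of a] sol[of b] ab(2) by simp
  then have "conj_shift ((real b - real a) * t - (v b - v a)) ?F = ?F"
    by (simp add: conj_shift_add conj_shift_0 algebra_simps)
  then have "(real b - real a) * t - (v b - v a) = 0"
    using conj_shift_faithful[OF s_R normalD(7,8,9)[OF n]] by blast
  then have "real (b - a) * t = v b - v a" using ab(1) by (simp add: of_nat_diff)
  then show ?thesis using stab_diff[OF v(1) v(1), of b a] ab(1) by (metis zero_less_diff)
qed

end

end

section \<open>The world far to the left\<close>

lemma labelled_ball_mono:
  assumes "s \<in> labelled_ball form pos s0 m" "m \<le> n" shows "s \<in> labelled_ball form pos s0 n"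
proof -
  obtain l where "l \<le> m" "(mutation_step form pos ^^ l) s0 s" using assms(1) unfolding labelled_ball_def by blast
  then show ?thesis unfolding labelled_ball_def using assms(2) le_trans by blast
qed

context affine_coherent begin

lemma pos_antimono:
  assumes "pos (f + a *\<^sub>R const_one)" "b \<le> a" shows "pos (f + b *\<^sub>R const_one)"
proof (cases "a = b")
  case False
  then have "pos ((a - b) *\<^sub>R - const_one)" using assms(2) pos_const by (intro pos_scale) simp_all
  then have "pos (f + a *\<^sub>R const_one + (a - b) *\<^sub>R - const_one)" using assms(1) pos_add by blast
  then show ?thesis by (simp add: algebra_simps)
qed (use assms in simp)

lemma shift_alt: "shift t f = f + (- t * slope f) *\<^sub>R const_one" by (simp add: shift_def)

text \<open>Positivity is monotone along translations, since negative constants are positive; so the limit exists.\<close>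

definition left :: "affine_fun \<Rightarrow> bool" where "left f \<longleftrightarrow> (\<exists>t0. \<forall>t\<le>t0. pos (shift t f))"

lemma left_eventually: "\<exists>t0. \<forall>t\<le>t0. pos (shift t f) = left f"
proof -
  have "(\<exists>t0. \<forall>t\<le>t0. pos (shift t f)) \<or> (\<exists>t0. \<forall>t\<le>t0. \<not> pos (shift t f))"
  proof (cases "slope f \<ge> 0")
    case True
    have mono: "pos (shift t f)" if "pos (shift u f)" "u \<le> t" for t u
      using pos_antimono[of f "- u * slope f" "- t * slope f"] that True mult_right_mono[of u t "slope f"]
      by (simp add: shift_alt)
    show ?thesis
    proof (cases "\<forall>t. pos (shift t f)")
      case False then show ?thesis using mono by blast
    qed blast
  next
    case False
    have mono: "pos (shift t f)" if "pos (shift u f)" "t \<le> u" for t u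
      using pos_antimono[of f "- u * slope f" "- t * slope f"] that False mult_right_mono_neg[of t u "slope f"]
      by (simp add: shift_alt)
    show ?thesis
    proof (cases "\<exists>t. pos (shift t f)")
      case True then show ?thesis using mono by blast
    qed blast
  qed
  then show ?thesis unfolding left_def by blast
qed

lemma left_common:
  assumes "finite A" shows "\<exists>t0. \<forall>t\<le>t0. \<forall>f\<in>A. pos (shift t f) = left f"
  using assms
proof (induction A rule: finite_induct)
  case (insert f A)
  then obtain t0 t1 where "\<forall>t\<le>t0. \<forall>f\<in>A. pos (shift t f) = left f" "\<forall>t\<le>t1. pos (shift t f) = left f"
    using left_eventually by blast
  then show ?case by (intro exI[of _ "min t0 t1"]) simp
qed simp

lemma left_shift: "left (shift u f) = left f"
proof -
  obtain t0 where t0: "\<forall>t\<le>t0. pos (shift t (shift u f)) = left (shift u f)" using left_eventually by blast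
  obtain t1 where t1: "\<forall>t\<le>t1. pos (shift t f) = left f" using left_eventually by blast
  let ?t = "min t0 (t1 - u)"
  have "?t \<le> t0" "?t + u \<le> t1" by simp_all
  then have "left (shift u f) = pos (shift ?t (shift u f))" "pos (shift (?t + u) f) = left f" using t0 t1 by blast+
  then show ?thesis unfolding shift.Phi_Phi by simp
qed

lemma left_const: "left (- const_one)"
  unfolding left_def shift_def slope_simps using pos_const by simp

lemma left_seed_space: "seed_space affine_form left"
proof
  fix x y z :: affine_fun and c :: real
  show "affine_form (x + y) z = affine_form x z + affine_form y z" by (rule form_add)
  show "affine_form (c *\<^sub>R x) z = c * affine_form x z" by (rule form_scale)
  show "affine_form x y = affine_form y x" by (rule form_sym)
  obtain t0 where t0: "\<forall>t\<le>t0. \<forall>f\<in>{x, y, x + y, c *\<^sub>R x, 0}. pos (shift t f) = left f"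
    using left_common[of "{x, y, x + y, c *\<^sub>R x, 0}"] by blast
  then have l: "left f = pos (shift t0 f)" if "f \<in> {x, y, x + y, c *\<^sub>R x, 0}" for f using that by blast
  show "left (x + y)" if "left x" "left y" using that l pos_add by (simp add: shift.Phi_add)
  show "left (c *\<^sub>R x)" if "c > 0" "left x" using that l pos_scale by (simp add: shift.Phi_scale)
  show "\<not> left 0" using l[of 0] pos_zero by (simp add: shift_def slope_simps)
qed

lemma left_transfer:
  "u \<in> mutation_reachable affine_form left s \<Longrightarrow> \<exists>t0. \<forall>t\<le>t0. act t s \<in> R \<longrightarrow> act t u \<in> R"
proof (induction rule: reachable_induct)
  case base show ?case by blast
next
  case (step u k)
  then obtain t0 t1 where t: "\<forall>t\<le>t0. act t s \<in> R \<longrightarrow> act t u \<in> R" "\<forall>t\<le>t1. pos (shift t (fst u k)) = left (fst u k)"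
    using left_eventually by blast
  have "act t (seed_mutation affine_form left k u) \<in> R" if "t \<le> min t0 t1" "act t s \<in> R" for t
  proof -
    have "seed_mutation affine_form pos k (act t u) = act t (seed_mutation affine_form left k u)"
      by (rule shift.act_mutation) (use t(2) that in simp)
    then show ?thesis using closed[of "act t u" k] t(1) that by simp
  qed
  then show ?case by blast
qed

text \<open>Since all seeds of the left world have copies in the given one, they inherit its properties.\<close>

lemma uniform_left:
  assumes far: "\<And>M. \<exists>t<M. act t s \<in> R"
  shows "uniform_coherent left (mutation_reachable affine_form left s) om"
proof -
  interpret L: seed_space affine_form left by (rule left_seed_space)
  have copy: "\<exists>t. act t u \<in> R \<and> (\<forall>i. left (fst u i) = pos (shift t (fst u i)) \<and> left (- fst u i) = pos (- shift t (fst u i)))"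
    if u: "u \<in> mutation_reachable affine_form left s" for u
  proof -
    obtain t0 where t0: "\<forall>t\<le>t0. act t s \<in> R \<longrightarrow> act t u \<in> R" using left_transfer[OF u] by blast
    obtain t1 where t1: "\<forall>t\<le>t1. \<forall>f\<in>range (fst u) \<union> range (\<lambda>i. - fst u i). pos (shift t f) = left f"
      using left_common[of "range (fst u) \<union> range (\<lambda>i. - fst u i)"] by auto
    obtain t where t: "t < min t0 t1" "act t s \<in> R" using far by blast
    have t01: "t \<le> t0" "t \<le> t1" using t(1) by simp_all
    have f: "pos (shift t f) = left f" if "f \<in> range (fst u) \<union> range (\<lambda>i. - fst u i)" for f
      using t1 t01(2) that by blast
    have "left (fst u i) = pos (shift t (fst u i)) \<and> left (- fst u i) = pos (- shift t (fst u i))" for i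
      using f[of "fst u i"] f[of "- fst u i"] by (simp add: shift.Phi_minus)
    then show ?thesis using t0 t01(1) t(2) by blast
  qed
  have fa: "fst (act t u) i = shift t (fst u i)" "snd (act t u) = snd u" for t and u :: "(3, affine_fun) labelled_seed" and i
    by (simp_all add: shift.act_def)
  show ?thesis
  proof
    show "skew_bilinear om" by (rule om)
    show "left (- const_one)" by (rule left_const)
    show "left (shift t f) = left f" for t f by (rule left_shift)
  next
    fix u k assume "u \<in> mutation_reachable affine_form left s"
    then show "seed_mutation affine_form left k u \<in> mutation_reachable affine_form left s" by (rule reachable_mutation)
  next
    fix u i assume "u \<in> mutation_reachable affine_form left s"
    from copy[OF this] obtain t where t: "act t u \<in> R" "\<And>i. left (fst u i) = pos (shift t (fst u i))"
      "\<And>i. left (- fst u i) = pos (- shift t (fst u i))" by blast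
    show "L.decided (fst u i)" using dec[OF t(1), of i] t(2,3) by (simp add: L.decided_def decided_def fa)
  next
    fix u assume "u \<in> mutation_reachable affine_form left s"
    from copy[OF this] obtain t where t: "act t u \<in> R" "\<And>i. left (fst u i) = pos (shift t (fst u i))" by blast
    show "realises affine_form u" using realis[OF t(1)] unfolding realises_def fa shift.Phi_form .
    show "sign_rule affine_form left u" using rule[OF t(1)] unfolding sign_rule_def fa shift.Phi_form t(2) .
    show "om (fst u i) (fst u j) = snd u $ i $ j" for i j using om_B[OF t(1), of i j] unfolding fa om_shift .
    show "\<not> isolated i (snd u)" for i using conn[OF t(1), of i] unfolding fa .
    have sh: "(\<Sum>i\<in>UNIV. c i *\<^sub>R shift t (fst u i)) = shift t (\<Sum>i\<in>UNIV. c i *\<^sub>R fst u i)" for c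
      unfolding sum_3 by (simp add: shift.Phi_add shift.Phi_scale)
    have b: "basis3 (\<lambda>i. shift t (fst u i))" using basis[OF t(1)] by (simp add: shift.act_def)
    have s0: "shift t 0 = 0" by (simp add: shift_def slope_simps)
    show "basis3 (fst u)" unfolding basis3_def
    proof (intro conjI allI impI)
      fix c i assume "(\<Sum>i\<in>UNIV. c i *\<^sub>R fst u i) = 0"
      then have "(\<Sum>i\<in>UNIV. c i *\<^sub>R shift t (fst u i)) = 0" unfolding sh by (simp only: s0)
      then show "c i = 0" using b unfolding basis3_def by blast
    next
      fix x
      obtain c where "shift t x = shift t (\<Sum>i\<in>UNIV. c i *\<^sub>R fst u i)" using b unfolding basis3_def sh by blast
      then have "shift (- t) (shift t x) = shift (- t) (shift t (\<Sum>i\<in>UNIV. c i *\<^sub>R fst u i))" by (rule arg_cong)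
      then have "x = (\<Sum>i\<in>UNIV. c i *\<^sub>R fst u i)" unfolding shift.Phi_Phi by (simp only: add.left_inverse shift.Phi_0)
      then show "\<exists>c. x = (\<Sum>i\<in>UNIV. c i *\<^sub>R fst u i)" by blast
    qed
  qed
qed

text \<open>A translation that preserves the exchange matrix preserves \<open>om\<close>.\<close>

lemma translation_parallel:
  assumes r: "r \<in> R" and B: "\<And>i j. om (fst s i) (fst s j) = snd s $ i $ j" and eq: "s = translate_seed w r"
  shows "\<exists>t. w = t *\<^sub>R dir"
proof -
  define d where "d i = - (fst (fst r i) \<bullet> w)" for i
  have fs: "fst s i = fst r i + d i *\<^sub>R const_one" for i
    by (simp add: eq translate_seed_def d_def const_one_def prod_eq_iff)
  have Br: "om (fst s i) (fst s j) = om (fst r i) (fst r j)" for i j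
    using B om_B[OF r] by (simp add: eq translate_seed_def)
  have dd: "d j * slope (fst r i) = d i * slope (fst r j)" for i j
    using Br[of i j] om_sym[of const_one "fst r j"] unfolding fs by (simp add: om_simps slope_def)
  obtain i where i: "slope (fst r i) \<noteq> 0" using slope_nonzero[OF r] by blast
  define t where "t = - d i / slope (fst r i)"
  have "translate_seed w r = translate_seed (t *\<^sub>R dir) r"
  proof -
    have "fst (fst r j) \<bullet> w = t * (fst (fst r j) \<bullet> dir)" for j
    proof -
      have "d j = - (t * slope (fst r j))" using dd[of j i] i by (simp add: t_def field_simps)
      then show ?thesis by (simp add: d_def slope_dir)
    qed
    then show ?thesis by (simp add: translate_seed_def)
  qed
  then show ?thesis using translate_unique[OF r] by blast
qed

section \<open>The lower bound for the growth\<close>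

definition twin_vectors :: "(real^2) set" where
  "twin_vectors = {w. \<exists>r\<in>R. \<exists>s\<in>R. \<exists>\<sigma>. bij \<sigma> \<and> translate_seed w r = reindex \<sigma> s}"

text \<open>The triples of both seeds are braid equivalent to the triple of a fixed seed \<open>s\<close>; so the translation
  preserves the braid orbit of that triple, which is also an orbit of the left world.\<close>

lemma twin_multiple:
  assumes R: "R = mutation_reachable affine_form pos s0" and fin: "finite (snd ` R)"
    and s: "s \<in> R" and a: "acyc s i j k" and far: "\<And>M. \<exists>t<M. act t s \<in> R" and w: "w \<in> twin_vectors"
  shows "\<exists>n::nat. \<exists>t. n > 0 \<and> real n *\<^sub>R w = t *\<^sub>R dir \<and> act t s \<in> mutation_reachable affine_form left s"
proof -
  let ?L = "mutation_reachable affine_form left s"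
  interpret U: uniform_coherent left ?L om by (rule uniform_left[OF far])
  have sL: "s \<in> ?L" by (rule reachable_refl)
  have finL: "finite (snd ` ?L)"
  proof (rule finite_subset[OF _ fin], rule image_subsetI)
    fix u assume "u \<in> ?L"
    from left_transfer[OF this] obtain t0 where t0: "\<forall>t\<le>t0. act t s \<in> R \<longrightarrow> act t u \<in> R" by blast
    obtain t where t: "t < t0" "act t s \<in> R" using far by blast
    then have "act t u \<in> R" using t0 by simp
    moreover have "snd (act t u) = snd u" by (simp add: shift.act_def)
    ultimately show "snd u \<in> snd ` R" by (metis image_eqI)
  qed
  obtain l where "left (fst s l)" using U.not_all_same(1)[OF sL] by blast
  then obtain x y z where xyz: "acyc s x y z" "left (fst s x)" "\<not> left (fst s z)"
    using U.acyc_normal[OF sL a] U.not_all_same(2)[OF sL] by blast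
  then have n: "U.normal s x y z" and c: "snd s $ x $ z \<ge> 0" and e: "exceptional s x y z"
    using sL by (auto simp: U.normal_def acyc_def)
  let ?F = "triple s x y z"
  have inv: "involutions ?F" by (rule involutions_triple[OF s])
  obtain r1 r2 \<sigma> where r: "r1 \<in> R" "r2 \<in> R" "bij \<sigma>" "translate_seed w r1 = reindex \<sigma> r2"
    using w unfolding twin_vectors_def by blast
  have fr: "fst (reindex \<sigma> r2) a = fst r2 (\<sigma> a)" "snd (reindex \<sigma> r2) $ a $ b = snd r2 $ \<sigma> a $ \<sigma> b" for a b
    by (simp_all add: reindex_def reindex_matrix_def)
  obtain t where t: "w = t *\<^sub>R dir"
    using translation_parallel[OF r(1) _ r(4)[symmetric]] om_B[OF r(2)] unfolding fr by blast
  have ra: "act t r1 = reindex \<sigma> r2" using r(4) by (simp add: t act_translate)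
  obtain a b d where abd: "exceptional r1 a b d" using exceptional_exists[OF r(1)] by blast
  have inj: "\<sigma> i = \<sigma> j \<longleftrightarrow> i = j" for i j using r(3) by (auto dest: bij_is_inj injD)
  have "exceptional (act t r1) a b d" unfolding exceptional_act by (rule abd)
  then have e2: "exceptional r2 (\<sigma> a) (\<sigma> b) (\<sigma> d)" unfolding ra exceptional_def fr inj .
  have T2: "triple r2 (\<sigma> a) (\<sigma> b) (\<sigma> d) = conj_shift t (triple r1 a b d)"
    unfolding triple_act[symmetric] ra by (simp add: triple_def fr)
  have reach: "mutation_reachable affine_form pos s = R" by (rule reachable_sym[OF R s])
  have q1: "braid_equiv ?F (triple r1 a b d)" and q2: "braid_equiv ?F (triple r2 (\<sigma> a) (\<sigma> b) (\<sigma> d))"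
    using braid_reachable[OF s e] abd e2 r(1,2) unfolding reach by blast+
  have "braid_equiv (conj_shift t (triple r1 a b d)) ?F"
    using braid_equiv_sym[OF q2 inv] unfolding T2 .
  then have "braid_equiv (conj_shift t ?F) ?F" using conj_shift_braid_equiv[OF q1] braid_equiv_trans by blast
  then have one: "braid_equiv ?F (conj_shift t ?F)"
    by (rule braid_equiv_sym) (use involutions_conj3[OF shift_inverse inv] in \<open>simp add: conj_shift_def\<close>)
  have br: "braid_equiv ?F (conj_shift (real k * t) ?F)" for k
  proof (induction k)
    case 0 show ?case by (simp add: conj_shift_0 braid_equiv.refl)
  next
    case (Suc k)
    have "braid_equiv (conj_shift t ?F) (conj_shift t (conj_shift (real k * t) ?F))"
      by (rule conj_shift_braid_equiv[OF Suc])
    then have "braid_equiv ?F (conj_shift t (conj_shift (real k * t) ?F))" using one braid_equiv_trans by blast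
    then show ?case by (simp add: conj_shift_add algebra_simps)
  qed
  obtain k :: nat where k: "k > 0" "real k * t \<in> U.stab s"
    using U.translation_multiple[OF HOL.refl n c finL br] by blast
  then have "act (real k * t) s \<in> ?L" by (simp add: U.stab_def[OF HOL.refl])
  then show ?thesis using k(1) t by (intro exI[of _ k] exI[of _ "real k * t"]) simp
qed

lemma far_left_copy:
  assumes "u \<in> labelled_ball affine_form left s m"
    and "\<And>v i. v \<in> labelled_ball affine_form left s m \<Longrightarrow> pos (shift t (fst v i)) = left (fst v i)"
  shows "act t u \<in> labelled_ball affine_form pos (act t s) m"
  using assms
proof (induction m arbitrary: u)
  case 0 then show ?case by (simp add: labelled_ball_0)
next
  case (Suc m)
  have IH: "act t v \<in> labelled_ball affine_form pos (act t s) m" if "v \<in> labelled_ball affine_form left s m" for v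
    using Suc.IH[OF that] Suc.prems(2) unfolding labelled_ball_Suc by blast
  from Suc.prems(1) consider "u \<in> labelled_ball affine_form left s m"
    | k v where "v \<in> labelled_ball affine_form left s m" "u = seed_mutation affine_form left k v"
    unfolding labelled_ball_Suc by blast
  then show ?case
  proof cases
    case 1 then show ?thesis using IH unfolding labelled_ball_Suc by blast
  next
    case 2
    have "v \<in> labelled_ball affine_form left s (Suc m)" using 2(1) unfolding labelled_ball_Suc by blast
    then have "act t u = seed_mutation affine_form pos k (act t v)"
      unfolding 2(2) using shift.act_mutation[of t v k left] Suc.prems(2) by metis
    then show ?thesis using IH[OF 2(1)] unfolding labelled_ball_Suc by blast
  qed
qed

text \<open>Sufficiently far to the left, paths of bounded length may be copied with all translations to the
  left, so that their translations may be performed one after the other.\<close>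

lemma lower_bound:
  assumes R: "R = mutation_reachable affine_form pos s0" and fin: "finite (snd ` R)"
    and s: "s \<in> R" and a: "acyc s i j k" and far: "\<And>M. \<exists>t<M. act t s \<in> R"
    and W: "finite W" "W \<subseteq> twin_vectors" "\<not> module.dependent int_scale W"
  shows "\<exists>A B. \<forall>n. (n + 1) ^ card W \<le> card (labelled_ball affine_form pos s0 (A + B * n))"
proof -
  have d0: "dir \<noteq> 0" by (rule dir_nonzero[OF s])
  have w0: "w \<noteq> 0" if "w \<in> W" for w using W(3) int_mod.dependent_zero that by blast
  have "\<exists>z::int. \<exists>t. z \<noteq> 0 \<and> t < 0 \<and> real_of_int z *\<^sub>R w = t *\<^sub>R dir \<and> act t s \<in> mutation_reachable affine_form left s"
    if w: "w \<in> W" for w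
  proof -
    interpret U: uniform_coherent left "mutation_reachable affine_form left s" om by (rule uniform_left[OF far])
    obtain n t where n: "n > 0" "real n *\<^sub>R w = t *\<^sub>R dir" "act t s \<in> mutation_reachable affine_form left s"
      using twin_multiple[OF R fin s a far, of w] W(2) w by blast
    have "t \<noteq> 0" using n(1,2) w0[OF w] by auto
    show ?thesis
    proof (cases "t < 0")
      case True then show ?thesis using n by (intro exI[of _ "int n"] exI[of _ t]) simp
    next
      case False
      have "- t \<in> U.stab s" by (rule U.stab_minus[OF HOL.refl]) (use n(3) in \<open>simp add: U.stab_def[OF HOL.refl]\<close>)
      then have "act (- t) s \<in> mutation_reachable affine_form left s" by (simp add: U.stab_def[OF HOL.refl])
      moreover have "real_of_int (- int n) *\<^sub>R w = (- t) *\<^sub>R dir" using n(2) by simp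
      ultimately show ?thesis using n(1) False \<open>t \<noteq> 0\<close> by (intro exI[of _ "- int n"] exI[of _ "- t"]) simp
    qed
  qed
  then obtain z tau where zt: "\<And>w. w \<in> W \<Longrightarrow> z w \<noteq> (0::int)" "\<And>w. w \<in> W \<Longrightarrow> tau w < 0"
    "\<And>w. w \<in> W \<Longrightarrow> real_of_int (z w) *\<^sub>R w = tau w *\<^sub>R dir"
    "\<And>w. w \<in> W \<Longrightarrow> act (tau w) s \<in> mutation_reachable affine_form left s" by metis
  have "\<exists>l. \<forall>w\<in>W. act (tau w) s \<in> labelled_ball affine_form left s l"
  proof -
    have "\<forall>w\<in>W. \<exists>l. act (tau w) s \<in> labelled_ball affine_form left s l" using zt(4) unfolding reachable_ball by blast
    then obtain l where l: "\<And>w. w \<in> W \<Longrightarrow> act (tau w) s \<in> labelled_ball affine_form left s (l w)" by metis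
    have "act (tau w) s \<in> labelled_ball affine_form left s (sum l W)" if "w \<in> W" for w
    proof -
      have "l w \<le> sum l W" using W(1) that by (simp add: member_le_sum)
      then show ?thesis using l[OF that] labelled_ball_mono by blast
    qed
    then show ?thesis by blast
  qed
  then obtain l where l: "\<And>w. w \<in> W \<Longrightarrow> act (tau w) s \<in> labelled_ball affine_form left s l" by blast
  have "finite (\<Union>v\<in>labelled_ball affine_form left s l. range (fst v))"
    by (intro finite_UN_I finite_labelled_ball finite_imageI finite)
  from left_common[OF this] obtain t0 where t0: "\<And>t v i. t \<le> t0 \<Longrightarrow> v \<in> labelled_ball affine_form left s l \<Longrightarrow>
      pos (shift t (fst v i)) = left (fst v i)" by blast
  \<comment> \<open>from here on all translations lead to the left, where the signs are those of the left world\<close>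
  obtain T where T: "T < t0" "act T s \<in> R" using far by blast
  obtain A where A: "act T s \<in> labelled_ball affine_form pos s0 A" using T(2) unfolding R reachable_ball by blast
  have step: "act (t + tau w) s \<in> labelled_ball affine_form pos s0 (a + l)"
    if "t \<le> t0" "w \<in> W" "act t s \<in> labelled_ball affine_form pos s0 a" for t w a
  proof -
    have "act t (act (tau w) s) \<in> labelled_ball affine_form pos (act t s) l"
      by (rule far_left_copy[OF l[OF that(2)]]) (rule t0[OF that(1)])
    then show ?thesis using labelled_ball_add[OF that(3)] by (simp add: shift.act_act)
  qed
  have steps: "act (t + real n * tau w) s \<in> labelled_ball affine_form pos s0 (a + l * n)"
    if "t \<le> t0" "w \<in> W" "act t s \<in> labelled_ball affine_form pos s0 a" for t w a n
  proof (induction n)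
    case (Suc n)
    have "real n * tau w \<le> 0" using zt(2)[OF that(2)] by (simp add: mult_nonneg_nonpos)
    then have "t + real n * tau w \<le> t0" using that(1) by simp
    from step[OF this that(2) Suc] show ?case by (simp add: algebra_simps)
  qed (use that in simp)
  have all: "T + (\<Sum>w\<in>V. real (c w) * tau w) \<le> t0 \<and>
      act (T + (\<Sum>w\<in>V. real (c w) * tau w)) s \<in> labelled_ball affine_form pos s0 (A + l * sum c V)"
    if "finite V" "V \<subseteq> W" for V and c :: "real^2 \<Rightarrow> nat"
    using that
  proof (induction V rule: finite_induct)
    case empty then show ?case using T A by simp
  next
    case (insert w V)
    then have IH: "T + (\<Sum>w\<in>V. real (c w) * tau w) \<le> t0"
      "act (T + (\<Sum>w\<in>V. real (c w) * tau w)) s \<in> labelled_ball affine_form pos s0 (A + l * sum c V)" and w: "w \<in> W" by auto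
    have "real (c w) * tau w \<le> 0" using zt(2)[OF w] by (simp add: mult_nonneg_nonpos)
    then show ?case using steps[OF IH(1) w IH(2), of "c w"] IH(1) insert(1,2) by (simp add: algebra_simps)
  qed
  define P where "P c = act (T + (\<Sum>w\<in>W. real (c w) * tau w)) s" for c :: "real^2 \<Rightarrow> nat"
  have "(n + 1) ^ card W \<le> card (labelled_ball affine_form pos s0 (A + (l * card W) * n))" for n
  proof -
    let ?D = "PiE W (\<lambda>_. {..n})"
    have sub: "P ` ?D \<subseteq> labelled_ball affine_form pos s0 (A + (l * card W) * n)"
    proof
      fix x assume "x \<in> P ` ?D"
      then obtain c where c: "c \<in> ?D" "x = P c" by blast
      have "sum c W \<le> card W * n" using c(1) sum_bounded_above[of W c n] by (auto simp: PiE_def)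
      then have "A + l * sum c W \<le> A + (l * card W) * n" by (simp add: mult.assoc)
      then show "x \<in> labelled_ball affine_form pos s0 (A + (l * card W) * n)"
        using all[OF W(1) subset_refl, of c] labelled_ball_mono unfolding c(2) P_def by blast
    qed
    have "inj_on P ?D"
    proof (rule inj_onI)
      fix c c' assume c: "c \<in> ?D" "c' \<in> ?D" "P c = P c'"
      have "(T + (\<Sum>w\<in>W. real (c w) * tau w)) *\<^sub>R dir = (T + (\<Sum>w\<in>W. real (c' w) * tau w)) *\<^sub>R dir"
        by (rule translate_unique[OF s c(3)[unfolded P_def act_translate]])
      then have "T + (\<Sum>w\<in>W. real (c w) * tau w) = T + (\<Sum>w\<in>W. real (c' w) * tau w)"
        using d0 by (simp only: scaleR_cancel_right simp_thms)
      then have "(\<Sum>w\<in>W. (real (c w) - real (c' w)) * tau w) = 0" by (simp add: left_diff_distrib sum_subtractf)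
      then have z0: "(\<Sum>w\<in>W. ((real (c w) - real (c' w)) * tau w) *\<^sub>R dir) = 0"
        unfolding scaleR_sum_left[symmetric] by (simp only: scaleR_zero_left)
      have e: "int_scale ((int (c w) - int (c' w)) * z w) w = ((real (c w) - real (c' w)) * tau w) *\<^sub>R dir"
        if "w \<in> W" for w
      proof -
        have "int_scale ((int (c w) - int (c' w)) * z w) w = (real (c w) - real (c' w)) *\<^sub>R (real_of_int (z w) *\<^sub>R w)"
          by (simp add: int_scale_def)
        also have "\<dots> = (real (c w) - real (c' w)) *\<^sub>R (tau w *\<^sub>R dir)" by (simp only: zt(3)[OF that])
        also have "\<dots> = ((real (c w) - real (c' w)) * tau w) *\<^sub>R dir" by (rule scaleR_scaleR)
        finally show ?thesis .
      qed
      have "(\<Sum>w\<in>W. int_scale ((int (c w) - int (c' w)) * z w) w) = (\<Sum>w\<in>W. ((real (c w) - real (c' w)) * tau w) *\<^sub>R dir)"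
        by (rule sum.cong[OF HOL.refl]) (rule e)
      then have "(\<Sum>w\<in>W. int_scale ((int (c w) - int (c' w)) * z w) w) = 0" using z0 by (rule trans)
      then have zz: "\<forall>w\<in>W. (int (c w) - int (c' w)) * z w = 0"
        using W(3)[unfolded int_mod.dependent_finite[OF W(1)], unfolded not_ex, rule_format,
          of "\<lambda>w. (int (c w) - int (c' w)) * z w"] by blast
      have "c w = c' w" if "w \<in> W" for w
      proof -
        have "(int (c w) - int (c' w)) * z w = 0" using zz that by blast
        then show ?thesis using zt(1)[OF that] by simp
      qed
      then show "c = c'" using c(1,2) by (intro PiE_ext[of c W "\<lambda>_. {..n}" c']) auto
    qed
    then have "card ?D \<le> card (labelled_ball affine_form pos s0 (A + (l * card W) * n))"
      using card_mono[OF finite_labelled_ball sub] by (simp add: card_image)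
    then show ?thesis by (simp add: card_PiE[OF W(1)])
  qed
  then show ?thesis by blast
qed

end

section \<open>The growth rate of a connected affine quiver\<close>

lemma translate_opposite: "translate_seed w (opposite s) = opposite (translate_seed w s)"
  by (simp add: translate_seed_def opposite_def prod_eq_iff fun_eq_iff)

lemma reindex_opposite: "reindex \<sigma> (opposite s) = opposite (reindex \<sigma> s)"
  by (simp add: reindex_def reindex_matrix_def opposite_def vec_eq_iff fun_eq_iff)

context affine_coherent begin

lemma ball_opposite:
  assumes R: "R = mutation_reachable affine_form pos s0"
  shows "labelled_ball affine_form pos (opposite s0) m = opposite ` labelled_ball affine_form pos s0 m"
proof (induction m)
  case 0 show ?case by (simp add: labelled_ball_0)
next
  case (Suc m)
  have o: "seed_mutation affine_form pos k (opposite u) = opposite (seed_mutation affine_form pos k u)"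
    if "u \<in> labelled_ball affine_form pos s0 m" for u k
  proof (rule opposite_mutation)
    have "u \<in> R" using that unfolding R reachable_ball by blast
    then show "pos (- fst u k) \<longleftrightarrow> \<not> pos (fst u k)" by (rule neg_iff)
  qed
  have "{seed_mutation affine_form pos k s | k s. s \<in> opposite ` labelled_ball affine_form pos s0 m} =
    opposite ` {seed_mutation affine_form pos k s | k s. s \<in> labelled_ball affine_form pos s0 m}" (is "?A = ?B")
  proof (intro equalityI subsetI)
    fix x assume "x \<in> ?A"
    then obtain k u where "u \<in> labelled_ball affine_form pos s0 m" "x = seed_mutation affine_form pos k (opposite u)" by blast
    then show "x \<in> ?B" using o by blast
  next
    fix x assume "x \<in> ?B"
    then obtain k u where u: "u \<in> labelled_ball affine_form pos s0 m" "x = opposite (seed_mutation affine_form pos k u)" by blast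
    then have "x = seed_mutation affine_form pos k (opposite u)" using o by simp
    then show "x \<in> ?A" using u(1) by blast
  qed
  then show ?case unfolding labelled_ball_Suc Suc by (simp only: image_Un)
qed

text \<open>If the constant function has negative coefficients, acyclic seeds roll in the direction where
  all signs become constant.\<close>

lemma growth_lower_neg:
  assumes R: "R = mutation_reachable affine_form pos s0" and fin: "finite (snd ` R)"
    and s: "s \<in> R" and a: "acyc s i j k" and mu: "const_one = (\<Sum>i\<in>UNIV. mu i *\<^sub>R fst s i)" "\<And>l. mu l < 0"
    and W: "finite W" "W \<subseteq> twin_vectors" "\<not> module.dependent int_scale W"
  shows "\<exists>A B. \<forall>n. (n + 1) ^ card W \<le> card (labelled_ball affine_form pos s0 (A + B * n))"
proof -
  obtain mu' xi where "coords s mu' xi" using coords_exist[OF s] by blast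
  then have c: "coords s mu xi" using mu(1) unfolding coords_def by blast
  obtain r i j k where r: "r \<in> R" "acyc r i j k" "\<And>M. \<exists>t<M. act t r \<in> R"
    using roll_far[OF fin s a c mu(2)] by blast
  show ?thesis by (rule lower_bound[OF R fin r W])
qed

text \<open>If the coefficients are positive, the opposite seeds have negative ones.\<close>

lemma growth_lower:
  assumes R: "R = mutation_reachable affine_form pos s0" and fin: "finite (snd ` R)"
    and W: "finite W" "W \<subseteq> twin_vectors" "\<not> module.dependent int_scale W"
  shows "\<exists>A B. \<forall>n. (n + 1) ^ card W \<le> card (labelled_ball affine_form pos s0 (A + B * n))"
proof -
  have "s0 \<in> R" unfolding R by (rule reachable_refl)
  then have "R \<noteq> {}" by blast
  then obtain s i j k where s: "s \<in> R" and a: "acyc s i j k" using acyc_exists[OF fin] by blast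
  obtain mu xi where "coords s mu xi" using coords_exist[OF s] by blast
  then have mu: "const_one = (\<Sum>i\<in>UNIV. mu i *\<^sub>R fst s i)" unfolding coords_def by blast
  have "(\<forall>i. mu i > 0) \<or> (\<forall>i. mu i < 0)" by (rule const_coefficients[OF s acyc_form[OF s a] mu])
  then show ?thesis
  proof
    assume "\<forall>i. mu i < 0"
    then show ?thesis using growth_lower_neg[OF R fin s a mu _ W] by blast
  next
    assume p: "\<forall>i. mu i > 0"
    interpret op: affine_coherent pos "opposite ` R" "\<lambda>x y. - om x y" by (rule affine_opposite)
    have oe: "op.eul x y = eul y x" for x y
      unfolding op.eul_def eul_def using om_sym[of x y] form_sym[of x y] by simp
    have oR: "opposite ` R = mutation_reachable affine_form pos (opposite s0)"
      unfolding R reachable_ball ball_opposite[OF R] by blast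
    have of: "finite (snd ` opposite ` R)"
    proof -
      have "snd ` opposite ` R = uminus ` snd ` R" unfolding image_image opposite_simps ..
      then show ?thesis using fin by simp
    qed
    have oa: "op.acyc (opposite s) k j i"
    proof -
      have sw: "snd s $ j $ i = - (snd s $ i $ j)" "snd s $ k $ i = - (snd s $ i $ k)" "snd s $ k $ j = - (snd s $ j $ k)"
        using skewD[OF skew[OF s]] by blast+
      show ?thesis using a unfolding op.acyc_def op.exceptional_def acyc_def exceptional_def oe opposite_simps eul_minus
        by (auto simp: sw)
    qed
    have om: "const_one = (\<Sum>i\<in>UNIV. (- mu i) *\<^sub>R fst (opposite s) i)" using mu by (simp add: opposite_simps)
    have oW: "W \<subseteq> op.twin_vectors"
    proof
      fix w assume "w \<in> W"
      then obtain r q \<sigma> where r: "r \<in> R" "q \<in> R" "bij \<sigma>" "translate_seed w r = reindex \<sigma> q"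
        using W(2) unfolding twin_vectors_def by blast
      have "translate_seed w (opposite r) = reindex \<sigma> (opposite q)" unfolding translate_opposite reindex_opposite r(4) ..
      then show "w \<in> op.twin_vectors" unfolding op.twin_vectors_def using r(1-3) by blast
    qed
    obtain A B where AB: "\<And>n. (n + 1) ^ card W \<le> card (labelled_ball affine_form pos (opposite s0) (A + B * n))"
      using op.growth_lower_neg[OF oR of _ oa om _ W(1) oW W(3)] s p by auto
    have "card (labelled_ball affine_form pos (opposite s0) m) = card (labelled_ball affine_form pos s0 m)" for m
      unfolding ball_opposite[OF R] by (intro card_image inj_on_inverseI[of _ opposite]) (rule opposite_simps)
    then show ?thesis using AB by metis
  qed
qed

end

text \<open>Any generating set of a group of rank \<open>r\<close> contains \<open>r\<close> independent elements, because rational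
  and integral independence are the same.\<close>

lemma int_rank_generators:
  assumes "has_int_rank (module.span int_scale V) r"
  shows "\<exists>W\<subseteq>V. finite W \<and> \<not> module.dependent int_scale W \<and> card W = r"
proof -
  obtain S where S: "S \<subseteq> module.span int_scale V" "finite S" "\<not> module.dependent int_scale S" "card S = r"
    using assms unfolding has_int_rank_def by blast
  obtain B where B: "B \<subseteq> V" "\<not> module.dependent rat_scale B" "V \<subseteq> module.span rat_scale B"
    using rat_vs.maximal_independent_subset[of V] by blast
  have "module.span rat_scale V \<subseteq> module.span rat_scale B" using rat_vs.span_minimal[OF B(3)] rat_vs.subspace_span by blast
  then have SB: "S \<subseteq> module.span rat_scale B" using S(1) int_span_subset_rat_span[of V] by blast
  have indS: "\<not> module.dependent rat_scale S" using S(3) int_independent_iff[OF S(2)] by blast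
  obtain W where W: "W \<subseteq> B" "finite W" "card W = r"
  proof (cases "finite B")
    case True
    then have "r \<le> card B" using rat_vs.independent_span_bound[OF True indS SB] S(4) by simp
    then show ?thesis using obtain_subset_with_card_n[of r B] True that finite_subset by metis
  next
    case False
    then show ?thesis using infinite_arbitrarily_large[OF False, of r] that by blast
  qed
  have "\<not> module.dependent rat_scale W" using B(2) W(1) rat_vs.independent_mono by blast
  then have "\<not> module.dependent int_scale W" using int_independent_iff[OF W(2)] by blast
  then show ?thesis using W B(1) by blast
qed

text \<open>Passing from labelled seeds to seeds divides the number by at most the number of permutations.\<close>

lemma growth_between:
  fixes s0 :: "(3, 'v::real_vector) labelled_seed"
  assumes inv: "\<And>s k. s \<in> mutation_reachable form pos s0 \<Longrightarrow> seed_mutation form pos k (seed_mutation form pos k s) = s"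
    and up: "\<And>m. real (card (labelled_ball form pos s0 m)) \<le> C * (real m + 1) ^ r"
    and low: "\<And>n. (n + 1) ^ r \<le> card (labelled_ball form pos s0 (A + B * n))"
  shows "polynomial_growth (exchange_growth form pos s0)" "growth_rate (exchange_growth form pos s0) = r"
proof -
  have g: "exchange_growth form pos s0 m = card (seed_class ` labelled_ball form pos s0 m)" for m
    by (rule exchange_growth_eq[OF inv])
  have u: "real (exchange_growth form pos s0 m) \<le> C * (real m + 1) ^ r" for m
  proof -
    have "real (exchange_growth form pos s0 m) \<le> real (card (labelled_ball form pos s0 m))"
      unfolding g of_nat_le_iff by (rule card_image_le[OF finite_labelled_ball])
    then show ?thesis using up[of m] by linarith
  qed
  show "polynomial_growth (exchange_growth form pos s0)" by (rule polynomial_growthI[OF u])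
  define N where "N = card {\<sigma> :: 3 \<Rightarrow> 3. bij \<sigma>}"
  have "finite {\<sigma> :: 3 \<Rightarrow> 3. bij \<sigma>}" by (rule finite_subset[OF subset_UNIV finite])
  moreover have "id \<in> {\<sigma> :: 3 \<Rightarrow> 3. bij \<sigma>}" by simp
  ultimately have N: "N > 0" unfolding N_def using card_gt_0_iff by blast
  have l: "(1 / real N) * (real n + 1) ^ r \<le> real (exchange_growth form pos s0 (A + B * n))" for n
  proof -
    have "(n + 1) ^ r \<le> N * exchange_growth form pos s0 (A + B * n)"
      using low[of n] card_ball_le[OF finite_labelled_ball, of form pos s0 "A + B * n"] unfolding g N_def by linarith
    then have "real ((n + 1) ^ r) \<le> real (N * exchange_growth form pos s0 (A + B * n))" by (simp only: of_nat_le_iff)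
    then have "(real n + 1) ^ r \<le> real N * real (exchange_growth form pos s0 (A + B * n))" by (simp add: add.commute)
    then show ?thesis using N by (simp add: field_simps)
  qed
  show "growth_rate (exchange_growth form pos s0) = r" by (rule growth_rate_eqI[OF u _ l]) (use N in simp)
qed

lemma connected_growth:
  fixes v :: "3 \<Rightarrow> affine_fun" and B :: "real^3^3" and u :: plane_ref
  assumes sk: "skew_symmetric B" and mf: "mutation_finite B" and gr: "geometric_realisation affine_form v B"
    and gp: "general_position affine_form (plane_pos u) (v, B)" and co: "compatible affine_form (plane_pos u) (v, B)"
    and c: "\<And>i. \<not> isolated i B"
  shows "polynomial_growth (exchange_growth affine_form (plane_pos u) (v, B))"
    "has_int_rank (translation_lattice (exchange_vertices affine_form (plane_pos u) (v, B)))
       (growth_rate (exchange_growth affine_form (plane_pos u) (v, B)))"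
proof -
  define R where "R = mutation_reachable affine_form (plane_pos u) (v, B)"
  obtain om where "coherent affine_form (plane_pos u) R om"
    using affine_coherent_exists[OF sk mf gr gp co c] unfolding R_def by blast
  then interpret affine_coherent "plane_pos u" R om
    unfolding affine_coherent_def affine_coherent_axioms_def using plane_pos_const by blast
  have fin: "finite (snd ` R)"
  proof (rule finite_subset)
    show "snd ` R \<subseteq> matrix_reach B" using reach_matrix by (fastforce simp: R_def)
    show "finite (matrix_reach B)" using mf by (simp add: mutation_finite_def matrix_reach_def)
  qed
  let ?L = "translation_lattice (exchange_vertices affine_form (plane_pos u) (v, B))"
  have tv: "translation_vectors (exchange_vertices affine_form (plane_pos u) (v, B)) = twin_vectors"
    unfolding set_eq_iff translation_vectors_iff twin_vectors_def R_def[symmetric] mem_Collect_eq by blast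
  obtain r C where r: "has_int_rank ?L r"
    "\<And>m. real (card (labelled_ball affine_form (plane_pos u) (v, B) m)) \<le> C * (real m + 1) ^ r"
    using upper_bound[OF R_def fin] by blast
  obtain W where W: "W \<subseteq> twin_vectors" "finite W" "\<not> module.dependent int_scale W" "card W = r"
    using int_rank_generators[OF r(1)[unfolded translation_lattice_def tv]] by blast
  obtain A D where AD: "\<And>n. (n + 1) ^ card W \<le> card (labelled_ball affine_form (plane_pos u) (v, B) (A + D * n))"
    using growth_lower[OF R_def fin W(2,1,3)] by blast
  note gb = growth_between[of affine_form "plane_pos u" "(v, B)" C r A D, OF involutive[unfolded R_def] r(2) AD[unfolded W(4)]]
  show "polynomial_growth (exchange_growth affine_form (plane_pos u) (v, B))" by (rule gb(1))
  show "has_int_rank ?L (growth_rate (exchange_growth affine_form (plane_pos u) (v, B)))"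
    using r(1) by (rule back_subst[of "has_int_rank ?L"]) (rule gb(2)[symmetric])
qed

section \<open>Affine quivers with an isolated vertex\<close>

lemma plane_perp:
  fixes a b w :: "real^2"
  assumes "b \<noteq> 0" "b \<bullet> a = 0" "b \<bullet> w = 0" "a \<bullet> a = 2"
  shows "w = ((w \<bullet> a) / 2) *\<^sub>R a"
proof -
  have ab: "b$1 * a$1 + b$2 * a$2 = 0" "b$1 * w$1 + b$2 * w$2 = 0" "a$1 * a$1 + a$2 * a$2 = 2"
    using assms(2-4) by (simp_all add: inner_vec_def sum_2)
  have "b$1 * (a$1 * w$2 - a$2 * w$1) = (b$1 * a$1 + b$2 * a$2) * w$2 - a$2 * (b$1 * w$1 + b$2 * w$2)"
    "b$2 * (a$1 * w$2 - a$2 * w$1) = a$1 * (b$1 * w$1 + b$2 * w$2) - (b$1 * a$1 + b$2 * a$2) * w$1" by algebra+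
  moreover have "b$1 \<noteq> 0 \<or> b$2 \<noteq> 0" using assms(1) by (simp add: vec_eq_iff forall_2)
  ultimately have d: "a$1 * w$2 = a$2 * w$1" unfolding ab by auto
  have "w$1 * (a$1 * a$1 + a$2 * a$2) = (w$1 * a$1 + w$2 * a$2) * a$1" using d by algebra
  moreover have "w$2 * (a$1 * a$1 + a$2 * a$2) = (w$1 * a$1 + w$2 * a$2) * a$2" using d by algebra
  ultimately show ?thesis unfolding ab by (simp add: vec_eq_iff forall_2 inner_vec_def sum_2)
qed

lemma infinite_ball:
  fixes s0 :: "('n::finite, 'v::real_vector) labelled_seed"
  assumes "infinite (mutation_reachable form pos s0)"
  shows "m + 1 \<le> card (labelled_ball form pos s0 m)"
proof (induction m)
  case 0 show ?case by (simp add: labelled_ball_0)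
next
  case (Suc m)
  have "labelled_ball form pos s0 (Suc m) \<noteq> labelled_ball form pos s0 m"
  proof
    assume eq: "labelled_ball form pos s0 (Suc m) = labelled_ball form pos s0 m"
    have "s \<in> labelled_ball form pos s0 m" if "s \<in> mutation_reachable form pos s0" for s
      using that
    proof (induction rule: reachable_induct)
      case base show ?case by (rule labelled_ball_mono[of _ _ _ _ 0]) (simp_all add: labelled_ball_0)
    next
      case (step s k)
      then have "seed_mutation form pos k s \<in> labelled_ball form pos s0 (Suc m)" unfolding labelled_ball_Suc by blast
      then show ?case unfolding eq .
    qed
    then have "mutation_reachable form pos s0 \<subseteq> labelled_ball form pos s0 m" by (rule subsetI)
    from finite_subset[OF this finite_labelled_ball] show False using assms by contradiction
  qed
  then have "labelled_ball form pos s0 m \<subset> labelled_ball form pos s0 (Suc m)" unfolding labelled_ball_Suc by blast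
  then have "card (labelled_ball form pos s0 m) < card (labelled_ball form pos s0 (Suc m))"
    by (rule psubset_card_mono[OF finite_labelled_ball])
  then show ?case using Suc by simp
qed

text \<open>The isolated vector is orthogonal to the other two, which are parallel therefore. Their lines are
  equidistant, and are described by one coordinate.\<close>

locale affine_isolated = seed_space affine_form pos for pos +
  fixes R :: "(3, affine_fun) labelled_seed set" and s0 and i j k :: 3
  assumes R: "R = mutation_reachable affine_form pos s0"
    and realis: "s \<in> R \<Longrightarrow> realises affine_form s"
    and basis: "s \<in> R \<Longrightarrow> basis3 (fst s)"
    and dec: "s \<in> R \<Longrightarrow> pos (- fst s l) \<longleftrightarrow> \<not> pos (fst s l)"
    and ne: "i \<noteq> j" "j \<noteq> k" "i \<noteq> k"
    and iso: "isolated i (snd s0)"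
begin

definition a :: "real^2" where "a = fst (fst s0 j)"

definition loc :: "affine_fun \<Rightarrow> real" where "loc f = snd f * (fst f \<bullet> a) / 2"

definition gap :: real where "gap = loc (fst s0 k) - loc (fst s0 j)"

lemma s0: "s0 \<in> R" unfolding R by (rule reachable_refl)

lemma closed: "s \<in> R \<Longrightarrow> seed_mutation affine_form pos l s \<in> R" unfolding R by (rule reachable_mutation)

lemma skew: "s \<in> R \<Longrightarrow> skew_symmetric (snd s)" using realis by (simp add: realises_def)

lemma norm: "s \<in> R \<Longrightarrow> fst (fst s l) \<bullet> fst (fst s l) = 2"
  using realis by (simp add: realises_def affine_form_def)

lemma nonzero: "s \<in> R \<Longrightarrow> fst (fst s l) \<noteq> 0" using norm[of s l] by auto

lemma weight: assumes "s \<in> R" "x \<noteq> y" shows "\<bar>fst (fst s x) \<bullet> fst (fst s y)\<bar> = \<bar>snd s $ x $ y\<bar>"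
proof -
  obtain z where "y \<noteq> z" "x \<noteq> z" using distinct3_ex assms(2) three_cases by metis
  then show ?thesis using realis[OF assms(1)] assms(2) unfolding realises_def sign_compat_def affine_form_def by blast
qed

lemma iso_R: "s \<in> R \<Longrightarrow> isolated i (snd s)"
proof -
  assume s: "s \<in> R"
  then have "s \<in> mutation_reachable affine_form pos s0" by (simp add: R)
  then show ?thesis
  proof (induction rule: reachable_induct)
    case base show ?case by (rule iso)
  next
    case (step s l)
    then have "skew_symmetric (snd s)" using skew R by blast
    then show ?case using step.IH isolated_mutation unfolding snd_mutation by blast
  qed
qed

lemma perp: assumes "s \<in> R" "l \<noteq> i" shows "fst (fst s i) \<bullet> fst (fst s l) = 0"
  using weight[OF assms(1) assms(2)[symmetric]] iso_R[OF assms(1)] by (simp add: isolated_def)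

lemma vec_i: "s \<in> R \<Longrightarrow> fst s i = fst s0 i \<or> fst s i = - fst s0 i"
proof -
  assume "s \<in> R"
  then have "s \<in> mutation_reachable affine_form pos s0" by (simp add: R)
  then show ?thesis
  proof (induction rule: reachable_induct)
    case (step s l)
    then have "snd s $ i $ l = 0" using iso_R R by (simp add: isolated_def)
    then have "fst (seed_mutation affine_form pos l s) i = (if i = l then - fst s l else fst s i)" by (simp add: fst_mutation)
    then show ?case using step.IH by auto
  qed simp
qed

lemma par: assumes s: "s \<in> R" and l: "l \<noteq> i" shows "fst (fst s l) = a \<or> fst (fst s l) = - a"
proof -
  have "fst (fst s0 i) \<bullet> a = 0" unfolding a_def by (rule perp[OF s0]) (use ne in simp)
  moreover have "fst (fst s0 i) \<bullet> fst (fst s l) = 0" using vec_i[OF s] perp[OF s l] by auto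
  moreover have aa: "a \<bullet> a = 2" unfolding a_def by (rule norm[OF s0])
  ultimately have e: "fst (fst s l) = ((fst (fst s l) \<bullet> a) / 2) *\<^sub>R a" using plane_perp nonzero[OF s0] by blast
  define c where "c = (fst (fst s l) \<bullet> a) / 2"
  have "fst (fst s l) = c *\<^sub>R a" using e by (simp add: c_def)
  moreover from this have "c * c * 2 = 2" using norm[OF s, of l] aa by simp
  then have "c = 1 \<or> c = -1" by (simp add: square_eq_1_iff)
  ultimately show ?thesis by auto
qed

lemma aa: "a \<bullet> a = 2" unfolding a_def by (rule norm[OF s0])

lemma loc_par: "fst f = a \<Longrightarrow> loc f = snd f" "fst f = - a \<Longrightarrow> loc f = - snd f" "loc (- f) = loc f"
  by (simp_all add: loc_def aa)

lemma weight_nz: assumes s: "s \<in> R" and xy: "x \<noteq> i" "y \<noteq> i" "x \<noteq> y" shows "snd s $ x $ y \<noteq> 0"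
proof
  assume "snd s $ x $ y = 0"
  then have "fst (fst s x) \<bullet> fst (fst s y) = 0" using weight[OF s xy(3)] by simp
  then show False using par[OF s xy(1)] par[OF s xy(2)] aa by auto
qed

lemma mu:
  assumes s: "s \<in> R" and xy: "x \<noteq> i" "y \<noteq> i" "x \<noteq> y"
  defines "t \<equiv> seed_mutation affine_form pos x s"
  shows "t \<in> R" "fst t x = - fst s x" "loc (fst t x) = loc (fst s x)" "snd t $ x $ y = - (snd s $ x $ y)"
    "pos (fst s x) = (snd s $ x $ y > 0) \<Longrightarrow> loc (fst t y) = 2 * loc (fst s x) - loc (fst s y)"
    "pos (fst s x) \<noteq> (snd s $ x $ y > 0) \<Longrightarrow> fst t y = fst s y"
proof -
  have sw: "snd s $ y $ x = - (snd s $ x $ y)" by (rule skewD[OF skew[OF s]])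
  have nz: "snd s $ x $ y \<noteq> 0" by (rule weight_nz[OF s xy])
  show "t \<in> R" unfolding t_def by (rule closed[OF s])
  show x: "fst t x = - fst s x" by (simp add: t_def fst_mutation)
  show "loc (fst t x) = loc (fst s x)" unfolding x by (rule loc_par)
  show "snd t $ x $ y = - (snd s $ x $ y)" using xy(3) by (simp add: t_def snd_mutation matrix_mutation_nth)
  show "fst t y = fst s y" if "pos (fst s x) \<noteq> (snd s $ x $ y > 0)"
    using that xy(3) by (auto simp: t_def fst_mutation sw)
  show "loc (fst t y) = 2 * loc (fst s x) - loc (fst s y)" if c: "pos (fst s x) = (snd s $ x $ y > 0)"
  proof -
    have "(pos (fst s x) \<and> snd s $ y $ x < 0) \<or> (\<not> pos (fst s x) \<and> snd s $ y $ x > 0)" using c nz by (auto simp: sw)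
    then have e: "fst t y = fst s y - affine_form (fst s y) (fst s x) *\<^sub>R fst s x"
      using xy(3)[symmetric] unfolding t_def fst_mutation by simp
    show ?thesis using par[OF s xy(1)] par[OF s xy(2)]
      by (auto simp: e loc_def affine_form_def aa inner_diff_left inner_add_left inner_scaleR_left algebra_simps diff_divide_distrib add_divide_distrib)
  qed
qed

lemma positions:
  assumes "s \<in> R"
  shows "\<exists>n m. loc (fst s j) = loc (fst s0 j) + real_of_int n * gap \<and> loc (fst s k) = loc (fst s0 j) + real_of_int m * gap \<and> \<bar>n - m\<bar> = 1"
proof -
  have "s \<in> mutation_reachable affine_form pos s0" using assms by (simp add: R)
  then show ?thesis
  proof (induction rule: reachable_induct)
    case base show ?case by (intro exI[of _ 0] exI[of _ 1]) (simp add: gap_def)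
  next
    case (step s l)
    have s: "s \<in> R" using step by (simp add: R)
    let ?t = "seed_mutation affine_form pos l s" and ?c = "loc (fst s0 j)"
    obtain n m :: int where nm: "loc (fst s j) = ?c + real_of_int n * gap" "loc (fst s k) = ?c + real_of_int m * gap" "\<bar>n - m\<bar> = 1"
      using step.IH by blast
    have alt: "\<bar>n - (2 * n - m)\<bar> = 1" "\<bar>2 * m - n - m\<bar> = 1" using nm(3) by linarith+
    have r: "2 * loc (fst s j) - loc (fst s k) = ?c + real_of_int (2 * n - m) * gap"
      "2 * loc (fst s k) - loc (fst s j) = ?c + real_of_int (2 * m - n) * gap" unfolding nm by (simp_all add: algebra_simps)
    note mj = mu[OF s, of j k] and mk = mu[OF s, of k j]
    consider "l = i" | "l = j" | "l = k" using three_cases[OF ne] by blast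
    then show ?case
    proof cases
      case 1
      have "snd s $ j $ i = 0" "snd s $ k $ i = 0"
        using iso_R[OF s] skewD[OF skew[OF s], of i j] skewD[OF skew[OF s], of i k] by (simp_all add: isolated_def)
      then have "fst ?t j = fst s j" "fst ?t k = fst s k" using 1 ne by (simp_all add: fst_mutation)
      then show ?thesis using nm by metis
    next
      case 2
      show ?thesis
      proof (cases "pos (fst s j) = (snd s $ j $ k > 0)")
        case True
        then have "loc (fst ?t k) = ?c + real_of_int (2 * n - m) * gap" using mj(5) ne 2 r by simp
        moreover have "loc (fst ?t j) = ?c + real_of_int n * gap" using mj(3) ne 2 nm by simp
        ultimately show ?thesis using alt(1) by blast
      next
        case False
        then have "fst ?t k = fst s k" "loc (fst ?t j) = loc (fst s j)" using mj(3,6) ne 2 by simp_all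
        then show ?thesis using nm by metis
      qed
    next
      case 3
      show ?thesis
      proof (cases "pos (fst s k) = (snd s $ k $ j > 0)")
        case True
        then have "loc (fst ?t j) = ?c + real_of_int (2 * m - n) * gap" using mk(5) ne 3 r by simp
        moreover have "loc (fst ?t k) = ?c + real_of_int m * gap" using mk(3) ne 3 nm by simp
        ultimately show ?thesis using alt(2) by blast
      next
        case False
        then have "fst ?t j = fst s j" "loc (fst ?t k) = loc (fst s k)" using mk(3,6) ne 3 by simp_all
        then show ?thesis using nm by metis
      qed
    qed
  qed
qed

lemma gap_nz: "gap \<noteq> 0"
proof
  assume "gap = 0"
  then have l: "loc (fst s0 j) = loc (fst s0 k)" by (simp add: gap_def)
  have "fst s0 k = fst s0 j \<or> fst s0 k = - fst s0 j"
    using par[OF s0, of j] par[OF s0, of k] ne l loc_par(1,2)[of "fst s0 j"] loc_par(1,2)[of "fst s0 k"]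
    by (auto simp: prod_eq_iff)
  then obtain c :: real where "fst s0 k = c *\<^sub>R fst s0 j" by (metis scaleR_minus1_left scaleR_one)
  then have "c *\<^sub>R fst s0 j + (- 1) *\<^sub>R fst s0 k + 0 *\<^sub>R fst s0 i = 0" by simp
  then have "(- 1 :: real) = 0" using basis[OF s0] ne unfolding basis3_three[OF ne(2) ne(3)[symmetric] ne(1)[symmetric]] by blast
  then show False by simp
qed

lemma loc_diff: assumes s: "s \<in> R" and xy: "x \<noteq> i" "y \<noteq> i" "x \<noteq> y" shows "loc (fst s x) \<noteq> loc (fst s y)"
proof -
  obtain n m :: int where nm: "loc (fst s j) = loc (fst s0 j) + real_of_int n * gap" "loc (fst s k) = loc (fst s0 j) + real_of_int m * gap" "\<bar>n - m\<bar> = 1"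
    using positions[OF s] by blast
  have "n \<noteq> m" using nm(3) by auto
  then have "loc (fst s j) \<noteq> loc (fst s k)" unfolding nm using gap_nz by simp
  then show ?thesis using three_cases[OF ne, of x] three_cases[OF ne, of y] xy by auto
qed

text \<open>If there were finitely many seeds, then a line with greatest coordinate would occur. Mutation at it
  cannot reflect the other line beyond it; changing the relevant signs by further mutations leads to a
  contradiction.\<close>

lemma infinite_R: "infinite R"
proof
  assume f: "finite R"
  define P where "P = {loc (fst s l) | s l. s \<in> R \<and> l \<noteq> i}"
  have "P \<subseteq> (\<lambda>(s, l). loc (fst s l)) ` (R \<times> UNIV)" unfolding P_def by force
  then have fP: "finite P" using f finite_subset by (metis finite_SigmaI finite_imageI finite)
  have "loc (fst s0 j) \<in> P" unfolding P_def by (intro CollectI exI[of _ s0] exI[of _ j]) (use s0 ne in simp)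
  then have "P \<noteq> {}" by blast
  have mem: "\<exists>s l. s \<in> R \<and> l \<noteq> i \<and> loc (fst s l) = p" if "p \<in> P" for p using that unfolding P_def by blast
  obtain s x where s: "s \<in> R" "x \<noteq> i" "loc (fst s x) = Max P" using mem[OF Max_in[OF fP \<open>P \<noteq> {}\<close>]] by blast
  have max: "loc (fst t l) \<le> Max P" if "t \<in> R" "l \<noteq> i" for t l
  proof (rule Max_ge[OF fP])
    show "loc (fst t l) \<in> P" unfolding P_def by (intro CollectI exI[of _ t] exI[of _ l]) (use that in simp)
  qed
  obtain y where y: "y \<noteq> i" "x \<noteq> y"
  proof (cases "x = j")
    case True then show ?thesis using that[of k] ne by simp
  next
    case False then show ?thesis using that[of j] ne by simp
  qed
  have one: "pos (fst t x) \<noteq> (snd t $ x $ y > 0)" if t: "t \<in> R" "loc (fst t x) = Max P" for t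
  proof
    assume "pos (fst t x) = (snd t $ x $ y > 0)"
    from mu(5)[OF t(1) s(2) y this] have "loc (fst (seed_mutation affine_form pos x t) y) = 2 * Max P - loc (fst t y)" using t by simp
    moreover have "loc (fst t y) < Max P" using max[OF t(1) y(1)] loc_diff[OF t(1) s(2) y] t(2) by simp
    moreover have "loc (fst (seed_mutation affine_form pos x t) y) \<le> Max P" by (rule max[OF closed[OF t(1)] y(1)])
    ultimately show False by simp
  qed
  have two: "pos (fst t y) = (snd t $ y $ x > 0)" if t: "t \<in> R" "loc (fst t x) = Max P" for t
  proof (rule ccontr)
    assume c: "pos (fst t y) \<noteq> (snd t $ y $ x > 0)"
    let ?u = "seed_mutation affine_form pos y t"
    note m = mu[OF t(1) y(1) s(2) y(2)[symmetric]]
    have ux: "fst ?u x = fst t x" by (rule m(6)[OF c])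
    have b: "snd ?u $ x $ y = - (snd t $ x $ y)" using y(2) by (simp add: snd_mutation matrix_mutation_nth)
    show False using one[OF t] one[OF m(1)] weight_nz[OF t(1) s(2) y] ux t(2) unfolding b by auto
  qed
  let ?t = "seed_mutation affine_form pos x s"
  note m = mu[OF s(1,2) y]
  have ty: "fst ?t y = fst s y" by (rule m(6)[OF one[OF s(1,3)]])
  have b: "snd ?t $ y $ x = - (snd s $ y $ x)" using y(2) by (simp add: snd_mutation matrix_mutation_nth)
  show False using two[OF s(1,3)] two[OF m(1)] m(3) s(3) ty weight_nz[OF s(1) y(1) s(2) y(2)[symmetric]] unfolding b by auto
qed

lemma same_i:
  assumes "s \<in> R" "r \<in> R" "fst (fst s i) = fst (fst r i)" shows "fst s i = fst r i"
proof -
  consider "fst s i = fst r i" | "fst s i = - fst r i" using vec_i[OF assms(1)] vec_i[OF assms(2)] by fastforce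
  then show ?thesis
  proof cases
    case 2
    have "fst (fst r i) = - fst (fst r i)" using assms(3) unfolding 2 by simp
    then have "fst (fst r i) \<bullet> fst (fst r i) = fst (fst r i) \<bullet> (- fst (fst r i))" by (rule arg_cong)
    then show ?thesis using norm[OF assms(2), of i] by simp
  qed
qed

text \<open>A translation has to fix the line of the isolated vector and to permute the equidistant lines of the
  other two.\<close>

lemma translation_vectors_gap:
  assumes w: "w \<in> translation_vectors (exchange_vertices affine_form pos s0)"
  shows "\<exists>z::int. w = of_int z *\<^sub>R ((gap / 2) *\<^sub>R a)"
proof -
  obtain r s \<sigma> where r: "r \<in> R" "s \<in> R" "bij \<sigma>" "translate_seed w r = reindex \<sigma> s"
    using w unfolding translation_vectors_iff R by blast
  have f: "fst s (\<sigma> l) = (fst (fst r l), snd (fst r l) - fst (fst r l) \<bullet> w)" for l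
  proof -
    have "fst (reindex \<sigma> s) l = fst (translate_seed w r) l" using r(4) by simp
    then show ?thesis by (simp add: reindex_def translate_seed_def)
  qed
  have b: "snd s $ \<sigma> l $ \<sigma> m = snd r $ l $ m" for l m
  proof -
    have "snd (reindex \<sigma> s) $ l $ m = snd (translate_seed w r) $ l $ m" using r(4) by simp
    then show ?thesis by (simp add: reindex_def reindex_matrix_def translate_seed_def)
  qed
  have si: "\<sigma> i = i"
  proof (rule ccontr)
    assume c: "\<sigma> i \<noteq> i"
    obtain y where y: "y \<noteq> i" "\<sigma> i \<noteq> y"
    proof (cases "\<sigma> i = j")
      case True then show ?thesis using that[of k] ne by simp
    next
      case False then show ?thesis using that[of j] ne by simp
    qed
    obtain m where m: "y = \<sigma> m" using r(3) by (metis bij_pointE)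
    have "snd s $ \<sigma> i $ \<sigma> m = 0" unfolding b using iso_R[OF r(1)] by (simp add: isolated_def)
    then show False using weight_nz[OF r(2) c y] m by simp
  qed
  have sj: "\<sigma> j \<noteq> i" using si r(3) ne by (metis bij_pointE)
  have "fst (fst s i) = fst (fst r i)" using f[of i] unfolding si by simp
  from same_i[OF r(2,1) this] have bw: "fst (fst r i) \<bullet> w = 0" using f[of i] unfolding si by (simp add: prod_eq_iff)
  have "fst (fst r i) \<bullet> a = 0" using par[OF r(1), of j] perp[OF r(1), of j] ne by auto
  then have w: "w = ((w \<bullet> a) / 2) *\<^sub>R a" using plane_perp[OF nonzero[OF r(1)] _ bw aa] by blast
  have in_lattice: "\<exists>n::int. loc (fst t l) = loc (fst s0 j) + real_of_int n * gap" if "t \<in> R" "l \<noteq> i" for t l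
    using positions[OF that(1)] three_cases[OF ne, of l] that(2) by blast
  obtain n m :: int where n: "loc (fst r j) = loc (fst s0 j) + real_of_int n * gap" "loc (fst s (\<sigma> j)) = loc (fst s0 j) + real_of_int m * gap"
    using in_lattice[OF r(1), of j] in_lattice[OF r(2) sj] ne by auto
  have "loc (fst s (\<sigma> j)) = loc (fst r j) - w \<bullet> a"
    using par[OF r(1), of j] ne unfolding f loc_def by (auto simp: aa inner_commute algebra_simps diff_divide_distrib add_divide_distrib)
  then have "w \<bullet> a = of_int (n - m) * gap" unfolding n by (simp add: algebra_simps)
  then have "w = of_int (n - m) *\<^sub>R ((gap / 2) *\<^sub>R a)" using w by simp
  then show ?thesis ..
qed

text \<open>There are infinitely many seeds, but finitely many types of seeds up to a translation of the two lines.\<close>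

lemma nonzero_translation:
  assumes fin: "finite (snd ` R)"
  shows "\<exists>w. w \<noteq> 0 \<and> w \<in> translation_vectors (exchange_vertices affine_form pos s0)"
proof -
  \<comment> \<open>the last entry tells which of the two neighbouring lines comes first\<close>
  define ty where "ty s = (snd s, fst s i, fst (fst s j), fst (fst s k), loc (fst s j) < loc (fst s k))" for s :: "(3, affine_fun) labelled_seed"
  have "ty ` R \<subseteq> snd ` R \<times> {fst s0 i, - fst s0 i} \<times> {a, - a} \<times> {a, - a} \<times> UNIV"
  proof
    fix y assume "y \<in> ty ` R"
    then obtain s where s: "s \<in> R" "y = ty s" by blast
    then show "y \<in> snd ` R \<times> {fst s0 i, - fst s0 i} \<times> {a, - a} \<times> {a, - a} \<times> UNIV"
      using vec_i[OF s(1)] par[OF s(1), of j] par[OF s(1), of k] ne by (simp add: ty_def)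
  qed
  moreover have "finite (snd ` R \<times> {fst s0 i, - fst s0 i} \<times> {a, - a} \<times> {a, - a} \<times> (UNIV :: bool set))"
    by (intro finite_cartesian_product fin) simp_all
  ultimately have "finite (ty ` R)" by (rule finite_subset)
  then have "\<not> inj_on ty R" using infinite_R finite_imageD by blast
  then obtain r s where rs: "r \<in> R" "s \<in> R" "r \<noteq> s" "ty r = ty s" unfolding inj_on_def by blast
  define d where "d = loc (fst s j) - loc (fst r j)"
  define w where "w = (- d / 2) *\<^sub>R a"
  have t: "snd r = snd s" "fst r i = fst s i" "fst (fst r j) = fst (fst s j)" "fst (fst r k) = fst (fst s k)"
    "loc (fst r j) < loc (fst r k) \<longleftrightarrow> loc (fst s j) < loc (fst s k)" using rs(4) by (simp_all add: ty_def)
  have dist: "\<bar>loc (fst t j) - loc (fst t k)\<bar> = \<bar>gap\<bar>" if t: "t \<in> R" for t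
  proof -
    obtain n m :: int where nm: "loc (fst t j) = loc (fst s0 j) + real_of_int n * gap" "loc (fst t k) = loc (fst s0 j) + real_of_int m * gap" "\<bar>n - m\<bar> = 1"
      using positions[OF t] by blast
    have "loc (fst t j) - loc (fst t k) = of_int (n - m) * gap" unfolding nm by (simp add: algebra_simps)
    then have "\<bar>loc (fst t j) - loc (fst t k)\<bar> = of_int \<bar>n - m\<bar> * \<bar>gap\<bar>" by (simp add: abs_mult)
    then show ?thesis unfolding nm(3) by simp
  qed
  have dk: "loc (fst s k) - loc (fst r k) = d" using dist[OF rs(1)] dist[OF rs(2)] t(5) unfolding d_def by linarith
  have sh: "fst s l = (fst (fst r l), snd (fst r l) - fst (fst r l) \<bullet> w)" if l: "l \<noteq> i" for l
  proof -
    have fl: "fst (fst r l) = fst (fst s l)" and dl: "loc (fst s l) - loc (fst r l) = d"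
      using three_cases[OF ne, of l] l t(3,4) dk by (auto simp: d_def)
    show ?thesis using par[OF rs(2) l] fl dl loc_par(1,2)[of "fst s l"] loc_par(1,2)[of "fst r l"]
      by (auto simp: prod_eq_iff w_def aa diff_divide_distrib)
  qed
  have iw: "fst (fst r i) \<bullet> w = 0" using par[OF rs(1), of j] perp[OF rs(1), of j] ne by (auto simp: w_def)
  have "fst s l = (fst (fst r l), snd (fst r l) - fst (fst r l) \<bullet> w)" for l
    using sh[of l] iw t(2) by (cases "l = i") (simp_all add: prod_eq_iff)
  then have eq: "translate_seed w r = s" using t(1) by (simp add: translate_seed_def prod_eq_iff fun_eq_iff)
  have "w \<noteq> 0"
  proof
    assume "w = 0" then show False using eq rs(3) by (simp add: translate_0)
  qed
  moreover have "translate_seed w r = reindex id s" using eq by (simp add: reindex_id)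
  then have "w \<in> translation_vectors (exchange_vertices affine_form pos s0)"
    unfolding translation_vectors_iff R[symmetric] using rs(1,2) bij_id by blast
  ultimately show ?thesis by blast
qed

lemma rank_one:
  assumes fin: "finite (snd ` R)"
  shows "has_int_rank (translation_lattice (exchange_vertices affine_form pos s0)) 1"
proof -
  let ?V = "translation_vectors (exchange_vertices affine_form pos s0)" and ?w = "(gap / 2) *\<^sub>R a"
  have "?V \<subseteq> module.span rat_scale {?w}"
  proof
    fix w assume "w \<in> ?V"
    then obtain z :: int where "w = of_int z *\<^sub>R ?w" using translation_vectors_gap by blast
    then have "w = rat_scale (of_int z) ?w" by (simp add: rat_scale_def)
    then show "w \<in> module.span rat_scale {?w}" by (simp add: rat_vs.span_base rat_vs.span_scale)
  qed
  then have "module.span rat_scale ?V \<subseteq> module.span rat_scale {?w}"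
    using rat_vs.span_minimal rat_vs.subspace_span by blast
  then have L: "module.span int_scale ?V \<subseteq> module.span rat_scale {?w}" using int_span_subset_rat_span[of ?V] by blast
  obtain w where w: "w \<noteq> 0" "w \<in> ?V" using nonzero_translation[OF fin] by blast
  show ?thesis unfolding has_int_rank_def translation_lattice_def
  proof (intro conjI allI impI)
    have "\<not> module.dependent int_scale {w}" unfolding int_independent_iff[OF finite.insertI[OF finite.emptyI]]
      using w(1) rat_vs.dependent_single[of w] by simp
    then show "\<exists>S\<subseteq>module.span int_scale ?V. finite S \<and> \<not> module.dependent int_scale S \<and> card S = 1"
      using w(2) by (intro exI[of _ "{w}"]) (simp add: int_mod.span_base)
  next
    fix S assume S: "S \<subseteq> module.span int_scale ?V" "finite S \<and> \<not> module.dependent int_scale S"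
    then have "\<not> module.dependent rat_scale S" using int_independent_iff by blast
    then show "card S \<le> 1" using rat_vs.independent_span_bound[of "{?w}" S] S(1) L by auto
  qed
qed

end

lemma isolated_growth:
  fixes v :: "3 \<Rightarrow> affine_fun" and B :: "real^3^3" and u :: plane_ref
  assumes sk: "skew_symmetric B" and mf: "mutation_finite B" and gr: "geometric_realisation affine_form v B"
    and gp: "general_position affine_form (plane_pos u) (v, B)"
    and i: "isolated i B"
  shows "polynomial_growth (exchange_growth affine_form (plane_pos u) (v, B))"
    "has_int_rank (translation_lattice (exchange_vertices affine_form (plane_pos u) (v, B)))
       (growth_rate (exchange_growth affine_form (plane_pos u) (v, B)))"
proof -
  interpret seed_space affine_form "plane_pos u" by (rule affine_seed_space)
  define R where "R = mutation_reachable affine_form (plane_pos u) (v, B)"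
  have re: "realises affine_form s" if "s \<in> R" for s
    using that unfolding R_def
    by (induction rule: reachable_induct) (auto intro: geometric_realisation_realises[OF gr sk] realises_mutation)
  have bas: "basis3 (fst s)" if "s \<in> R" for s
    using that unfolding R_def
    by (induction rule: reachable_induct) (auto intro: geometric_realisation_basis[OF gr] basis3_mutation)
  have dec: "decided (fst s i)" if "s \<in> R" for s i
    using gp that unfolding general_position_def R_def decided_def by blast
  have inv: "seed_mutation affine_form (plane_pos u) k (seed_mutation affine_form (plane_pos u) k s) = s" if "s \<in> R" for s k
    using mutation_invol[of s k] re[OF that] dec[OF that, of k] unfolding realises_def decided_def by blast
  obtain j k where ne: "i \<noteq> j" "j \<noteq> k" "i \<noteq> k" using distinct3_ex by blast
  interpret affine_isolated "plane_pos u" R "(v, B)" i j k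
  proof
    show "R = mutation_reachable affine_form (plane_pos u) (v, B)" by (rule R_def)
    show "i \<noteq> j" "j \<noteq> k" "i \<noteq> k" by (rule ne)+
    show "isolated i (snd (v, B))" using i by simp
  qed (use re bas dec decidedD in blast)+
  have fin: "finite (snd ` R)"
  proof (rule finite_subset)
    show "snd ` R \<subseteq> matrix_reach B" using reach_matrix by (fastforce simp: R_def)
    show "finite (matrix_reach B)" using mf by (simp add: mutation_finite_def matrix_reach_def)
  qed
  have up: "real (card (labelled_ball affine_form (plane_pos u) (v, B) m)) \<le> 4 * (real m + 1) ^ 1" for m
  proof -
    have "card (labelled_ball affine_form (plane_pos u) (v, B) m) \<le> 4 * (m + 1)"
      by (rule isolated_ball[of affine_form "plane_pos u" "(v, B)" i]) (use inv sk i in \<open>auto simp: R_def\<close>)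
    then have "real (card (labelled_ball affine_form (plane_pos u) (v, B) m)) \<le> real (4 * (m + 1))" by (simp only: of_nat_le_iff)
    then show ?thesis by simp
  qed
  have low: "(n + 1) ^ 1 \<le> card (labelled_ball affine_form (plane_pos u) (v, B) (0 + 1 * n))" for n
    using infinite_ball[OF infinite_R[unfolded R_def], of n] by simp
  note gb = growth_between[of affine_form "plane_pos u" "(v, B)" 4 1 0 1, OF inv[unfolded R_def] up low]
  show "polynomial_growth (exchange_growth affine_form (plane_pos u) (v, B))" by (rule gb(1))
  show "has_int_rank (translation_lattice (exchange_vertices affine_form (plane_pos u) (v, B)))
       (growth_rate (exchange_growth affine_form (plane_pos u) (v, B)))"
    using rank_one[OF fin] by (rule back_subst) (rule gb(2)[symmetric])
qed

section \<open>The theorem\<close>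

theorem mainTheorem3:
  fixes B :: "real^3^3"
  assumes "skew_symmetric B"
    and "mutation_finite B"
    and "\<not> same_quiver B markov_quiver"
  shows
    "(\<forall>(v :: 3 \<Rightarrow> real^3) (u :: real^3).
        geometric_realisation (\<bullet>) v B \<and> u \<in> sphere 0 1 \<and>
        general_position (\<bullet>) (sphere_pos u) (v, B) \<and>
        compatible (\<bullet>) (sphere_pos u) (v, B) \<longrightarrow>
        polynomial_growth (exchange_growth (\<bullet>) (sphere_pos u) (v, B))) \<and>
     (\<forall>(v :: 3 \<Rightarrow> affine_fun) (u :: plane_ref).
        geometric_realisation affine_form v B \<and> valid_plane_ref u \<and>
        general_position affine_form (plane_pos u) (v, B) \<and>
        compatible affine_form (plane_pos u) (v, B) \<longrightarrow>
        polynomial_growth (exchange_growth affine_form (plane_pos u) (v, B)) \<and>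
        has_int_rank
          (translation_lattice (exchange_vertices affine_form (plane_pos u) (v, B)))
          (growth_rate (exchange_growth affine_form (plane_pos u) (v, B))))"
proof (intro conjI allI impI; elim conjE)
  fix v :: "3 \<Rightarrow> real^3" and u :: "real^3"
  assume "geometric_realisation (\<bullet>) v B" "general_position (\<bullet>) (sphere_pos u) (v, B)"
    "compatible (\<bullet>) (sphere_pos u) (v, B)"
  then show "polynomial_growth (exchange_growth (\<bullet>) (sphere_pos u) (v, B))"
    by (rule sphere_growth[OF assms(1,2)])
next
  fix v :: "3 \<Rightarrow> affine_fun" and u :: plane_ref
  assume a: "geometric_realisation affine_form v B" "general_position affine_form (plane_pos u) (v, B)"
    "compatible affine_form (plane_pos u) (v, B)"
  show "polynomial_growth (exchange_growth affine_form (plane_pos u) (v, B))"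
  proof (cases "\<exists>i. isolated i B")
    case True then show ?thesis using isolated_growth(1)[OF assms(1,2) a(1,2)] by blast
  next
    case False then show ?thesis using connected_growth(1)[OF assms(1,2) a] by blast
  qed
  show "has_int_rank (translation_lattice (exchange_vertices affine_form (plane_pos u) (v, B)))
      (growth_rate (exchange_growth affine_form (plane_pos u) (v, B)))"
  proof (cases "\<exists>i. isolated i B")
    case True then show ?thesis using isolated_growth(2)[OF assms(1,2) a(1,2)] by blast
  next
    case False then show ?thesis using connected_growth(2)[OF assms(1,2) a] by blast
  qed
qed

end
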